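(* Let $f$ be a centered Gaussian field over $\mathbb{R}^2$ satisfying conditions (Symmetries), (Strong regularity) and (Strong decay of correlations) defined in the context. Let $\varphi:\mathbb{R}\to\mathbb{R}_+^*$ be a continuous positive non-decreasing map such that $\int_0^\infty\varphi(u)e^{-u^2/2}\,du<\infty$. Let $g$ be the random Riemannian metric over $\mathbb{R}^2$ defined by $$g=\varphi(f)\,g_0,$$ where $g_0$ is the standard metric over $\mathbb{R}^2$, and let $T$ be its associated random distance. Then the time constant $\mu(v)=\lim_{n\to\infty}\frac1nT(0,nv)$ (deterministic almost sure and $L^1$ limit, for $v\in\mathbb{R}^2$) is a norm.
   Context: For a continuous Riemannian metric $g$ on $\mathbb{R}^2$ (a continuous map to positive definite symmetric matrices), $T(x,y)=\inf_\gamma\mathrm{Length}_g(\gamma)$ over piecewise $C^1$ paths from $x$ to $y$, with $\mathrm{Length}_g(\gamma)=\int_a^b\|\gamma'(s)\|_{g(\gamma(s))}\,ds$. Let $f$ be a centered Gaussian field on $\mathbb{R}^2$ with covariance $e(x,y)=\mathbb{E}(f(x)f(y))$. It is assumed stationary, $e(x,y)=\kappa(x-y)$, with $\kappa$ continuous, so that $\kappa$ is the Fourier transform of a spectral measure $m$; it is assumed that $m$ is absolutely continuous with respect to Lebesgue measure, $dm(x)=\rho^2(x)\,dx$ with $\rho:\mathbb{R}^2\to\mathbb{R}$. Let $q=\mathcal{F}[\rho]$ be the Fourier transform of $\rho$ (normalised so that $\kappa=q\star q$). - (Symmetries) $f$ is centered and stationary, $\kappa(0)=1$, and $\kappa$ is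 symmetric under both reflection in the $x$-axis and rotation by $\pi/2$ about the origin. - (Strong regularity) $q$ is in $L^2(\mathbb{R}^2)$, $C^3$ and even, and the support of $\rho$ contains a neighbourhood of $0$. - (Strong decay of correlations) There exist $C,\beta>0$ such that for every multi-index $\alpha$ with $|\alpha|\le3$ and every $x\in\mathbb{R}^2$, $|\partial^\alpha q(x)|\le C\exp(-\|x\|^\beta)$. *)

theory Defs
  imports "HOL-Probability.Probability"
begin

section \<open>Riemannian distance\<close>

text \<open>A metric on the plane is a function \<open>g\<close> assigning to each point a (positive definite
  symmetric) matrix.\<close>

definition metric_norm :: "real^2^2 \<Rightarrow> real^2 \<Rightarrow> real" where
  "metric_norm A v = sqrt (v \<bullet> (A *v v))"

text \<open>The library's piecewise \<open>C\<^sup>1\<close> paths may have an unbounded, even non-integrable, derivative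
  near the finitely many break points. The length is therefore a nonnegative integral with values
  in \<^typ>\<open>ennreal\<close>, so that such a path gets length \<open>\<infinity>\<close> instead of a junk value. The derivative
  at the break points is irrelevant, since they form a null set.\<close>

definition riem_length :: "(real^2 \<Rightarrow> real^2^2) \<Rightarrow> real \<Rightarrow> real \<Rightarrow> (real \<Rightarrow> real^2) \<Rightarrow> ennreal" where
  "riem_length g a b \<gamma> =
     (\<integral>\<^sup>+ s\<in>{a..b}. ennreal (metric_norm (g (\<gamma> s)) (vector_derivative \<gamma> (at s))) \<partial>lborel)"

text \<open>The infimum is finite for every continuous metric, because segments have finite length.\<close>

definition riem_dist :: "(real^2 \<Rightarrow> real^2^2) \<Rightarrow> real^2 \<Rightarrow> real^2 \<Rightarrow> real" where
  "riem_dist g x y =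
     enn2real (Inf {riem_length g a b \<gamma> | a b \<gamma>.
       a < b \<and> \<gamma> piecewise_C1_differentiable_on {a..b} \<and> \<gamma> a = x \<and> \<gamma> b = y})"

definition standard_metric :: "real^2 \<Rightarrow> real^2^2" where
  "standard_metric x = mat 1"


section \<open>Gaussian fields\<close>

text \<open>Degenerate Gaussian variables (almost sure constants) are included.\<close>

definition gaussian_rv :: "'w measure \<Rightarrow> ('w \<Rightarrow> real) \<Rightarrow> bool" where
  "gaussian_rv M X \<longleftrightarrow>
     (\<exists>m \<sigma>. \<sigma> > 0 \<and> distributed M lborel X (normal_density m \<sigma>)) \<or>
     (X \<in> borel_measurable M \<and> (\<exists>m. AE \<omega> in M. X \<omega> = m))"

definition gaussian_field :: "'w measure \<Rightarrow> (real^2 \<Rightarrow> 'w \<Rightarrow> real) \<Rightarrow> bool" where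
  "gaussian_field M f \<longleftrightarrow>
     (\<forall>S c. finite S \<longrightarrow> gaussian_rv M (\<lambda>\<omega>. \<Sum>x\<in>S. c x * f x \<omega>))"

definition centered :: "'w measure \<Rightarrow> (real^2 \<Rightarrow> 'w \<Rightarrow> real) \<Rightarrow> bool" where
  "centered M f \<longleftrightarrow> (\<forall>x. (\<integral>\<omega>. f x \<omega> \<partial>M) = 0)"

definition covariance :: "'w measure \<Rightarrow> (real^2 \<Rightarrow> 'w \<Rightarrow> real) \<Rightarrow> real^2 \<Rightarrow> real^2 \<Rightarrow> real" where
  "covariance M f x y = (\<integral>\<omega>. f x \<omega> * f y \<omega> \<partial>M)"

definition stationary_cov :: "'w measure \<Rightarrow> (real^2 \<Rightarrow> 'w \<Rightarrow> real) \<Rightarrow> (real^2 \<Rightarrow> real) \<Rightarrow> bool" where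
  "stationary_cov M f \<kappa> \<longleftrightarrow>
     continuous_on UNIV \<kappa> \<and> (\<forall>x y. covariance M f x y = \<kappa> (x - y))"


section \<open>Fourier transforms and the spectral density\<close>

text \<open>All Fourier transforms use the kernel \<open>exp (-2 \<pi> i \<langle>x, \<xi>\<rangle>)\<close>. This is the normalisation for
  which \<open>\<kappa> = \<F>[\<rho>\<^sup>2]\<close> and \<open>q = \<F>[\<rho>]\<close> give \<open>\<kappa> = q \<star> q\<close> without a constant.\<close>

definition fourier :: "(real^2 \<Rightarrow> real) \<Rightarrow> real^2 \<Rightarrow> complex" where
  "fourier h x = (\<integral>\<xi>. h \<xi> *\<^sub>R cis (- 2 * pi * (x \<bullet> \<xi>)) \<partial>lborel)"

definition fourier_measure :: "(real^2) measure \<Rightarrow> real^2 \<Rightarrow> complex" where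
  "fourier_measure m x = (\<integral>\<xi>. cis (- 2 * pi * (x \<bullet> \<xi>)) \<partial>m)"

definition spectral_density :: "(real^2 \<Rightarrow> real) \<Rightarrow> (real^2 \<Rightarrow> real) \<Rightarrow> bool" where
  "spectral_density \<kappa> \<rho> \<longleftrightarrow>
     \<rho> \<in> borel_measurable lborel \<and> integrable lborel (\<lambda>\<xi>. (\<rho> \<xi>)\<^sup>2) \<and>
     (\<forall>x. complex_of_real (\<kappa> x) = fourier_measure (density lborel (\<lambda>\<xi>. ennreal ((\<rho> \<xi>)\<^sup>2))) x)"

text \<open>A spectral density is square integrable but not assumed integrable, so \<open>\<F>[\<rho>]\<close> is its
  Fourier--Plancherel transform: the \<open>L\<^sup>2\<close> limit of the Fourier transforms of the truncations of
  \<open>\<rho>\<close> to large balls. The function \<open>q\<close> is a representative of this \<open>L\<^sup>2\<close> class.\<close>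

definition fourier_L2 :: "(real^2 \<Rightarrow> real) \<Rightarrow> (real^2 \<Rightarrow> complex) \<Rightarrow> bool" where
  "fourier_L2 \<rho> q \<longleftrightarrow>
     \<rho> \<in> borel_measurable lborel \<and> integrable lborel (\<lambda>\<xi>. (\<rho> \<xi>)\<^sup>2) \<and>
     q \<in> borel_measurable lborel \<and>
     ((\<lambda>R. \<integral>\<^sup>+ x. ennreal ((cmod (q x - fourier (\<lambda>\<xi>. indicator (cball 0 R) \<xi> * \<rho> \<xi>) x))\<^sup>2) \<partial>lborel)
        \<longlongrightarrow> 0) (at_top :: real filter)"

text \<open>Since \<open>\<rho>\<close> is determined only almost everywhere, its support is the essential one: the closure
  of \<open>{\<xi>. \<rho> \<xi> \<noteq> 0}\<close> could be enlarged arbitrarily by changing \<open>\<rho>\<close> on a null set.\<close>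

definition ess_support :: "(real^2 \<Rightarrow> real) \<Rightarrow> (real^2) set" where
  "ess_support \<rho> =
     - \<Union>{U. open U \<and> (AE \<xi> in lborel. \<xi> \<in> U \<longrightarrow> \<rho> \<xi> = 0)}"


section \<open>Partial derivatives\<close>

definition partial :: "2 \<Rightarrow> (real^2 \<Rightarrow> real) \<Rightarrow> real^2 \<Rightarrow> real" where
  "partial i h x = frechet_derivative h (at x) (axis i 1)"

text \<open>The multi-index is \<open>(a, b)\<close>.\<close>

definition partials :: "nat \<Rightarrow> nat \<Rightarrow> (real^2 \<Rightarrow> real) \<Rightarrow> real^2 \<Rightarrow> real" where
  "partials a b h = (partial 1 ^^ a) ((partial 2 ^^ b) h)"

primrec C_diff :: "nat \<Rightarrow> (real^2 \<Rightarrow> real) \<Rightarrow> bool" where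
  "C_diff 0 h \<longleftrightarrow> continuous_on UNIV h"
| "C_diff (Suc k) h \<longleftrightarrow> (\<forall>x. h differentiable (at x)) \<and> (\<forall>i. C_diff k (partial i h))"


section \<open>Conditions on the field\<close>

definition symmetries ::
  "'w measure \<Rightarrow> (real^2 \<Rightarrow> 'w \<Rightarrow> real) \<Rightarrow> (real^2 \<Rightarrow> real) \<Rightarrow> bool" where
  "symmetries M f \<kappa> \<longleftrightarrow>
     centered M f \<and> stationary_cov M f \<kappa> \<and> \<kappa> 0 = 1 \<and>
     (\<forall>x. \<kappa> (vector [x $ 1, - (x $ 2)]) = \<kappa> x) \<and>
     (\<forall>x. \<kappa> (vector [- (x $ 2), x $ 1]) = \<kappa> x)"

definition strong_regularity :: "(real^2 \<Rightarrow> real) \<Rightarrow> (real^2 \<Rightarrow> real) \<Rightarrow> bool" where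
  "strong_regularity \<rho> q \<longleftrightarrow>
     integrable lborel (\<lambda>x. (q x)\<^sup>2) \<and> C_diff 3 q \<and> (\<forall>x. q (- x) = q x) \<and>
     0 \<in> interior (ess_support \<rho>)"

definition strong_decay :: "(real^2 \<Rightarrow> real) \<Rightarrow> bool" where
  "strong_decay q \<longleftrightarrow>
     (\<exists>C>0. \<exists>\<beta>>0. \<forall>a b. a + b \<le> 3 \<longrightarrow>
        (\<forall>x. \<bar>partials a b q x\<bar> \<le> C * exp (- (norm x powr \<beta>))))"


section \<open>Time constant\<close>

text \<open>If the paths of the field are continuous only almost surely, the random distance agrees almost
  surely with a measurable function but need not be measurable itself; hence the \<open>L\<^sup>1\<close> convergence is
  stated on the completion of the probability space.\<close>

definition is_time_constant ::
  "'w measure \<Rightarrow> ('w \<Rightarrow> real^2 \<Rightarrow> real^2 \<Rightarrow> real) \<Rightarrow> (real^2 \<Rightarrow> real) \<Rightarrow> bool" where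
  "is_time_constant M T \<mu> \<longleftrightarrow>
     (\<forall>v. (AE \<omega> in M. (\<lambda>n. T \<omega> 0 (real n *\<^sub>R v) / real n) \<longlonglongrightarrow> \<mu> v) \<and>
          (\<forall>n. integrable (completion M) (\<lambda>\<omega>. T \<omega> 0 (real n *\<^sub>R v))) \<and>
          (\<lambda>n. \<integral>\<omega>. \<bar>T \<omega> 0 (real n *\<^sub>R v) / real n - \<mu> v\<bar> \<partial>completion M) \<longlonglongrightarrow> 0)"

definition is_norm :: "(real^2 \<Rightarrow> real) \<Rightarrow> bool" where
  "is_norm N \<longleftrightarrow>
     (\<forall>v. 0 \<le> N v) \<and> (\<forall>v. N v = 0 \<longleftrightarrow> v = 0) \<and>
     (\<forall>c v. N (c *\<^sub>R v) = \<bar>c\<bar> * N v) \<and> (\<forall>v w. N (v + w) \<le> N v + N w)"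

end

(* The distance of the metric phi(f) g_0 is a first passage time with weight sqrt(phi(f)). For
   continuous paths of f it is an infimum of countably many functions of the values of f, hence a
   measurable function of the path, and translations act on the paths in a mixing way because the
   covariance kappa = q * q tends to 0 at infinity. The subadditive ergodic theorem then gives the
   almost sure limit, and Scheffe's lemma turns convergence of the means into L^1 convergence.

   The limit is positive because most cells of a long path are good. Call a unit cell bad if |f|
   exceeds m somewhere near it; by chaining, this is detected by dyadic increments and corner values.
   Writing f as q convolved with white noise, the decay of q and Schur's test bound the variance of
   a sum of such increments, one for each cell of a finite set S, by a constant times |S|. Gaussian
   tails then show that all cells of S are bad with probability at most delta^|S|, where delta is
   small for large m, and a count of cell paths finishes the argument. *)

theory Submission
  imports Defs "HOL-Library.Transitive_Closure_Table"
begin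


section \<open>Conformal distances\<close>

text \<open>Two obstacles shape the details. On the spectral side, \<open>q\<close> is only the
  Fourier-Plancherel transform of \<open>\<rho>\<close>, which is not assumed integrable, so the
  identity \<open>\<kappa> = q * q\<close> does not come from the convolution theorem: both sides
  are multiplied by a Gaussian and their transforms are compared. Once it is known, no white noise
  has to be built, since every variance of a finite combination of field values is the squared norm
  of the same combination of translates of \<open>q\<close>.

  On the probabilistic side, correlations have infinite range, so no two cells are independent, yet
  the union bound over tests needs an estimate that is a product over the cells. It arises by
  weighting each test with its own threshold: the threshold sum and the variance bound are then
  proportional to the same sum of squares, and the exponent of Chernoff's bound is additive.
  Increments over the length \<open>2 ^ -j\<close> are multiplied by \<open>2 ^ j\<close>, which
  bounds their variances uniformly in \<open>j\<close>; thresholds growing like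
  \<open>(3 / 2) ^ j\<close> beat the number \<open>4 ^ j\<close> of tests and still leave true
  increments of summable size \<open>(3 / 4) ^ j\<close>.\<close>

definition path_cost :: "('a::euclidean_space \<Rightarrow> real) \<Rightarrow> real \<Rightarrow> real \<Rightarrow> (real \<Rightarrow> 'a) \<Rightarrow> ennreal" where
  "path_cost w a b \<gamma> =
     (\<integral>\<^sup>+ s\<in>{a..b}. ennreal (w (\<gamma> s) * norm (vector_derivative \<gamma> (at s))) \<partial>lborel)"

definition cost_dist :: "('a::euclidean_space \<Rightarrow> real) \<Rightarrow> 'a \<Rightarrow> 'a \<Rightarrow> ennreal" where
  "cost_dist w x y = Inf {path_cost w a b \<gamma> | a b \<gamma>.
     a < b \<and> \<gamma> piecewise_C1_differentiable_on {a..b} \<and> \<gamma> a = x \<and> \<gamma> b = y}"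

lemma riem_dist_conformal:
  assumes "\<And>x. 0 \<le> c x"
  shows "riem_dist (\<lambda>x. c x *\<^sub>R standard_metric x) x y = enn2real (cost_dist (\<lambda>x. sqrt (c x)) x y)"
proof -
  have "metric_norm (c p *\<^sub>R standard_metric p) v = sqrt (c p) * norm v" for p v
    by (simp add: metric_norm_def standard_metric_def scaleR_matrix_vector_assoc [symmetric]
        real_sqrt_mult norm_eq_sqrt_inner)
  then show ?thesis
    by (simp add: riem_dist_def cost_dist_def riem_length_def path_cost_def)
qed

lemma cost_dist_le:
  "a < b \<Longrightarrow> \<gamma> piecewise_C1_differentiable_on {a..b} \<Longrightarrow> \<gamma> a = x \<Longrightarrow> \<gamma> b = y \<Longrightarrow>
    cost_dist w x y \<le> path_cost w a b \<gamma>"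
  unfolding cost_dist_def by (rule Inf_lower) blast

lemma cost_dist_greatest:
  assumes "\<And>a b \<gamma>. a < b \<Longrightarrow> \<gamma> piecewise_C1_differentiable_on {a..b} \<Longrightarrow> \<gamma> a = x \<Longrightarrow> \<gamma> b = y \<Longrightarrow>
    c \<le> path_cost w a b \<gamma>"
  shows "c \<le> cost_dist w x y"
  unfolding cost_dist_def by (rule Inf_greatest) (use assms in blast)

text \<open>The derivative is continuous off the finitely many break points, so cutting with the
  punctured interval gives a Borel function, and restoring a finite set of points keeps it
  measurable. The second part serves the fundamental theorem of calculus.\<close>

lemma path_cost_measurable:
  fixes \<gamma> :: "real \<Rightarrow> 'a::euclidean_space"
  assumes "\<gamma> piecewise_C1_differentiable_on {a..b}" and w: "continuous_on UNIV w"
  shows "(\<lambda>s. ennreal (w (\<gamma> s) * norm (vector_derivative \<gamma> (at s))) * indicator {a..b} s)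
      \<in> borel_measurable lborel"
    and "(\<lambda>s. indicator {a..b} s *\<^sub>R vector_derivative \<gamma> (at s)) \<in> borel_measurable lborel"
proof -
  obtain S where S: "finite S" "\<gamma> C1_differentiable_on ({a..b} - S)" and c: "continuous_on {a..b} \<gamma>"
    using assms(1) by (auto simp: piecewise_C1_differentiable_on_def)
  have d: "continuous_on ({a..b} - S) (\<lambda>s. vector_derivative \<gamma> (at s))"
    using S(2) by (auto simp: C1_differentiable_on_eq)
  have m: "{a..b} - S \<in> sets borel"
    using S(1) by (intro sets.Diff) (auto intro: borel_closed finite_imp_closed)
  have "continuous_on ({a..b} - S) (\<lambda>s. w (\<gamma> s) * norm (vector_derivative \<gamma> (at s)))"
    by (intro continuous_intros d continuous_on_compose2[OF w] continuous_on_subset[OF c]) auto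
  from borel_measurable_continuous_on_indicator[OF m this]
  have "(\<lambda>s. ennreal (indicator ({a..b} - S) s *\<^sub>R (w (\<gamma> s) * norm (vector_derivative \<gamma> (at s)))))
      \<in> borel_measurable lborel" by simp
  then show "(\<lambda>s. ennreal (w (\<gamma> s) * norm (vector_derivative \<gamma> (at s))) * indicator {a..b} s)
      \<in> borel_measurable lborel"
    by (rule measurable_discrete_difference[where X=S])
      (use S(1) in \<open>auto intro: countable_finite split: split_indicator\<close>)
  from borel_measurable_continuous_on_indicator[OF m d]
  have "(\<lambda>s. indicator ({a..b} - S) s *\<^sub>R vector_derivative \<gamma> (at s)) \<in> borel_measurable lborel" by simp
  then show "(\<lambda>s. indicator {a..b} s *\<^sub>R vector_derivative \<gamma> (at s)) \<in> borel_measurable lborel"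
    by (rule measurable_discrete_difference[where X=S])
      (use S(1) in \<open>auto intro: countable_finite split: split_indicator\<close>)
qed

lemma AE_lborel_notin_finite: "finite S \<Longrightarrow> AE s in lborel. s \<notin> (S :: real set)"
  by (rule AE_not_in) (simp add: finite_imp_null_set_lborel)

lemma path_cost_split:
  assumes "\<gamma> piecewise_C1_differentiable_on {a..b}" "continuous_on UNIV w" "a \<le> c" "c \<le> b"
  shows "path_cost w a b \<gamma> = path_cost w a c \<gamma> + path_cost w c b \<gamma>"
proof -
  let ?f = "\<lambda>s. ennreal (w (\<gamma> s) * norm (vector_derivative \<gamma> (at s)))"
  have "path_cost w a b \<gamma> = (\<integral>\<^sup>+ s. ?f s * indicator {a..c} s + ?f s * indicator {c..b} s \<partial>lborel)"
    unfolding path_cost_def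
    by (rule nn_integral_cong_AE, rule AE_mp[OF AE_lborel_notin_finite[of "{c}"]])
      (use assms(3,4) in \<open>auto split: split_indicator\<close>)
  also have "\<dots> = path_cost w a c \<gamma> + path_cost w c b \<gamma>"
    unfolding path_cost_def
    by (rule nn_integral_add; rule path_cost_measurable(1)[OF _ assms(2)])
      (use assms in \<open>auto intro: piecewise_C1_differentiable_on_subset\<close>)
  finally show ?thesis .
qed

text \<open>A finite cost makes the derivative Lebesgue integrable; the gauge integral from the
  fundamental theorem of calculus is then the Lebesgue integral, and its norm bound gives the claim.
  An infinite cost leaves nothing to prove.\<close>

lemma dist_le_path_cost_1:
  fixes \<gamma> :: "real \<Rightarrow> 'a::euclidean_space"
  assumes g: "\<gamma> piecewise_C1_differentiable_on {a..b}" and "a \<le> b"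
  shows "ennreal (dist (\<gamma> a) (\<gamma> b)) \<le> path_cost (\<lambda>_. 1) a b \<gamma>"
proof (cases "path_cost (\<lambda>_. 1) a b \<gamma> = \<infinity>")
  case False
  let ?d = "\<lambda>s. vector_derivative \<gamma> (at s)"
  have eq: "path_cost (\<lambda>_. 1) a b \<gamma> = (\<integral>\<^sup>+ s. norm (indicator {a..b} s *\<^sub>R ?d s) \<partial>lborel)"
    unfolding path_cost_def by (rule nn_integral_cong) (auto split: split_indicator)
  have int: "integrable lborel (\<lambda>s. indicator {a..b} s *\<^sub>R ?d s)"
    by (rule integrableI_bounded)
      (use path_cost_measurable(2)[OF g, of "\<lambda>_. 1"] False eq in \<open>auto simp: less_top\<close>)
  obtain S where S: "finite S" "\<gamma> C1_differentiable_on ({a..b} - S)" and c: "continuous_on {a..b} \<gamma>"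
    using g by (auto simp: piecewise_C1_differentiable_on_def)
  have "(?d has_integral (\<gamma> b - \<gamma> a)) {a..b}"
    by (rule fundamental_theorem_of_calculus_interior_strong[OF S(1) assms(2) _ c])
      (use S(2) in \<open>auto simp: C1_differentiable_on_eq vector_derivative_works\<close>)
  moreover have "set_integrable lborel {a..b} ?d"
    using int by (simp add: set_integrable_def)
  then have "(?d has_integral (LINT s:{a..b}|lborel. ?d s)) {a..b}"
    by (simp add: set_borel_integral_eq_integral integrable_integral)
  ultimately have "\<gamma> b - \<gamma> a = (LINT s|lborel. indicator {a..b} s *\<^sub>R ?d s)"
    by (auto simp: set_lebesgue_integral_def dest: has_integral_unique)
  then show ?thesis
    using integral_norm_bound_ennreal[OF int] eq by (subst dist_commute) (simp add: dist_norm)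
qed simp

text \<open>Covers the parameter changes \<open>k + t\<close> and \<open>k - t\<close>, hence both
  gluing and reversal of paths. Agreement is asked on the open interval only, because the formula of
  a glued path changes at the junction.\<close>

lemma path_cost_isometry:
  fixes \<gamma> :: "real \<Rightarrow> 'a::euclidean_space"
  assumes g: "\<gamma> piecewise_C1_differentiable_on {a'..b'}" and w: "continuous_on UNIV w"
    and m: "m = 1 \<or> m = -1" and im: "\<And>t. k + m * t \<in> {a'..b'} \<longleftrightarrow> t \<in> {a..b}"
    and eq: "\<And>t. a < t \<Longrightarrow> t < b \<Longrightarrow> \<eta> t = \<gamma> (k + m * t)"
  shows "path_cost w a b \<eta> = path_cost w a' b' \<gamma>"
proof -
  obtain S where S: "finite S" "\<gamma> C1_differentiable_on ({a'..b'} - S)"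
    using g by (auto simp: piecewise_C1_differentiable_on_def)
  have fin: "finite ({a, b} \<union> (\<lambda>s. m * (s - k)) ` S)" using S(1) by simp
  have mm: "m * m = 1" using m by auto
  have "path_cost w a' b' \<gamma> = \<bar>m\<bar> * (\<integral>\<^sup>+ t. ennreal (w (\<gamma> (k + m * t)) *
      norm (vector_derivative \<gamma> (at (k + m * t)))) * indicator {a'..b'} (k + m * t) \<partial>lborel)"
    unfolding path_cost_def
    by (rule nn_integral_real_affine) (use m path_cost_measurable(1)[OF g w] in auto)
  also have "\<dots> = (\<integral>\<^sup>+ t. ennreal (w (\<gamma> (k + m * t)) *
      norm (vector_derivative \<gamma> (at (k + m * t)))) * indicator {a'..b'} (k + m * t) \<partial>lborel)"
    using m by auto
  also have "\<dots> = path_cost w a b \<eta>"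
    unfolding path_cost_def
  proof (rule nn_integral_cong_AE, rule AE_mp[OF AE_lborel_notin_finite[OF fin]], rule AE_I2, rule impI)
    fix t assume t: "t \<notin> {a, b} \<union> (\<lambda>s. m * (s - k)) ` S"
    show "ennreal (w (\<gamma> (k + m * t)) * norm (vector_derivative \<gamma> (at (k + m * t)))) *
        indicator {a'..b'} (k + m * t) =
      ennreal (w (\<eta> t) * norm (vector_derivative \<eta> (at t))) * indicator {a..b} t"
    proof (cases "t \<in> {a..b}")
      case True
      then have ab: "a < t" "t < b" using t by auto
      have "t = m * ((k + m * t) - k)" using mm by (simp add: mult.assoc[symmetric])
      then have "k + m * t \<notin> S" using t by blast
      then have "\<gamma> differentiable (at (k + m * t))"
        using S(2) im True by (auto simp: C1_differentiable_on_eq)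
      then have "(\<gamma> has_vector_derivative vector_derivative \<gamma> (at (k + m * t))) (at (k + m * t))"
        by (simp add: vector_derivative_works)
      moreover have "((\<lambda>t. k + m * t) has_vector_derivative m) (at t)"
        by (auto intro!: derivative_eq_intros)
      ultimately have "(\<gamma> \<circ> (\<lambda>t. k + m * t) has_vector_derivative m *\<^sub>R vector_derivative \<gamma> (at (k + m * t))) (at t)"
        by (rule vector_diff_chain_at[rotated])
      then have "(\<eta> has_vector_derivative m *\<^sub>R vector_derivative \<gamma> (at (k + m * t))) (at t)"
        by (rule has_vector_derivative_transform_within_open[where S="{a<..<b}"]) (use eq ab in auto)
      then have "vector_derivative \<eta> (at t) = m *\<^sub>R vector_derivative \<gamma> (at (k + m * t))"
        by (rule vector_derivative_at)
      then show ?thesis using m im True eq ab by auto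
    qed (use im in auto)
  qed
  finally show ?thesis ..
qed

lemma piecewise_C1_differentiable_isometry:
  fixes \<gamma> :: "real \<Rightarrow> 'a::euclidean_space"
  assumes g: "\<gamma> piecewise_C1_differentiable_on {a'..b'}"
    and im: "\<And>t. k + m * t \<in> {a'..b'} \<longleftrightarrow> t \<in> {a..b}"
  shows "(\<lambda>t. \<gamma> (k + m * t)) piecewise_C1_differentiable_on {a..b}"
proof -
  have "(\<lambda>x. m * x + k) ` {a..b} \<subseteq> {a'..b'}"
    using im by (force simp: add.commute)
  from piecewise_C1_differentiable_affine[OF piecewise_C1_differentiable_on_subset[OF g this]]
  show ?thesis by (simp add: o_def add.commute)
qed

lemma cost_dist_triangle:
  fixes x y z :: "'a::euclidean_space"
  assumes w: "continuous_on UNIV w"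
  shows "cost_dist w x z \<le> cost_dist w x y + cost_dist w y z"
proof -
  have *: "cost_dist w x z \<le> path_cost w a b \<gamma> + path_cost w c d \<delta>"
    if "a < b" "\<gamma> piecewise_C1_differentiable_on {a..b}" "\<gamma> a = x" "\<gamma> b = y"
      "c < d" "\<delta> piecewise_C1_differentiable_on {c..d}" "\<delta> c = y" "\<delta> d = z" for a b \<gamma> c d \<delta>
  proof -
    \<comment> \<open>The second path is shifted in time so that it starts at \<open>b\<close>,
      where both formulas give \<open>y\<close>.\<close>
    define \<eta> where "\<eta> t = (if t \<le> b then \<gamma> t else \<delta> ((c - b) + 1 * t))" for t
    let ?e = "b + (d - c)"
    have p: "\<eta> piecewise_C1_differentiable_on {a..?e}"
      unfolding \<eta>_def
      by (rule piecewise_C1_differentiable_cases[OF that(2) piecewise_C1_differentiable_isometry[OF that(6)]])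
        (use that in auto)
    have "cost_dist w x z \<le> path_cost w a ?e \<eta>"
      by (rule cost_dist_le) (use that p in \<open>auto simp: \<eta>_def\<close>)
    also have "\<dots> = path_cost w a b \<eta> + path_cost w b ?e \<eta>"
      by (rule path_cost_split[OF p w]) (use that in auto)
    also have "path_cost w a b \<eta> = path_cost w a b \<gamma>"
      by (rule path_cost_isometry[OF that(2) w, of 1 0]) (auto simp: \<eta>_def)
    also have "path_cost w b ?e \<eta> = path_cost w c d \<delta>"
      by (rule path_cost_isometry[OF that(6) w, of 1 "c - b"]) (auto simp: \<eta>_def)
    finally show ?thesis .
  qed
  show ?thesis
    unfolding cost_dist_def[of w x y] cost_dist_def[of w y z]
  proof (rule ennreal_le_epsilon)
    fix e :: real assume e: "0 < e"
    let ?A = "{path_cost w a b \<gamma> | a b \<gamma>. a < b \<and> \<gamma> piecewise_C1_differentiable_on {a..b} \<and> \<gamma> a = x \<and> \<gamma> b = y}"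
    let ?B = "{path_cost w a b \<gamma> | a b \<gamma>. a < b \<and> \<gamma> piecewise_C1_differentiable_on {a..b} \<and> \<gamma> a = y \<and> \<gamma> b = z}"
    assume fin: "Inf ?A + Inf ?B < top"
    have less_add_same: "u < u + ennreal (e/2)" if "u < top" for u
      using that e by (cases u) (auto simp flip: ennreal_plus intro!: ennreal_lessI)
    have "Inf ?A < top" "Inf ?B < top"
      by (rule le_less_trans[OF _ fin]; simp)+
    note less_add_same[OF this(1)] less_add_same[OF this(2)]
    then obtain u v where uv: "u \<in> ?A" "v \<in> ?B" "u < Inf ?A + ennreal (e/2)" "v < Inf ?B + ennreal (e/2)"
      unfolding Inf_less_iff by blast
    have "cost_dist w x z \<le> u + v" using uv(1,2) * by auto
    also have "\<dots> \<le> (Inf ?A + ennreal (e/2)) + (Inf ?B + ennreal (e/2))"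
      using uv(3,4) by (intro add_mono) auto
    also have "\<dots> = Inf ?A + Inf ?B + (ennreal (e/2) + ennreal (e/2))" by (simp add: ac_simps)
    also have "ennreal (e/2) + ennreal (e/2) = ennreal e" using e by (simp flip: ennreal_plus)
    finally show "cost_dist w x z \<le> Inf ?A + Inf ?B + ennreal e" .
  qed
qed

lemma cost_dist_commute:
  fixes x y :: "'a::euclidean_space"
  assumes w: "continuous_on UNIV w"
  shows "cost_dist w x y = cost_dist w y x"
proof -
  have *: "cost_dist w x y \<le> cost_dist w y x" for x y :: 'a
  proof (rule cost_dist_greatest)
    fix a b and \<gamma> :: "real \<Rightarrow> 'a" assume h: "a < b" "\<gamma> piecewise_C1_differentiable_on {a..b}" "\<gamma> a = y" "\<gamma> b = x"
    have "cost_dist w x y \<le> path_cost w a b (\<lambda>t. \<gamma> ((a + b) + (-1) * t))"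
      by (rule cost_dist_le[OF h(1) piecewise_C1_differentiable_isometry[OF h(2)]]) (use h in auto)
    also have "\<dots> = path_cost w a b \<gamma>"
      by (rule path_cost_isometry[OF h(2) w, of "-1" "a + b"]) auto
    finally show "cost_dist w x y \<le> path_cost w a b \<gamma>" .
  qed
  show ?thesis by (intro antisym *)
qed

lemma cost_dist_translate:
  fixes x y :: "'a::euclidean_space"
  shows "cost_dist (\<lambda>p. w (p + z)) x y = cost_dist w (x + z) (y + z)"
proof -
  have *: "cost_dist (\<lambda>p. w (p + z)) x y \<le> cost_dist w (x + z) (y + z)" for w and x y z :: 'a
  proof (rule cost_dist_greatest)
    fix a b and \<gamma> :: "real \<Rightarrow> 'a"
    assume h: "a < b" "\<gamma> piecewise_C1_differentiable_on {a..b}" "\<gamma> a = x + z" "\<gamma> b = y + z"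
    have "((+) (- z) \<circ> \<gamma>) piecewise_C1_differentiable_on {a..b}"
      using h(2) by (simp only: piecewise_C1_differentiable_on_translation_eq)
    then have "cost_dist (\<lambda>p. w (p + z)) x y \<le> path_cost (\<lambda>p. w (p + z)) a b ((+) (- z) \<circ> \<gamma>)"
      by (rule cost_dist_le[OF h(1)]) (use h in auto)
    also have "\<dots> = path_cost w a b \<gamma>"
    proof -
      have "((+) (- z) \<circ> \<gamma> has_vector_derivative D) (at s) = (\<gamma> has_vector_derivative D) (at s)" for D s
        using has_vector_derivative_add_const[of \<gamma> "-z" D "at s"] by (simp add: o_def add.commute)
      then show ?thesis by (simp add: path_cost_def vector_derivative_def)
    qed
    finally show "cost_dist (\<lambda>p. w (p + z)) x y \<le> path_cost w a b \<gamma>" .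
  qed
  \<comment> \<open>The reverse inequality is the same one for the weight already translated by
    \<open>z\<close>, moved back by \<open>-z\<close>.\<close>
  show ?thesis using *[of w z x y] *[of "\<lambda>p. w (p + z)" "-z" "x + z" "y + z"] by (intro antisym) simp_all
qed

text \<open>The bound \<open>K\<close> is extended-valued because it will be a supremum over a dense
  set, whose finiteness is not known beforehand.\<close>

lemma cost_dist_le_segment:
  fixes x y :: "'a::euclidean_space"
  assumes "\<And>p. p \<in> closed_segment x y \<Longrightarrow> ennreal (w p) \<le> K"
  shows "cost_dist w x y \<le> ennreal (dist x y) * K"
proof -
  have d: "(linepath x y has_vector_derivative (y - x)) (at s)" for s
    by (rule has_vector_derivative_linepath_within)
  have "cost_dist w x y \<le> path_cost w 0 1 (linepath x y)"
    by (rule cost_dist_le) (auto intro!: C1_differentiable_imp_piecewise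
        simp: linepath_0' linepath_1' C1_differentiable_on_def intro!: exI[of _ "\<lambda>_. y - x"] d)
  also have "\<dots> \<le> (\<integral>\<^sup>+ s\<in>{0..1::real}. (ennreal (dist x y) * K) \<partial>lborel)"
    unfolding path_cost_def
  proof (rule nn_integral_mono)
    fix s :: real
    have "ennreal (w (linepath x y s) * norm (vector_derivative (linepath x y) (at s))) \<le> ennreal (dist x y) * K"
      if s: "0 \<le> s" "s \<le> 1"
    proof -
    have "ennreal (w (linepath x y s) * norm (vector_derivative (linepath x y) (at s)))
       = ennreal (norm (y - x)) * ennreal (w (linepath x y s))"
      using vector_derivative_at[OF d] by (subst mult.commute) (simp add: ennreal_mult'')
    also have "\<dots> \<le> ennreal (dist x y) * K"
      by (intro mult_mono assms) (use s in \<open>auto simp: dist_norm norm_minus_commute linepath_in_path\<close>)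
    finally show ?thesis .
    qed
    then show "ennreal (w (linepath x y s) * norm (vector_derivative (linepath x y) (at s))) * indicator {0..1} s
        \<le> ennreal (dist x y) * K * indicator {0..1} s"
      by (auto split: split_indicator)
  qed
  also have "\<dots> = ennreal (dist x y) * K" by (simp add: nn_integral_cmult)
  finally show ?thesis .
qed

lemma cost_dist_self: "cost_dist w x x = 0"
  using cost_dist_le_segment[of x x w "ennreal (w x)"] by simp

lemma cost_dist_finite:
  fixes x y :: "'a::euclidean_space"
  assumes w: "continuous_on UNIV w"
  shows "cost_dist w x y < \<infinity>"
proof -
  have "bounded (w ` closed_segment x y)"
    by (intro compact_imp_bounded compact_continuous_image continuous_on_subset[OF w]) auto
  then obtain B where "\<And>p. p \<in> closed_segment x y \<Longrightarrow> \<bar>w p\<bar> \<le> B" by (auto simp: bounded_iff)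
  then have "cost_dist w x y \<le> ennreal (dist x y) * ennreal B"
    by (intro cost_dist_le_segment ennreal_leI) (metis abs_le_D1)
  then show ?thesis by (auto simp: ennreal_mult_less_top intro: le_less_trans)
qed


section \<open>Distances as infima over chains\<close>

text \<open>An upper bound for the cost of the segment from \<open>x\<close> to \<open>y\<close>
  that reads \<open>w\<close> only on \<open>D\<close>. The factor 2 puts the segment inside the
  open ball; a dense \<open>D\<close> is dense in that ball, so for continuous \<open>w\<close> the
  supremum over \<open>D\<close> dominates \<open>w\<close> on the segment.\<close>

definition step_cost :: "('a::euclidean_space \<Rightarrow> real) \<Rightarrow> 'a set \<Rightarrow> 'a \<Rightarrow> 'a \<Rightarrow> ennreal" where
  "step_cost w D x y = ennreal (dist x y) * (SUP p\<in>D \<inter> ball x (2 * dist x y). ennreal (w p))"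

fun chain_cost :: "('a::euclidean_space \<Rightarrow> real) \<Rightarrow> 'a set \<Rightarrow> 'a list \<Rightarrow> ennreal" where
  "chain_cost w D (x # y # zs) = step_cost w D x y + chain_cost w D (y # zs)"
| "chain_cost w D _ = 0"

lemma chain_cost_append:
  "chain_cost w D (xs @ [y, z]) = chain_cost w D (xs @ [y]) + step_cost w D y z"
proof (induction xs)
  case (Cons x xs)
  then show ?case by (cases xs) (auto simp: ac_simps)
qed simp

lemma cost_dist_le_step:
  fixes x y :: "'a::euclidean_space"
  assumes w: "continuous_on UNIV w" and D: "closure D = UNIV"
  shows "cost_dist w x y \<le> step_cost w D x y"
proof (cases "x = y")
  case False
  show ?thesis
    unfolding step_cost_def
  proof (rule cost_dist_le_segment)
    fix p assume "p \<in> closed_segment x y"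
    then have "dist x p \<le> dist x y"
      by (metis dist_commute dist_in_closed_segment(1))
    then have p: "p \<in> ball x (2 * dist x y)" using False by (auto intro: le_less_trans)
    show "ennreal (w p) \<le> (SUP p\<in>D \<inter> ball x (2 * dist x y). ennreal (w p))" (is "_ \<le> ?K")
    proof (cases ?K)
      case (real K)
      have "p \<in> closure (D \<inter> ball x (2 * dist x y))"
        using p D open_Int_closure_subset[of "ball x (2 * dist x y)" D] by (auto simp: Int_commute)
      moreover have "closed {p. w p \<le> K}" by (intro closed_Collect_le w continuous_intros)
      moreover have "D \<inter> ball x (2 * dist x y) \<subseteq> {p. w p \<le> K}"
      proof safe
        fix q assume "q \<in> D" "q \<in> ball x (2 * dist x y)"
        then have "ennreal (w q) \<le> ?K" by (intro SUP_upper) auto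
        then show "w q \<le> K" using real by (auto simp: ennreal_le_iff2)
      qed
      ultimately have "w p \<le> K" using closure_minimal by blast
      then show ?thesis using real by (auto intro: ennreal_leI)
    next
      case top
      show ?thesis unfolding top by (rule top_greatest)
    qed
  qed
qed (simp add: cost_dist_self)

lemma cost_dist_le_chain:
  fixes x y :: "'a::euclidean_space"
  assumes w: "continuous_on UNIV w" and D: "closure D = UNIV"
  shows "cost_dist w x y \<le> chain_cost w D (x # zs @ [y])"
proof (induction zs arbitrary: x)
  case Nil
  then show ?case using cost_dist_le_step[OF assms] by simp
next
  case (Cons z zs)
  have "cost_dist w x y \<le> cost_dist w x z + cost_dist w z y" by (rule cost_dist_triangle[OF w])
  also have "\<dots> \<le> chain_cost w D (x # (z # zs) @ [y])"
    using Cons.IH cost_dist_le_step[OF assms] by (auto intro: add_mono)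
  finally show ?case .
qed

lemma path_cost_add_const:
  assumes "\<gamma> piecewise_C1_differentiable_on {a..b}" "continuous_on UNIV w" "\<And>x. 0 \<le> w x" "0 \<le> c"
  shows "path_cost (\<lambda>x. w x + c) a b \<gamma> = path_cost w a b \<gamma> + ennreal c * path_cost (\<lambda>_. 1) a b \<gamma>"
proof -
  have "path_cost (\<lambda>x. w x + c) a b \<gamma> = (\<integral>\<^sup>+ s. ennreal (w (\<gamma> s) * norm (vector_derivative \<gamma> (at s))) * indicator {a..b} s
      + ennreal c * (ennreal (1 * norm (vector_derivative \<gamma> (at s))) * indicator {a..b} s) \<partial>lborel)"
    unfolding path_cost_def
    by (rule nn_integral_cong) (use assms in \<open>auto split: split_indicator simp: ennreal_mult'[symmetric] algebra_simps ennreal_plus[symmetric] simp del: ennreal_plus\<close>)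
  also have "\<dots> = path_cost w a b \<gamma> + ennreal c * path_cost (\<lambda>_. 1) a b \<gamma>"
    unfolding path_cost_def
    using path_cost_measurable(1)[OF assms(1,2)] path_cost_measurable(1)[OF assms(1), of "\<lambda>_. 1"]
    by (subst nn_integral_add) (auto simp: nn_integral_cmult)
  finally show ?thesis .
qed

text \<open>The path is cut into short pieces and the cut points are replaced by nearby points of
  \<open>D\<close>. On a short piece \<open>w\<close> varies by less than \<open>e1\<close>, so a
  step costs little more than the minimum of \<open>w\<close> on the piece plus \<open>e1\<close>,
  times the length of the piece. Summed, this is nearly the cost for \<open>w + e1\<close>, that is,
  the cost for \<open>w\<close> plus \<open>e1\<close> times the Euclidean length.\<close>

lemma chain_approx_path:
  fixes x y :: "'a::euclidean_space"
  assumes w: "continuous_on UNIV w" and pos: "\<And>x. 0 < w x" and D: "closure D = UNIV"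
    and ab: "a < b" and g: "\<gamma> piecewise_C1_differentiable_on {a..b}" and x: "\<gamma> a = x" and y: "\<gamma> b = y"
    and fin: "path_cost w a b \<gamma> < \<infinity>" and e: "0 < e"
  shows "\<exists>zs\<in>lists D. chain_cost w D (x # zs @ [y]) \<le> path_cost w a b \<gamma> + ennreal e"
proof -
  have c: "continuous_on {a..b} \<gamma>" using g by (auto simp: piecewise_C1_differentiable_on_def)
  let ?K = "\<gamma> ` {a..b}"
  have comp: "compact ?K" by (intro compact_continuous_image c) auto
  obtain p0 where p0: "p0 \<in> ?K" "\<And>p. p \<in> ?K \<Longrightarrow> w p0 \<le> w p"
    using continuous_attains_inf[OF comp _ continuous_on_subset[OF w]] ab by auto
  define L where "L = enn2real (path_cost (\<lambda>_. 1) a b \<gamma>)"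
  \<comment> \<open>The minimum of \<open>w\<close> on the compact trace is positive, so the finite
    cost bounds the Euclidean length \<open>L\<close>.\<close>
  have "ennreal (w p0) * path_cost (\<lambda>_. 1) a b \<gamma> \<le> path_cost w a b \<gamma>"
  proof -
    have "ennreal (w p0) * path_cost (\<lambda>_. 1) a b \<gamma> =
      (\<integral>\<^sup>+s. ennreal (w p0) * (ennreal (1 * norm (vector_derivative \<gamma> (at s))) * indicator {a..b} s) \<partial>lborel)"
      unfolding path_cost_def
      by (rule nn_integral_cmult[symmetric]) (use path_cost_measurable(1)[OF g, of "\<lambda>_. 1"] in auto)
    also have "\<dots> \<le> path_cost w a b \<gamma>"
      unfolding path_cost_def
      by (rule nn_integral_mono) (use p0 pos[of p0] in \<open>auto split: split_indicator simp: ennreal_mult'[symmetric]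
        intro!: ennreal_leI mult_right_mono\<close>)
    finally show ?thesis .
  qed
  then have "ennreal (w p0) * path_cost (\<lambda>_. 1) a b \<gamma> < \<infinity>" using fin by (rule le_less_trans)
  then have finL: "path_cost (\<lambda>_. 1) a b \<gamma> = ennreal L" and L0: "0 \<le> L"
    using pos[of p0] by (auto simp: L_def ennreal_mult_less_top)
  obtain R where R: "\<And>p. p \<in> ?K \<Longrightarrow> norm p \<le> R"
    using compact_imp_bounded[OF comp] by (auto simp: bounded_iff)
  \<comment> \<open>The extra weight costs \<open>e1 * L\<close>, at most half of \<open>e\<close>;
    the other half pays for moving points into \<open>D\<close>.\<close>
  define e1 where "e1 = e / (2 * (L + 1))"
  have e1: "0 < e1" using e L0 by (simp add: e1_def)
  have "uniformly_continuous_on (cball 0 (R + 1)) w"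
    by (intro compact_uniformly_continuous continuous_on_subset[OF w]) auto
  then obtain d0 where d0: "0 < d0" "\<And>p p'. p \<in> cball 0 (R+1) \<Longrightarrow> p' \<in> cball 0 (R+1) \<Longrightarrow> dist p' p < d0 \<Longrightarrow> \<bar>w p' - w p\<bar> < e1"
    using e1 unfolding uniformly_continuous_on_def dist_real_def by metis
  define d where "d = min d0 1"
  have d: "0 < d" "d \<le> d0" "d \<le> 1" using d0 by (auto simp: d_def)
  have near: "w p \<le> w (\<gamma> t) + e1" if "t \<in> {a..b}" "dist (\<gamma> t) p < d" for p t
  proof -
    have "norm (\<gamma> t) \<le> R" using R that by auto
    moreover have "norm p \<le> norm (\<gamma> t) + dist (\<gamma> t) p" by (metis dist_norm norm_triangle_sub add.commute norm_minus_commute)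
    ultimately have "p \<in> cball 0 (R+1)" "\<gamma> t \<in> cball 0 (R+1)" using that d by auto
    from d0(2)[OF this(2,1)] that d show ?thesis by (auto simp: dist_commute)
  qed
  have "bounded (w ` cball 0 (R + 1))"
    by (intro compact_imp_bounded compact_continuous_image continuous_on_subset[OF w]) auto
  then obtain W0 where W0: "\<forall>p\<in>cball 0 (R+1). \<bar>w p\<bar> \<le> W0" by (auto simp: bounded_iff)
  define W where "W = max W0 1"
  have W: "1 \<le> W" "\<And>t p. t \<in> {a..b} \<Longrightarrow> dist (\<gamma> t) p < d \<Longrightarrow> w p \<le> W"
  proof -
    fix t p assume that: "t \<in> {a..b}" "dist (\<gamma> t) p < d"
    have "norm (\<gamma> t) \<le> R" using R that by auto
    moreover have "norm p \<le> norm (\<gamma> t) + dist (\<gamma> t) p" by (metis dist_norm norm_triangle_sub add.commute norm_minus_commute)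
    ultimately have "p \<in> cball 0 (R+1)" using that d by auto
    with W0 have "\<bar>w p\<bar> \<le> W0" by blast
    then show "w p \<le> W" by (simp add: W_def)
  qed (simp add: W_def)
  have "uniformly_continuous_on {a..b} \<gamma>" by (intro compact_uniformly_continuous c) auto
  then obtain h where h: "0 < h" "\<And>t t'. t \<in> {a..b} \<Longrightarrow> t' \<in> {a..b} \<Longrightarrow> \<bar>t' - t\<bar> < h \<Longrightarrow> dist (\<gamma> t') (\<gamma> t) < d / 8"
    using d unfolding uniformly_continuous_on_def dist_real_def by (metis divide_pos_pos zero_less_numeral)
  obtain N :: nat where N: "(b - a) / h < N" using reals_Archimedean2 by blast
  then have N0: "0 < N" using ab h by (metis diff_gt_0_iff_gt divide_pos_pos less_trans of_nat_0_less_iff)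
  define t where "t i = a + (b - a) * real i / real N" for i :: nat
  have tmono: "t i \<le> t (Suc i)" for i using ab N0 by (auto simp: t_def field_simps)
  have "(b - a) / real N < h" using N h N0 by (simp add: pos_divide_less_eq mult.commute)
  moreover have "t (Suc i) - t i = (b - a) / real N" for i
    by (simp add: t_def diff_divide_distrib [symmetric] algebra_simps)
  ultimately have tstep: "t (Suc i) - t i < h" for i by simp
  have tab: "t i \<in> {a..b}" if "i \<le> N" for i
  proof -
    have "(b - a) * (real i / real N) \<le> (b - a) * 1"
      using that N0 ab by (intro mult_left_mono) auto
    then show ?thesis using ab by (auto simp: t_def)
  qed
  let ?w = "\<lambda>p. w p + e1"
  have w': "continuous_on UNIV ?w" by (intro continuous_intros w)
  \<comment> \<open>If \<open>z\<close> and \<open>z'\<close> lie within \<open>d / 16\<close> of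
    path points less than \<open>d / 8\<close> apart, they are closer than \<open>d / 4\<close>. The
    ball in the step cost then has radius below \<open>d / 2\<close> and stays within
    \<open>d / 2 + d / 16 < 5 * d / 8\<close> of \<open>\<gamma> s\<close>.\<close>
  have stepb: "step_cost w D z z' \<le> ennreal (dist (\<gamma> s) (\<gamma> s') + 2 * \<eta>) * K"
    if "dist z (\<gamma> s) < \<eta>" "dist z' (\<gamma> s') < \<eta>" "\<eta> \<le> d / 16" "s \<in> {a..b}" "s' \<in> {a..b}" "\<bar>s - s'\<bar> < h"
      "\<And>p. dist p (\<gamma> s) < 5 * d / 8 \<Longrightarrow> ennreal (w p) \<le> K" for z z' s s' \<eta> K
  proof -
    have zz: "dist z z' \<le> dist (\<gamma> s) (\<gamma> s') + 2 * \<eta>"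
      using that(1,2) dist_triangle[of z z' "\<gamma> s"] dist_triangle[of "\<gamma> s" z' "\<gamma> s'"] by (simp add: dist_commute)
    have "dist (\<gamma> s) (\<gamma> s') < d / 8" using h(2)[of s' s] that by (simp add: abs_minus_commute)
    then have "dist z z' < d / 4" using zz that(3) by simp
    then have "(SUP p\<in>D \<inter> ball z (2 * dist z z'). ennreal (w p)) \<le> K"
    proof (intro SUP_least that(7))
      fix p assume "dist z z' < d / 4" "p \<in> D \<inter> ball z (2 * dist z z')"
      then show "dist p (\<gamma> s) < 5 * d / 8"
        using that(1,3) dist_triangle[of p "\<gamma> s" z] d by (auto simp: dist_commute)
    qed
    then show ?thesis unfolding step_cost_def using zz by (intro mult_mono ennreal_leI) auto
  qed
  have dense: "\<exists>z\<in>D. dist z p < \<eta>" if "0 < \<eta>" for p \<eta>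
    using D that closure_approachable[of p D] by auto
  \<comment> \<open>The error \<open>\<eta>\<close> is arbitrary at every stage, so that the
    induction can ask for a smaller error at the previous one.\<close>
  have main: "\<exists>zs\<in>lists D. \<exists>z\<in>D. dist z (\<gamma> (t i)) < \<eta> \<and>
      chain_cost w D (x # zs @ [z]) \<le> path_cost ?w a (t i) \<gamma> + ennreal \<eta>"
    if "i \<le> N" "0 < \<eta>" for i \<eta>
    using that
  proof (induction i arbitrary: \<eta>)
    case 0
    have \<eta>': "0 < min (\<eta> / (2 * W)) (d / 16)" (is "0 < ?\<eta>") using 0 d W by auto
    obtain z where z: "z \<in> D" "dist z (\<gamma> a) < ?\<eta>" using dense[OF \<eta>'] by blast
    have "step_cost w D x z \<le> ennreal (dist (\<gamma> a) (\<gamma> a) + 2 * ?\<eta>) * ennreal W"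
      by (rule stepb) (use z \<eta>' x ab h d in \<open>auto intro!: ennreal_leI W(2)[of a] simp: dist_commute\<close>)
    also have "\<dots> \<le> ennreal \<eta>"
      using W(1) 0 \<eta>' by (auto simp: ennreal_mult'[symmetric] field_simps min_def intro!: ennreal_leI)
    finally have "step_cost w D x z \<le> path_cost ?w a (t 0) \<gamma> + ennreal \<eta>" by (simp add: add_increasing)
    moreover have "\<eta> / (2 * W) \<le> \<eta>" using W(1) 0 by (simp add: field_simps)
    then have "?\<eta> \<le> \<eta>" by (rule min.coboundedI1)
    ultimately show ?case
      using z by (intro bexI[of _ "[]"] bexI[of _ z]) (auto simp: t_def)
  next
    case (Suc i)
    have i: "i \<le> N" "t i \<in> {a..b}" "t (Suc i) \<in> {a..b}" using Suc.prems tab by auto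
    \<comment> \<open>A third of \<open>\<eta>\<close> covers the error inherited from the previous
      stage, two thirds the displacement of both end points at unit cost at most
      \<open>W + e1\<close>.\<close>
    define \<eta>' where "\<eta>' = min (\<eta> / (3 * (W + e1))) (d / 16)"
    have We: "1 \<le> W + e1" using W(1) e1 by simp
    have \<eta>': "0 < \<eta>'" "\<eta>' \<le> d / 16"
      using Suc.prems d We unfolding \<eta>'_def by (simp, intro min.cobounded2)
    have "\<eta>' \<le> \<eta> / (3 * (W + e1))" unfolding \<eta>'_def by (rule min.cobounded1)
    then have "\<eta>' * (3 * (W + e1)) \<le> \<eta>" using We by (subst (asm) pos_le_divide_eq) auto
    moreover have "\<eta>' \<le> \<eta>' * (W + e1)" using We \<eta>' by simp
    ultimately have \<eta>'b: "\<eta>' + 2 * \<eta>' * (W + e1) \<le> \<eta>" by (simp add: algebra_simps)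
    then have \<eta>'2: "\<eta>' \<le> \<eta>" using We \<eta>' by (smt (verit) mult_nonneg_nonneg)
    obtain zs z where z: "zs \<in> lists D" "z \<in> D" "dist z (\<gamma> (t i)) < \<eta>'"
      "chain_cost w D (x # zs @ [z]) \<le> path_cost ?w a (t i) \<gamma> + ennreal \<eta>'"
      using Suc.IH[OF i(1) \<eta>'(1)] by blast
    obtain z' where z': "z' \<in> D" "dist z' (\<gamma> (t (Suc i))) < \<eta>'" using dense[OF \<eta>'(1)] by blast
    let ?T = "{t i..t (Suc i)}"
    have Tsub: "?T \<subseteq> {a..b}" using i by auto
    have "compact (\<gamma> ` ?T)" by (intro compact_continuous_image continuous_on_subset[OF c] Tsub) auto
    \<comment> \<open>\<open>q\<close> minimises \<open>w\<close> on the current piece, so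
      \<open>w q\<close> times the length of the piece is at most the cost of the piece.\<close>
    then obtain q where q: "q \<in> \<gamma> ` ?T" "\<And>p. p \<in> \<gamma> ` ?T \<Longrightarrow> w q \<le> w p"
      using continuous_attains_inf[of "\<gamma> ` ?T" w] continuous_on_subset[OF w] tmono[of i] by auto
    then obtain s where s: "s \<in> ?T" "q = \<gamma> s" by auto
    let ?\<kappa> = "w q + e1"
    have \<kappa>: "0 \<le> ?\<kappa>" "?\<kappa> \<le> W + e1" using pos[of q] e1 W(2)[of s q] s Tsub d by auto
    have "step_cost w D z z' \<le> ennreal (dist (\<gamma> (t i)) (\<gamma> (t (Suc i))) + 2 * \<eta>') * ennreal ?\<kappa>"
    proof (rule stepb[OF z(3) z'(2) \<eta>'(2) i(2,3)])
      show "\<bar>t i - t (Suc i)\<bar> < h" using tstep[of i] tmono[of i] by auto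
      fix p assume p: "dist p (\<gamma> (t i)) < 5 * d / 8"
      have "dist (\<gamma> s) (\<gamma> (t i)) < d / 8" by (rule h(2)) (use s i tstep[of i] Tsub in auto)
      then have "dist (\<gamma> s) p < d" using p dist_triangle[of "\<gamma> s" p "\<gamma> (t i)"] d by (simp add: dist_commute)
      then show "ennreal (w p) \<le> ennreal ?\<kappa>" using near[of s p] s Tsub by (auto intro: ennreal_leI)
    qed
    also have "\<dots> \<le> ennreal ?\<kappa> * ennreal (dist (\<gamma> (t i)) (\<gamma> (t (Suc i)))) + ennreal (2 * \<eta>' * (W + e1))"
    proof -
      have "(dist (\<gamma> (t i)) (\<gamma> (t (Suc i))) + 2 * \<eta>') * ?\<kappa> \<le> ?\<kappa> * dist (\<gamma> (t i)) (\<gamma> (t (Suc i))) + 2 * \<eta>' * (W + e1)"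
        using \<kappa> \<eta>'(1) mult_left_mono[of ?\<kappa> "W + e1" "2 * \<eta>'"] by (simp add: algebra_simps)
      then show ?thesis
        using \<kappa> \<eta>'(1) We by (simp add: ennreal_mult'[symmetric] ennreal_plus[symmetric] ennreal_leI del: ennreal_plus)
    qed
    also have "ennreal ?\<kappa> * ennreal (dist (\<gamma> (t i)) (\<gamma> (t (Suc i)))) \<le> ennreal ?\<kappa> * path_cost (\<lambda>_. 1) (t i) (t (Suc i)) \<gamma>"
      by (intro mult_left_mono dist_le_path_cost_1 tmono piecewise_C1_differentiable_on_subset[OF g Tsub]) auto
    also have "\<dots> = (\<integral>\<^sup>+s. ennreal ?\<kappa> * (ennreal (1 * norm (vector_derivative \<gamma> (at s))) * indicator ?T s) \<partial>lborel)"
      unfolding path_cost_def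
      by (rule nn_integral_cmult[symmetric])
        (use path_cost_measurable(1)[OF piecewise_C1_differentiable_on_subset[OF g Tsub], of "\<lambda>_. 1"] in auto)
    also have "\<dots> \<le> path_cost ?w (t i) (t (Suc i)) \<gamma>"
      unfolding path_cost_def
      by (rule nn_integral_mono) (use q \<kappa> in \<open>auto split: split_indicator simp: ennreal_mult'[symmetric]
        intro!: ennreal_leI mult_right_mono\<close>)
    finally have "step_cost w D z z' \<le> path_cost ?w (t i) (t (Suc i)) \<gamma> + ennreal (2 * \<eta>' * (W + e1))"
      by (simp add: add_right_mono)
    then have "chain_cost w D (x # (zs @ [z]) @ [z']) \<le>
       (path_cost ?w a (t i) \<gamma> + ennreal \<eta>') + (path_cost ?w (t i) (t (Suc i)) \<gamma> + ennreal (2 * \<eta>' * (W + e1)))"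
      using z(4) chain_cost_append[of w D "x # zs" z z'] by (auto intro: add_mono)
    also have "\<dots> = (path_cost ?w a (t i) \<gamma> + path_cost ?w (t i) (t (Suc i)) \<gamma>) + ennreal (\<eta>' + 2 * \<eta>' * (W + e1))"
      using \<eta>'(1) We by (simp add: ennreal_plus ac_simps)
    also have "path_cost ?w a (t i) \<gamma> + path_cost ?w (t i) (t (Suc i)) \<gamma> = path_cost ?w a (t (Suc i)) \<gamma>"
      by (rule path_cost_split[symmetric, OF piecewise_C1_differentiable_on_subset[OF g] w'])
        (use i tmono[of i] in auto)
    also have "ennreal (\<eta>' + 2 * \<eta>' * (W + e1)) \<le> ennreal \<eta>" using \<eta>'b by (rule ennreal_leI)
    finally show ?case
      using z z' \<eta>'2 by (intro bexI[of _ "zs @ [z]"] bexI[of _ z']) (auto simp: add_left_mono)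
  qed
  define \<eta> where "\<eta> = min (e / (6 * W)) (d / 16)"
  have \<eta>: "0 < \<eta>" "\<eta> \<le> d / 16" using e W d unfolding \<eta>_def by (simp, intro min.cobounded2)
  have "\<eta> \<le> e / (6 * W)" unfolding \<eta>_def by (rule min.cobounded1)
  then have "\<eta> * (6 * W) \<le> e" using W by (subst (asm) pos_le_divide_eq) auto
  moreover have "\<eta> \<le> \<eta> * W" using W \<eta> by simp
  ultimately have \<eta>b: "\<eta> + 2 * \<eta> * W \<le> e / 2" by (simp add: algebra_simps)
  obtain zs z where z: "zs \<in> lists D" "z \<in> D" "dist z (\<gamma> (t N)) < \<eta>"
      "chain_cost w D (x # zs @ [z]) \<le> path_cost ?w a (t N) \<gamma> + ennreal \<eta>"
    using main[OF order_refl \<eta>(1)] by blast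
  have tN: "t N = b" using N0 by (simp add: t_def)
  have "step_cost w D z y \<le> ennreal (dist (\<gamma> b) (\<gamma> b) + 2 * \<eta>) * ennreal W"
    by (rule stepb) (use z tN \<eta> y ab h d in \<open>auto intro!: ennreal_leI W(2)[of b] simp: dist_commute\<close>)
  also have "\<dots> = ennreal (2 * \<eta> * W)" using W \<eta> by (simp add: ennreal_mult'[symmetric])
  finally have "chain_cost w D (x # (zs @ [z]) @ [y]) \<le> (path_cost ?w a b \<gamma> + ennreal \<eta>) + ennreal (2 * \<eta> * W)"
    using z(4) chain_cost_append[of w D "x # zs" z y] tN by (auto intro: add_mono)
  also have "\<dots> = path_cost w a b \<gamma> + ennreal (e1 * L + (\<eta> + 2 * \<eta> * W))"
    using path_cost_add_const[OF g w, of e1] pos e1 W \<eta> L0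
    by (simp add: less_imp_le finL ennreal_mult' ennreal_plus ac_simps)
  also have "\<dots> \<le> path_cost w a b \<gamma> + ennreal e"
  proof (intro add_left_mono ennreal_leI)
    have "e1 * L \<le> e / 2" using L0 e by (simp add: e1_def field_simps)
    then show "e1 * L + (\<eta> + 2 * \<eta> * W) \<le> e" using \<eta>b by simp
  qed
  finally show ?thesis using z by (intro bexI[of _ "zs @ [z]"]) auto
qed

text \<open>The right-hand side depends on \<open>w\<close> only through its values on \<open>D\<close>, which makes the distance
  of a random continuous weight measurable.\<close>

lemma cost_dist_eq_chain:
  fixes x y :: "'a::euclidean_space"
  assumes w: "continuous_on UNIV w" and pos: "\<And>x. 0 < w x" and D: "closure D = UNIV"
  shows "cost_dist w x y = (INF zs\<in>lists D. chain_cost w D (x # zs @ [y]))"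
proof (rule antisym)
  show "cost_dist w x y \<le> (INF zs\<in>lists D. chain_cost w D (x # zs @ [y]))"
    by (rule INF_greatest) (rule cost_dist_le_chain[OF w D])
  show "(INF zs\<in>lists D. chain_cost w D (x # zs @ [y])) \<le> cost_dist w x y"
  proof (rule cost_dist_greatest, rule ennreal_le_epsilon)
    fix a b e :: real and \<gamma> :: "real \<Rightarrow> 'a"
    assume "a < b" "\<gamma> piecewise_C1_differentiable_on {a..b}" "\<gamma> a = x" "\<gamma> b = y"
      "path_cost w a b \<gamma> < top" "0 < e"
    then obtain zs where "zs \<in> lists D" "chain_cost w D (x # zs @ [y]) \<le> path_cost w a b \<gamma> + ennreal e"
      using chain_approx_path[OF w pos D, of a b \<gamma> x y e] by auto
    then show "(INF zs\<in>lists D. chain_cost w D (x # zs @ [y])) \<le> path_cost w a b \<gamma> + ennreal e"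
      by (auto intro: INF_lower2)
  qed
qed

text \<open>The bound involves \<open>w\<close> at finitely many points only, so for a random weight
  its mean is computed from the laws at single points. Uniform continuity on the segment makes it
  valid for all large \<open>n\<close>.\<close>

lemma cost_dist_le_riemann_sum:
  fixes x y :: "'a::euclidean_space"
  assumes w: "continuous_on UNIV w" and nn: "\<And>x. 0 \<le> w x" and e: "0 < e"
  shows "\<forall>\<^sub>F n in sequentially.
    cost_dist w x y \<le> ennreal (dist x y * (\<Sum>i<n. w (x + (real i / real n) *\<^sub>R (y - x))) / n + e)"
proof -
  define e1 where "e1 = e / (dist x y + 1)"
  have e1: "0 < e1" unfolding e1_def using e by (intro divide_pos_pos add_nonneg_pos) auto
  have e1d: "dist x y * e1 \<le> e"
    unfolding e1_def using e by (simp add: divide_le_eq mult_left_mono add_nonneg_pos mult.commute)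
  have "uniformly_continuous_on (closed_segment x y) w"
    by (intro compact_uniformly_continuous continuous_on_subset[OF w]) auto
  then obtain d where d: "0 < d" "\<And>p q. p \<in> closed_segment x y \<Longrightarrow> q \<in> closed_segment x y \<Longrightarrow> dist q p < d \<Longrightarrow> \<bar>w q - w p\<bar> < e1"
    using e1 unfolding uniformly_continuous_on_def dist_real_def by metis
  obtain N :: nat where N: "dist x y / d < N" using reals_Archimedean2 by blast
  show ?thesis
  proof (rule eventually_sequentiallyI[of "Suc N"])
    fix n assume n: "Suc N \<le> n"
    then have n0: "0 < n" by simp
    define p where "p i = x + (real i / real n) *\<^sub>R (y - x)" for i
    have pd: "dist (p i) (p (Suc i)) = dist x y / n" for i
    proof -
      have "p (Suc i) - p i = (1 / real n) *\<^sub>R (y - x)"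
        by (simp add: p_def scaleR_diff_left[symmetric] diff_divide_distrib[symmetric] del: scaleR_diff_right)
      then show ?thesis by (metis dist_commute dist_norm norm_scaleR abs_of_nonneg divide_nonneg_nonneg zero_le_one of_nat_0_le_iff mult.commute mult_1 times_divide_eq_left mult.left_neutral times_divide_eq_right)
    qed
    have "dist x y < N * d" using N d(1) by (simp add: pos_divide_less_eq)
    also have "\<dots> \<le> n * d" using n d(1) by (intro mult_right_mono) auto
    finally have small: "dist x y / n < d" using n0 by (simp add: pos_divide_less_eq mult.commute)
    have seg: "p i \<in> closed_segment x y" if "i \<le> n" for i
    proof -
      have "p i = (1 - real i / n) *\<^sub>R x + (real i / n) *\<^sub>R y" by (simp add: p_def algebra_simps)
      moreover have "real i / n \<le> 1" using that n0 by simp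
      ultimately show ?thesis unfolding in_segment by (metis divide_nonneg_nonneg of_nat_0_le_iff)
    qed
    have st: "cost_dist w (p i) (p (Suc i)) \<le> ennreal (dist x y / n * (w (p i) + e1))" if "i < n" for i
    proof -
      have "cost_dist w (p i) (p (Suc i)) \<le> ennreal (dist (p i) (p (Suc i))) * ennreal (w (p i) + e1)"
      proof (rule cost_dist_le_segment, rule ennreal_leI)
        fix q assume q: "q \<in> closed_segment (p i) (p (Suc i))"
        then have "q \<in> closed_segment x y"
          using closed_segment_subset[OF seg[of i] seg[of "Suc i"]] that by auto
        moreover have "dist q (p i) \<le> dist (p i) (p (Suc i))"
          using dist_in_closed_segment(1)[OF q] by simp
        ultimately have "\<bar>w q - w (p i)\<bar> < e1"
          using seg[of i] that small pd by (intro d(2)) auto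
        then show "w q \<le> w (p i) + e1" by linarith
      qed
      also have "\<dots> = ennreal (dist x y / n * (w (p i) + e1))"
        using nn[of "p i"] e1 by (simp add: pd ennreal_mult'[symmetric] del: ennreal_plus)
      finally show ?thesis .
    qed
    have "cost_dist w (p 0) (p k) \<le> ennreal (\<Sum>i<k. dist x y / n * (w (p i) + e1))" if "k \<le> n" for k
      using that
    proof (induction k)
      case (Suc k)
      have "cost_dist w (p 0) (p (Suc k)) \<le> cost_dist w (p 0) (p k) + cost_dist w (p k) (p (Suc k))"
        by (rule cost_dist_triangle[OF w])
      also have "\<dots> \<le> ennreal (\<Sum>i<k. dist x y / n * (w (p i) + e1)) + ennreal (dist x y / n * (w (p k) + e1))"
        using Suc st by (intro add_mono) auto
      also have "\<dots> = ennreal (\<Sum>i<Suc k. dist x y / n * (w (p i) + e1))"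
        using nn less_imp_le[OF e1] by (simp add: ennreal_plus[symmetric] sum_nonneg del: ennreal_plus)
      finally show ?case .
    qed (simp add: cost_dist_self)
    from this[of n] have "cost_dist w (p 0) (p n) \<le> ennreal (\<Sum>i<n. dist x y / n * (w (p i) + e1))" by simp
    also have "(\<Sum>i<n. dist x y / n * (w (p i) + e1)) = dist x y * (\<Sum>i<n. w (p i)) / n + dist x y * e1"
      using n0 by (simp add: sum.distrib distrib_left add_divide_distrib sum_distrib_left sum_divide_distrib)
    also have "ennreal \<dots> \<le> ennreal (dist x y * (\<Sum>i<n. w (p i)) / n + e)"
      using e1d by (intro ennreal_leI) simp
    finally show "cost_dist w x y \<le> ennreal (dist x y * (\<Sum>i<n. w (x + (real i / real n) *\<^sub>R (y - x))) / n + e)"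
      using n0 by (simp add: p_def)
  qed
qed


section \<open>Crossing unit cells\<close>

definition cell :: "real^2 \<Rightarrow> int \<times> int" where
  "cell p = (\<lfloor>p $ 1\<rfloor>, \<lfloor>p $ 2\<rfloor>)"

definition king :: "int \<times> int \<Rightarrow> int \<times> int \<Rightarrow> bool" where
  "king z z' \<longleftrightarrow> \<bar>fst z - fst z'\<bar> \<le> 1 \<and> \<bar>snd z - snd z'\<bar> \<le> 1"

definition cell_norm :: "int \<times> int \<Rightarrow> int" where
  "cell_norm z = max \<bar>fst z\<bar> \<bar>snd z\<bar>"

text \<open>Self-avoiding walks from the cell of the origin in the eight-neighbour lattice.
  \<open>king\<close> is reflexive, but distinctness excludes pauses and makes \<open>n\<close> the
  number of visited cells; the empty list is there for \<open>n = 0\<close>.\<close>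

definition king_walks :: "nat \<Rightarrow> (int \<times> int) list set" where
  "king_walks n = {zs. length zs = n \<and> distinct zs \<and> successively king zs \<and> (zs \<noteq> [] \<longrightarrow> hd zs = (0, 0))}"

lemma king_cell: "dist p p' < 1 \<Longrightarrow> king (cell p) (cell p')"
proof -
  assume d: "dist p p' < 1"
  have *: "\<bar>\<lfloor>p $ i\<rfloor> - \<lfloor>p' $ i\<rfloor>\<bar> \<le> 1" for i
  proof -
    have "\<bar>p $ i - p' $ i\<bar> < 1"
      using d component_le_norm_cart[of "p - p'" i] by (simp add: dist_norm)
    then show ?thesis by linarith
  qed
  then show ?thesis by (simp add: king_def cell_def)
qed

lemma cell_norm_king: "king z z' \<Longrightarrow> cell_norm z' \<le> cell_norm z + 1"
  by (auto simp: king_def cell_norm_def)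

lemma successively_king_nth:
  "successively king zs \<Longrightarrow> i < length zs \<Longrightarrow> cell_norm (zs ! i) \<le> cell_norm (hd zs) + int i"
proof (induction zs arbitrary: i)
  case (Cons z zs)
  show ?case
  proof (cases i)
    case (Suc j)
    then have z: "zs \<noteq> []" "j < length zs" using Cons.prems by auto
    then have "king z (hd zs)" "successively king zs" using Cons.prems by (auto simp: successively_Cons)
    then show ?thesis using Cons.IH[of j] z Suc cell_norm_king[of z "hd zs"] by auto
  qed simp
qed simp

lemma rtrancl_path_successively:
  "rtrancl_path r x xs y \<Longrightarrow> successively r (x # xs)"
  by (induction rule: rtrancl_path.induct) auto

lemma rtrancl_path_last: "rtrancl_path r x xs y \<Longrightarrow> last (x # xs) = y"
  by (induction rule: rtrancl_path.induct) auto

text \<open>Sampling the path at distances below 1 gives a walk through adjacent visited cells, and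
  erasing its loops makes it self-avoiding. The cell with index \<open>i\<close> has norm at most
  \<open>i\<close>, so the walk has more than \<open>n\<close> cells and none of its first
  \<open>n\<close> cells is adjacent to the last cell of the path.\<close>

lemma king_walk_of_path:
  fixes \<gamma> :: "real \<Rightarrow> real^2"
  assumes c: "continuous_on {a..b} \<gamma>" and ab: "a < b" and z: "\<gamma> a = 0"
    and far: "int n + 1 \<le> cell_norm (cell (\<gamma> b))"
  shows "\<exists>zs\<in>king_walks n. set zs \<subseteq> {u \<in> cell ` \<gamma> ` {a..b}. \<not> king u (cell (\<gamma> b))}"
proof -
  let ?V = "cell ` \<gamma> ` {a..b}"
  define r where "r u v \<longleftrightarrow> king u v \<and> u \<in> ?V \<and> v \<in> ?V" for u v
  have "uniformly_continuous_on {a..b} \<gamma>" by (intro compact_uniformly_continuous c) auto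
  then obtain h where h: "0 < h" "\<And>t t'. t \<in> {a..b} \<Longrightarrow> t' \<in> {a..b} \<Longrightarrow> \<bar>t' - t\<bar> < h \<Longrightarrow> dist (\<gamma> t') (\<gamma> t) < 1"
    unfolding uniformly_continuous_on_def dist_real_def by (metis zero_less_one)
  obtain N :: nat where N: "(b - a) / h < N" using reals_Archimedean2 by blast
  then have N0: "0 < N" using ab h by (metis diff_gt_0_iff_gt divide_pos_pos less_trans of_nat_0_less_iff)
  define t where "t i = a + (b - a) * real i / real N" for i :: nat
  have tab: "t i \<in> {a..b}" if "i \<le> N" for i
  proof -
    have "(b - a) * (real i / real N) \<le> (b - a) * 1"
      using that N0 ab by (intro mult_left_mono) auto
    then show ?thesis using ab by (auto simp: t_def)
  qed
  have "\<bar>(b - a) / real N\<bar> < h" using N h(1) N0 ab by (simp add: pos_divide_less_eq mult.commute)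
  moreover have "t (Suc i) - t i = (b - a) / real N" for i
    by (simp add: t_def diff_divide_distrib [symmetric] algebra_simps)
  ultimately have st: "\<bar>t (Suc i) - t i\<bar> < h" for i by simp
  have "r\<^sup>*\<^sup>* (cell (\<gamma> a)) (cell (\<gamma> (t i)))" if "i \<le> N" for i
    using that
  proof (induction i)
    case (Suc i)
    have "dist (\<gamma> (t (Suc i))) (\<gamma> (t i)) < 1"
      using Suc.prems by (intro h(2) tab st) auto
    then have "r (cell (\<gamma> (t i))) (cell (\<gamma> (t (Suc i))))"
      unfolding r_def using Suc.prems tab by (auto intro!: king_cell simp: dist_commute)
    then show ?case using Suc by (auto intro: rtranclp.rtrancl_into_rtrancl)
  qed (simp add: t_def)
  from this[of N] have "r\<^sup>*\<^sup>* (cell (\<gamma> a)) (cell (\<gamma> b))" using N0 by (simp add: t_def)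
  then obtain xs' where "rtrancl_path r (cell (\<gamma> a)) xs' (cell (\<gamma> b))"
    using rtranclp_eq_rtrancl_path by metis
  then obtain xs where xs: "rtrancl_path r (cell (\<gamma> a)) xs (cell (\<gamma> b))" "distinct (cell (\<gamma> a) # xs)"
    by (rule rtrancl_path_distinct) blast
  define ys where "ys = cell (\<gamma> a) # xs"
  have ca: "cell (\<gamma> a) = (0, 0)" by (simp add: z cell_def)
  have sr: "successively r ys" unfolding ys_def by (rule rtrancl_path_successively[OF xs(1)])
  have sk: "successively king ys" by (rule successively_mono[OF sr]) (simp add: r_def)
  have V: "set ys \<subseteq> ?V"
  proof -
    have "set zs \<subseteq> ?V" if "successively r zs" "2 \<le> length zs" for zs
      using that
    proof (induction zs)
      case (Cons u zs)
      then obtain v vs where zs: "zs = v # vs" by (cases zs) auto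
      then show ?case using Cons by (cases vs) (auto simp: r_def)
    qed simp
    then have "set ys \<subseteq> ?V" if "2 \<le> length ys" using sr that by blast
    then show ?thesis
      using ab by (cases xs) (auto simp: ys_def)
  qed
  have norm_nth: "cell_norm (ys ! i) \<le> int i" if "i < length ys" for i
    using successively_king_nth[OF sk that] by (simp add: ys_def ca cell_norm_def)
  have "cell (\<gamma> b) = ys ! (length ys - 1)"
    using rtrancl_path_last[OF xs(1)] by (metis last_conv_nth list.distinct(1) ys_def)
  then have "int n + 1 \<le> int (length ys - 1)" using norm_nth[of "length ys - 1"] far by (simp add: ys_def)
  then have len: "n \<le> length ys" by simp
  show ?thesis
  proof (intro bexI[of _ "take n ys"] subsetI)
    show "take n ys \<in> king_walks n"
      unfolding king_walks_def
    proof (intro CollectI conjI impI)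
      show "length (take n ys) = n" using len by simp
      show "distinct (take n ys)" using xs(2) by (simp add: ys_def del: distinct.simps take.simps)
      show "successively king (take n ys)"
        using sk by (metis append_take_drop_id successively_append_iff)
      assume "take n ys \<noteq> []"
      then show "hd (take n ys) = (0, 0)" by (cases n) (auto simp: ys_def ca)
    qed
    fix u assume u: "u \<in> set (take n ys)"
    then obtain i where i: "i < n" "i < length ys" "u = ys ! i" by (auto simp: in_set_conv_nth)
    have "\<not> king u (cell (\<gamma> b))"
      using norm_nth[OF i(2)] i far cell_norm_king[of u "cell (\<gamma> b)"] by auto
    then show "u \<in> {u \<in> ?V. \<not> king u (cell (\<gamma> b))}"
      using V in_set_takeD[OF u] by auto
  qed
qed

lemma cell_component_borel: "{p :: real^2. king z (cell p)} \<in> sets borel"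
proof -
  have "{p :: real^2. king z (cell p)} =
    {p. real_of_int (fst z - 1) \<le> p $ 1} \<inter> {p. p $ 1 < real_of_int (fst z + 2)} \<inter>
    ({p. real_of_int (snd z - 1) \<le> p $ 2} \<inter> {p. p $ 2 < real_of_int (snd z + 2)})"
    by (auto simp: king_def cell_def abs_le_iff le_floor_iff floor_less_iff; linarith)
  also have "\<dots> \<in> sets borel"
    by (intro sets.Int borel_closed borel_open closed_Collect_le open_Collect_less continuous_intros)
  finally show ?thesis .
qed

text \<open>A path that visits a cell and ends outside the surrounding block of nine cells travels at least
  unit distance inside that block.\<close>

lemma path_cost_block:
  fixes \<gamma> :: "real \<Rightarrow> real^2"
  assumes g: "\<gamma> piecewise_C1_differentiable_on {a..b}"
    and u: "u \<in> cell ` \<gamma> ` {a..b}" "\<not> king u (cell (\<gamma> b))"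
  shows "1 \<le> (\<integral>\<^sup>+ s. indicator {s. king u (cell (\<gamma> s))} s *
    (ennreal (norm (vector_derivative \<gamma> (at s))) * indicator {a..b} s) \<partial>lborel)"
proof -
  have c: "continuous_on {a..b} \<gamma>" using g by (auto simp: piecewise_C1_differentiable_on_def)
  obtain t0 where t0: "t0 \<in> {a..b}" "u = cell (\<gamma> t0)" using u by auto
  \<comment> \<open>The half-open block is replaced by its interior so that a first exit time
    \<open>t1\<close> exists. A point outside the interior is still at distance at least 1 from
    every point of the cell.\<close>
  let ?O = "{p :: real^2. real_of_int (fst u - 1) < p $ 1} \<inter> {p. p $ 1 < real_of_int (fst u + 2)} \<inter>
    ({p. real_of_int (snd u - 1) < p $ 2} \<inter> {p. p $ 2 < real_of_int (snd u + 2)})"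
  have O: "open ?O" by (intro open_Int open_Collect_less continuous_intros)
  have Ok: "king u (cell p)" if "p \<in> ?O" for p
    using that by (auto simp: king_def cell_def abs_le_iff le_floor_iff floor_less_iff; linarith)
  have nO: "1 \<le> dist p (\<gamma> t0)" if "p \<notin> ?O" for p
  proof -
    have "\<exists>i. 1 \<le> \<bar>p $ i - \<gamma> t0 $ i\<bar>"
    proof -
      have f: "real_of_int (fst u) \<le> \<gamma> t0 $ 1" "\<gamma> t0 $ 1 < real_of_int (fst u) + 1"
        "real_of_int (snd u) \<le> \<gamma> t0 $ 2" "\<gamma> t0 $ 2 < real_of_int (snd u) + 1"
        using t0(2) by (auto simp: cell_def)
      have "1 \<le> \<bar>p $ 1 - \<gamma> t0 $ 1\<bar> \<or> 1 \<le> \<bar>p $ 2 - \<gamma> t0 $ 2\<bar>"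
        using that f by auto
      then show ?thesis by auto
    qed
    then show ?thesis
      using component_le_norm_cart[of "p - \<gamma> t0"] by (metis dist_norm order_trans vector_minus_component)
  qed
  have "b \<in> {t0..b} \<inter> \<gamma> -` (- ?O)" using t0 u(2) Ok by auto
  moreover have "compact ({t0..b} \<inter> \<gamma> -` (- ?O))"
  proof -
    have "closed ({t0..b} \<inter> \<gamma> -` (- ?O))"
    proof (rule continuous_closed_preimage[OF continuous_on_subset[OF c]])
      show "{t0..b} \<subseteq> {a..b}" using t0 by auto
    qed (rule closed_atLeastAtMost, rule O[unfolded open_closed])
    then have "compact ({t0..b} \<inter> ({t0..b} \<inter> \<gamma> -` (- ?O)))" by (intro compact_Int_closed) auto
    then show ?thesis by (simp only: Int_assoc[symmetric] Int_absorb)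
  qed
  ultimately obtain t1 where t1: "t1 \<in> {t0..b}" "\<gamma> t1 \<notin> ?O" and min: "\<And>t. t \<in> {t0..b} \<Longrightarrow> \<gamma> t \<notin> ?O \<Longrightarrow> t1 \<le> t"
    using compact_attains_inf[of "{t0..b} \<inter> \<gamma> -` (- ?O)"] by blast
  have "1 \<le> ennreal (dist (\<gamma> t0) (\<gamma> t1))"
    using nO[OF t1(2)] by (simp add: dist_commute)
  also have "\<dots> \<le> path_cost (\<lambda>_. 1) t0 t1 \<gamma>"
    by (rule dist_le_path_cost_1) (use t0 t1 g in \<open>auto intro: piecewise_C1_differentiable_on_subset\<close>)
  also have "\<dots> \<le> (\<integral>\<^sup>+ s. indicator {s. king u (cell (\<gamma> s))} s *
    (ennreal (norm (vector_derivative \<gamma> (at s))) * indicator {a..b} s) \<partial>lborel)"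
    unfolding path_cost_def
  proof (rule nn_integral_mono_AE, rule AE_mp[OF AE_lborel_notin_finite[of "{t1}"]], simp, rule AE_I2, rule impI)
    fix s assume "s \<notin> {t1}"
    show "ennreal (1 * norm (vector_derivative \<gamma> (at s))) * indicator {t0..t1} s
      \<le> indicator {s. king u (cell (\<gamma> s))} s * (ennreal (norm (vector_derivative \<gamma> (at s))) * indicator {a..b} s)"
    proof (cases "s \<in> {t0..t1}")
      case True
      then have "s < t1" using \<open>s \<notin> {t1}\<close> by auto
      then have "\<gamma> s \<in> ?O" using min[of s] True t1 by (meson atLeastAtMost_iff not_le order.trans less_imp_le)
      then have "king u (cell (\<gamma> s))" by (rule Ok)
      then show ?thesis using True t0 t1 by auto
    qed simp
  qed
  finally show ?thesis .
qed

lemma card_king: "card {u. king u z} \<le> 9" and finite_king: "finite {u. king u z}"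
proof -
  have "{u. king u z} \<subseteq> {fst z - 1..fst z + 1} \<times> {snd z - 1..snd z + 1}"
    by (auto simp: king_def)
  then show "finite {u. king u z}" by (rule finite_subset) simp
  have "card {u. king u z} \<le> card ({fst z - 1..fst z + 1} \<times> {snd z - 1..snd z + 1})"
    by (rule card_mono) (use \<open>{u. king u z} \<subseteq> _\<close> in auto)
  then show "card {u. king u z} \<le> 9" by (simp add: card_cartesian_product)
qed

text \<open>Each good cell of the walk makes the path pay at least \<open>c\<close> inside its block
  of nine cells. A point lies in the blocks of at most nine cells, so adding these payments counts
  the cost at most nine times.\<close>

lemma cost_dist_lower_bound:
  fixes w :: "real^2 \<Rightarrow> real"
  assumes w: "continuous_on UNIV w" and c0: "0 \<le> c"
    and nn: "\<And>p. 0 \<le> w p"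
    and good: "\<And>z p. z \<notin> B \<Longrightarrow> king z (cell p) \<Longrightarrow> c \<le> w p"
    and far: "int n + 1 \<le> cell_norm (cell x)"
    and few: "\<And>zs. zs \<in> king_walks n \<Longrightarrow> m \<le> card (set zs - B)"
  shows "ennreal (c * real m / 9) \<le> cost_dist w 0 x"
proof (rule cost_dist_greatest)
  fix a b and \<gamma> :: "real \<Rightarrow> real^2"
  assume ab: "a < b" and g: "\<gamma> piecewise_C1_differentiable_on {a..b}" and e: "\<gamma> a = 0" "\<gamma> b = x"
  have cont: "continuous_on {a..b} \<gamma>" using g by (auto simp: piecewise_C1_differentiable_on_def)
  obtain zs where zs: "zs \<in> king_walks n" "set zs \<subseteq> {u \<in> cell ` \<gamma> ` {a..b}. \<not> king u (cell (\<gamma> b))}"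
    using king_walk_of_path[OF cont ab e(1), of n] far e(2) by auto
  define G where "G = set zs - B"
  have finG: "finite G" by (simp add: G_def)
  define v where "v s = ennreal (norm (vector_derivative \<gamma> (at s))) * indicator {a..b} s" for s
  have vm: "v \<in> borel_measurable lborel"
    unfolding v_def[abs_def] using path_cost_measurable(1)[OF g, of "\<lambda>_. 1"] by simp
  have cm: "(\<lambda>s. indicator {s. king u (cell (\<gamma> s))} s * v s) \<in> borel_measurable lborel" for u
  proof -
    \<comment> \<open>The path is known to be continuous on \<open>{a..b}\<close> only; cutting it
      off there changes nothing, because \<open>v\<close> vanishes elsewhere.\<close>
    have "(\<lambda>s. indicator {a..b} s *\<^sub>R \<gamma> s) \<in> borel_measurable lborel"
      using borel_measurable_continuous_on_indicator[OF _ cont] by simp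
    from measurable_sets[OF this cell_component_borel[of u]]
    have "{s. king u (cell (indicator {a..b} s *\<^sub>R \<gamma> s))} \<in> sets lborel"
      by (simp add: vimage_def)
    then have "(\<lambda>s. indicator {s. king u (cell (indicator {a..b} s *\<^sub>R \<gamma> s))} s * v s) \<in> borel_measurable lborel"
      using vm by (auto intro!: borel_measurable_times_ennreal borel_measurable_indicator)
    also have "(\<lambda>s. indicator {s. king u (cell (indicator {a..b} s *\<^sub>R \<gamma> s))} s * v s) =
        (\<lambda>s. indicator {s. king u (cell (\<gamma> s))} s * v s)"
      by (auto simp: v_def fun_eq_iff split: split_indicator)
    finally show ?thesis .
  qed
  have "ennreal (c * real m) \<le> (\<Sum>u\<in>G. ennreal c * 1)"
    using few[OF zs(1)] c0 by (simp add: G_def ennreal_mult'[symmetric] ennreal_of_nat_eq_real_of_nat mult.commute mult_left_mono ennreal_leI)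
  also have "\<dots> \<le> (\<Sum>u\<in>G. ennreal c * (\<integral>\<^sup>+ s. indicator {s. king u (cell (\<gamma> s))} s * v s \<partial>lborel))"
    unfolding v_def
    by (intro sum_mono mult_left_mono path_cost_block[OF g]) (use zs(2) in \<open>auto simp: G_def\<close>)
  also have "\<dots> = (\<integral>\<^sup>+ s. (\<Sum>u\<in>G. ennreal c * (indicator {s. king u (cell (\<gamma> s))} s * v s)) \<partial>lborel)"
    using cm by (simp add: nn_integral_sum nn_integral_cmult)
  also have "\<dots> \<le> (\<integral>\<^sup>+ s. 9 * (ennreal (w (\<gamma> s) * norm (vector_derivative \<gamma> (at s))) * indicator {a..b} s) \<partial>lborel)"
  proof (rule nn_integral_mono)
    fix s
    let ?R = "ennreal (w (\<gamma> s) * norm (vector_derivative \<gamma> (at s))) * indicator {a..b} s"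
    have "(\<Sum>u\<in>G. ennreal c * (indicator {s. king u (cell (\<gamma> s))} s * v s)) \<le>
       (\<Sum>u\<in>G. if king u (cell (\<gamma> s)) then ?R else 0)"
    proof (rule sum_mono)
      fix u assume "u \<in> G"
      then have "u \<notin> B" by (simp add: G_def)
      then show "ennreal c * (indicator {s. king u (cell (\<gamma> s))} s * v s) \<le> (if king u (cell (\<gamma> s)) then ?R else 0)"
        using good[of u "\<gamma> s"] nn[of "\<gamma> s"] c0
        by (auto simp: v_def ennreal_mult' intro!: mult_right_mono ennreal_leI split: split_indicator)
    qed
    also have "\<dots> = (\<Sum>u\<in>G \<inter> {u. king u (cell (\<gamma> s))}. ?R)"
      by (subst sum.inter_restrict[OF finG]) simp
    also have "\<dots> = of_nat (card (G \<inter> {u. king u (cell (\<gamma> s))})) * ?R" by simp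
    also have "\<dots> \<le> of_nat 9 * ?R"
    proof (intro mult_right_mono of_nat_mono)
      have "card (G \<inter> {u. king u (cell (\<gamma> s))}) \<le> card {u. king u (cell (\<gamma> s))}"
        by (rule card_mono[OF finite_king]) auto
      then show "card (G \<inter> {u. king u (cell (\<gamma> s))}) \<le> 9" using card_king le_trans by blast
    qed simp
    finally show "(\<Sum>u\<in>G. ennreal c * (indicator {s. king u (cell (\<gamma> s))} s * v s)) \<le> 9 * ?R" by simp
  qed
  also have "\<dots> = 9 * path_cost w a b \<gamma>"
    unfolding path_cost_def by (rule nn_integral_cmult) (use path_cost_measurable(1)[OF g w] in auto)
  finally have *: "ennreal (c * real m) \<le> 9 * path_cost w a b \<gamma>" .
  show "ennreal (c * real m / 9) \<le> path_cost w a b \<gamma>"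
  proof (cases "path_cost w a b \<gamma>")
    case (real r)
    then have "9 * path_cost w a b \<gamma> = ennreal (9 * r)" by (simp add: ennreal_mult')
    then show ?thesis using * real c0 by (auto simp: ennreal_le_iff2 intro!: ennreal_leI)
  qed simp
qed


section \<open>Trigonometric polynomials\<close>

text \<open>Real trigonometric polynomials in the functions of \<open>L\<close>, with the phase
  \<open>c\<close> supplying the sines. They form an algebra when \<open>L\<close> is a linear
  space, and centred Gaussian variables give them explicit means. \<open>L\<close> will be the
  linear forms on a Euclidean space and the finite combinations of field values.\<close>

inductive_set trig_polys :: "('a \<Rightarrow> real) set \<Rightarrow> ('a \<Rightarrow> real) set" for L where
  cos: "h \<in> L \<Longrightarrow> (\<lambda>x. a * cos (h x + c)) \<in> trig_polys L"
| add: "P \<in> trig_polys L \<Longrightarrow> Q \<in> trig_polys L \<Longrightarrow> (\<lambda>x. P x + Q x) \<in> trig_polys L"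

definition function_subspace :: "('a \<Rightarrow> real) set \<Rightarrow> bool" where
  "function_subspace L \<longleftrightarrow> (\<lambda>_. 0) \<in> L \<and> (\<forall>f\<in>L. \<forall>g\<in>L. (\<lambda>x. f x + g x) \<in> L) \<and>
     (\<forall>f\<in>L. \<forall>c. (\<lambda>x. c * f x) \<in> L)"

lemma trig_polys_const:
  assumes "function_subspace L"
  shows "(\<lambda>_. c) \<in> trig_polys L"
  using trig_polys.cos[of "\<lambda>_. 0" L c 0] assms by (simp add: function_subspace_def)

lemma trig_polys_scale: "P \<in> trig_polys L \<Longrightarrow> (\<lambda>x. c * P x) \<in> trig_polys L"
proof (induction rule: trig_polys.induct)
  case (cos h a d)
  then show ?case using trig_polys.cos[of h L "c * a" d] by (simp add: mult.assoc)
next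
  case (add P Q)
  then show ?case using trig_polys.add[of "\<lambda>x. c * P x" L "\<lambda>x. c * Q x"] by (simp add: distrib_left)
qed

lemma trig_polys_mult:
  assumes L: "function_subspace L" and "P \<in> trig_polys L" "Q \<in> trig_polys L"
  shows "(\<lambda>x. P x * Q x) \<in> trig_polys L"
  using assms(2)
proof (induction rule: trig_polys.induct)
  case (cos h a c)
  show ?case using assms(3)
  proof (induction rule: trig_polys.induct)
    case (cos k b d)
    have add: "(\<lambda>x. f x + g x) \<in> L" if "f \<in> L" "g \<in> L" for f g
      using L that unfolding function_subspace_def by blast
    have "(\<lambda>x. (-1) * k x) \<in> L"
      using L \<open>k \<in> L\<close> unfolding function_subspace_def by blast
    note add[OF \<open>h \<in> L\<close> \<open>k \<in> L\<close>] add[OF \<open>h \<in> L\<close> this]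
    from trig_polys.add[OF trig_polys.cos[OF this(1), of "a * b / 2" "c + d"] trig_polys.cos[OF this(2), of "a * b / 2" "c - d"]]
    moreover have "a * b / 2 * cos (h x + k x + (c + d)) + a * b / 2 * cos (h x + (-1) * k x + (c - d)) =
        a * cos (h x + c) * (b * cos (k x + d))" for x
    proof -
      have e: "h x + k x + (c + d) = (h x + c) + (k x + d)" "h x + (-1) * k x + (c - d) = (h x + c) - (k x + d)"
        by simp_all
      have "a * cos (h x + c) * (b * cos (k x + d)) = a * b * (cos (h x + c) * cos (k x + d))" by simp
      then show ?thesis unfolding e cos_times_cos by (simp add: distrib_left add.commute)
    qed
    ultimately show ?case by simp
  next
    case (add P Q)
    then show ?case
      using trig_polys.add[OF add.IH] by (simp add: distrib_left)
  qed
next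
  case (add P1 P2)
  then show ?case using trig_polys.add[OF add.IH] by (simp add: distrib_right)
qed

lemma trig_polys_polynomial:
  assumes L: "function_subspace L" and s: "s \<in> trig_polys L" and p: "real_polynomial_function (p :: real \<Rightarrow> real)"
  shows "(\<lambda>x. p (s x)) \<in> trig_polys L"
  using p
proof (induction rule: real_polynomial_function.induct)
  case (linear f)
  have "f y = f 1 * y" for y
    using linear_scale[OF bounded_linear.linear[OF linear], of y 1] by simp
  then have "(\<lambda>x. f (s x)) = (\<lambda>x. f 1 * s x)" by (intro ext)
  then show ?case using trig_polys_scale[OF s, of "f 1"] by simp
next
  case (const c)
  show ?case by (rule trig_polys_const[OF L])
next
  case (add f g)
  show ?case by (rule trig_polys.add[OF add.IH])
next
  case (mult f g)
  show ?case by (rule trig_polys_mult[OF L mult.IH])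
qed

lemma trig_polys_bounded: "P \<in> trig_polys L \<Longrightarrow> \<exists>B\<ge>0. \<forall>x. \<bar>P x\<bar> \<le> B"
proof (induction rule: trig_polys.induct)
  case (cos h a c)
  have "\<bar>a * cos (h x + c)\<bar> \<le> \<bar>a\<bar> * 1" for x
    unfolding abs_mult by (intro mult_left_mono abs_cos_le_one) auto
  then show ?case by (intro exI[of _ "\<bar>a\<bar>"]) auto
next
  case (add P Q)
  then obtain B C where "B \<ge> 0" "C \<ge> 0" "\<And>x. \<bar>P x\<bar> \<le> B" "\<And>x. \<bar>Q x\<bar> \<le> C" by auto
  then show ?case by (intro exI[of _ "B + C"]) (auto intro!: order_trans[OF abs_triangle_ineq] add_mono)
qed

lemma trig_polys_measurable:
  "P \<in> trig_polys L \<Longrightarrow> L \<subseteq> borel_measurable M \<Longrightarrow> P \<in> borel_measurable M"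
proof (induction rule: trig_polys.induct)
  case (cos h a c)
  then have [measurable]: "h \<in> borel_measurable M" by blast
  show ?case by measurable
qed (auto intro: borel_measurable_add)

text \<open>Two measures are treated at once, so that the same trigonometric polynomial serves for both
  when two laws are compared.\<close>

lemma trig_polys_dense:
  fixes M N :: "'a measure"
  assumes fin: "finite_measure M" "finite_measure N" and sN: "sets N = sets M"
    and L: "function_subspace L" and Lm: "L \<subseteq> borel_measurable M"
    and gen: "sets M = sigma_sets (space M) {{x \<in> space M. t < h x} | t h. h \<in> L}"
    and B: "B \<in> sets M" and e: "0 < e"
  shows "\<exists>P\<in>trig_polys L. (\<integral>x. \<bar>indicator B x - P x\<bar> \<partial>M) < e \<and> (\<integral>x. \<bar>indicator B x - P x\<bar> \<partial>N) < e"
proof -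
  interpret M: finite_measure M by fact
  interpret N: finite_measure N by fact
  have sp: "space N = space M" using sets_eq_imp_space_eq[OF sN] .
  have mN[simp]: "borel_measurable N = borel_measurable M"
    by (rule measurable_cong_sets[OF sN refl])
  define bd where "bd f \<longleftrightarrow> f \<in> borel_measurable M \<and> (\<exists>B. \<forall>x. \<bar>f x\<bar> \<le> B)" for f :: "'a \<Rightarrow> real"
  define nrm where "nrm f = (\<integral>x. \<bar>f x\<bar> \<partial>M) + (\<integral>x. \<bar>f x\<bar> \<partial>N)" for f :: "'a \<Rightarrow> real"
  have int: "integrable M (\<lambda>x. \<bar>f x\<bar>)" "integrable N (\<lambda>x. \<bar>f x\<bar>)" if bf: "bd f" for f
  proof -
    obtain B where "\<And>x. \<bar>f x\<bar> \<le> B" using bf by (auto simp: bd_def)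
    then show "integrable M (\<lambda>x. \<bar>f x\<bar>)" "integrable N (\<lambda>x. \<bar>f x\<bar>)"
      using bf by (auto simp: bd_def intro!: M.integrable_const_bound[of _ B] N.integrable_const_bound[of _ B])
  qed
  have bd_diff: "bd (\<lambda>x. f x - g x)" if bf: "bd f" and bg: "bd g" for f g
  proof -
    obtain B where B: "\<And>x. \<bar>f x\<bar> \<le> B" using bf by (auto simp: bd_def)
    obtain C where "\<And>x. \<bar>g x\<bar> \<le> C" using bg by (auto simp: bd_def)
    with B have "\<bar>f x - g x\<bar> \<le> B + C" for x by (metis abs_triangle_ineq4 add_mono order_trans)
    then show ?thesis using that by (auto simp: bd_def)
  qed
  have bd_trig: "bd P" if "P \<in> trig_polys L" for P
    using trig_polys_bounded[OF that] trig_polys_measurable[OF that Lm] by (auto simp: bd_def)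
  have bd_ind: "bd (indicator A)" if "A \<in> sets M" for A
    using that by (auto simp: bd_def intro!: exI[of _ 1] split: split_indicator)
  have nrm_tri: "nrm f \<le> a * nrm g + b * nrm h" if "bd f" "bd g" "bd h" "\<And>x. x \<in> space M \<Longrightarrow> \<bar>f x\<bar> \<le> a * \<bar>g x\<bar> + b * \<bar>h x\<bar>" for f g h a b
  proof -
    have "(\<integral>x. \<bar>f x\<bar> \<partial>M) \<le> (\<integral>x. a * \<bar>g x\<bar> + b * \<bar>h x\<bar> \<partial>M)" "(\<integral>x. \<bar>f x\<bar> \<partial>N) \<le> (\<integral>x. a * \<bar>g x\<bar> + b * \<bar>h x\<bar> \<partial>N)"
      by (rule integral_mono; use that int in \<open>simp add: sp\<close>)+
    then show ?thesis using int that(2,3) by (simp add: nrm_def distrib_left)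
  qed
  have nrm_const: "nrm f \<le> c * (measure M (space M) + measure N (space N))"
    if "bd f" "\<And>x. x \<in> space M \<Longrightarrow> \<bar>f x\<bar> \<le> c" for f c
  proof -
    have "(\<integral>x. \<bar>f x\<bar> \<partial>M) \<le> (\<integral>x. c \<partial>M)" "(\<integral>x. \<bar>f x\<bar> \<partial>N) \<le> (\<integral>x. c \<partial>N)"
      by (rule integral_mono; use that int[OF that(1)] in \<open>simp add: sp\<close>)+
    then show ?thesis by (simp add: nrm_def distrib_left mult.commute)
  qed
  have nrm_lim: "(\<lambda>n. nrm (f n)) \<longlonglongrightarrow> 0" if "\<And>n. bd (f n)" "\<And>n x. \<bar>f n x\<bar> \<le> 1"
     "\<And>x. x \<in> space M \<Longrightarrow> eventually (\<lambda>n. \<bar>f n x\<bar> \<le> 1 / real (Suc n)) sequentially" for f :: "nat \<Rightarrow> 'a \<Rightarrow> real"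
  proof -
    have pt: "(\<lambda>n. \<bar>f n x\<bar>) \<longlonglongrightarrow> 0" if "x \<in> space M" for x
      by (rule tendsto_sandwich[OF _ _ tendsto_const LIMSEQ_Suc[OF lim_1_over_n]])
        (use \<open>\<And>x. x \<in> space M \<Longrightarrow> _\<close>[OF that] in auto)
    have fm: "(\<lambda>x. \<bar>f n x\<bar>) \<in> borel_measurable M" for n
      using that(1)[of n] by (auto simp: bd_def)
    have "(\<lambda>n. \<integral>x. \<bar>f n x\<bar> \<partial>M) \<longlonglongrightarrow> (\<integral>x. 0 \<partial>M)"
      by (rule integral_dominated_convergence[where w="\<lambda>_. 1"]) (use that(2) fm pt in auto)
    moreover have "(\<lambda>n. \<integral>x. \<bar>f n x\<bar> \<partial>N) \<longlonglongrightarrow> (\<integral>x. 0 \<partial>N)"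
      by (rule integral_dominated_convergence[where w="\<lambda>_. 1"]) (use that(2) fm pt in \<open>auto simp: sp intro!: AE_I2\<close>)
    ultimately have "(\<lambda>n. \<integral>x. \<bar>f n x\<bar> \<partial>M) \<longlonglongrightarrow> (\<integral>x. 0 \<partial>M)" "(\<lambda>n. \<integral>x. \<bar>f n x\<bar> \<partial>N) \<longlonglongrightarrow> (\<integral>x. 0 \<partial>N)" .
    from tendsto_add[OF this] show ?thesis by (simp add: nrm_def)
  qed
  \<comment> \<open>The sets approximable in mean for both measures at once. Closure under
    complements, finite intersections and pointwise limits of sets yields countable unions, so the
    generating half-spaces suffice.\<close>
  define K where "K A \<longleftrightarrow> A \<in> sets M \<and> (\<forall>e>0. \<exists>P\<in>trig_polys L. nrm (\<lambda>x. indicator A x - P x) < e)" for A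
  have K_sets: "K A \<Longrightarrow> A \<in> sets M" for A by (simp add: K_def)
  have K_lim: "K A" if KA: "A \<in> sets M" and KC: "\<And>n :: nat. K (C n)"
    and KE: "\<And>x. x \<in> space M \<Longrightarrow> eventually (\<lambda>n. x \<in> C n \<longleftrightarrow> x \<in> A) sequentially" for A C
    unfolding K_def
  proof (intro conjI allI impI)
    fix e :: real assume e: "0 < e"
    have "(\<lambda>n. nrm (\<lambda>x. indicator A x - indicator (C n) x)) \<longlonglongrightarrow> 0"
    proof (rule nrm_lim)
      fix x assume "x \<in> space M"
      from KE[OF this] show "eventually (\<lambda>n. \<bar>indicator A x - indicator (C n) x :: real\<bar> \<le> 1 / real (Suc n)) sequentially"
        by eventually_elim (auto split: split_indicator)
    qed (use that K_sets in \<open>auto intro!: bd_diff bd_ind split: split_indicator\<close>)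
    then have "eventually (\<lambda>n. nrm (\<lambda>x. indicator A x - indicator (C n) x) < e / 2) sequentially"
      using e by (intro order_tendstoD) auto
    then obtain n where n: "nrm (\<lambda>x. indicator A x - indicator (C n) x) < e / 2"
      by (auto dest: eventually_happens)
    obtain P where P: "P \<in> trig_polys L" "nrm (\<lambda>x. indicator (C n) x - P x) < e / 2"
      using KC[of n] e by (auto simp: K_def dest!: spec[of _ "e / 2"])
    have "nrm (\<lambda>x. indicator A x - P x) \<le> 1 * nrm (\<lambda>x. indicator A x - indicator (C n) x) + 1 * nrm (\<lambda>x. indicator (C n) x - P x)"
      by (rule nrm_tri) (use P KA KC K_sets in \<open>auto intro!: bd_diff bd_ind bd_trig[OF P(1)]\<close>)
    then show "\<exists>P\<in>trig_polys L. nrm (\<lambda>x. indicator A x - P x) < e" using P n by (intro bexI[of _ P]) auto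
  qed (use that in auto)
  have K_Int: "K (A \<inter> C)" if A: "K A" and C: "K C" for A C
    unfolding K_def
  proof (intro conjI allI impI)
    fix e :: real assume e: "0 < e"
    obtain P where P: "P \<in> trig_polys L" "nrm (\<lambda>x. indicator A x - P x) < e / 2"
      using A e by (auto simp: K_def dest!: spec[of _ "e / 2"])
    obtain b where b: "b \<ge> 0" "\<And>x. \<bar>P x\<bar> \<le> b" using trig_polys_bounded[OF P(1)] by auto
    \<comment> \<open>\<open>Q\<close> is chosen after \<open>P\<close>, because its error is
      multiplied by the bound \<open>b\<close> of \<open>P\<close>.\<close>
    have e': "0 < e / (2 * (b + 1))" using e b by simp
    obtain Q where Q: "Q \<in> trig_polys L" "nrm (\<lambda>x. indicator C x - Q x) < e / (2 * (b + 1))"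
      using C e' by (auto simp: K_def dest!: spec[of _ "e / (2 * (b + 1))"])
    have "nrm (\<lambda>x. indicator (A \<inter> C) x - P x * Q x) \<le> 1 * nrm (\<lambda>x. indicator A x - P x) + b * nrm (\<lambda>x. indicator C x - Q x)"
    proof (rule nrm_tri)
      fix x
      have "\<bar>indicator (A \<inter> C) x - P x * Q x\<bar> = \<bar>(indicator A x - P x) * indicator C x + P x * (indicator C x - Q x)\<bar>"
        by (auto simp: algebra_simps split: split_indicator)
      also have "\<dots> \<le> \<bar>indicator A x - P x\<bar> * \<bar>indicator C x\<bar> + \<bar>P x\<bar> * \<bar>indicator C x - Q x\<bar>"
        by (metis abs_mult abs_triangle_ineq)
      also have "\<dots> \<le> \<bar>indicator A x - P x\<bar> * 1 + b * \<bar>indicator C x - Q x\<bar>"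
        by (intro add_mono mult_left_mono mult_right_mono b) (auto split: split_indicator)
      finally show "\<bar>indicator (A \<inter> C) x - P x * Q x\<bar> \<le> 1 * \<bar>indicator A x - P x\<bar> + b * \<bar>indicator C x - Q x\<bar>" by simp
    qed (use A C K_sets in \<open>auto intro!: bd_diff bd_ind bd_trig[OF P(1)] bd_trig[OF Q(1)]
      bd_trig[OF trig_polys_mult[OF L P(1) Q(1)]]\<close>)
    also have "\<dots> < e"
    proof -
      have "b * nrm (\<lambda>x. indicator C x - Q x) \<le> b * (e / (2 * (b + 1)))" using Q b by (intro mult_left_mono) auto
      also have "\<dots> \<le> e / 2" using b e by (simp add: field_simps)
      finally show ?thesis using P(2) by simp
    qed
    finally show "\<exists>P\<in>trig_polys L. nrm (\<lambda>x. indicator (A \<inter> C) x - P x) < e"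
      by (intro bexI[of _ "\<lambda>x. P x * Q x"] trig_polys_mult[OF L P(1) Q(1)])
  qed (use A C K_sets in auto)
  have K_compl: "K (space M - A)" if A: "K A" for A
    unfolding K_def
  proof (intro conjI allI impI)
    fix e :: real assume e: "0 < e"
    obtain P where P: "P \<in> trig_polys L" "nrm (\<lambda>x. indicator A x - P x) < e"
      using A e by (auto simp: K_def)
    have 1: "(\<lambda>x. 1 + (-1) * P x) \<in> trig_polys L"
      by (intro trig_polys.add trig_polys_const[OF L] trig_polys_scale P)
    have "nrm (\<lambda>x. indicator (space M - A) x - (1 + (-1) * P x)) \<le> 1 * nrm (\<lambda>x. indicator A x - P x) + 0 * nrm (\<lambda>x. indicator A x - P x)"
      by (rule nrm_tri) (use A K_sets bd_trig[OF 1] bd_trig[OF P(1)] in \<open>auto intro!: bd_diff bd_ind split: split_indicator\<close>)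
    then show "\<exists>P\<in>trig_polys L. nrm (\<lambda>x. indicator (space M - A) x - P x) < e"
      using P 1 by (intro bexI[OF _ 1]) auto
  qed (use A K_sets in auto)
  have K_empty: "K {}"
    unfolding K_def
    by (auto intro!: bexI[of _ "\<lambda>_. 0"] trig_polys_const[OF L] simp: nrm_def)
  have K_basic: "K {x \<in> space M. t < h x}" if h: "h \<in> L" for t h
  proof -
    have hm: "h \<in> borel_measurable M" using h Lm by auto
    \<comment> \<open>For large \<open>n\<close> the argument of the sine lies strictly between
      \<open>- pi\<close> and \<open>pi\<close>, so \<open>s n x\<close> has the sign of
      \<open>h x - t\<close>. This replaces a half-space by a condition on a bounded trigonometric
      polynomial.\<close>
    define s where "s n x = sin ((h x - t) / real (Suc n))" for n x
    have st: "s n \<in> trig_polys L" for n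
    proof -
      have "(\<lambda>x. (1 / real (Suc n)) * h x) \<in> L" using L h unfolding function_subspace_def by blast
      from trig_polys.cos[OF this, of 1 "- t / real (Suc n) - pi / 2"]
      show ?thesis
        by (rule back_subst[of "\<lambda>f. f \<in> trig_polys L"])
          (auto simp: fun_eq_iff s_def diff_divide_distrib cos_diff cos_add sin_add sin_diff)
    qed
    have sm: "s n \<in> borel_measurable M" for n using trig_polys_measurable[OF st Lm] .
    show ?thesis
    proof (rule K_lim[of "{x \<in> space M. t < h x}" "\<lambda>n. {x \<in> space M. 0 < s n x}"])
      show "{x \<in> space M. t < h x} \<in> sets M" using hm by measurable
      fix x assume x: "x \<in> space M"
      obtain n0 :: nat where n0: "\<bar>h x - t\<bar> < n0" using reals_Archimedean2 by blast
      show "eventually (\<lambda>n. x \<in> {x \<in> space M. 0 < s n x} \<longleftrightarrow> x \<in> {x \<in> space M. t < h x}) sequentially"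
      proof (rule eventually_sequentiallyI[of n0])
        fix n assume "n0 \<le> n"
        then have "\<bar>(h x - t) / real (Suc n)\<bar> < 1" using n0 by (simp add: abs_divide)
        then have b: "\<bar>(h x - t) / real (Suc n)\<bar> < pi" using pi_gt3 by linarith
        have "0 < s n x \<longleftrightarrow> t < h x"
        proof
          assume "t < h x" then show "0 < s n x" unfolding s_def using b by (intro sin_gt_zero) auto
        next
          assume *: "0 < s n x"
          show "t < h x"
          proof (rule ccontr)
            assume "\<not> t < h x"
            then have "(h x - t) / real (Suc n) \<le> 0" by (simp add: divide_le_0_iff)
            then have "0 \<le> sin (- ((h x - t) / real (Suc n)))"
              using b by (intro sin_ge_zero) linarith+
            then show False using * by (simp add: s_def)
          qed
        qed
        then show "x \<in> {x \<in> space M. 0 < s n x} \<longleftrightarrow> x \<in> {x \<in> space M. t < h x}" using x by simp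
      qed
    next
      fix n
      show "K {x \<in> space M. 0 < s n x}"
        unfolding K_def
      proof (intro conjI allI impI)
        show S: "{x \<in> space M. 0 < s n x} \<in> sets M" using sm by measurable
        fix e :: real assume e: "0 < e"
        \<comment> \<open>A continuous approximation to the indicator of \<open>0 < s n x\<close>.
          It is a continuous function of a value in \<open>{-1..1}\<close>, where polynomials
          approximate it uniformly.\<close>
        define u where "u k x = min 1 (real k * max 0 (s n x))" for k x
        have um: "bd (u k)" for k
          unfolding bd_def u_def[abs_def] using sm[of n] by (auto intro!: exI[of _ 1] simp: abs_le_iff)
        have "(\<lambda>k. nrm (\<lambda>x. indicator {x \<in> space M. 0 < s n x} x - u k x)) \<longlonglongrightarrow> 0"
        proof (rule nrm_lim)
          fix x assume x: "x \<in> space M"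
          obtain k0 :: nat where k0: "1 / s n x < k0" using reals_Archimedean2 by blast
          show "eventually (\<lambda>k. \<bar>indicator {x \<in> space M. 0 < s n x} x - u k x\<bar> \<le> 1 / real (Suc k)) sequentially"
          proof (rule eventually_sequentiallyI[of k0])
            fix k assume k: "k0 \<le> k"
            show "\<bar>indicator {x \<in> space M. 0 < s n x} x - u k x\<bar> \<le> 1 / real (Suc k)"
            proof (cases "0 < s n x")
              case True
              then have "1 < real k0 * s n x" using k0 by (simp add: pos_divide_less_eq)
              also have "\<dots> \<le> real k * s n x" using k True by (intro mult_right_mono) auto
              finally show ?thesis using True x by (simp add: u_def)
            qed (use x in \<open>simp add: u_def\<close>)
          qed
        next
          fix k x
          have "0 \<le> u k x \<and> u k x \<le> 1" by (simp add: u_def)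
          then show "\<bar>indicator {x \<in> space M. 0 < s n x} x - u k x\<bar> \<le> 1"
            by (auto split: split_indicator)
        qed (intro bd_diff bd_ind S um)
        then have "eventually (\<lambda>k. nrm (\<lambda>x. indicator {x \<in> space M. 0 < s n x} x - u k x) < e / 2) sequentially"
          using e by (intro order_tendstoD) auto
        then obtain k where k: "nrm (\<lambda>x. indicator {x \<in> space M. 0 < s n x} x - u k x) < e / 2"
          by (auto dest: eventually_happens)
        define T where "T = measure M (space M) + measure N (space N)"
        have T: "0 \<le> T" by (simp add: T_def)
        have e': "0 < e / (2 * (T + 1))" using e T by simp
        obtain p where p: "real_polynomial_function p" "\<And>y. y \<in> {-1..1} \<Longrightarrow> \<bar>min 1 (real k * max 0 y) - p y\<bar> < e / (2 * (T + 1))"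
          by (rule Stone_Weierstrass_real_polynomial_function[of "{-1..1}" "\<lambda>y. min 1 (real k * max 0 y)" "e / (2 * (T + 1))"])
            (use e' in \<open>auto intro!: continuous_intros\<close>)
        have ps: "(\<lambda>x. p (s n x)) \<in> trig_polys L" by (rule trig_polys_polynomial[OF L st p(1)])
        have "nrm (\<lambda>x. u k x - p (s n x)) \<le> e / (2 * (T + 1)) * T"
          unfolding T_def
        proof (rule nrm_const)
          fix x show "\<bar>u k x - p (s n x)\<bar> \<le> e / (2 * (measure M (space M) + measure N (space N) + 1))"
            using p(2)[of "s n x"] by (simp add: u_def T_def s_def less_imp_le)
        qed (intro bd_diff um bd_trig ps)
        also have "\<dots> \<le> e / 2" using e T by (simp add: field_simps)
        finally have "nrm (\<lambda>x. u k x - p (s n x)) \<le> e / 2" .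
        moreover have "nrm (\<lambda>x. indicator {x \<in> space M. 0 < s n x} x - p (s n x)) \<le>
            1 * nrm (\<lambda>x. indicator {x \<in> space M. 0 < s n x} x - u k x) + 1 * nrm (\<lambda>x. u k x - p (s n x))"
          by (rule nrm_tri) (use S um bd_trig[OF ps] in \<open>auto intro!: bd_diff bd_ind\<close>)
        ultimately show "\<exists>P\<in>trig_polys L. nrm (\<lambda>x. indicator {x \<in> space M. 0 < s n x} x - P x) < e"
          using k by (intro bexI[OF _ ps]) auto
      qed
    qed
  qed
  have "K B"
    using B unfolding gen
  proof (induction rule: sigma_sets.induct)
    case (Basic a)
    then show ?case using K_basic by auto
  next
    case (Union a)
    have fin: "K (\<Union>i<n. a i)" for n :: nat
    proof (induction n)
      case (Suc n)
      have "(\<Union>i<Suc n. a i) = space M - ((space M - (\<Union>i<n. a i)) \<inter> (space M - a n))"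
        using sets.sets_into_space[OF K_sets[OF Suc]] sets.sets_into_space[OF K_sets[OF Union.IH[of n]]]
        unfolding lessThan_Suc by blast
      also have "K \<dots>" using Suc Union.IH by (intro K_compl K_Int)
      finally show ?case .
    qed (simp add: K_empty)
    show ?case
    proof (rule K_lim[OF _ fin])
      show "(\<Union>i. a i) \<in> sets M" using K_sets[OF Union.IH] by blast
      fix x
      show "eventually (\<lambda>n. x \<in> (\<Union>i<n. a i) \<longleftrightarrow> x \<in> (\<Union>i. a i)) sequentially"
      proof (cases "\<exists>i. x \<in> a i")
        case True
        then obtain i where "x \<in> a i" ..
        then show ?thesis by (intro eventually_sequentiallyI[of "Suc i"]) auto
      qed auto
    qed
  qed (auto intro: K_empty K_compl)
  then obtain P where P: "P \<in> trig_polys L" "nrm (\<lambda>x. indicator B x - P x) < e" using e by (auto simp: K_def)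
  from P(2) show ?thesis
    unfolding nrm_def by (intro bexI[OF _ P(1)] conjI; elim le_less_trans[rotated]) simp_all
qed


section \<open>Gaussian variables\<close>

lemma integral_cos_std_normal:
  "(\<integral>x. cos (s * x + c) \<partial>std_normal_distribution) = cos c * exp (- s\<^sup>2 / 2)"
proof -
  interpret real_distribution std_normal_distribution by (rule real_dist_normal_dist)
  have int: "integrable std_normal_distribution (\<lambda>x. iexp (s * x + c))"
    by (rule integrable_const_bound[of _ 1]) (auto simp flip: exp_add)
  have "(\<integral>x. cos (s * x + c) \<partial>std_normal_distribution) = (\<integral>x. Re (iexp (s * x + c)) \<partial>std_normal_distribution)"
    by (simp add: Re_exp)
  also have "\<dots> = Re (\<integral>x. iexp (s * x + c) \<partial>std_normal_distribution)"
    using int by (rule integral_Re)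
  also have "(\<integral>x. iexp (s * x + c) \<partial>std_normal_distribution) = (\<integral>x. iexp c * iexp (s * x) \<partial>std_normal_distribution)"
    by (intro Bochner_Integration.integral_cong) (auto simp: exp_add[symmetric] algebra_simps)
  also have "\<dots> = iexp c * char std_normal_distribution s"
    by (simp add: char_def)
  also have "Re \<dots> = cos c * exp (- s\<^sup>2 / 2)"
    by (simp add: char_std_normal_distribution Re_exp Im_exp)
  finally show ?thesis .
qed

context prob_space
begin

text \<open>In the degenerate case centring forces the constant to be 0, and every formula holds
  with variance 0. In the normal case the formulas are the Fourier and Laplace transforms of the
  normal density.\<close>

lemma centered_gaussian_rv:
  assumes g: "gaussian_rv M X" and m0: "expectation X = 0"
  shows "X \<in> borel_measurable M"
    and "integrable M X"
    and "integrable M (\<lambda>\<omega>. (X \<omega>)\<^sup>2)"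
    and "expectation (\<lambda>\<omega>. cos (X \<omega> + c)) = cos c * exp (- expectation (\<lambda>\<omega>. (X \<omega>)\<^sup>2) / 2)"
    and "integrable M (\<lambda>\<omega>. exp (l * X \<omega>))"
    and "expectation (\<lambda>\<omega>. exp (l * X \<omega>)) = exp (l\<^sup>2 * expectation (\<lambda>\<omega>. (X \<omega>)\<^sup>2) / 2)"
    and "expectation (\<lambda>\<omega>. (X \<omega>)\<^sup>2) = 1 \<Longrightarrow> distributed M lborel X std_normal_density"
proof -
  consider (normal) m s where "s > 0" "distributed M lborel X (normal_density m s)"
    | (const) m where "X \<in> borel_measurable M" "AE \<omega> in M. X \<omega> = m"
    using g unfolding gaussian_rv_def by blast
  note cases = this
  have "X \<in> borel_measurable M \<and> integrable M X \<and> integrable M (\<lambda>\<omega>. (X \<omega>)\<^sup>2) \<and>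
    expectation (\<lambda>\<omega>. cos (X \<omega> + c)) = cos c * exp (- expectation (\<lambda>\<omega>. (X \<omega>)\<^sup>2) / 2) \<and>
    integrable M (\<lambda>\<omega>. exp (l * X \<omega>)) \<and>
    expectation (\<lambda>\<omega>. exp (l * X \<omega>)) = exp (l\<^sup>2 * expectation (\<lambda>\<omega>. (X \<omega>)\<^sup>2) / 2) \<and>
    (expectation (\<lambda>\<omega>. (X \<omega>)\<^sup>2) = 1 \<longrightarrow> distributed M lborel X std_normal_density)"
    using cases
  proof cases
    case (normal m s)
    note D = normal(2) and s = normal(1)
    have Xm[measurable]: "X \<in> borel_measurable M" using distributed_measurable[OF D] by simp
    have m: "m = 0" using normal_distributed_expectation[OF s D] m0 by simp
    note D0 = D[unfolded m]
    have "variance X = s\<^sup>2" by (rule normal_distributed_variance[OF s D])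
    then have var: "expectation (\<lambda>\<omega>. (X \<omega>)\<^sup>2) = s\<^sup>2" using m0 by simp
    have i1: "integrable M X"
      using distributed_integrable[OF D0, of "\<lambda>x. x"] integrable_normal_moment[OF s, of 0 1] by simp
    have i2: "integrable M (\<lambda>\<omega>. (X \<omega>)\<^sup>2)"
      using distributed_integrable[OF D0, of "\<lambda>x. x\<^sup>2"] integrable_normal_moment[OF s, of 0 2] by simp
    have D1: "distributed M lborel (\<lambda>x. (X x - 0) / s) std_normal_density"
      using D0 normal_standard_normal_convert[OF s, of X 0] by simp
    have "expectation (\<lambda>\<omega>. cos (X \<omega> + c)) = expectation (\<lambda>\<omega>. cos (s * ((X \<omega> - 0) / s) + c))"
      using s by simp
    also have "\<dots> = (\<integral>x. cos (s * x + c) \<partial>distr M lborel (\<lambda>x. (X x - 0) / s))"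
      by (subst integral_distr) auto
    also have "\<dots> = cos c * exp (- s\<^sup>2 / 2)"
      unfolding distributed_distr_eq_density[OF D1] by (rule integral_cos_std_normal)
    finally have c: "expectation (\<lambda>\<omega>. cos (X \<omega> + c)) = cos c * exp (- s\<^sup>2 / 2)" .
    \<comment> \<open>Completing the square: tilting the density by \<open>exp (l * x)\<close> moves
      its mean to \<open>l * s\<^sup>2\<close>.\<close>
    have sq: "normal_density 0 s x * exp (l * x) = exp (l\<^sup>2 * s\<^sup>2 / 2) * normal_density (l * s\<^sup>2) s x" for x
    proof -
      have "- x\<^sup>2 / (2 * s\<^sup>2) + l * x = l\<^sup>2 * s\<^sup>2 / 2 + - (x - l * s\<^sup>2)\<^sup>2 / (2 * s\<^sup>2)"
        using s by (simp add: field_simps power2_eq_square)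
      then have "exp (- x\<^sup>2 / (2 * s\<^sup>2)) * exp (l * x) = exp (l\<^sup>2 * s\<^sup>2 / 2) * exp (- (x - l * s\<^sup>2)\<^sup>2 / (2 * s\<^sup>2))"
        by (simp only: exp_add[symmetric])
      then show ?thesis by (simp add: normal_density_def)
    qed
    have i3: "integrable M (\<lambda>\<omega>. exp (l * X \<omega>))"
      using distributed_integrable[OF D0, of "\<lambda>x. exp (l * x)"] s by (simp add: sq)
    have e: "expectation (\<lambda>\<omega>. exp (l * X \<omega>)) = exp (l\<^sup>2 * s\<^sup>2 / 2)"
      using distributed_integral[OF D0, of "\<lambda>x. exp (l * x)"] s by (simp add: sq)
    have "distributed M lborel X std_normal_density" if "s\<^sup>2 = 1"
      using D0 that s by (simp add: power2_eq_1_iff)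
    with Xm i1 i2 c i3 e show ?thesis unfolding var by blast
  next
    case (const m)
    note [measurable] = const(1)
    have "expectation X = expectation (\<lambda>_. m)" by (rule integral_cong_AE) (use const in auto)
    then have "m = 0" using m0 by (simp add: prob_space)
    then have AE: "AE \<omega> in M. X \<omega> = 0" using const(2) by simp
    have var: "expectation (\<lambda>\<omega>. (X \<omega>)\<^sup>2) = 0"
      by (subst integral_cong_AE[where g="\<lambda>_. 0"]) (use AE in auto)
    have "expectation (\<lambda>\<omega>. cos (X \<omega> + c)) = expectation (\<lambda>_. cos c)"
      by (rule integral_cong_AE) (use AE in auto)
    then have c: "expectation (\<lambda>\<omega>. cos (X \<omega> + c)) = cos c" by (simp add: prob_space)
    have "expectation (\<lambda>\<omega>. exp (l * X \<omega>)) = expectation (\<lambda>_. 1)"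
      by (rule integral_cong_AE) (use AE in auto)
    then have e: "expectation (\<lambda>\<omega>. exp (l * X \<omega>)) = 1" by (simp add: prob_space)
    have "integrable M X = integrable M (\<lambda>_. 0 :: real)"
      "integrable M (\<lambda>\<omega>. (X \<omega>)\<^sup>2) = integrable M (\<lambda>_. 0 :: real)"
      "integrable M (\<lambda>\<omega>. exp (l * X \<omega>)) = integrable M (\<lambda>_. 1 :: real)"
      by (rule integrable_cong_AE; use AE in \<open>auto\<close>)+
    then show ?thesis using const(1) var c e by simp
  qed
  then show "X \<in> borel_measurable M"
    and "integrable M X"
    and "integrable M (\<lambda>\<omega>. (X \<omega>)\<^sup>2)"
    and "expectation (\<lambda>\<omega>. cos (X \<omega> + c)) = cos c * exp (- expectation (\<lambda>\<omega>. (X \<omega>)\<^sup>2) / 2)"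
    and "integrable M (\<lambda>\<omega>. exp (l * X \<omega>))"
    and "expectation (\<lambda>\<omega>. exp (l * X \<omega>)) = exp (l\<^sup>2 * expectation (\<lambda>\<omega>. (X \<omega>)\<^sup>2) / 2)"
    and "expectation (\<lambda>\<omega>. (X \<omega>)\<^sup>2) = 1 \<Longrightarrow> distributed M lborel X std_normal_density"
    by blast+
qed

text \<open>Chernoff's bound with parameter \<open>1 / C\<close>. The level \<open>s\<close> also
  appears in the variance bound because, in the application, both are governed by the sum of the
  squared thresholds of several tests.\<close>

lemma centered_gaussian_tail:
  assumes g: "gaussian_rv M X" and m0: "expectation X = 0"
    and v: "expectation (\<lambda>\<omega>. (X \<omega>)\<^sup>2) \<le> C * s" and C: "0 < C" and s: "0 \<le> s"
  shows "prob {\<omega> \<in> space M. s \<le> X \<omega>} \<le> exp (- s / (2 * C))"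
proof -
  note G = centered_gaussian_rv[OF g m0]
  note [measurable] = G(1)
  have "prob {\<omega> \<in> space M. s \<le> X \<omega>} = expectation (indicator {\<omega> \<in> space M. s \<le> X \<omega>})"
    by simp
  also have "\<dots> \<le> expectation (\<lambda>\<omega>. exp (- s / C) * exp (1 / C * X \<omega>))"
  proof (rule integral_mono)
    fix \<omega> assume "\<omega> \<in> space M"
    show "indicator {\<omega> \<in> space M. s \<le> X \<omega>} \<omega> \<le> exp (- s / C) * exp (1 / C * X \<omega>)"
    proof (cases "s \<le> X \<omega>")
      case True
      then have "0 \<le> - s / C + 1 / C * X \<omega>" using C by (simp add: divide_right_mono)
      then have "1 \<le> exp (- s / C + 1 / C * X \<omega>)" by simp
      then show ?thesis unfolding exp_add by (simp split: split_indicator)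
    qed simp
  next
    show "integrable M (\<lambda>\<omega>. exp (- s / C) * exp (1 / C * X \<omega>))"
      by (intro integrable_mult_right G(5))
  qed (simp add: integrable_real_indicator emeasure_eq_measure)
  also have "\<dots> = exp (- s / C) * exp ((1 / C)\<^sup>2 * expectation (\<lambda>\<omega>. (X \<omega>)\<^sup>2) / 2)"
    using G(6)[of "1 / C"] by simp
  also have "\<dots> = exp (- s / C + (1 / C)\<^sup>2 * expectation (\<lambda>\<omega>. (X \<omega>)\<^sup>2) / 2)" by (simp only: exp_add)
  also have "\<dots> \<le> exp (- s / (2 * C))"
  proof -
    have "(1 / C)\<^sup>2 * expectation (\<lambda>\<omega>. (X \<omega>)\<^sup>2) / 2 \<le> (1 / C)\<^sup>2 * (C * s) / 2"
      by (intro divide_right_mono mult_left_mono v) auto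
    also have "\<dots> = s / (2 * C)" using C by (simp add: power2_eq_square)
    also have "\<dots> = s / C - s / (2 * C)" by simp
    finally show ?thesis by simp
  qed
  finally show ?thesis .
qed

end


section \<open>A subadditive ergodic theorem\<close>

text \<open>Fekete's lemma: the limit is the infimum of the quotients, approached by dividing
  \<open>n\<close> with remainder by a nearly optimal \<open>m\<close>.\<close>

lemma subadditive_limit:
  fixes a :: "nat \<Rightarrow> real"
  assumes nn: "\<And>n. 0 \<le> a n" and sub: "\<And>m n. a (m + n) \<le> a m + a n" and a0: "a 0 = 0"
  shows "\<exists>l. (\<lambda>n. a n / real n) \<longlonglongrightarrow> l \<and> (\<forall>n\<ge>1. l \<le> a n / real n)"
proof -
  define S where "S = (\<lambda>n. a n / real n) ` {1..}"
  define l where "l = Inf S"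
  have bdd: "bdd_below S" unfolding S_def using nn by (intro bdd_belowI[of _ 0]) auto
  have low: "l \<le> a n / real n" if "1 \<le> n" for n
    unfolding l_def using that by (intro cInf_lower bdd) (auto simp: S_def)
  have mult: "a (q * m) \<le> real q * a m" for q m
  proof (induction q)
    case (Suc q)
    then show ?case using sub[of m "q * m"] by (simp add: distrib_right)
  qed (simp add: a0)
  have "(\<lambda>n. a n / real n) \<longlonglongrightarrow> l"
  proof (rule LIMSEQ_I)
    fix e :: real assume e: "0 < e"
    have "S \<noteq> {}" by (auto simp: S_def)
    then obtain m where m: "1 \<le> m" "a m / real m < l + e / 2"
      using cInf_lessD[of S "l + e / 2"] e by (auto simp: l_def S_def)
    obtain N :: nat where N: "2 * real m * a 1 / e < N" using reals_Archimedean2 by blast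
    show "\<exists>no. \<forall>n\<ge>no. norm (a n / real n - l) < e"
    proof (intro exI[of _ "Suc N"] allI impI)
      fix n assume n: "Suc N \<le> n"
      then have n0: "0 < real n" by simp
      define q where "q = n div m"
      define r where "r = n mod m"
      have nqr: "n = q * m + r" by (simp add: q_def r_def)
      have r: "r < m" using m by (simp add: r_def)
      have "a n \<le> a (q * m) + a r" using sub[of "q * m" r] nqr by simp
      also have "a r \<le> real r * a 1" using mult[of r 1] by simp
      also have "\<dots> \<le> real m * a 1" using r nn[of 1] by (intro mult_right_mono) auto
      also have "a (q * m) \<le> real q * a m" by (rule mult)
      also have "real q * a m \<le> real n * (a m / real m)"
      proof -
        have "real q \<le> real n / real m" using m nqr by (simp add: le_divide_eq of_nat_mult[symmetric] del: of_nat_mult)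
        then have "real q * a m \<le> real n / real m * a m" using nn by (intro mult_right_mono)
        then show ?thesis by simp
      qed
      finally have "a n \<le> real n * (a m / real m) + real m * a 1" by simp
      then have "a n / real n \<le> (real n * (a m / real m) + real m * a 1) / real n"
        using n0 by (intro divide_right_mono) auto
      also have "\<dots> = a m / real m + real m * a 1 / real n" using n0 by (simp add: add_divide_distrib)
      also have "real m * a 1 / real n < e / 2"
      proof -
        have "2 * real m * a 1 / e < real n" using N n by linarith
        then show ?thesis using e n0 by (simp add: field_simps)
      qed
      finally have "a n / real n < l + e" using m by simp
      then show "norm (a n / real n - l) < e" using low[of n] n by simp
    qed
  qed
  with low show ?thesis by blast
qed

text \<open>Mixing is required instead of ergodicity because it is inherited by the powers of
  \<open>\<theta>\<close>, and the upper half of the ergodic theorem averages along such a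
  power.\<close>

locale mixing_system = prob_space N for N :: "'a measure" +
  fixes \<theta> :: "'a \<Rightarrow> 'a"
  assumes shift_measurable: "\<theta> \<in> measurable N N"
    and shift_invariant: "distr N N \<theta> = N"
    and mixing: "A \<in> sets N \<Longrightarrow> B \<in> sets N \<Longrightarrow>
      (\<lambda>n. prob (A \<inter> ((\<theta> ^^ n) -` B \<inter> space N))) \<longlonglongrightarrow> prob A * prob B"
begin

lemma pow_measurable[measurable]: "\<theta> ^^ n \<in> measurable N N"
proof (induction n)
  case (Suc n)
  then show ?case using measurable_comp[OF Suc shift_measurable] by (simp add: comp_def)
qed (simp add: id_def)

lemma pow_invariant: "distr N N (\<theta> ^^ n) = N"
proof (induction n)
  case (Suc n)
  have "distr N N (\<theta> ^^ Suc n) = distr (distr N N (\<theta> ^^ n)) N \<theta>"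
    by (subst distr_distr[OF shift_measurable pow_measurable]) simp
  then show ?case by (simp only: Suc shift_invariant)
qed (simp add: id_def distr_id)

lemma integral_pow:
  fixes f :: "'a \<Rightarrow> real"
  assumes "integrable N f"
  shows "integrable N (\<lambda>s. f ((\<theta> ^^ n) s))" "expectation (\<lambda>s. f ((\<theta> ^^ n) s)) = expectation f"
proof -
  have [measurable]: "f \<in> borel_measurable N" using assms by simp
  show "integrable N (\<lambda>s. f ((\<theta> ^^ n) s))"
    using assms integrable_distr_eq[OF pow_measurable, of f n] pow_invariant[of n] by simp
  show "expectation (\<lambda>s. f ((\<theta> ^^ n) s)) = expectation f"
    using integral_distr[OF pow_measurable, of f n] pow_invariant[of n] by simp
qed

lemma AE_pow:
  assumes "AE s in N. P s"
  shows "AE s in N. P ((\<theta> ^^ n) s)"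
proof (rule AE_distrD[OF pow_measurable])
  show "AE s in distr N N (\<theta> ^^ n). P s" unfolding pow_invariant by fact
qed

lemma mixing_system_pow:
  assumes "0 < m"
  shows "mixing_system N (\<theta> ^^ m)"
proof
  show "\<theta> ^^ m \<in> measurable N N" by (rule pow_measurable)
  show "distr N N (\<theta> ^^ m) = N" by (rule pow_invariant)
  fix A B assume "A \<in> sets N" "B \<in> sets N"
  then have "((\<lambda>n. prob (A \<inter> ((\<theta> ^^ n) -` B \<inter> space N))) \<circ> (\<lambda>n. m * n)) \<longlonglongrightarrow> prob A * prob B"
    by (intro LIMSEQ_subseq_LIMSEQ mixing) (use assms in \<open>auto simp: strict_mono_def\<close>)
  then show "(\<lambda>n. prob (A \<inter> (((\<theta> ^^ m) ^^ n) -` B \<inter> space N))) \<longlonglongrightarrow> prob A * prob B"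
    by (simp add: comp_def funpow_mult)
qed

text \<open>A set that contains its preimage up to a null set agrees with it up to a null set,
  because both have the same measure. Mixing of \<open>A\<close> with itself then says that its
  probability equals its own square.\<close>

lemma zero_one:
  assumes A[measurable]: "A \<in> sets N" and inv: "AE s in N. \<theta> s \<in> A \<longrightarrow> s \<in> A"
  shows "prob A = 0 \<or> prob A = 1"
proof -
  define C where "C = \<theta> -` A \<inter> space N"
  have C[measurable]: "C \<in> sets N" unfolding C_def by (rule measurable_sets[OF shift_measurable A])
  have pC: "prob C = prob A"
    using measure_distr[OF shift_measurable A] shift_invariant by (simp add: C_def)
  have "prob (A \<inter> C) = prob C"
  proof (rule finite_measure_eq_AE)
    show "AE s in N. s \<in> A \<inter> C \<longleftrightarrow> s \<in> C"
      using inv by eventually_elim (auto simp: C_def)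
  qed auto
  then have "prob (A - C) = 0" using pC by (simp add: finite_measure_Diff')
  then have "AE s in N. s \<notin> A - C" by (subst (asm) prob_eq_0) auto
  then have iff: "AE s in N. \<theta> s \<in> A \<longleftrightarrow> s \<in> A"
    using inv AE_space by eventually_elim (auto simp: C_def)
  have iffn: "AE s in N. (\<theta> ^^ n) s \<in> A \<longleftrightarrow> s \<in> A" for n
  proof (induction n)
    case (Suc n)
    from AE_pow[OF iff, of n] Suc show ?case by eventually_elim auto
  qed simp
  have "prob (A \<inter> ((\<theta> ^^ n) -` A \<inter> space N)) = prob A" for n
  proof (rule finite_measure_eq_AE)
    show "AE s in N. s \<in> A \<inter> ((\<theta> ^^ n) -` A \<inter> space N) \<longleftrightarrow> s \<in> A"
      using iffn[of n] AE_space by eventually_elim auto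
  qed (use measurable_sets[OF pow_measurable A] in auto)
  with mixing[OF A A] have "(\<lambda>n::nat. prob A) \<longlonglongrightarrow> prob A * prob A" by simp
  then have "prob A = prob A * prob A" by (simp add: LIMSEQ_const_iff)
  then show ?thesis by simp
qed

text \<open>The covering argument of Katznelson and Weiss. Cut \<open>{0..<n}\<close> greedily into blocks on which \<open>h\<close>
  is at most \<open>t\<close> times the block length, which is possible wherever the orbit is not in the exceptional
  set \<open>{c = 1}\<close>, up to a final stretch of length \<open>K\<close>.\<close>

lemma covering_bound:
  fixes h :: "nat \<Rightarrow> 'a \<Rightarrow> real" and c b :: "'a \<Rightarrow> real"
  assumes sub: "\<And>k m n. h (m + n) ((\<theta> ^^ k) s) \<le> h m ((\<theta> ^^ k) s) + h n ((\<theta> ^^ (m + k)) s)"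
    and b: "\<And>s. b s = \<bar>h 1 s\<bar> + \<bar>t\<bar>" and c0: "\<And>s. 0 \<le> c s"
    and c1: "\<And>k. c ((\<theta> ^^ k) s) < 1 \<Longrightarrow> \<exists>n. 1 \<le> n \<and> n \<le> K \<and> h n ((\<theta> ^^ k) s) \<le> t * real n"
    and n: "1 \<le> n"
  shows "h n s \<le> t * real n + (\<Sum>k<n. b ((\<theta> ^^ k) s) * (c ((\<theta> ^^ k) s) + of_bool (n \<le> k + K)))"
proof -
  \<comment> \<open>The error on the orbit segment of length \<open>n\<close> that starts at time
    \<open>j\<close>: a position counts if it is exceptional, through \<open>c\<close>, or if it is
    one of the last \<open>K\<close>.\<close>
  define W where "W n j = (\<Sum>k<n. b ((\<theta> ^^ (j + k)) s) * (c ((\<theta> ^^ (j + k)) s) + of_bool (n \<le> k + K)))" for n j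
  have b0: "0 \<le> b s" for s by (simp add: b)
  have tb: "h 1 s \<le> t + b s" for s by (simp add: b)
  have W0: "0 \<le> W n j" for n j
    unfolding W_def by (intro sum_nonneg mult_nonneg_nonneg add_nonneg_nonneg b0 c0) auto
  have Wsplit: "(\<Sum>k<i. b ((\<theta> ^^ (j + k)) s) * c ((\<theta> ^^ (j + k)) s)) + W (n - i) (j + i) \<le> W n j" if "i \<le> n" for i j n
  proof -
    let ?g = "\<lambda>k. b ((\<theta> ^^ (j + k)) s) * (c ((\<theta> ^^ (j + k)) s) + of_bool (n \<le> k + K))"
    have "W n j = (\<Sum>k<i. ?g k) + (\<Sum>k=i..<n. ?g k)"
      unfolding W_def using that by (simp add: sum.atLeastLessThan_concat lessThan_atLeast0)
    also have "(\<Sum>k=i..<n. ?g k) = (\<Sum>k<n-i. ?g (k + i))"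
      using that sum.shift_bounds_nat_ivl[of ?g 0 i "n - i"] by (simp add: lessThan_atLeast0)
    also have "\<dots> = W (n - i) (j + i)"
      unfolding W_def using that by (intro sum.cong refl) (auto simp: ac_simps le_diff_conv)
    finally have "W n j = (\<Sum>k<i. ?g k) + W (n - i) (j + i)" .
    moreover have "(\<Sum>k<i. b ((\<theta> ^^ (j + k)) s) * c ((\<theta> ^^ (j + k)) s)) \<le> (\<Sum>k<i. ?g k)"
      by (intro sum_mono mult_left_mono b0) auto
    ultimately show ?thesis by simp
  qed
  have all1: "h n ((\<theta> ^^ j) s) \<le> (\<Sum>k<n. h 1 ((\<theta> ^^ (j + k)) s))" if "1 \<le> n" for n j
    using that
  proof (induction n rule: nat_induct_at_least)
    case (Suc n)
    have "h (Suc n) ((\<theta> ^^ j) s) \<le> h n ((\<theta> ^^ j) s) + h 1 ((\<theta> ^^ (j + n)) s)"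
      using sub[of n 1 j] by (simp add: add.commute)
    then show ?case using Suc by simp
  qed simp
  have "h n ((\<theta> ^^ j) s) \<le> t * real n + W n j" for j
    using n
  proof (induction n arbitrary: j rule: less_induct)
    case (less n)
    show ?case
    proof (cases "c ((\<theta> ^^ j) s) < 1")
      case True
      then obtain i where i: "1 \<le> i" "i \<le> K" "h i ((\<theta> ^^ j) s) \<le> t * real i" using c1 by blast
      consider "i = n" | "i < n" | "n < i" by linarith
      then show ?thesis
      proof cases
        case 1
        then show ?thesis using i W0[of n j] by simp
      next
        case 2
        have "h n ((\<theta> ^^ j) s) \<le> h i ((\<theta> ^^ j) s) + h (n - i) ((\<theta> ^^ (j + i)) s)"
          using sub[of i "n - i" j] 2 by (simp add: add.commute)
        also have "\<dots> \<le> t * real i + (t * real (n - i) + W (n - i) (j + i))"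
          using i 2 by (intro add_mono less.IH) auto
        also have "\<dots> \<le> t * real n + W n j"
          using Wsplit[of i n j] 2 sum_nonneg[of "{..<i}" "\<lambda>k. b ((\<theta> ^^ (j + k)) s) * c ((\<theta> ^^ (j + k)) s)"] b0 c0
          by (simp add: of_nat_diff algebra_simps)
        finally show ?thesis .
      next
        \<comment> \<open>The block overshoots the segment. Then \<open>n < K\<close>, every
          position is one of the last \<open>K\<close>, and the whole segment can be bounded step by
          step.\<close>
        case 3
        have "h n ((\<theta> ^^ j) s) \<le> (\<Sum>k<n. h 1 ((\<theta> ^^ (j + k)) s))" by (rule all1[OF less.prems])
        also have "\<dots> \<le> (\<Sum>k<n. t + b ((\<theta> ^^ (j + k)) s) * (c ((\<theta> ^^ (j + k)) s) + of_bool (n \<le> k + K)))"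
        proof (rule sum_mono)
          fix k
          have "b ((\<theta> ^^ (j + k)) s) * 1 \<le> b ((\<theta> ^^ (j + k)) s) * (c ((\<theta> ^^ (j + k)) s) + of_bool (n \<le> k + K))"
            using 3 i c0 by (intro mult_left_mono b0) auto
          then show "h 1 ((\<theta> ^^ (j + k)) s) \<le> t + b ((\<theta> ^^ (j + k)) s) * (c ((\<theta> ^^ (j + k)) s) + of_bool (n \<le> k + K))"
            using tb[of "(\<theta> ^^ (j + k)) s"] by simp
        qed
        also have "\<dots> = t * real n + W n j" by (simp add: W_def sum.distrib)
        finally show ?thesis .
      qed
    next
      case False
      \<comment> \<open>At an exceptional position a block of length 1 is used; its cost is absorbed
        by \<open>b * c\<close>, since here \<open>c\<close> is at least 1.\<close>
      have "h 1 ((\<theta> ^^ j) s) \<le> t + b ((\<theta> ^^ j) s) * 1" using tb by simp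
      also have "\<dots> \<le> t + b ((\<theta> ^^ j) s) * c ((\<theta> ^^ j) s)"
        using False by (intro add_left_mono mult_left_mono b0) auto
      finally have 1: "h 1 ((\<theta> ^^ j) s) \<le> t + b ((\<theta> ^^ j) s) * c ((\<theta> ^^ j) s)" .
      show ?thesis
      proof (cases "n = 1")
        case True
        then show ?thesis using 1 Wsplit[of 1 1 j] W0[of 0 "j + 1"] by simp
      next
        case False
        have "h n ((\<theta> ^^ j) s) \<le> h 1 ((\<theta> ^^ j) s) + h (n - 1) ((\<theta> ^^ (j + 1)) s)"
          using sub[of 1 "n - 1" j] less.prems by (simp add: add.commute)
        also have "\<dots> \<le> (t + b ((\<theta> ^^ j) s) * c ((\<theta> ^^ j) s)) + (t * real (n - 1) + W (n - 1) (j + 1))"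
          using less.prems False 1 by (intro add_mono less.IH) auto
        also have "\<dots> \<le> t * real n + W n j"
          using Wsplit[of 1 n j] less.prems by (simp add: of_nat_diff algebra_simps)
        finally show ?thesis .
      qed
    qed
  qed
  from this[of 0] show ?thesis by (simp add: W_def)
qed

text \<open>That \<open>h n / n\<close> stays below \<open>t\<close> by some fixed margin infinitely
  often is an invariant event, so it has probability 0 or 1. If it were almost sure, the exceptional
  set of the covering bound would shrink to a null set as \<open>K\<close> grows, and taking means
  would give \<open>\<mu> \<le> t\<close>, contrary to \<open>t = \<mu> - e / 2\<close>.\<close>

lemma AE_subadditive_lower:
  fixes h :: "nat \<Rightarrow> 'a \<Rightarrow> real"
  assumes int: "\<And>n. integrable N (h n)"
    and sub: "AE s in N. \<forall>m n. h (m + n) s \<le> h m s + h n ((\<theta> ^^ m) s)"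
    and mean: "(\<lambda>n. expectation (h n) / real n) \<longlonglongrightarrow> \<mu>" and e: "0 < e"
  shows "AE s in N. eventually (\<lambda>n. (\<mu> - e) * real n < h n s) sequentially"
proof -
  note [measurable] = borel_measurable_integrable[OF int]
  define t where "t = \<mu> - e / 2"
  \<comment> \<open>The margin \<open>1 / Suc k\<close> is what makes the event invariant: passing
    from \<open>\<theta> s\<close> to \<open>s\<close> adds \<open>h 1 s\<close>, which is absorbed
    for large \<open>n\<close> at the price of half the margin.\<close>
  define A where "A = {s \<in> space N. \<exists>k. \<forall>n0. \<exists>n. n0 \<le> n \<and> h n s \<le> (t - 1 / real (Suc k)) * real n}"
  have Am[measurable]: "A \<in> sets N" unfolding A_def by measurable
  have "AE s in N. \<theta> s \<in> A \<longrightarrow> s \<in> A"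
    using sub AE_space
  proof eventually_elim
    case (elim s)
    show ?case
    proof
      assume "\<theta> s \<in> A"
      then obtain k where k: "\<And>n0. \<exists>n. n0 \<le> n \<and> h n (\<theta> s) \<le> (t - 1 / real (Suc k)) * real n"
        by (auto simp: A_def)
      let ?d = "1 / real (Suc k)"
      have "\<exists>n. n0 \<le> n \<and> h n s \<le> (t - 1 / real (Suc (2 * k + 1))) * real n" for n0
      proof -
        obtain n1 :: nat where n1: "\<bar>h 1 s - t + ?d\<bar> / (?d / 2) < n1" using reals_Archimedean2 by blast
        obtain n where n: "max n0 n1 \<le> n" "h n (\<theta> s) \<le> (t - ?d) * real n" using k by blast
        have "\<bar>h 1 s - t + ?d\<bar> < real n1 * (?d / 2)" using n1 by (subst (asm) pos_divide_less_eq) auto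
        also have "\<dots> \<le> real (Suc n) * (?d / 2)" using n by (intro mult_right_mono) auto
        finally have *: "h 1 s - t + ?d \<le> real (Suc n) * (?d / 2)" by linarith
        have "h (Suc n) s \<le> h 1 s + h n (\<theta> s)" using elim(1)[rule_format, of 1 n] by simp
        also have "\<dots> \<le> h 1 s + (t - ?d) * real n" using n by simp
        also have "\<dots> = (t - ?d) * real (Suc n) + (h 1 s - t + ?d)"
        proof -
          have "y + (t - d) * x = (t - d) * (x + 1) + (y - t + d)" for d x y :: real by (simp add: algebra_simps)
          from this[of "h 1 s" ?d "real n"] show ?thesis by (simp add: add.commute)
        qed
        also have "\<dots> \<le> (t - ?d) * real (Suc n) + real (Suc n) * (?d / 2)" using * by simp
        also have "\<dots> = (t - ?d / 2) * real (Suc n)"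
        proof -
          have "(t - d) * x + x * (d / 2) = (t - d / 2) * x" for d x :: real by (simp add: field_simps)
          then show ?thesis .
        qed
        also have "?d / 2 = 1 / real (Suc (2 * k + 1))" by (simp add: field_simps)
        finally show ?thesis using n by (intro exI[of _ "Suc n"]) auto
      qed
      then show "s \<in> A" using elim(2) unfolding A_def by blast
    qed
  qed
  then consider "prob A = 0" | "prob A = 1" using zero_one[OF Am] by blast
  then show ?thesis
  proof cases
    case 1
    obtain k :: nat where k: "2 / e < real k" using reals_Archimedean2 by blast
    have k': "1 / real (Suc k) < e / 2" using k e by (simp add: field_simps)
    have "AE s in N. s \<notin> A" using 1 by (subst (asm) prob_eq_0) auto
    then show ?thesis
      using AE_space
    proof eventually_elim
      case (elim s)
      then have "\<not> (\<forall>n0. \<exists>n. n0 \<le> n \<and> h n s \<le> (t - 1 / real (Suc k)) * real n)"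
        unfolding A_def by blast
      then obtain n0 where n0: "\<And>n. n0 \<le> n \<Longrightarrow> (t - 1 / real (Suc k)) * real n < h n s"
        by (meson not_le)
      show ?case
      proof (rule eventually_sequentiallyI[of n0])
        fix n assume "n0 \<le> n"
        have "(\<mu> - e) * real n \<le> (t - 1 / real (Suc k)) * real n"
          using k' by (intro mult_right_mono) (auto simp: t_def)
        also have "\<dots> < h n s" by (rule n0) fact
        finally show "(\<mu> - e) * real n < h n s" .
      qed
    qed
  next
    case 2
    define b where "b s = \<bar>h 1 s\<bar> + \<bar>t\<bar>" for s
    define G where "G K = {s \<in> space N. \<exists>n. 1 \<le> n \<and> n \<le> K \<and> h n s \<le> t * real n}" for K :: nat
    have Gm[measurable]: "G K \<in> sets N" for K unfolding G_def by measurable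
    define c where "c K s = (1 - indicator (G K) s :: real)" for K s
    have cm[measurable]: "c K \<in> borel_measurable N" for K unfolding c_def[abs_def] by measurable
    have c01: "0 \<le> c K s" "c K s \<le> 1" for K s by (auto simp: c_def split: split_indicator)
    have ib: "integrable N b" unfolding b_def[abs_def] using int by auto
    have b0: "0 \<le> b s" for s by (simp add: b_def)
    have ibc: "integrable N (\<lambda>s. b s * c K s)" for K
    proof (rule Bochner_Integration.integrable_bound[OF ib])
      show "AE s in N. norm (b s * c K s) \<le> norm (b s)"
        using b0 c01 by (intro AE_I2) (simp add: abs_mult mult_left_le)
    qed (use ib in measurable)
    have orb: "AE s in N. \<forall>k m n. h (m + n) ((\<theta> ^^ k) s) \<le> h m ((\<theta> ^^ k) s) + h n ((\<theta> ^^ (m + k)) s)"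
      using AE_pow[OF sub] by (simp add: AE_all_countable funpow_add)
    have bound: "expectation (h n) / real n \<le> t + expectation (\<lambda>s. b s * c K s) + real K * expectation b / real n"
      if n: "1 \<le> n" for n K
    proof -
      have "AE s in N. h n s \<le> t * real n + (\<Sum>k<n. b ((\<theta> ^^ k) s) * (c K ((\<theta> ^^ k) s) + of_bool (n \<le> k + K)))"
        using orb AE_space
      proof eventually_elim
        case (elim s)
        show ?case
        proof (rule covering_bound[where h=h and c="c K" and b=b and K=K and t=t and s=s and n=n])
          fix k assume "c K ((\<theta> ^^ k) s) < 1"
          then show "\<exists>n. 1 \<le> n \<and> n \<le> K \<and> h n ((\<theta> ^^ k) s) \<le> t * real n"
            by (auto simp: c_def G_def split: split_indicator_asm)
        qed (use elim b_def c01(1) n in \<open>blast+\<close>)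
      qed
      then have "expectation (h n) \<le> expectation (\<lambda>s. t * real n + (\<Sum>k<n. b ((\<theta> ^^ k) s) * c K ((\<theta> ^^ k) s) + of_bool (n \<le> k + K) * b ((\<theta> ^^ k) s)))"
        using integral_pow(1)[OF ibc] integral_pow(1)[OF ib]
        by (intro integral_mono_AE int) (auto simp: distrib_left mult.commute)
      also have "\<dots> = t * real n + (\<Sum>k<n. expectation (\<lambda>s. b s * c K s) + of_bool (n \<le> k + K) * expectation b)"
        using integral_pow[OF ibc] integral_pow[OF ib] by (simp add: prob_space)
      also have "\<dots> \<le> t * real n + (real n * expectation (\<lambda>s. b s * c K s) + real K * expectation b)"
      proof -
        have "(\<Sum>k<n. of_bool (n \<le> k + K)) = (real (card {k. k < n \<and> n \<le> k + K}))"
          by (simp add: of_bool_def sum.If_cases lessThan_def Collect_conj_eq Int_commute)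
        also have "\<dots> \<le> real K"
        proof -
          have "card {k. k < n \<and> n \<le> k + K} \<le> card {n - K..<n}"
            by (intro card_mono) auto
          then show ?thesis by simp
        qed
        finally have "(\<Sum>k<n. of_bool (n \<le> k + K)) * expectation b \<le> real K * expectation b"
          using b0 by (intro mult_right_mono integral_nonneg) auto
        then show ?thesis by (simp add: sum.distrib sum_distrib_right)
      qed
      finally have *: "expectation (h n) \<le> t * real n + (real n * expectation (\<lambda>s. b s * c K s) + real K * expectation b)" .
      have "expectation (h n) / real n \<le> (t * real n + (real n * expectation (\<lambda>s. b s * c K s) + real K * expectation b)) / real n"
        using * by (intro divide_right_mono) auto
      also have "\<dots> = t + expectation (\<lambda>s. b s * c K s) + real K * expectation b / real n"
        using n by (simp add: add_divide_distrib)
      finally show ?thesis .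
    qed
    \<comment> \<open>First \<open>n\<close> tends to infinity with \<open>K\<close> fixed, which
      removes the contribution of the last \<open>K\<close> positions; only then does
      \<open>K\<close> grow.\<close>
    have lim: "\<mu> \<le> t + expectation (\<lambda>s. b s * c K s)" for K
    proof (rule LIMSEQ_le[OF mean])
      have "(\<lambda>n. t + expectation (\<lambda>s. b s * c K s) + real K * expectation b / real n) \<longlonglongrightarrow> t + expectation (\<lambda>s. b s * c K s) + 0"
        by (intro tendsto_add tendsto_const lim_const_over_n)
      then show "(\<lambda>n. t + expectation (\<lambda>s. b s * c K s) + real K * expectation b / real n) \<longlonglongrightarrow> t + expectation (\<lambda>s. b s * c K s)" by simp
      show "\<exists>N. \<forall>n\<ge>N. expectation (h n) / real n \<le> t + expectation (\<lambda>s. b s * c K s) + real K * expectation b / real n"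
        using bound by blast
    qed
    have "(\<lambda>K. expectation (\<lambda>s. b s * c K s)) \<longlonglongrightarrow> expectation (\<lambda>s. 0)"
    proof (rule integral_dominated_convergence[where w=b])
      have "AE s in N. s \<in> A" using 2 by (subst (asm) prob_eq_1) auto
      then show "AE s in N. (\<lambda>K. b s * c K s) \<longlonglongrightarrow> 0"
      proof eventually_elim
        case (elim s)
        then obtain k where "\<forall>n0. \<exists>n. n0 \<le> n \<and> h n s \<le> (t - 1 / real (Suc k)) * real n" and sp: "s \<in> space N"
          unfolding A_def by blast
        then obtain n where n: "1 \<le> n" "h n s \<le> (t - 1 / real (Suc k)) * real n" by blast
        have "h n s \<le> t * real n" using n(2) by (rule order_trans) (intro mult_right_mono, auto)
        then have "c K s = 0" if "n \<le> K" for K using n sp that by (auto simp: c_def G_def split: split_indicator)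
        then have "eventually (\<lambda>K. b s * c K s = 0) sequentially"
          by (intro eventually_sequentiallyI[of n]) auto
        then show ?case by (rule tendsto_eventually)
      qed
      show "AE s in N. norm (b s * c K s) \<le> b s" for K
        using b0 c01 by (intro AE_I2) (simp add: abs_mult mult_left_le)
    qed (use ib in \<open>simp_all add: b_def[abs_def]\<close>)
    then have "\<mu> \<le> t + 0"
      by (intro LIMSEQ_le_const[OF tendsto_add[OF tendsto_const]]) (use lim in auto)
    then show ?thesis using e by (simp add: t_def)
  qed
qed

text \<open>Birkhoff's theorem. Orbit sums are additive, hence subadditive, so the lower bound
  applies both to \<open>f\<close> and to \<open>- f\<close>.\<close>

lemma AE_ergodic_average:
  fixes f :: "'a \<Rightarrow> real"
  assumes f: "integrable N f" and e: "0 < e"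
  shows "AE s in N. eventually (\<lambda>n. \<bar>(\<Sum>k<n. f ((\<theta> ^^ k) s)) - expectation f * real n\<bar> < e * real n) sequentially"
proof -
  have *: "AE s in N. eventually (\<lambda>n. (expectation f - e) * real n < (\<Sum>k<n. f ((\<theta> ^^ k) s))) sequentially"
    if f: "integrable N f" for f
  proof (rule AE_subadditive_lower[OF _ _ _ e])
    note i = integral_pow[OF f]
    show "integrable N (\<lambda>s. \<Sum>k<n. f ((\<theta> ^^ k) s))" for n using i by auto
    show "(\<lambda>n. expectation (\<lambda>s. \<Sum>k<n. f ((\<theta> ^^ k) s)) / real n) \<longlonglongrightarrow> expectation f"
      by (rule tendsto_eventually, rule eventually_sequentiallyI[of 1]) (use i in simp)
    have "(\<Sum>k<m + n. f ((\<theta> ^^ k) s)) = (\<Sum>k<m. f ((\<theta> ^^ k) s)) + (\<Sum>k<n. f ((\<theta> ^^ k) ((\<theta> ^^ m) s)))" for m n s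
      by (induction n) (simp_all add: funpow_add[symmetric, THEN fun_cong, unfolded comp_def] add.commute)
    then show "AE s in N. \<forall>m n. (\<Sum>k<m + n. f ((\<theta> ^^ k) s)) \<le> (\<Sum>k<m. f ((\<theta> ^^ k) s)) + (\<Sum>k<n. f ((\<theta> ^^ k) ((\<theta> ^^ m) s)))"
      by simp
  qed
  have "integrable N (\<lambda>s. - f s)" using f by simp
  from *[OF f] *[OF this] show ?thesis
  proof eventually_elim
    case (elim s)
    from elim(1,2) eventually_gt_at_top[of 0] show ?case
      by eventually_elim (auto simp: abs_less_iff sum_negf algebra_simps)
  qed
qed

text \<open>Kingman's theorem for a non-negative sequence over a mixing map. For the upper bound,
  \<open>n\<close> is split into blocks of a length \<open>m\<close> whose mean per step is below
  \<open>\<mu> + e\<close>, and the ergodic theorem for the \<open>m\<close>-th power averages over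
  the blocks.\<close>

theorem subadditive_ergodic:
  fixes h :: "nat \<Rightarrow> 'a \<Rightarrow> real"
  assumes int: "\<And>n. integrable N (h n)"
    and sub: "AE s in N. \<forall>m n. h (m + n) s \<le> h m s + h n ((\<theta> ^^ m) s)"
    and nn: "\<And>n s. 0 \<le> h n s" and h0: "\<And>s. h 0 s = 0"
    and mean: "(\<lambda>n. expectation (h n) / real n) \<longlonglongrightarrow> \<mu>"
  shows "AE s in N. (\<lambda>n. h n s / real n) \<longlonglongrightarrow> \<mu>"
proof -
  have orb: "AE s in N. \<forall>k m n. h (m + n) ((\<theta> ^^ k) s) \<le> h m ((\<theta> ^^ k) s) + h n ((\<theta> ^^ (m + k)) s)"
    using AE_pow[OF sub] by (simp add: AE_all_countable funpow_add)
  have upper: "AE s in N. eventually (\<lambda>n. h n s < (\<mu> + 6 * e) * real n) sequentially" if e: "0 < e" for e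
  proof -
    have "eventually (\<lambda>n. expectation (h n) / real n < \<mu> + e \<and> 0 < n) sequentially"
      using order_tendstoD(2)[OF mean, of "\<mu> + e"] e eventually_gt_at_top[of 0] by (auto intro: eventually_conj)
    then obtain m where m: "0 < m" "expectation (h m) / real m < \<mu> + e" by (auto dest: eventually_happens)
    have em: "0 < e / real m" using e m by simp
    interpret P: mixing_system N "\<theta> ^^ m" by (rule mixing_system_pow[OF m(1)])
    from P.AE_ergodic_average[OF int[of m] e] AE_ergodic_average[OF int[of 1] em] orb
    show ?thesis
    proof eventually_elim
      case (elim s)
      obtain q0 where q0: "\<And>q. q0 \<le> q \<Longrightarrow> (\<Sum>k<q. h m ((\<theta> ^^ (m * k)) s)) \<le> (expectation (h m) + e) * real q"
        using elim(1) by (force simp: eventually_sequentially funpow_mult abs_less_iff algebra_simps)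
      obtain n1 where n1: "\<And>n. n1 \<le> n \<Longrightarrow> \<bar>(\<Sum>k<n. h 1 ((\<theta> ^^ k) s)) - expectation (h 1) * real n\<bar> < e / real m * real n"
        using elim(2) by (auto simp: eventually_sequentially)
      have pr: "h (q * m) s \<le> (\<Sum>k<q. h m ((\<theta> ^^ (m * k)) s))" for q
      proof (induction q)
        case (Suc q)
        have "h (q * m + m) s \<le> h (q * m) s + h m ((\<theta> ^^ (q * m)) s)" using elim(3)[rule_format, of "q * m" m 0] by simp
        then show ?case using Suc by (simp add: ac_simps)
      qed (simp add: h0)
      have rs: "h r ((\<theta> ^^ j) s) \<le> (\<Sum>k<r. h 1 ((\<theta> ^^ (j + k)) s))" for r j
      proof (induction r)
        case (Suc r)
        have "h (r + 1) ((\<theta> ^^ j) s) \<le> h r ((\<theta> ^^ j) s) + h 1 ((\<theta> ^^ (r + j)) s)" using elim(3) by blast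
        then show ?case using Suc by (simp add: ac_simps)
      qed (simp add: h0)
      \<comment> \<open>Beyond \<open>n2\<close> the mean of \<open>m\<close> single steps is below
        \<open>e * n\<close>.\<close>
      obtain n2 :: nat where n2: "expectation (h 1) * real m / e < n2" using reals_Archimedean2 by blast
      let ?n0 = "Suc (m * (q0 + 1) + n1 + n2 + m)"
      show ?case
      proof (rule eventually_sequentiallyI[of ?n0])
        fix n assume n: "?n0 \<le> n"
        define q where "q = n div m"
        define r where "r = n mod m"
        have nqr: "n = q * m + r" by (simp add: q_def r_def)
        have r: "r < m" using m by (simp add: r_def)
        have "q0 * m \<le> n" using n by (simp add: algebra_simps)
        then have "q0 \<le> q" unfolding q_def using m by (simp add: less_eq_div_iff_mult_less_eq)
        have qm: "n1 + m \<le> q * m + m" "n1 \<le> q * m"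
          using n r nqr by (auto simp: algebra_simps)
        have "h n s \<le> h (q * m) s + h r ((\<theta> ^^ (q * m)) s)"
          using elim(3)[rule_format, of "q * m" r 0] nqr by simp
        also have "h (q * m) s \<le> (expectation (h m) + e) * real q" using pr q0[OF \<open>q0 \<le> q\<close>] by (rule order_trans)
        also have "(expectation (h m) + e) * real q \<le> (\<mu> + 2 * e) * real n"
        proof -
          have E0: "0 \<le> expectation (h m)" using nn by simp
          have "real q * real m \<le> real n" using nqr by (simp add: of_nat_mult[symmetric] del: of_nat_mult)
          have "(expectation (h m) + e) * real q = (expectation (h m) / real m + e / real m) * (real q * real m)"
            using m by (simp add: field_simps)
          also have "\<dots> \<le> (expectation (h m) / real m + e / real m) * real n"
            using E0 e m \<open>real q * real m \<le> real n\<close> by (intro mult_left_mono) auto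
          also have "\<dots> \<le> (\<mu> + 2 * e) * real n"
          proof (rule mult_right_mono)
            have "e / real m \<le> e" using e m by (simp add: divide_le_eq)
            then show "expectation (h m) / real m + e / real m \<le> \<mu> + 2 * e" using m by simp
          qed simp
          finally show ?thesis .
        qed
        \<comment> \<open>The remainder, shorter than \<open>m\<close>, is enlarged to a window of
          \<open>m\<close> steps, which is a difference of two ergodic sums. Each of them is known
          up to \<open>e / m\<close> per step, so the window costs at most \<open>3 * e * n\<close>
          in error and \<open>e * n\<close> in mean.\<close>
        also have "h r ((\<theta> ^^ (q * m)) s) \<le> (\<Sum>k<m. h 1 ((\<theta> ^^ (q * m + k)) s))"
          by (rule order_trans[OF rs[of r "q * m"]], rule sum_mono2) (use r nn in auto)
        also have "\<dots> = (\<Sum>k<q * m + m. h 1 ((\<theta> ^^ k) s)) - (\<Sum>k<q * m. h 1 ((\<theta> ^^ k) s))"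
        proof -
          have "(\<Sum>k<i + j. g k) = (\<Sum>k<i. g k) + (\<Sum>k<j. g (i + k))" for g :: "nat \<Rightarrow> real" and i j
            by (induction j) auto
          from this[of "\<lambda>k. h 1 ((\<theta> ^^ k) s)" "q * m" m] show ?thesis by simp
        qed
        also have "\<dots> < 4 * e * real n"
        proof -
          let ?S = "\<lambda>n. \<Sum>k<n. h 1 ((\<theta> ^^ k) s)"
          let ?E = "expectation (h 1)"
          have "?S (q * m + m) < ?E * real (q * m + m) + e / real m * real (q * m + m)"
            using n1[of "q * m + m"] qm by (simp add: abs_less_iff)
          moreover have "?E * real (q * m) - e / real m * real (q * m) < ?S (q * m)"
            using n1[of "q * m"] qm by (simp add: abs_less_iff)
          ultimately have "?S (q * m + m) - ?S (q * m) < ?E * real m + (e / real m * real (q * m + m) + e / real m * real (q * m))"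
            by (simp add: algebra_simps)
          also have "e / real m * real (q * m + m) + e / real m * real (q * m) = e * (2 * real q + 1)"
            using m by (simp add: field_simps)
          also have "\<dots> \<le> e * (3 * real n)"
          proof (rule mult_left_mono)
            have "q \<le> n" "1 \<le> n" using n by (auto simp: q_def)
            then show "2 * real q + 1 \<le> 3 * real n" by linarith
          qed (use e in simp)
          also have "?E * real m \<le> e * real n"
          proof -
            have "?E * real m \<le> e * real n2" using n2 e by (simp add: pos_divide_less_eq mult.commute)
            also have "\<dots> \<le> e * real n" using n e by (intro mult_left_mono) auto
            finally show ?thesis .
          qed
          finally show ?thesis by simp
        qed
        finally show "h n s < (\<mu> + 6 * e) * real n" by (simp add: algebra_simps)
      qed
    qed
  qed
  have "AE s in N. \<forall>k. eventually (\<lambda>n. h n s < (\<mu> + 6 * (1 / real (Suc k))) * real n) sequentially \<and>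
      eventually (\<lambda>n. (\<mu> - 1 / real (Suc k)) * real n < h n s) sequentially"
    unfolding AE_all_countable
  proof
    fix k
    have p: "0 < 1 / real (Suc k)" by simp
    from upper[OF p] AE_subadditive_lower[OF int sub mean p]
    show "AE s in N. eventually (\<lambda>n. h n s < (\<mu> + 6 * (1 / real (Suc k))) * real n) sequentially \<and>
      eventually (\<lambda>n. (\<mu> - 1 / real (Suc k)) * real n < h n s) sequentially"
      by eventually_elim blast
  qed
  then show ?thesis
  proof eventually_elim
    case (elim s)
    show ?case
    proof (rule LIMSEQ_I)
      fix e :: real assume e: "0 < e"
      obtain k :: nat where k: "6 / e < real k" using reals_Archimedean2 by blast
      have k': "6 * (1 / real (Suc k)) < e" using k e by (simp add: field_simps)
      have "eventually (\<lambda>n. h n s < (\<mu> + 6 * (1 / real (Suc k))) * real n \<and>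
         (\<mu> - 1 / real (Suc k)) * real n < h n s \<and> 0 < n) sequentially"
        using elim[rule_format, of k] eventually_gt_at_top[of "0 :: nat"] by (intro eventually_conj) blast+
      then have "eventually (\<lambda>n. norm (h n s / real n - \<mu>) < e) sequentially"
      proof eventually_elim
        case (elim n)
        then have "h n s / real n < \<mu> + 6 * (1 / real (Suc k))" "\<mu> - 1 / real (Suc k) < h n s / real n"
          by (auto simp: pos_divide_less_eq pos_less_divide_eq)
        moreover have "1 / real (Suc k) \<le> 6 * (1 / real (Suc k))" by (simp add: divide_right_mono)
        ultimately show ?case using k' by (simp add: abs_less_iff)
      qed
      then show "\<exists>no. \<forall>n\<ge>no. norm (h n s / real n - \<mu>) < e" by (simp add: eventually_sequentially)
    qed
  qed
qed

end


section \<open>Fourier transforms\<close>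

text \<open>The sign in the kernel is opposite to that of \<open>fourier\<close>; for real functions
  the two transforms are complex conjugates of each other.\<close>

definition ft :: "('a::euclidean_space \<Rightarrow> complex) \<Rightarrow> 'a \<Rightarrow> complex" where
  "ft f x = (\<integral>y. f y * cis (2 * pi * (x \<bullet> y)) \<partial>lborel)"

text \<open>The Gaussian that is its own transform for this kernel.\<close>

definition gauss :: "'a::euclidean_space \<Rightarrow> real" where
  "gauss x = exp (- pi * (norm x)\<^sup>2)"

lemma gauss_pos: "0 < gauss x" and gauss_le_1: "gauss x \<le> 1" and gauss_uminus: "gauss (- x) = gauss x"
  by (simp_all add: gauss_def)

lemma gauss_measurable[measurable]: "gauss \<in> borel_measurable borel"
  unfolding gauss_def[abs_def] by measurable

lemma cis_measurable[measurable]: "cis \<in> borel_measurable borel"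
  by (intro borel_measurable_continuous_onI continuous_intros)

lemma integrable_times_cis:
  fixes f :: "'a::euclidean_space \<Rightarrow> complex"
  assumes f: "integrable lborel f" and [measurable]: "u \<in> borel_measurable borel"
  shows "integrable lborel (\<lambda>y. f y * cis (u y))"
  by (rule Bochner_Integration.integrable_bound[OF f]) (use f in \<open>auto simp: norm_mult\<close>)

text \<open>The substitution \<open>u = c * y\<close> turns the integrand into the standard normal
  density times a character, up to a constant, and its integral is the known characteristic
  function.\<close>

lemma gauss_real_transform:
  fixes t :: real
  shows "integrable lborel (\<lambda>u :: real. complex_of_real (exp (- pi * u\<^sup>2)) * cis (2 * pi * (t * u)))"
    and "(\<integral>u. complex_of_real (exp (- pi * u\<^sup>2)) * cis (2 * pi * (t * u)) \<partial>lborel) = complex_of_real (exp (- pi * t\<^sup>2))"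
proof -
  let ?F = "\<lambda>u :: real. complex_of_real (exp (- pi * u\<^sup>2)) * cis (2 * pi * (t * u))"
  define c where "c = 1 / sqrt (2 * pi)"
  define s where "s = sqrt (2 * pi) * t"
  have c0: "c \<noteq> 0" "0 < c" by (simp_all add: c_def)
  have Fc: "?F (0 + c * y) = (1 / c) *\<^sub>R (std_normal_density y *\<^sub>R iexp (s * y))" for y
  proof -
    have e1: "- pi * (c * y)\<^sup>2 = - y\<^sup>2 / 2" by (simp add: c_def power_divide power_mult_distrib)
    have "2 * pi * c = sqrt (2 * pi)"
      unfolding c_def by (simp add: real_div_sqrt)
    then have e2: "2 * pi * (t * (c * y)) = s * y" unfolding s_def by (metis mult.assoc mult.commute)
    have e3: "1 / c * std_normal_density y = exp (- y\<^sup>2 / 2)" by (simp add: std_normal_density_def c_def)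
    show ?thesis
      unfolding add_0 e1 e2 scaleR_scaleR e3 by (simp add: cis_conv_exp scaleR_conv_of_real)
  qed
  interpret real_distribution std_normal_distribution by (rule real_dist_normal_dist)
  have "integrable std_normal_distribution (\<lambda>y. iexp (s * y))"
    by (rule integrable_const_bound[of _ 1]) auto
  then have int: "integrable lborel (\<lambda>y. std_normal_density y *\<^sub>R iexp (s * y))"
    by (subst (asm) integrable_density) auto
  then have "integrable lborel (\<lambda>y. ?F (0 + c * y))" unfolding Fc by (intro integrable_scaleR_right int)
  then show "integrable lborel ?F"
    using lborel_integrable_real_affine_iff[OF c0(1), of ?F 0] by blast
  have "(\<integral>u. ?F u \<partial>lborel) = c *\<^sub>R (\<integral>y. ?F (0 + c * y) \<partial>lborel)"
    using lborel_integral_real_affine[OF c0(1), of ?F 0] c0(2) by simp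
  also have "\<dots> = (\<integral>y. std_normal_density y *\<^sub>R iexp (s * y) \<partial>lborel)"
    unfolding Fc integral_scaleR_right using c0 by simp
  also have "\<dots> = char std_normal_distribution s"
    unfolding char_def by (subst integral_density) auto
  also have "\<dots> = complex_of_real (exp (- pi * t\<^sup>2))"
    unfolding char_std_normal_distribution by (simp add: s_def power_mult_distrib)
  finally show "(\<integral>u. ?F u \<partial>lborel) = complex_of_real (exp (- pi * t\<^sup>2))" .
qed

text \<open>The Gaussian and the character both factor over the coordinates, so the integral is a
  product of one-dimensional ones.\<close>

lemma ft_gauss:
  fixes x :: "'a::euclidean_space"
  shows "ft (\<lambda>y. complex_of_real (gauss y)) x = complex_of_real (gauss x)"
    and "integrable lborel (gauss :: 'a \<Rightarrow> real)"
proof -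
  interpret product_sigma_finite "\<lambda>_ :: 'a. lborel :: real measure" ..
  let ?F = "\<lambda>t u :: real. complex_of_real (exp (- pi * u\<^sup>2)) * cis (2 * pi * (t * u))"
  have norm_sq: "(norm y)\<^sup>2 = (\<Sum>b\<in>Basis. (y \<bullet> b)\<^sup>2)" for y :: 'a
    unfolding power2_norm_eq_inner by (subst euclidean_inner) (simp add: power2_eq_square)
  have gauss_prod: "gauss y = (\<Prod>b\<in>Basis. exp (- pi * (y \<bullet> b)\<^sup>2))" for y :: 'a
    unfolding gauss_def norm_sq sum_distrib_left by (rule exp_sum) simp
  have cis_sum: "cis (\<Sum>b\<in>A. h b) = (\<Prod>b\<in>A. cis (h b))" if "finite A" for A :: "'a set" and h
    using that
  proof (induction rule: finite_induct)
    case (insert b A)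
    then show ?case by (simp add: insert.IH[symmetric] cis_mult del: insert.IH)
  qed simp
  have prod: "complex_of_real (gauss y) * cis (2 * pi * (x \<bullet> y)) = (\<Prod>b\<in>Basis. ?F (x \<bullet> b) (y \<bullet> b))" for x y :: 'a
  proof -
    have "gauss y = (\<Prod>b\<in>Basis. exp (- pi * (y \<bullet> b)\<^sup>2))" by (rule gauss_prod)
    moreover have "cis (2 * pi * (x \<bullet> y)) = (\<Prod>b\<in>Basis. cis (2 * pi * ((x \<bullet> b) * (y \<bullet> b))))"
      unfolding euclidean_inner[of x y] sum_distrib_left by (rule cis_sum) simp
    ultimately show ?thesis by (simp only: prod.distrib of_real_prod)
  qed
  have int: "integrable lborel (\<lambda>y :: 'a. complex_of_real (gauss y) * cis (2 * pi * (x \<bullet> y)))"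
    and eq: "ft (\<lambda>y. complex_of_real (gauss y)) x = complex_of_real (gauss x)" for x :: 'a
  proof -
    have inner: "(\<Sum>b\<in>Basis. f b *\<^sub>R b) \<bullet> c = f c" if "c \<in> Basis" for c :: 'a and f :: "'a \<Rightarrow> real"
      using that by simp
    have m: "(\<lambda>y :: 'a. complex_of_real (gauss y) * cis (2 * pi * (x \<bullet> y))) \<in> borel_measurable borel"
      by measurable
    have m2: "(\<lambda>f. \<Sum>b\<in>Basis. f b *\<^sub>R b) \<in> (\<Pi>\<^sub>M b\<in>(Basis :: 'a set). lborel) \<rightarrow>\<^sub>M borel"
      by measurable
    have pr: "complex_of_real (gauss (\<Sum>b\<in>Basis. f b *\<^sub>R b)) * cis (2 * pi * (x \<bullet> (\<Sum>b\<in>Basis. f b *\<^sub>R b)))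
       = (\<Prod>b\<in>Basis. ?F (x \<bullet> b) (f b))" for f
      unfolding prod by (intro prod.cong refl) simp
    show "integrable lborel (\<lambda>y :: 'a. complex_of_real (gauss y) * cis (2 * pi * (x \<bullet> y)))"
      by (subst lborel_eq, subst integrable_distr_eq[OF m2 m], unfold pr, rule product_integrable_prod)
        (simp_all only: finite_Basis gauss_real_transform(1))
    have "ft (\<lambda>y. complex_of_real (gauss y)) x = (\<integral>f. (\<Prod>b\<in>Basis. ?F (x \<bullet> b) (f b)) \<partial>(\<Pi>\<^sub>M b\<in>Basis. lborel))"
      unfolding ft_def by (subst lborel_eq, subst integral_distr[OF m2 m]) (simp only: pr)
    also have "\<dots> = (\<Prod>b\<in>Basis. \<integral>u. ?F (x \<bullet> b) u \<partial>lborel)"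
      by (rule product_integral_prod) (simp_all only: finite_Basis gauss_real_transform(1))
    also have "\<dots> = (\<Prod>b\<in>Basis. complex_of_real (exp (- pi * (x \<bullet> b)\<^sup>2)))"
      by (simp only: gauss_real_transform(2))
    also have "\<dots> = complex_of_real (gauss x)"
      unfolding gauss_prod by simp
    finally show "ft (\<lambda>y. complex_of_real (gauss y)) x = complex_of_real (gauss x)" .
  qed
  from eq show "ft (\<lambda>y. complex_of_real (gauss y)) x = complex_of_real (gauss x)" .
  from int[of 0] have "integrable lborel (\<lambda>y :: 'a. complex_of_real (gauss y))" by simp
  then show "integrable lborel (gauss :: 'a \<Rightarrow> real)" by (simp only: complex_of_real_integrable_eq)
qed

lemma lborel_integral_translation:
  fixes f :: "'a::euclidean_space \<Rightarrow> 'b::{banach, second_countable_topology}"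
  assumes [measurable]: "f \<in> borel_measurable borel"
  shows "(\<integral>x. f (c + x) \<partial>lborel) = (\<integral>x. f x \<partial>lborel)"
    and "integrable lborel (\<lambda>x. f (c + x)) \<longleftrightarrow> integrable lborel f"
proof -
  show "(\<integral>x. f (c + x) \<partial>lborel) = (\<integral>x. f x \<partial>lborel)"
    by (subst (2) lborel_distr_plus[of c, symmetric]) (simp add: integral_distr)
  show "integrable lborel (\<lambda>x. f (c + x)) \<longleftrightarrow> integrable lborel f"
    by (subst (2) lborel_distr_plus[of c, symmetric]) (simp add: integrable_distr_eq)
qed

lemma lborel_integral_reflect:
  fixes f :: "'a::euclidean_space \<Rightarrow> 'b::{banach, second_countable_topology}"
  assumes [measurable]: "f \<in> borel_measurable borel"
  shows "(\<integral>x. f (- x) \<partial>lborel) = (\<integral>x. f x \<partial>lborel)"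
proof -
  have "lborel = distr lborel borel (uminus :: 'a \<Rightarrow> 'a)"
    using lborel_affine[of "-1" "0 :: 'a"] by (simp add: density_1)
  then have "(\<integral>x. f x \<partial>lborel) = (\<integral>x. f x \<partial>distr lborel borel uminus)" by simp
  also have "\<dots> = (\<integral>x. f (- x) \<partial>lborel)" by (simp add: integral_distr)
  finally show ?thesis ..
qed

lemma integrable_pair_bound:
  fixes F :: "'a::euclidean_space \<times> 'b::euclidean_space \<Rightarrow> complex"
  assumes f: "integrable lborel f" and g: "integrable lborel g"
    and F[measurable]: "F \<in> borel_measurable borel" and b: "\<And>x y. norm (F (x, y)) \<le> f x * g y"
  shows "integrable (lborel \<Otimes>\<^sub>M lborel) F"
proof -
  have [measurable]: "f \<in> borel_measurable borel" "g \<in> borel_measurable borel" using f g by auto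
  have "integrable (lborel \<Otimes>\<^sub>M lborel) (\<lambda>(x, y). f x * g y)"
  proof (rule lborel_pair.Fubini_integrable)
    show "integrable lborel (\<lambda>x. \<integral>y. norm (case (x, y) of (x, y) \<Rightarrow> f x * g y) \<partial>lborel)"
      using f by (simp add: abs_mult)
  qed (use g in auto)
  then show ?thesis
    by (rule Bochner_Integration.integrable_bound)
      (use F b in \<open>auto simp: lborel_prod split: prod.split intro: order_trans[OF _ abs_ge_self]\<close>)
qed

text \<open>Fubini: both sides are the double integral of \<open>f x * g y\<close> against the same
  symmetric kernel. Below, transforms are compared by moving them between the two factors in this
  way.\<close>

lemma ft_multiplication:
  fixes f g :: "'a::euclidean_space \<Rightarrow> complex"
  assumes f: "integrable lborel f" and g: "integrable lborel g"
  shows "(\<integral>x. f x * ft g x \<partial>lborel) = (\<integral>y. ft f y * g y \<partial>lborel)"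
proof -
  have [measurable]: "f \<in> borel_measurable borel" "g \<in> borel_measurable borel" using f g by auto
  have i: "integrable (lborel \<Otimes>\<^sub>M lborel) (\<lambda>(x, y). f x * (g y * cis (2 * pi * (x \<bullet> y))))"
  proof (rule integrable_pair_bound)
    show "integrable lborel (\<lambda>x. norm (f x))" "integrable lborel (\<lambda>x. norm (g x))" using f g by auto
    show "(\<lambda>(x, y). f x * (g y * cis (2 * pi * (x \<bullet> y)))) \<in> borel_measurable borel"
      unfolding borel_prod[symmetric] by measurable
  qed (simp add: norm_mult)
  have "(\<integral>x. f x * ft g x \<partial>lborel) = (\<integral>x. (\<integral>y. f x * (g y * cis (2 * pi * (x \<bullet> y))) \<partial>lborel) \<partial>lborel)"
    unfolding ft_def by simp
  also have "\<dots> = (\<integral>y. (\<integral>x. f x * (g y * cis (2 * pi * (x \<bullet> y))) \<partial>lborel) \<partial>lborel)"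
    by (rule lborel_pair.Fubini_integral[symmetric, OF i])
  also have "\<dots> = (\<integral>y. (\<integral>x. g y * (f x * cis (2 * pi * (y \<bullet> x))) \<partial>lborel) \<partial>lborel)"
    by (simp add: mult_ac inner_commute)
  also have "\<dots> = (\<integral>y. ft f y * g y \<partial>lborel)"
    unfolding ft_def by (simp add: mult.commute)
  finally show ?thesis .
qed

lemma ft_modulate:
  fixes f :: "'a::euclidean_space \<Rightarrow> complex"
  shows "ft (\<lambda>y. f y * cis (2 * pi * (a \<bullet> y))) x = ft f (x + a)"
  unfolding ft_def by (simp add: mult.assoc cis_mult inner_add_left distrib_left add.commute)

lemma ft_translate:
  fixes f :: "'a::euclidean_space \<Rightarrow> complex"
  assumes [measurable]: "f \<in> borel_measurable borel"
  shows "ft (\<lambda>y. f (y - a)) x = cis (2 * pi * (x \<bullet> a)) * ft f x"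
proof -
  have "ft (\<lambda>y. f (y - a)) x = (\<integral>y. f ((a + y) - a) * cis (2 * pi * (x \<bullet> (a + y))) \<partial>lborel)"
    unfolding ft_def by (rule lborel_integral_translation(1)[symmetric]) measurable
  also have "\<dots> = (\<integral>y. cis (2 * pi * (x \<bullet> a)) * (f y * cis (2 * pi * (x \<bullet> y))) \<partial>lborel)"
    by (simp add: inner_add_right distrib_left cis_mult[symmetric] mult_ac)
  finally show ?thesis by (simp add: ft_def)
qed

lemma sets_borel_halfspaces:
  "sets (borel :: 'a::euclidean_space measure) = sigma_sets UNIV {{x \<in> UNIV. t < h x} | t h. h \<in> range (\<lambda>v x. v \<bullet> x)}"
proof -
  have "sets (borel :: 'a measure) = sigma_sets UNIV ((\<lambda>(a, i). {x::'a. a < x \<bullet> i}) ` (UNIV \<times> Basis))"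
    by (subst borel_eq_halfspace_greater) (rule sets_measure_of, simp)
  also have "\<dots> = sigma_sets UNIV {{x \<in> UNIV. t < h x} | t h. h \<in> range (\<lambda>v x. v \<bullet> x)}"
  proof (rule sigma_sets_eqI)
    fix A assume "A \<in> (\<lambda>(a, i). {x::'a. a < x \<bullet> i}) ` (UNIV \<times> Basis)"
    then obtain a i where A: "A = {x::'a. a < x \<bullet> i}" by auto
    show "A \<in> sigma_sets UNIV {{x \<in> UNIV. t < h x} | t h. h \<in> range (\<lambda>v x. v \<bullet> x)}"
      unfolding A
      by (intro sigma_sets.Basic CollectI exI[of _ a] exI[of _ "(\<bullet>) i"] conjI rangeI) (auto simp: inner_commute)
  next
    fix A :: "'a set" assume "A \<in> {{x \<in> UNIV. t < h x} | t h. h \<in> range (\<lambda>v x. v \<bullet> x)}"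
    then obtain t v where "A = {x. t < v \<bullet> x}" by auto
    then have "A \<in> sets borel" by simp
    then show "A \<in> sigma_sets UNIV ((\<lambda>(a, i). {x::'a. a < x \<bullet> i}) ` (UNIV \<times> Basis))"
      by (subst (asm) borel_eq_halfspace_greater) (simp add: sets_measure_of)
  qed
  finally show ?thesis .
qed

text \<open>Uniqueness of the Fourier transform. If the transform vanishes, \<open>u\<close>
  integrates to 0 against every trigonometric polynomial; these approximate indicators in mean for
  the finite measure with density \<open>\<bar>u\<bar>\<close>, so \<open>u\<close> has integral 0
  over every Borel set.\<close>

lemma ft_eq_0_imp_AE_0:
  fixes u :: "'a::euclidean_space \<Rightarrow> real"
  assumes u: "integrable lborel u" and z: "\<And>x. ft (\<lambda>y. complex_of_real (u y)) x = 0"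
  shows "AE y in lborel. u y = 0"
proof -
  have um[measurable]: "u \<in> borel_measurable borel" using u by simp
  define L :: "('a \<Rightarrow> real) set" where "L = range (\<lambda>v x. v \<bullet> x)"
  have L: "function_subspace L"
    unfolding function_subspace_def
  proof (intro conjI ballI allI)
    show "(\<lambda>_. 0) \<in> L" unfolding L_def by (rule image_eqI[of _ _ 0]) auto
    fix f g assume "f \<in> L" "g \<in> L"
    then obtain a b where "f = (\<lambda>x. a \<bullet> x)" "g = (\<lambda>x. b \<bullet> x)" by (auto simp: L_def)
    then show "(\<lambda>x. f x + g x) \<in> L" unfolding L_def by (intro image_eqI[of _ _ "a + b"]) (auto simp: inner_add_left)
  next
    fix f c assume "f \<in> L"
    then obtain a where "f = (\<lambda>x. a \<bullet> x)" by (auto simp: L_def)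
    then show "(\<lambda>x. c * f x) \<in> L" unfolding L_def by (intro image_eqI[of _ _ "c *\<^sub>R a"]) auto
  qed
  have z': "(\<integral>y. u y * P y \<partial>lborel) = 0 \<and> integrable lborel (\<lambda>y. u y * P y)" if "P \<in> trig_polys L" for P
    using that
  proof (induction rule: trig_polys.induct)
    case (cos h a c)
    then obtain v where h: "h = (\<lambda>x. v \<bullet> x)" by (auto simp: L_def)
    let ?x = "(1 / (2 * pi)) *\<^sub>R v"
    let ?G = "\<lambda>y. complex_of_real (u y) * cis (2 * pi * (?x \<bullet> y))"
    have iG: "integrable lborel ?G"
      by (rule integrable_times_cis) (use u in auto)
    have eq: "u y * (a * cos (h y + c)) = a * Re (cis c * ?G y)" for y
      by (simp add: h cos_add algebra_simps)
    have "(\<integral>y. u y * (a * cos (h y + c)) \<partial>lborel) = a * (\<integral>y. Re (cis c * ?G y) \<partial>lborel)"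
      unfolding eq by simp
    also have "(\<integral>y. Re (cis c * ?G y) \<partial>lborel) = Re (\<integral>y. cis c * ?G y \<partial>lborel)"
      by (rule integral_Re) (use iG in simp)
    also have "(\<integral>y. cis c * ?G y \<partial>lborel) = cis c * ft (\<lambda>y. complex_of_real (u y)) ?x"
      unfolding ft_def by simp
    finally have "(\<integral>y. u y * (a * cos (h y + c)) \<partial>lborel) = a * Re (cis c * ft (\<lambda>y. complex_of_real (u y)) ?x)" .
    moreover have "integrable lborel (\<lambda>y. u y * (a * cos (h y + c)))"
      unfolding eq by (intro integrable_mult_right integrable_Re iG)
    ultimately show ?case by (simp add: z)
  next
    case (add P Q)
    then show ?case by (simp add: distrib_left)
  qed
  have ui: "integrable lborel (\<lambda>y. \<bar>u y\<bar>)" using u by simp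
  define M where "M = density lborel (\<lambda>y. ennreal \<bar>u y\<bar>)"
  have fin: "finite_measure M"
  proof
    show "emeasure M (space M) \<noteq> \<infinity>"
      using nn_integral_eq_integral[OF ui] by (simp add: M_def emeasure_density)
  qed
  have B0: "(\<integral>y. indicator B y * u y \<partial>lborel) = 0" if B[measurable]: "B \<in> sets borel" for B
  proof -
    have "\<bar>\<integral>y. indicator B y * u y \<partial>lborel\<bar> \<le> e" if e: "0 < e" for e
    proof -
      have "\<exists>P\<in>trig_polys L. (\<integral>x. \<bar>indicator B x - P x\<bar> \<partial>M) < e \<and> (\<integral>x. \<bar>indicator B x - P x\<bar> \<partial>M) < e"
      proof (rule trig_polys_dense[OF fin fin refl L])
        show "L \<subseteq> borel_measurable M" by (auto simp: L_def M_def)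
        show "sets M = sigma_sets (space M) {{x \<in> space M. t < h x} |t h. h \<in> L}"
          unfolding L_def M_def using sets_borel_halfspaces by simp
      qed (use B e in \<open>auto simp: M_def\<close>)
      then obtain P where P: "P \<in> trig_polys L" "(\<integral>x. \<bar>indicator B x - P x\<bar> \<partial>M) < e" by blast
      have Pm[measurable]: "P \<in> borel_measurable borel"
        by (rule trig_polys_measurable[OF P(1)]) (auto simp: L_def)
      have i1: "integrable lborel (\<lambda>y. indicator B y * u y)"
        using integrable_mult_indicator[OF _ u, of B] B by simp
      have "(\<integral>y. indicator B y * u y \<partial>lborel) = (\<integral>y. indicator B y * u y - u y * P y \<partial>lborel)"
        using z'[OF P(1)] i1 by simp
      also have "\<bar>\<dots>\<bar> \<le> (\<integral>y. \<bar>indicator B y * u y - u y * P y\<bar> \<partial>lborel)" by (rule integral_abs_bound)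
      also have "\<dots> = (\<integral>y. \<bar>u y\<bar> *\<^sub>R \<bar>indicator B y - P y\<bar> \<partial>lborel)"
        by (intro Bochner_Integration.integral_cong refl) (simp add: abs_mult[symmetric] algebra_simps)
      also have "\<dots> = (\<integral>x. \<bar>indicator B x - P x\<bar> \<partial>M)"
        unfolding M_def by (rule integral_density[symmetric]) auto
      finally show ?thesis using P(2) by simp
    qed
    then have "\<bar>\<integral>y. indicator B y * u y \<partial>lborel\<bar> \<le> 0"
      by (metis field_le_epsilon add_0)
    then show ?thesis by simp
  qed
  have "AE y in lborel. indicator {y. 0 < u y} y * u y = 0"
    by (subst integral_nonneg_eq_0_iff_AE[symmetric])
      (use B0[of "{y. 0 < u y}"] integrable_mult_indicator[OF _ u, of "{y. 0 < u y}"] in \<open>auto split: split_indicator\<close>)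
  moreover have "AE y in lborel. - (indicator {y. u y < 0} y * u y) = 0"
    by (subst integral_nonneg_eq_0_iff_AE[symmetric])
      (use B0[of "{y. u y < 0}"] integrable_mult_indicator[OF _ u, of "{y. u y < 0}"] in \<open>auto split: split_indicator\<close>)
  ultimately show ?thesis
    by eventually_elim (auto split: split_indicator_asm)
qed

lemma ft_measurable:
  fixes f :: "'a::euclidean_space \<Rightarrow> complex"
  assumes [measurable]: "f \<in> borel_measurable borel"
  shows "ft f \<in> borel_measurable borel"
  unfolding ft_def[abs_def] by measurable

lemma norm_ft_le:
  fixes f :: "'a::euclidean_space \<Rightarrow> complex"
  shows "norm (ft f x) \<le> (\<integral>y. norm (f y) \<partial>lborel)"
  unfolding ft_def using integral_norm_bound[of lborel "\<lambda>y. f y * cis (2 * pi * (x \<bullet> y))"] by (simp add: norm_mult)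

lemma cnj_ft:
  fixes f :: "'a::euclidean_space \<Rightarrow> complex"
  shows "cnj (ft f x) = (\<integral>y. cnj (f y) * cis (- 2 * pi * (x \<bullet> y)) \<partial>lborel)"
  unfolding ft_def by (subst Bochner_Integration.integral_cnj[symmetric]) (simp only: complex_cnj_mult cis_cnj mult_minus_left)


section \<open>Covariance and spectral density\<close>

text \<open>The set where the functions differ is open, and a non-empty open set is not
  null.\<close>

lemma continuous_AE_eq:
  fixes f g :: "'a::euclidean_space \<Rightarrow> real"
  assumes f: "continuous_on UNIV f" and g: "continuous_on UNIV g" and ae: "AE x in lborel. f x = g x"
  shows "f x = g x"
proof (rule ccontr)
  let ?U = "{x. f x \<noteq> g x}"
  assume "f x \<noteq> g x"
  then have ne: "?U \<noteq> {}" by auto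
  have op: "open ?U" by (intro open_Collect_neq f g)
  have "emeasure lborel ?U = 0"
    by (rule AE_iff_measurable[THEN iffD1, OF _ _ ae]) (use op in auto)
  then have "?U \<in> null_sets lebesgue" using op by (intro null_sets_completionI) (auto simp: null_sets_def)
  then have "negligible ?U" by (simp add: negligible_iff_null_sets)
  then show False using open_not_negligible[OF op ne] by simp
qed

text \<open>Isolates the deterministic part: there is no probability space here, and of
  \<open>q\<close> only integrability, boundedness, continuity and evenness are kept.\<close>

locale spectral_kernel =
  fixes \<kappa> \<rho> q :: "real^2 \<Rightarrow> real" and b :: real
  assumes spectral: "spectral_density \<kappa> \<rho>"
    and transform: "fourier_L2 \<rho> (\<lambda>x. complex_of_real (q x))"
    and q_int: "integrable lborel q" and q_cont: "continuous_on UNIV q"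
    and q_bound: "\<And>x. \<bar>q x\<bar> \<le> b" and q_even: "\<And>x. q (- x) = q x"
    and \<kappa>_cont: "continuous_on UNIV \<kappa>" and \<kappa>_even: "\<And>x. \<kappa> (- x) = \<kappa> x"
begin

abbreviation "Q \<equiv> \<lambda>y. complex_of_real (q y)"

lemma q_measurable[measurable]: "q \<in> borel_measurable borel"
  by (rule borel_measurable_continuous_onI[OF q_cont])

lemma Q_int: "integrable lborel Q"
  using q_int by simp

lemma ft_Q_real: "ft Q x = complex_of_real (Re (ft Q x))"
proof -
  have "cnj (ft Q x) = (\<integral>y. Q (- y) * cis (2 * pi * (x \<bullet> (- y))) \<partial>lborel)"
    unfolding cnj_ft by (simp add: q_even)
  also have "\<dots> = ft Q x"
    unfolding ft_def by (rule lborel_integral_reflect) measurable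
  finally show ?thesis by (metis Reals_cnj_iff of_real_Re)
qed

lemma \<rho>_measurable[measurable]: "\<rho> \<in> borel_measurable borel"
  and \<rho>_sq: "integrable lborel (\<lambda>\<xi>. (\<rho> \<xi>)\<^sup>2)"
  using spectral by (auto simp: spectral_density_def)

lemma b_nonneg: "0 \<le> b"
  using q_bound[of 0] by linarith

lemma q_mult_bound: "\<bar>q y * q z\<bar> \<le> b * \<bar>q y\<bar>"
  unfolding abs_mult mult.commute[of b] by (intro mult_left_mono q_bound) simp

lemma gauss_int: "integrable lborel (gauss :: real^2 \<Rightarrow> real)"
  by (rule ft_gauss(2))

lemma gauss_complex_int: "integrable lborel (\<lambda>\<xi> :: real^2. complex_of_real (gauss \<xi>))"
  using gauss_int by (simp only: complex_of_real_integrable_eq)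

lemma gauss_shift_int: "integrable lborel (\<lambda>y :: real^2. gauss (y - a))"
  using lborel_integral_translation(2)[of "gauss :: real^2 \<Rightarrow> real" "-a"] gauss_int by simp

lemma \<rho>_gauss_int: "integrable lborel (\<lambda>\<xi>. \<rho> \<xi> * gauss \<xi>)"
proof (rule Bochner_Integration.integrable_bound)
  show "integrable lborel (\<lambda>\<xi>. (\<rho> \<xi>)\<^sup>2 + gauss \<xi>)" using \<rho>_sq gauss_int by auto
  show "AE \<xi> in lborel. norm (\<rho> \<xi> * gauss \<xi>) \<le> norm ((\<rho> \<xi>)\<^sup>2 + gauss \<xi>)"
  proof (rule AE_I2)
    fix \<xi>
    have "\<bar>\<rho> \<xi>\<bar> * gauss \<xi> \<le> (\<rho> \<xi>)\<^sup>2 + gauss \<xi>"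
    proof (cases "\<bar>\<rho> \<xi>\<bar> \<le> 1")
      case True
      then show ?thesis using gauss_pos[of \<xi>] by (intro add_increasing) (auto intro: mult_left_le_one_le)
    next
      case False
      have "\<bar>\<rho> \<xi>\<bar> * gauss \<xi> \<le> \<bar>\<rho> \<xi>\<bar> * 1" using gauss_le_1 by (intro mult_left_mono) auto
      also have "\<dots> \<le> \<bar>\<rho> \<xi>\<bar> * \<bar>\<rho> \<xi>\<bar>" using False by (intro mult_left_mono) auto
      finally show ?thesis using gauss_pos[of \<xi>] by (simp add: power2_eq_square add_increasing2)
    qed
    then show "norm (\<rho> \<xi> * gauss \<xi>) \<le> norm ((\<rho> \<xi>)\<^sup>2 + gauss \<xi>)"
      using gauss_pos[of \<xi>] by (simp add: abs_mult)
  qed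
qed measurable

text \<open>The product of \<open>\<rho>\<close> with a Gaussian is integrable. The multiplication
  formula for the truncations of \<open>\<rho>\<close> and a translated Gaussian passes to the
  limit: by domination on the side of \<open>\<rho>\<close>, and by the mean square convergence of
  the truncated transforms to \<open>q\<close> on the other.\<close>

lemma ft_\<rho>_gauss: "ft (\<lambda>\<xi>. complex_of_real (\<rho> \<xi> * gauss \<xi>)) a = (\<integral>y. Q y * complex_of_real (gauss (y - a)) \<partial>lborel)"
proof -
  define h :: "real^2 \<Rightarrow> complex" where "h y = complex_of_real (gauss (y - a))" for y
  have hm[measurable]: "h \<in> borel_measurable borel" unfolding h_def[abs_def] by measurable
  have h_int: "integrable lborel h" unfolding h_def[abs_def] using gauss_shift_int[of a] by simp
  have ft_h: "ft h x = cis (2 * pi * (x \<bullet> a)) * complex_of_real (gauss x)" for x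
    unfolding h_def[abs_def] by (subst ft_translate[of "\<lambda>y. complex_of_real (gauss y)"]) (auto simp: ft_gauss)
  define P where "P n \<xi> = complex_of_real (indicator (cball 0 (real n)) \<xi> * \<rho> \<xi>)" for n :: nat and \<xi>
  have P_int: "integrable lborel (P n)" for n
  proof (rule Bochner_Integration.integrable_bound)
    show "integrable lborel (\<lambda>\<xi> :: real^2. (\<rho> \<xi>)\<^sup>2 + indicator (cball 0 (real n)) \<xi>)"
      using \<rho>_sq emeasure_bounded_finite[OF bounded_cball, of "0 :: real^2" "real n"]
      by (intro Bochner_Integration.integrable_add integrable_real_indicator) auto
    show "AE \<xi> in lborel. norm (P n \<xi>) \<le> norm ((\<rho> \<xi>)\<^sup>2 + indicator (cball 0 (real n)) \<xi> :: real)"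
    proof (rule AE_I2)
      fix \<xi>
      have "\<bar>\<rho> \<xi>\<bar> \<le> (\<rho> \<xi>)\<^sup>2 + 1"
        using zero_le_power2[of "\<bar>\<rho> \<xi>\<bar> - 1"] by (simp add: power2_eq_square algebra_simps)
      then show "norm (P n \<xi>) \<le> norm ((\<rho> \<xi>)\<^sup>2 + indicator (cball 0 (real n)) \<xi> :: real)"
        by (simp add: P_def split: split_indicator)
    qed
  next
    have "(\<lambda>\<xi> :: real^2. indicator (cball 0 (real n)) \<xi> * \<rho> \<xi>) \<in> borel_measurable borel"
      by (intro borel_measurable_times borel_measurable_indicator \<rho>_measurable) auto
    then have "(\<lambda>\<xi>. complex_of_real (indicator (cball 0 (real n)) \<xi> * \<rho> \<xi>)) \<in> borel_measurable borel"
      by (rule measurable_compose) measurable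
    then show "P n \<in> borel_measurable lborel" by (simp add: P_def[abs_def] del: of_real_mult)
  qed
  have Pm[measurable]: "P n \<in> borel_measurable borel" for n using P_int[of n] by simp
  define D where "D n = (\<integral>\<^sup>+x. ennreal ((cmod (Q x - ft (P n) x))\<^sup>2) \<partial>lborel)" for n
  have ftm[measurable]: "ft (P n) \<in> borel_measurable borel" for n by (rule ft_measurable) measurable
  have D: "D \<longlonglongrightarrow> 0"
  proof -
    have "cmod (Q x - fourier (\<lambda>\<xi>. indicator (cball 0 (real n)) \<xi> * \<rho> \<xi>) x) = cmod (Q x - ft (P n) x)" for x n
    proof -
      \<comment> \<open>The two transforms differ by a conjugation, which the modulus ignores
        because \<open>q\<close> is real.\<close>
      have "fourier (\<lambda>\<xi>. indicator (cball 0 (real n)) \<xi> * \<rho> \<xi>) x = cnj (ft (P n) x)"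
        unfolding fourier_def cnj_ft P_def by (simp add: scaleR_conv_of_real)
      then have "Q x - fourier (\<lambda>\<xi>. indicator (cball 0 (real n)) \<xi> * \<rho> \<xi>) x = cnj (Q x - ft (P n) x)" by simp
      then show ?thesis by (metis complex_mod_cnj)
    qed
    then have "D = (\<lambda>R. \<integral>\<^sup>+ x. ennreal ((cmod (Q x - fourier (\<lambda>\<xi>. indicator (cball 0 R) \<xi> * \<rho> \<xi>) x))\<^sup>2) \<partial>lborel) \<circ> real"
      by (auto simp: D_def fun_eq_iff)
    moreover have "((\<lambda>R. \<integral>\<^sup>+ x. ennreal ((cmod (Q x - fourier (\<lambda>\<xi>. indicator (cball 0 R) \<xi> * \<rho> \<xi>) x))\<^sup>2) \<partial>lborel)
        \<longlongrightarrow> 0) (at_top :: real filter)"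
      using transform by (simp add: fourier_L2_def)
    ultimately show ?thesis
      using filterlim_compose[OF _ filterlim_real_sequentially] by (simp add: comp_def)
  qed
  have lim1: "(\<lambda>n. \<integral>x. P n x * ft h x \<partial>lborel) \<longlonglongrightarrow> (\<integral>x. complex_of_real (\<rho> x) * ft h x \<partial>lborel)"
  proof (rule integral_dominated_convergence[where w="\<lambda>x. \<bar>\<rho> x * gauss x\<bar>"])
    show "integrable lborel (\<lambda>x. \<bar>\<rho> x * gauss x\<bar>)" using \<rho>_gauss_int by simp
    show "AE x in lborel. (\<lambda>n. P n x * ft h x) \<longlonglongrightarrow> complex_of_real (\<rho> x) * ft h x"
    proof (rule AE_I2, rule tendsto_eventually)
      fix x :: "real^2"
      obtain n0 :: nat where "norm x < n0" using reals_Archimedean2 by blast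
      then show "eventually (\<lambda>n. P n x * ft h x = complex_of_real (\<rho> x) * ft h x) sequentially"
        by (intro eventually_sequentiallyI[of n0]) (auto simp: P_def split: split_indicator)
    qed
    show "AE x in lborel. norm (P n x * ft h x) \<le> \<bar>\<rho> x * gauss x\<bar>" for n
      by (rule AE_I2) (auto simp: P_def ft_h norm_mult abs_mult split: split_indicator)
    show "(\<lambda>x. P n x * ft h x) \<in> borel_measurable lborel" for n unfolding ft_h by measurable
    show "(\<lambda>x. complex_of_real (\<rho> x) * ft h x) \<in> borel_measurable lborel" unfolding ft_h by measurable
  qed
  have lim2: "(\<lambda>n. \<integral>y. ft (P n) y * h y \<partial>lborel) \<longlonglongrightarrow> (\<integral>y. Q y * h y \<partial>lborel)"
  proof (rule LIMSEQ_I)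
    fix e :: real assume e: "0 < e"
    define G where "G = (\<integral>y. gauss (y - a) \<partial>lborel)"
    have G0: "0 \<le> G" unfolding G_def by (intro integral_nonneg_AE AE_I2 less_imp_le gauss_pos)
    define \<eta> where "\<eta> = e / (2 * (G + 1))"
    have \<eta>: "0 < \<eta>" "\<eta> * G < e / 2" using e G0 by (auto simp: \<eta>_def field_simps)
    have "eventually (\<lambda>n. D n < ennreal (\<eta> * (e / 2))) sequentially"
      using \<eta> e by (intro order_tendstoD[OF D]) auto
    then obtain n0 where n0: "\<And>n. n0 \<le> n \<Longrightarrow> D n < ennreal (\<eta> * (e / 2))" by (auto simp: eventually_sequentially)
    show "\<exists>no. \<forall>n\<ge>no. norm ((\<integral>y. ft (P n) y * h y \<partial>lborel) - (\<integral>y. Q y * h y \<partial>lborel)) < e"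
    proof (intro exI allI impI)
      fix n assume n: "n0 \<le> n"
      have i1: "integrable lborel (\<lambda>y. ft (P n) y * h y)"
      proof (rule Bochner_Integration.integrable_bound)
        show "integrable lborel (\<lambda>y. (\<integral>y. norm (P n y) \<partial>lborel) * norm (h y))" using h_int by simp
        show "AE y in lborel. norm (ft (P n) y * h y) \<le> norm ((\<integral>y. norm (P n y) \<partial>lborel) * norm (h y))"
          by (rule AE_I2) (use norm_ft_le in \<open>auto simp: norm_mult abs_mult intro!: mult_right_mono order_trans[OF _ abs_ge_self]\<close>)
      qed measurable
      have i2: "integrable lborel (\<lambda>y. Q y * h y)"
      proof (rule Bochner_Integration.integrable_bound)
        show "integrable lborel (\<lambda>y. b * norm (h y))" using h_int by simp
        show "AE y in lborel. norm (Q y * h y) \<le> norm (b * norm (h y))"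
          by (rule AE_I2) (use q_bound in \<open>auto simp: norm_mult abs_mult intro!: mult_right_mono order_trans[OF _ abs_ge_self]\<close>)
      qed measurable
      have "ennreal (norm ((\<integral>y. ft (P n) y * h y \<partial>lborel) - (\<integral>y. Q y * h y \<partial>lborel)))
         = ennreal (norm (\<integral>y. ft (P n) y * h y - Q y * h y \<partial>lborel))"
        using i1 i2 by simp
      also have "\<dots> \<le> (\<integral>\<^sup>+y. norm (ft (P n) y * h y - Q y * h y) \<partial>lborel)"
        using i1 i2 by (intro integral_norm_bound_ennreal) auto
      also have "\<dots> \<le> (\<integral>\<^sup>+y. ennreal \<eta> * ennreal (gauss (y - a)) + ennreal (1 / \<eta>) * ennreal ((cmod (Q y - ft (P n) y))\<^sup>2) \<partial>lborel)"
      proof (rule nn_integral_mono)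
        fix y
        let ?d = "cmod (Q y - ft (P n) y)" let ?g = "gauss (y - a)"
        have "norm (ft (P n) y * h y - Q y * h y) = ?d * ?g"
          using gauss_pos[of "y - a"]
          by (simp add: h_def norm_mult[symmetric] norm_minus_commute[of "Q y"] left_diff_distrib[symmetric])
             (simp add: norm_mult)
        \<comment> \<open>This weighted inequality stands in for Cauchy-Schwarz: either
          \<open>?d \<le> \<eta>\<close>, or \<open>?g \<le> 1\<close> and
          \<open>?d \<le> ?d\<^sup>2 / \<eta>\<close>.\<close>
        also have "?d * ?g \<le> \<eta> * ?g + 1 / \<eta> * ?d\<^sup>2"
        proof (cases "?d \<le> \<eta>")
          case True
          then show ?thesis using gauss_pos[of "y - a"] \<eta>(1)
            by (intro add_increasing2 mult_right_mono) auto
        next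
          case False
          have "?d * ?g \<le> ?d * 1" using gauss_le_1 by (intro mult_left_mono) auto
          also have "\<dots> \<le> ?d * (?d / \<eta>)" using False \<eta>(1) by (intro mult_left_mono) auto
          finally show ?thesis using gauss_pos[of "y - a"] \<eta>(1)
            by (intro add_increasing) (auto simp: power2_eq_square)
        qed
        finally have "norm (ft (P n) y * h y - Q y * h y) \<le> \<eta> * ?g + 1 / \<eta> * ?d\<^sup>2" .
        then have "ennreal (norm (ft (P n) y * h y - Q y * h y)) \<le> ennreal (\<eta> * ?g + 1 / \<eta> * ?d\<^sup>2)" by (rule ennreal_leI)
        also have "\<dots> = ennreal \<eta> * ennreal ?g + ennreal (1 / \<eta>) * ennreal (?d\<^sup>2)"
        proof -
          have "ennreal \<eta> * ennreal ?g = ennreal (\<eta> * ?g)"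
            by (rule ennreal_mult[symmetric]) (use \<eta>(1) less_imp_le[OF gauss_pos] in simp_all)
          moreover have "ennreal (1 / \<eta>) * ennreal (?d\<^sup>2) = ennreal (1 / \<eta> * ?d\<^sup>2)"
            by (rule ennreal_mult[symmetric]) (use \<eta>(1) in simp_all)
          ultimately show ?thesis
            using \<eta>(1) less_imp_le[OF gauss_pos[of "y - a"]] by (simp only:) (rule ennreal_plus, auto)
        qed
        finally show "ennreal (norm (ft (P n) y * h y - Q y * h y)) \<le> ennreal \<eta> * ennreal ?g + ennreal (1 / \<eta>) * ennreal (?d\<^sup>2)" .
      qed
      also have "\<dots> = ennreal \<eta> * ennreal G + ennreal (1 / \<eta>) * D n"
      proof -
        have "(\<integral>\<^sup>+y. ennreal (gauss (y - a)) \<partial>lborel) = ennreal G"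
          unfolding G_def using gauss_shift_int by (rule nn_integral_eq_integral) (simp add: less_imp_le gauss_pos)
        then show ?thesis unfolding D_def by (simp add: nn_integral_add nn_integral_cmult)
      qed
      also have "\<dots> \<le> ennreal \<eta> * ennreal G + ennreal (1 / \<eta>) * ennreal (\<eta> * (e / 2))"
        using n0[OF n] by (intro add_left_mono mult_left_mono) auto
      also have "\<dots> = ennreal (\<eta> * G + e / 2)"
        using \<eta> G0 e by (simp add: ennreal_mult'[symmetric] ennreal_plus[symmetric] del: ennreal_plus)
      finally have "norm ((\<integral>y. ft (P n) y * h y \<partial>lborel) - (\<integral>y. Q y * h y \<partial>lborel)) \<le> \<eta> * G + e / 2"
        using \<eta> G0 e by (subst (asm) ennreal_le_iff) auto
      then show "norm ((\<integral>y. ft (P n) y * h y \<partial>lborel) - (\<integral>y. Q y * h y \<partial>lborel)) < e" using \<eta> by simp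
    qed
  qed
  have "(\<lambda>n. \<integral>x. P n x * ft h x \<partial>lborel) \<longlonglongrightarrow> (\<integral>y. Q y * h y \<partial>lborel)"
    unfolding ft_multiplication[OF P_int h_int] by (rule lim2)
  then have "(\<integral>x. complex_of_real (\<rho> x) * ft h x \<partial>lborel) = (\<integral>y. Q y * h y \<partial>lborel)"
    using lim1 by (rule LIMSEQ_unique[rotated])
  then show ?thesis unfolding ft_h by (simp add: ft_def h_def mult_ac inner_commute)
qed

lemma ft_Q_bound: "norm (ft Q x) \<le> (\<integral>y. \<bar>q y\<bar> \<partial>lborel)"
  using norm_ft_le[of Q x] by simp

lemma ft_Q_times_int:
  assumes g: "integrable lborel g"
  shows "integrable lborel (\<lambda>\<xi>. ft Q \<xi> * g \<xi>)"
proof (rule Bochner_Integration.integrable_bound)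
  have [measurable]: "g \<in> borel_measurable borel" using g by simp
  have [measurable]: "ft Q \<in> borel_measurable borel" by (rule ft_measurable) measurable
  show "integrable lborel (\<lambda>\<xi>. (\<integral>y. \<bar>q y\<bar> \<partial>lborel) * norm (g \<xi>))" using g by simp
  show "AE \<xi> in lborel. norm (ft Q \<xi> * g \<xi>) \<le> norm ((\<integral>y. \<bar>q y\<bar> \<partial>lborel) * norm (g \<xi>))"
    by (rule AE_I2) (use ft_Q_bound in \<open>auto simp: norm_mult abs_mult intro!: mult_right_mono order_trans[OF _ abs_ge_self]\<close>)
  show "(\<lambda>\<xi>. ft Q \<xi> * g \<xi>) \<in> borel_measurable lborel" by measurable
qed

text \<open>Fourier inversion in disguise: multiplied by the Gaussian, both functions are integrable
  and have the same transform, so they agree almost everywhere. Evenness of \<open>q\<close> absorbs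
  the change of sign.\<close>

lemma \<rho>_eq: "AE \<xi> in lborel. \<rho> \<xi> = Re (ft Q \<xi>)"
proof -
  have [measurable]: "ft Q \<in> borel_measurable borel" by (rule ft_measurable) measurable
  note G_int = gauss_complex_int
  let ?u = "\<lambda>\<xi>. \<rho> \<xi> * gauss \<xi> - Re (ft Q \<xi>) * gauss \<xi>"
  have QG: "integrable lborel (\<lambda>\<xi>. ft Q \<xi> * complex_of_real (gauss \<xi>))" by (rule ft_Q_times_int[OF G_int])
  have QGr: "ft Q \<xi> * complex_of_real (gauss \<xi>) = complex_of_real (Re (ft Q \<xi>) * gauss \<xi>)" for \<xi>
    using ft_Q_real[of \<xi>] by (metis of_real_mult)
  have i2: "integrable lborel (\<lambda>\<xi>. Re (ft Q \<xi>) * gauss \<xi>)"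
    using QG unfolding QGr by (simp only: complex_of_real_integrable_eq)
  have "AE \<xi> in lborel. ?u \<xi> = 0"
  proof (rule ft_eq_0_imp_AE_0)
    show "integrable lborel ?u" using \<rho>_gauss_int i2 by simp
    fix a :: "real^2"
    define H where "H \<xi> = complex_of_real (gauss \<xi>) * cis (2 * pi * (a \<bullet> \<xi>))" for \<xi>
    have H_int: "integrable lborel H" unfolding H_def[abs_def] by (rule integrable_times_cis[OF G_int]) measurable
    have "ft (\<lambda>\<xi>. complex_of_real (Re (ft Q \<xi>) * gauss \<xi>)) a = (\<integral>\<xi>. ft Q \<xi> * H \<xi> \<partial>lborel)"
      unfolding ft_def[of _ a] QGr[symmetric] H_def by (simp add: mult.assoc)
    also have "\<dots> = (\<integral>y. Q y * ft H y \<partial>lborel)" by (rule ft_multiplication[OF Q_int H_int, symmetric])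
    also have "\<dots> = (\<integral>y. Q y * complex_of_real (gauss (y + a)) \<partial>lborel)"
      unfolding H_def[abs_def] ft_modulate ft_gauss ..
    also have "\<dots> = (\<integral>y. Q (- y) * complex_of_real (gauss (- y + a)) \<partial>lborel)"
      by (rule lborel_integral_reflect[symmetric]) measurable
    also have "\<dots> = (\<integral>y. Q y * complex_of_real (gauss (y - a)) \<partial>lborel)"
      using gauss_uminus[of "y - a" for y] by (simp add: q_even)
    finally have e: "ft (\<lambda>\<xi>. complex_of_real (Re (ft Q \<xi>) * gauss \<xi>)) a = ft (\<lambda>\<xi>. complex_of_real (\<rho> \<xi> * gauss \<xi>)) a"
      unfolding ft_\<rho>_gauss .
    have "ft (\<lambda>\<xi>. complex_of_real (?u \<xi>)) a =
      (\<integral>\<xi>. complex_of_real (\<rho> \<xi> * gauss \<xi>) * cis (2 * pi * (a \<bullet> \<xi>)) - complex_of_real (Re (ft Q \<xi>) * gauss \<xi>) * cis (2 * pi * (a \<bullet> \<xi>)) \<partial>lborel)"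
      unfolding ft_def by (simp only: of_real_diff left_diff_distrib)
    also have "\<dots> = ft (\<lambda>\<xi>. complex_of_real (\<rho> \<xi> * gauss \<xi>)) a - ft (\<lambda>\<xi>. complex_of_real (Re (ft Q \<xi>) * gauss \<xi>)) a"
      unfolding ft_def[of _ a]
      by (intro Bochner_Integration.integral_diff integrable_times_cis)
        (use \<rho>_gauss_int i2 in \<open>simp_all only: complex_of_real_integrable_eq\<close>, measurable)
    finally show "ft (\<lambda>\<xi>. complex_of_real (?u \<xi>)) a = 0" unfolding e by simp
  qed
  then show ?thesis
  proof eventually_elim
    case (elim \<xi>)
    then show ?case using gauss_pos[of \<xi>] by (simp add: left_diff_distrib[symmetric])
  qed
qed

section \<open>The covariance as a convolution square\<close>

definition autoconv :: "real^2 \<Rightarrow> real" where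
  "autoconv x = (\<integral>y. q y * q (x - y) \<partial>lborel)"

lemma autoconv_integrand_int: "integrable lborel (\<lambda>y. q y * q (x - y))"
proof (rule Bochner_Integration.integrable_bound)
  show "integrable lborel (\<lambda>y. b * \<bar>q y\<bar>)" using q_int by simp
  show "AE y in lborel. norm (q y * q (x - y)) \<le> norm (b * \<bar>q y\<bar>)"
    using q_mult_bound b_nonneg by (intro AE_I2) (simp add: abs_mult)
qed measurable

lemma autoconv_tendsto:
  assumes "\<And>y. (\<lambda>n. q (X n - y)) \<longlonglongrightarrow> l y" "l \<in> borel_measurable borel"
  shows "(\<lambda>n. autoconv (X n)) \<longlonglongrightarrow> (\<integral>y. q y * l y \<partial>lborel)"
  unfolding autoconv_def
proof (rule integral_dominated_convergence[where w="\<lambda>y. b * \<bar>q y\<bar>"])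
  show "integrable lborel (\<lambda>y. b * \<bar>q y\<bar>)" using q_int by simp
  show "AE y in lborel. norm (q y * q (X n - y)) \<le> b * \<bar>q y\<bar>" for n
    using q_mult_bound by (intro AE_I2) simp
  show "AE y in lborel. (\<lambda>n. q y * q (X n - y)) \<longlonglongrightarrow> q y * l y"
    by (intro AE_I2 tendsto_mult tendsto_const assms)
qed (use assms(2) in measurable)

lemma q_tendsto: "(X \<longlongrightarrow> x) F \<Longrightarrow> ((\<lambda>n. q (X n)) \<longlongrightarrow> q x) F"
  using q_cont by (metis continuous_on_tendsto_compose UNIV_I eventually_True iso_tuple_UNIV_I always_eventually)

lemma autoconv_continuous: "continuous_on UNIV autoconv"
  unfolding continuous_on_sequentially
proof (intro allI ballI impI, elim conjE)
  fix X :: "nat \<Rightarrow> real^2" and x assume "X \<longlonglongrightarrow> x"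
  then have "(\<lambda>n. autoconv (X n)) \<longlonglongrightarrow> (\<integral>y. q y * q (x - y) \<partial>lborel)"
    by (intro autoconv_tendsto q_tendsto tendsto_diff tendsto_const) measurable
  then show "(autoconv \<circ> X) \<longlonglongrightarrow> autoconv x" by (simp add: comp_def autoconv_def)
qed

lemma autoconv_bound: "\<bar>autoconv x\<bar> \<le> b * (\<integral>y. \<bar>q y\<bar> \<partial>lborel)"
proof -
  have "\<bar>autoconv x\<bar> \<le> (\<integral>y. \<bar>q y * q (x - y)\<bar> \<partial>lborel)" unfolding autoconv_def by (rule integral_abs_bound)
  also have "\<dots> \<le> (\<integral>y. b * \<bar>q y\<bar> \<partial>lborel)"
    by (rule integral_mono) (use autoconv_integrand_int q_int q_mult_bound in auto)
  finally show ?thesis by simp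
qed

text \<open>Both functions are continuous, so agreement almost everywhere suffices; after
  multiplication by the Gaussian it follows from equality of transforms. The multiplication formula
  replaces \<open>\<kappa>\<close> by the squared spectral density, that by the square of the
  transform of \<open>q\<close>, and that by the convolution.\<close>

theorem \<kappa>_eq_autoconv: "\<kappa> x = autoconv x"
proof -
  have [measurable]: "ft Q \<in> borel_measurable borel" by (rule ft_measurable) measurable
  have [measurable]: "\<kappa> \<in> borel_measurable borel" by (rule borel_measurable_continuous_onI[OF \<kappa>_cont])
  have [measurable]: "autoconv \<in> borel_measurable borel" by (rule borel_measurable_continuous_onI[OF autoconv_continuous])
  note G_int = gauss_complex_int
  define w where "w \<xi> = complex_of_real ((\<rho> \<xi>)\<^sup>2)" for \<xi>
  have w_int: "integrable lborel w" unfolding w_def[abs_def] using \<rho>_sq by (simp only: complex_of_real_integrable_eq)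
  have \<kappa>_ft: "complex_of_real (\<kappa> x) = ft w x" for x
  proof -
    have "complex_of_real (\<kappa> x) = (\<integral>\<xi>. cis (- 2 * pi * (x \<bullet> \<xi>)) \<partial>density lborel (\<lambda>\<xi>. ennreal ((\<rho> \<xi>)\<^sup>2)))"
      using spectral by (simp add: spectral_density_def fourier_measure_def)
    also have "\<dots> = (\<integral>\<xi>. (\<rho> \<xi>)\<^sup>2 *\<^sub>R cis (- 2 * pi * (x \<bullet> \<xi>)) \<partial>lborel)"
      by (rule integral_density) auto
    also have "\<dots> = cnj (ft w x)" unfolding cnj_ft by (simp add: w_def scaleR_conv_of_real)
    finally show ?thesis by (metis complex_cnj_cnj complex_cnj_complex_of_real)
  qed
  have \<kappa>_bound: "\<bar>\<kappa> x\<bar> \<le> (\<integral>\<xi>. norm (w \<xi>) \<partial>lborel)" for x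
    using norm_ft_le[of w x] unfolding \<kappa>_ft[symmetric] by simp
  have bd_int: "integrable lborel (\<lambda>x. u x * gauss x)" if "u \<in> borel_measurable borel" "\<And>x. \<bar>u x\<bar> \<le> c" for u :: "real^2 \<Rightarrow> real" and c
  proof (rule Bochner_Integration.integrable_bound)
    show "integrable lborel (\<lambda>x :: real^2. c * gauss x)" using gauss_int by simp
    show "AE x in lborel. norm (u x * gauss x) \<le> norm (c * gauss x)"
      by (rule AE_I2) (use that(2) less_imp_le[OF gauss_pos] in \<open>auto simp: abs_mult intro!: mult_right_mono order_trans[OF _ abs_ge_self]\<close>)
  qed (use that(1) in measurable)
  have i\<kappa>: "integrable lborel (\<lambda>x. \<kappa> x * gauss x)" by (rule bd_int[OF _ \<kappa>_bound]) measurable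
  have ia: "integrable lborel (\<lambda>x. autoconv x * gauss x)" by (rule bd_int[OF _ autoconv_bound]) measurable
  have key: "ft (\<lambda>x. complex_of_real (\<kappa> x * gauss x)) a = ft (\<lambda>x. complex_of_real (autoconv x * gauss x)) a" for a
  proof -
    define H where "H \<xi> = complex_of_real (gauss \<xi>) * cis (2 * pi * ((- a) \<bullet> \<xi>))" for \<xi> :: "real^2"
    have [measurable]: "H \<in> borel_measurable borel" unfolding H_def[abs_def] by measurable
    have H_int: "integrable lborel H" unfolding H_def[abs_def] by (rule integrable_times_cis[OF G_int]) measurable
    have nH: "norm (H x) = gauss x" for x using gauss_pos[of x] by (simp add: H_def norm_mult)
    define g where "g \<xi> = complex_of_real (gauss (\<xi> - a))" for \<xi> :: "real^2"
    have [measurable]: "g \<in> borel_measurable borel" unfolding g_def[abs_def] by measurable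
    have g_int: "integrable lborel g" unfolding g_def[abs_def] using gauss_shift_int by (simp only: complex_of_real_integrable_eq)
    have gc_int: "integrable lborel (\<lambda>\<xi>. g \<xi> * cis (2 * pi * (y \<bullet> \<xi>)))" for y
      by (rule integrable_times_cis[OF g_int]) measurable
    define H' where "H' x = cis (2 * pi * (x \<bullet> a)) * complex_of_real (gauss x)" for x :: "real^2"
    have [measurable]: "H' \<in> borel_measurable borel" unfolding H'_def[abs_def] by measurable
    have nH': "norm (H' x) = gauss x" for x using gauss_pos[of x] by (simp add: H'_def norm_mult)
    \<comment> \<open>Reflection turns the character of \<open>a\<close> into that of
      \<open>- a\<close>, so that the transform of \<open>H\<close> is the Gaussian centred at
      \<open>a\<close>.\<close>
    have "ft (\<lambda>x. complex_of_real (\<kappa> x * gauss x)) a = (\<integral>x. complex_of_real (\<kappa> (- x) * gauss (- x)) * cis (2 * pi * (a \<bullet> (- x))) \<partial>lborel)"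
      unfolding ft_def by (rule lborel_integral_reflect[symmetric]) measurable
    also have "\<dots> = (\<integral>x. ft w x * H x \<partial>lborel)"
      unfolding \<kappa>_ft[symmetric] by (simp add: \<kappa>_even gauss_uminus H_def mult.assoc)
    also have "\<dots> = (\<integral>\<xi>. w \<xi> * ft H \<xi> \<partial>lborel)" by (rule ft_multiplication[OF w_int H_int, symmetric])
    also have "\<dots> = (\<integral>\<xi>. w \<xi> * g \<xi> \<partial>lborel)"
      unfolding H_def[abs_def] ft_modulate ft_gauss g_def by simp
    also have "\<dots> = (\<integral>\<xi>. ft Q \<xi> * (ft Q \<xi> * g \<xi>) \<partial>lborel)"
    proof (rule integral_cong_AE)
      show "AE \<xi> in lborel. w \<xi> * g \<xi> = ft Q \<xi> * (ft Q \<xi> * g \<xi>)"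
        using \<rho>_eq
      proof eventually_elim
        case (elim \<xi>)
        have "w \<xi> = ft Q \<xi> * ft Q \<xi>"
          using elim ft_Q_real[of \<xi>] by (simp add: w_def power2_eq_square)
        then show ?case by simp
      qed
    qed (unfold w_def[abs_def], measurable)
    \<comment> \<open>The two factors \<open>ft Q\<close> are removed one after the other, each by
      the multiplication formula.\<close>
    also have "\<dots> = (\<integral>y. Q y * ft (\<lambda>\<xi>. ft Q \<xi> * g \<xi>) y \<partial>lborel)"
      by (rule ft_multiplication[OF Q_int ft_Q_times_int[OF g_int], symmetric])
    also have "\<dots> = (\<integral>y. Q y * (\<integral>x. Q (x - y) * H' x \<partial>lborel) \<partial>lborel)"
    proof (rule Bochner_Integration.integral_cong[OF refl])
      fix y
      have "ft (\<lambda>\<xi>. ft Q \<xi> * g \<xi>) y = (\<integral>\<xi>. ft Q \<xi> * (g \<xi> * cis (2 * pi * (y \<bullet> \<xi>))) \<partial>lborel)"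
        unfolding ft_def[of _ y] by (simp add: mult.assoc)
      also have "\<dots> = (\<integral>z. Q z * ft (\<lambda>\<xi>. g \<xi> * cis (2 * pi * (y \<bullet> \<xi>))) z \<partial>lborel)"
        by (rule ft_multiplication[OF Q_int gc_int, symmetric])
      also have "\<dots> = (\<integral>z. Q z * H' (z + y) \<partial>lborel)"
        unfolding ft_modulate g_def[abs_def] H'_def
        by (subst ft_translate[of "\<lambda>\<xi>. complex_of_real (gauss \<xi>)"]) (simp_all add: ft_gauss)
      also have "\<dots> = (\<integral>x. Q (- y + x) * H' ((- y + x) + y) \<partial>lborel)"
        by (rule lborel_integral_translation(1)[symmetric]) measurable
      also have "\<dots> = (\<integral>x. Q (x - y) * H' x \<partial>lborel)" by simp
      finally show "Q y * ft (\<lambda>\<xi>. ft Q \<xi> * g \<xi>) y = Q y * (\<integral>x. Q (x - y) * H' x \<partial>lborel)" by simp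
    qed
    also have "\<dots> = (\<integral>y. (\<integral>x. Q y * (Q (x - y) * H' x) \<partial>lborel) \<partial>lborel)" by simp
    also have "\<dots> = (\<integral>x. (\<integral>y. Q y * (Q (x - y) * H' x) \<partial>lborel) \<partial>lborel)"
    proof (rule lborel_pair.Fubini_integral[symmetric], rule integrable_pair_bound)
      show "integrable lborel (\<lambda>y. \<bar>q y\<bar>)" using q_int by simp
      show "integrable lborel (\<lambda>x :: real^2. b * gauss x)" using gauss_int by simp
      show "(\<lambda>(y, x). Q y * (Q (x - y) * H' x)) \<in> borel_measurable borel"
        unfolding borel_prod[symmetric] by measurable
      show "norm (case (y, x) of (y, x) \<Rightarrow> Q y * (Q (x - y) * H' x)) \<le> \<bar>q y\<bar> * (b * gauss x)" for y x
        using q_bound[of "x - y"] gauss_pos[of x] by (auto simp: norm_mult nH' intro!: mult_left_mono mult_right_mono)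
    qed
    also have "\<dots> = (\<integral>x. (\<integral>y. complex_of_real (q y * q (x - y)) \<partial>lborel) * H' x \<partial>lborel)"
      by (simp add: mult.assoc[symmetric])
    also have "\<dots> = (\<integral>x. complex_of_real (autoconv x) * H' x \<partial>lborel)"
      unfolding autoconv_def by (simp only: integral_complex_of_real)
    also have "\<dots> = ft (\<lambda>x. complex_of_real (autoconv x * gauss x)) a"
      unfolding ft_def H'_def by (simp add: mult_ac inner_commute)
    finally show ?thesis .
  qed
  have "AE x in lborel. \<kappa> x * gauss x - autoconv x * gauss x = 0"
  proof (rule ft_eq_0_imp_AE_0)
    show "integrable lborel (\<lambda>x. \<kappa> x * gauss x - autoconv x * gauss x)" using i\<kappa> ia by simp
    fix a
    have "ft (\<lambda>x. complex_of_real (\<kappa> x * gauss x - autoconv x * gauss x)) a =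
      (\<integral>x. complex_of_real (\<kappa> x * gauss x) * cis (2 * pi * (a \<bullet> x)) - complex_of_real (autoconv x * gauss x) * cis (2 * pi * (a \<bullet> x)) \<partial>lborel)"
      unfolding ft_def by (simp only: of_real_diff left_diff_distrib)
    also have "\<dots> = ft (\<lambda>x. complex_of_real (\<kappa> x * gauss x)) a - ft (\<lambda>x. complex_of_real (autoconv x * gauss x)) a"
      unfolding ft_def
      by (intro Bochner_Integration.integral_diff integrable_times_cis)
        (use i\<kappa> ia in \<open>simp_all only: complex_of_real_integrable_eq\<close>, measurable)
    finally show "ft (\<lambda>x. complex_of_real (\<kappa> x * gauss x - autoconv x * gauss x)) a = 0" unfolding key by simp
  qed
  then have "AE x in lborel. \<kappa> x = autoconv x"
  proof eventually_elim
    case (elim x)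
    then show ?case using gauss_pos[of x] by (simp add: left_diff_distrib[symmetric])
  qed
  then show ?thesis by (rule continuous_AE_eq[OF \<kappa>_cont autoconv_continuous])
qed

text \<open>The convolution is rewritten, using evenness, as the inner product of two translates of
  \<open>q\<close>. This is the covariance that \<open>q\<close> convolved with white noise would
  have.\<close>

lemma \<kappa>_diff: "\<kappa> (x - x') = (\<integral>y. q (x - y) * q (x' - y) \<partial>lborel)"
  and \<kappa>_diff_integrable: "integrable lborel (\<lambda>y. q (x - y) * q (x' - y))"
proof -
  have e: "q (- x' + y) * q (x - x' - (- x' + y)) = q (x - y) * q (x' - y)" for y
    using q_even[of "x' - y"] by simp
  show "integrable lborel (\<lambda>y. q (x - y) * q (x' - y))"
    using lborel_integral_translation(2)[of "\<lambda>y. q y * q (x - x' - y)" "- x'"] autoconv_integrand_int[of "x - x'"]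
    unfolding e by simp
  show "\<kappa> (x - x') = (\<integral>y. q (x - y) * q (x' - y) \<partial>lborel)"
    using lborel_integral_translation(1)[of "\<lambda>y. q y * q (x - x' - y)" "- x'"]
    unfolding e \<kappa>_eq_autoconv autoconv_def by simp
qed

text \<open>Dominated convergence: for each fixed \<open>y\<close> the argument of the second factor
  of the convolution tends to infinity.\<close>

lemma \<kappa>_decay:
  assumes q0: "(q \<longlongrightarrow> 0) at_infinity" and v: "v \<noteq> 0"
  shows "(\<lambda>n. \<kappa> (w + real n *\<^sub>R v)) \<longlonglongrightarrow> 0"
proof -
  have *: "(\<lambda>n. q (real n *\<^sub>R v - y)) \<longlonglongrightarrow> 0" for y
  proof (rule filterlim_compose[OF q0])
    have "filterlim (\<lambda>n. norm v * real n - norm y) at_top sequentially"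
      using filterlim_tendsto_add_at_top[OF tendsto_const[of "- norm y"]
          filterlim_tendsto_pos_mult_at_top[OF tendsto_const _ filterlim_real_sequentially, of "norm v"]] v
      by simp
    then have "filterlim (\<lambda>n. norm (real n *\<^sub>R v - y)) at_top sequentially"
    proof (rule filterlim_at_top_mono)
      show "eventually (\<lambda>n. norm v * real n - norm y \<le> norm (real n *\<^sub>R v - y)) sequentially"
        by (intro always_eventually allI) (use norm_triangle_ineq2[of "real _ *\<^sub>R v" y] in \<open>simp add: mult.commute\<close>)
    qed
    then show "filterlim (\<lambda>n. real n *\<^sub>R v - y) at_infinity sequentially"
      by (rule filterlim_norm_at_top_imp_at_infinity)
  qed
  have "(\<lambda>n. q (w + real n *\<^sub>R v - y)) \<longlonglongrightarrow> 0" for y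
    using *[of "y - w"] by (simp add: algebra_simps)
  from autoconv_tendsto[OF this] show ?thesis by (simp add: \<kappa>_eq_autoconv)
qed

end


section \<open>Localised functionals of the field\<close>

text \<open>A product of one-variable functions, so that its integral and its lattice sums factor.
  It dominates the stretched exponential of the decay condition, but unlike it changes only by a
  bounded factor under bounded shifts, whatever the exponent \<open>\<beta>\<close>.\<close>

definition envelope :: "real^2 \<Rightarrow> real" where
  "envelope x = 1 / ((1 + (x $ 1)\<^sup>2) * (1 + (x $ 2)\<^sup>2))"

lemma envelope_pos: "0 < envelope x"
  unfolding envelope_def by (intro divide_pos_pos mult_pos_pos add_pos_nonneg) auto

lemma envelope_uminus: "envelope (- x) = envelope x"
  by (simp add: envelope_def)

lemma envelope_measurable[measurable]: "envelope \<in> borel_measurable borel"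
  unfolding envelope_def[abs_def]
  by (intro borel_measurable_continuous_onI continuous_intros) (simp add: add_nonneg_eq_0_iff)

text \<open>From \<open>v\<^sup>2 \<le> 2 * u\<^sup>2 + 2 * 16\<close> follows
  \<open>1 + v\<^sup>2 \<le> 33 + 2 * u\<^sup>2\<close>, which is at most 34 times
  \<open>1 + u\<^sup>2\<close>.\<close>

lemma inverse_quadratic_shift:
  fixes u v :: real
  assumes "\<bar>u - v\<bar> \<le> 4"
  shows "1 / (1 + u\<^sup>2) \<le> 34 / (1 + v\<^sup>2)"
proof -
  have "v\<^sup>2 \<le> 2 * u\<^sup>2 + 2 * (u - v)\<^sup>2"
    using zero_le_power2[of "2 * u - v"] by (simp add: power2_eq_square algebra_simps)
  moreover have "(u - v)\<^sup>2 \<le> 4\<^sup>2" using assms by (metis abs_le_square_iff abs_numeral)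
  then have "(u - v)\<^sup>2 \<le> 16" by simp
  moreover have "c \<le> 2 * a + 2 * b \<Longrightarrow> b \<le> 16 \<Longrightarrow> 0 \<le> a \<Longrightarrow> 1 + c \<le> 34 * (1 + a)" for a b c :: real by simp
  ultimately have "1 + v\<^sup>2 \<le> 34 * (1 + u\<^sup>2)" using zero_le_power2[of u] by blast
  moreover have "0 < 1 + u\<^sup>2" "0 < 1 + v\<^sup>2" by (auto intro: add_pos_nonneg)
  ultimately show ?thesis by (simp add: field_simps)
qed

text \<open>\<open>1156 = 34 * 34\<close>, one factor for each coordinate.\<close>

lemma envelope_shift:
  assumes "\<And>i. \<bar>x $ i - y $ i\<bar> \<le> 4"
  shows "envelope x \<le> 1156 * envelope y"
proof -
  have "envelope x = 1 / (1 + (x $ 1)\<^sup>2) * (1 / (1 + (x $ 2)\<^sup>2))" by (simp add: envelope_def)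
  also have "\<dots> \<le> 34 / (1 + (y $ 1)\<^sup>2) * (34 / (1 + (y $ 2)\<^sup>2))"
    by (intro mult_mono inverse_quadratic_shift assms divide_nonneg_nonneg) auto
  also have "\<dots> = 1156 * envelope y" by (simp add: envelope_def)
  finally show ?thesis .
qed

lemma prod_Basis_real2: "(\<Prod>b\<in>Basis. F b) = F (axis 1 1) * F (axis 2 (1 :: real) :: real^2)"
proof -
  have B: "Basis = {axis 1 1, axis 2 (1 :: real) :: real^2}"
    by (auto simp: Basis_vec_def UNIV_2)
  have "axis 1 1 \<noteq> (axis 2 1 :: real^2)" by (simp add: axis_eq_axis)
  then show ?thesis unfolding B by simp
qed

lemma envelope_int: "integrable lborel envelope"
proof (rule integrableI_nonneg)
  have i: "integrable lborel (\<lambda>u :: real. 1 / (1 + u\<^sup>2))"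
    using integrable_inverse_1_plus_square by (simp add: set_integrable_def inverse_eq_divide)
  have "(\<integral>\<^sup>+x. ennreal (envelope x) \<partial>lborel) = (\<integral>\<^sup>+(x :: real^2). (\<Prod>b\<in>Basis. ennreal (1 / (1 + (x \<bullet> b)\<^sup>2))) \<partial>lborel)"
  proof (rule nn_integral_cong)
    fix x :: "real^2"
    have "envelope x = (1 / (1 + (x $ 1)\<^sup>2)) * (1 / (1 + (x $ 2)\<^sup>2))" by (simp add: envelope_def)
    then show "ennreal (envelope x) = (\<Prod>b\<in>Basis. ennreal (1 / (1 + (x \<bullet> b)\<^sup>2)))"
      unfolding prod_Basis_real2 by (simp add: inner_axis ennreal_mult[symmetric] del: times_divide_eq_left times_divide_eq_right)
  qed
  also have "\<dots> = (\<Prod>b\<in>(Basis :: (real^2) set). (\<integral>\<^sup>+(u :: real). ennreal (1 / (1 + u\<^sup>2)) \<partial>lborel))"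
    by (rule nn_integral_lborel_prod) auto
  also have "\<dots> < \<infinity>"
    unfolding prod_Basis_real2 using nn_integral_eq_integral[OF i] by (simp add: ennreal_mult_less_top)
  finally show "(\<integral>\<^sup>+x. ennreal (envelope x) \<partial>lborel) < \<infinity>" .
qed (auto simp: less_imp_le envelope_pos)

definition cell_corner :: "int \<times> int \<Rightarrow> real^2" where
  "cell_corner z = vector [of_int (fst z), of_int (snd z)]"

lemma cell_corner_nth[simp]: "cell_corner z $ 1 = of_int (fst z)" "cell_corner z $ 2 = of_int (snd z)"
  by (simp_all add: cell_corner_def vector_def)

text \<open>Induction over symmetric intervals against a telescoping bound: the two new terms add at
  most \<open>4 / (n + 1) - 4 / (n + 2)\<close>. At the start the bound \<open>5 - 4 = 1\<close> is
  exact.\<close>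

lemma sum_inverse_quadratic:
  fixes A :: "int set"
  assumes "finite A"
  shows "(\<Sum>k\<in>A. 1 / (1 + (of_int k)\<^sup>2)) \<le> (5 :: real)"
proof -
  define n where "n = nat (Max (abs ` A \<union> {0}))"
  have A: "A \<subseteq> {- int n..int n}"
  proof
    fix k assume "k \<in> A"
    then have "\<bar>k\<bar> \<le> Max (abs ` A \<union> {0})" using assms by (intro Max_ge) auto
    then show "k \<in> {- int n..int n}" by (auto simp: n_def)
  qed
  have pos: "0 \<le> 1 / (1 + (real_of_int k)\<^sup>2)" for k by simp
  have tel: "(\<Sum>k\<in>{- int n..int n}. 1 / (1 + (real_of_int k)\<^sup>2)) \<le> 5 - 4 / (real n + 1)" for n
  proof (induction n)
    case (Suc n)
    have eq: "{- int (Suc n)..int (Suc n)} = insert (- int (Suc n)) (insert (int (Suc n)) {- int n..int n})"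
      by auto
    have "(\<Sum>k\<in>{- int (Suc n)..int (Suc n)}. 1 / (1 + (real_of_int k)\<^sup>2)) =
       2 / (1 + (real n + 1)\<^sup>2) + (\<Sum>k\<in>{- int n..int n}. 1 / (1 + (real_of_int k)\<^sup>2))"
      unfolding eq by (simp add: power2_eq_square algebra_simps)
    also have "2 / (1 + (real n + 1)\<^sup>2) \<le> 4 / ((real n + 1) * (real n + 2))"
    proof -
      have "2 * ((real n + 1) * (real n + 2)) \<le> 4 * (1 + (real n + 1)\<^sup>2)"
        using zero_le_power2[of "real n"] by (simp add: power2_eq_square algebra_simps)
      then show ?thesis by (simp add: divide_simps add_pos_nonneg)
    qed
    also have "4 / ((real n + 1) * (real n + 2)) = 4 / (real n + 1) - 4 / (real n + 2)"
      by (simp add: divide_simps)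
    finally show ?case using Suc by (simp add: add.commute)
  qed simp
  have "(\<Sum>k\<in>A. 1 / (1 + (real_of_int k)\<^sup>2)) \<le> (\<Sum>k\<in>{- int n..int n}. 1 / (1 + (real_of_int k)\<^sup>2))"
    by (rule sum_mono2) (use A in auto)
  also have "\<dots> \<le> 5 - 4 / (real n + 1)" by (rule tel)
  also have "\<dots> \<le> 5" by simp
  finally show ?thesis .
qed

text \<open>Up to a bounded shift, \<open>y - cell_corner z\<close> is the lattice point
  \<open>g z\<close>, and these points are distinct. Enlarging them to a product set makes the sum
  factor: \<open>28900 = 1156 * 5 * 5\<close>.\<close>

lemma sum_envelope_cells:
  assumes S: "finite S"
  shows "(\<Sum>z\<in>S. envelope (y - cell_corner z)) \<le> 28900"
proof -
  define g where "g z = (\<lfloor>y $ 1\<rfloor> - fst z, \<lfloor>y $ 2\<rfloor> - snd z)" for z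
  have inj: "inj_on g S" by (auto simp: inj_on_def g_def prod_eq_iff)
  let ?h = "\<lambda>k. 1 / (1 + (real_of_int k)\<^sup>2)"
  have "(\<Sum>z\<in>S. envelope (y - cell_corner z)) \<le> (\<Sum>z\<in>S. 1156 * envelope (cell_corner (g z)))"
  proof (intro sum_mono envelope_shift)
    fix z and i :: 2
    show "\<bar>(y - cell_corner z) $ i - cell_corner (g z) $ i\<bar> \<le> 4"
      using exhaust_2[of i] by (auto simp: g_def; linarith)
  qed
  also have "\<dots> = 1156 * (\<Sum>z\<in>g ` S. envelope (cell_corner z))"
    using inj by (simp add: sum_distrib_left sum.reindex)
  also have "\<dots> \<le> 1156 * (\<Sum>z\<in>fst ` g ` S \<times> snd ` g ` S. envelope (cell_corner z))"
  proof (intro mult_left_mono sum_mono2)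
    show "g ` S \<subseteq> fst ` g ` S \<times> snd ` g ` S"
      by (rule subsetI) (simp only: mem_Times_iff imageI simp_thms)
  qed (use S in \<open>auto simp: less_imp_le envelope_pos\<close>)
  also have "(\<Sum>z\<in>fst ` g ` S \<times> snd ` g ` S. envelope (cell_corner z)) =
      (\<Sum>k\<in>fst ` g ` S. ?h k) * (\<Sum>k\<in>snd ` g ` S. ?h k)"
    by (simp add: envelope_def sum_product sum.cartesian_product split_def)
  also have "\<dots> \<le> 5 * 5"
    by (intro mult_mono sum_inverse_quadratic sum_nonneg) (use S in auto)
  finally show ?thesis by simp
qed

text \<open>The envelope decays no faster than the inverse fourth power of the norm, and a single
  term of the exponential series, with \<open>4 \<le> \<beta> * n\<close>, already provides that
  power.\<close>

lemma exp_powr_le_envelope: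
  assumes "0 < \<beta>"
  shows "\<exists>K>0. \<forall>x :: real^2. exp (- (norm x powr \<beta>)) \<le> K * envelope x"
proof -
  obtain n :: nat where n: "4 / \<beta> < n" using reals_Archimedean2 by blast
  have n4: "4 \<le> \<beta> * real n" using n assms by (simp add: pos_divide_less_eq mult.commute)
  define K where "K = 4 * fact n + (4 :: real)"
  have "exp (- (norm x powr \<beta>)) \<le> K * envelope x" for x :: "real^2"
  proof -
    let ?t = "norm x"
    have xi: "(x $ i)\<^sup>2 \<le> ?t\<^sup>2" for i using component_le_norm_cart[of x i] by (metis abs_le_square_iff abs_norm_cancel)
    have "(1 + (x $ 1)\<^sup>2) * (1 + (x $ 2)\<^sup>2) \<le> (1 + ?t\<^sup>2) * (1 + ?t\<^sup>2)"
      by (intro mult_mono add_left_mono xi) auto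
    also have "\<dots> * exp (- (?t powr \<beta>)) \<le> K"
    proof (cases "?t \<le> 1")
      case True
      then have "?t\<^sup>2 \<le> 1" by (simp add: power_le_one)
      then have "(1 + ?t\<^sup>2) * (1 + ?t\<^sup>2) * exp (- (?t powr \<beta>)) \<le> (1 + 1) * (1 + 1) * 1"
        by (intro mult_mono add_left_mono) auto
      also have "\<dots> \<le> K" by (simp add: K_def)
      finally show ?thesis .
    next
      case False
      then have t1: "1 \<le> ?t" by simp
      let ?u = "?t powr \<beta>"
      have "?u ^ n / fact n \<le> exp ?u"
      proof -
        have "(\<Sum>k\<in>{n}. ?u ^ k /\<^sub>R fact k) \<le> (\<Sum>k. ?u ^ k /\<^sub>R fact k)"
          by (rule sum_le_suminf[OF summable_exp_generic]) auto
        then show ?thesis by (simp add: exp_def divide_inverse mult.commute)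
      qed
      moreover have "?t ^ 4 \<le> ?u ^ n"
      proof -
        have "?u ^ n = ?t powr (\<beta> * real n)"
          using t1 by (subst powr_powr[symmetric], subst powr_realpow) auto
        moreover have "?t powr real 4 \<le> ?t powr (\<beta> * real n)" by (rule powr_mono) (use n4 t1 in auto)
        ultimately show ?thesis using t1 by (simp add: powr_realpow[symmetric])
      qed
      ultimately have "?t ^ 4 / fact n \<le> exp ?u" by (meson divide_right_mono fact_ge_zero order_trans)
      then have "?t ^ 4 \<le> exp ?u * fact n" by (simp add: pos_divide_le_eq)
      then have e: "?t ^ 4 * exp (- ?u) \<le> fact n" by (simp add: exp_minus field_simps)
      have "1 \<le> ?t\<^sup>2" using t1 by simp
      then have "(1 + ?t\<^sup>2) * (1 + ?t\<^sup>2) \<le> (2 * ?t\<^sup>2) * (2 * ?t\<^sup>2)" by (intro mult_mono) auto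
      also have "\<dots> = 4 * ?t ^ 4" by (simp add: power2_eq_square power4_eq_xxxx)
      finally have "(1 + ?t\<^sup>2) * (1 + ?t\<^sup>2) * exp (- ?u) \<le> 4 * ?t ^ 4 * exp (- ?u)" by (intro mult_right_mono) auto
      also have "\<dots> \<le> K" using e by (simp add: K_def)
      finally show ?thesis .
    qed
    finally have "(1 + (x $ 1)\<^sup>2) * (1 + (x $ 2)\<^sup>2) * exp (- (?t powr \<beta>)) \<le> K" by simp
    then show ?thesis
      unfolding envelope_def by (simp add: pos_le_divide_eq mult_pos_pos add_pos_nonneg mult.commute)
  qed
  moreover have "0 < K" by (simp add: K_def add_nonneg_pos)
  ultimately show ?thesis by blast
qed

lemma frechet_derivative_partial_bound:
  fixes h :: "real^2 \<Rightarrow> real"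
  assumes d: "h differentiable (at x)"
  shows "\<bar>frechet_derivative h (at x) v\<bar> \<le> (\<bar>partial 1 h x\<bar> + \<bar>partial 2 h x\<bar>) * norm v"
proof -
  interpret l: linear "frechet_derivative h (at x)"
    using d by (rule linear_frechet_derivative)
  have "v = (v $ 1) *\<^sub>R axis 1 1 + (v $ 2) *\<^sub>R axis 2 1"
    by (simp add: vec_eq_iff axis_def forall_2)
  then have "frechet_derivative h (at x) v = frechet_derivative h (at x) ((v $ 1) *\<^sub>R axis 1 1 + (v $ 2) *\<^sub>R axis 2 1)"
    by simp
  also have "\<dots> = (v $ 1) * partial 1 h x + (v $ 2) * partial 2 h x"
    by (simp add: l.add l.scale partial_def)
  also have "\<bar>\<dots>\<bar> \<le> \<bar>v $ 1\<bar> * \<bar>partial 1 h x\<bar> + \<bar>v $ 2\<bar> * \<bar>partial 2 h x\<bar>"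
    by (metis abs_mult abs_triangle_ineq)
  also have "\<dots> \<le> norm v * \<bar>partial 1 h x\<bar> + norm v * \<bar>partial 2 h x\<bar>"
    by (intro add_mono mult_right_mono component_le_norm_cart) auto
  finally show ?thesis by (simp add: algebra_simps)
qed

section \<open>Second moments of the field and their localisation to cells\<close>

locale decaying_field = prob_space M for M :: "'w measure" +
  fixes f :: "real^2 \<Rightarrow> 'w \<Rightarrow> real" and \<kappa> \<rho> q :: "real^2 \<Rightarrow> real"
  assumes gaussian: "gaussian_field M f"
    and continuous_paths: "AE \<omega> in M. continuous_on UNIV (\<lambda>x. f x \<omega>)"
    and sd: "spectral_density \<kappa> \<rho>"
    and fl2: "fourier_L2 \<rho> (\<lambda>x. complex_of_real (q x))"
    and sym: "symmetries M f \<kappa>"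
    and reg: "strong_regularity \<rho> q"
    and decay: "strong_decay q"
begin

lemma q_differentiable: "q differentiable (at x)"
  using reg by (simp add: strong_regularity_def numeral_3_eq_3)

text \<open>Condenses the decay condition to one constant for \<open>q\<close> and its first partial
  derivatives, from the multi-indices (0, 0), (1, 0) and (0, 1).\<close>

lemma decay_envelope:
  obtains K where "0 < K" "\<And>x. \<bar>q x\<bar> \<le> K * envelope x" "\<And>i x. \<bar>partial i q x\<bar> \<le> K * envelope x"
proof -
  obtain C \<beta> where C: "0 < C" "0 < \<beta>"
    "\<And>a b x. a + b \<le> 3 \<Longrightarrow> \<bar>partials a b q x\<bar> \<le> C * exp (- (norm x powr \<beta>))"
    using decay unfolding strong_decay_def by blast
  obtain K where K: "0 < K" "\<And>x :: real^2. exp (- (norm x powr \<beta>)) \<le> K * envelope x"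
    using exp_powr_le_envelope[OF C(2)] by blast
  have *: "\<bar>partials a b q x\<bar> \<le> C * K * envelope x" if "a + b \<le> 3" for a b x
    by (rule order_trans[OF C(3)[OF that]]) (use K(2)[of x] C(1) in \<open>simp add: mult.assoc\<close>)
  show ?thesis
  proof (rule that[of "C * K"])
    show "0 < C * K" using C K by simp
    show "\<bar>q x\<bar> \<le> C * K * envelope x" for x using *[of 0 0 x] by (simp add: partials_def)
    show "\<bar>partial i q x\<bar> \<le> C * K * envelope x" for i x
      using exhaust_2[of i] *[of 1 0 x] *[of 0 1 x] by (auto simp: partials_def)
  qed
qed

lemma centered_f: "expectation (f x) = 0"
  using sym by (simp add: symmetries_def centered_def)

lemma cov: "expectation (\<lambda>\<omega>. f x \<omega> * f y \<omega>) = \<kappa> (x - y)"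
  using sym by (simp add: symmetries_def stationary_cov_def covariance_def)

lemma \<kappa>_0: "\<kappa> 0 = 1"
  using sym by (simp add: symmetries_def)

text \<open>The points \<open>x i\<close> may coincide, whereas \<open>gaussian_field\<close> speaks
  of sums over a set of points; the coefficients belonging to equal points are collected.\<close>

lemma gaussian_sum:
  assumes I: "finite I"
  shows "gaussian_rv M (\<lambda>\<omega>. \<Sum>i\<in>I. c i * f (x i) \<omega>)"
proof -
  have "(\<lambda>\<omega>. \<Sum>i\<in>I. c i * f (x i) \<omega>) = (\<lambda>\<omega>. \<Sum>p\<in>x ` I. (\<Sum>i\<in>{i \<in> I. x i = p}. c i) * f p \<omega>)"
  proof
    fix \<omega>
    have "(\<Sum>i\<in>I. c i * f (x i) \<omega>) = (\<Sum>p\<in>x ` I. \<Sum>i\<in>{i \<in> I. x i = p}. c i * f (x i) \<omega>)"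
      by (rule sum.image_gen[OF I])
    also have "\<dots> = (\<Sum>p\<in>x ` I. (\<Sum>i\<in>{i \<in> I. x i = p}. c i) * f p \<omega>)"
      by (intro sum.cong refl) (auto simp: sum_distrib_right)
    finally show "(\<Sum>i\<in>I. c i * f (x i) \<omega>) = (\<Sum>p\<in>x ` I. (\<Sum>i\<in>{i \<in> I. x i = p}. c i) * f p \<omega>)" .
  qed
  then show ?thesis using gaussian I unfolding gaussian_field_def by simp
qed

lemma gaussian_f: "gaussian_rv M (f x)"
  using gaussian_sum[of "{x}" "\<lambda>_. 1" "\<lambda>x. x"] by simp

lemma f_measurable[measurable]: "f x \<in> borel_measurable M"
  by (rule centered_gaussian_rv(1)[OF gaussian_f centered_f])

lemma f_int: "integrable M (f x)"
  by (rule centered_gaussian_rv(2)[OF gaussian_f centered_f])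

lemma f_mult_int: "integrable M (\<lambda>\<omega>. f x \<omega> * f y \<omega>)"
proof (rule Bochner_Integration.integrable_bound)
  show "integrable M (\<lambda>\<omega>. (f x \<omega>)\<^sup>2 + (f y \<omega>)\<^sup>2)"
    using centered_gaussian_rv(3)[OF gaussian_f centered_f] by simp
  show "AE \<omega> in M. norm (f x \<omega> * f y \<omega>) \<le> norm ((f x \<omega>)\<^sup>2 + (f y \<omega>)\<^sup>2)"
  proof (rule AE_I2)
    fix \<omega>
    have "2 * (\<bar>f x \<omega>\<bar> * \<bar>f y \<omega>\<bar>) \<le> (f x \<omega>)\<^sup>2 + (f y \<omega>)\<^sup>2"
      using zero_le_power2[of "\<bar>f x \<omega>\<bar> - \<bar>f y \<omega>\<bar>"] by (simp add: power2_eq_square algebra_simps)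
    moreover have "0 \<le> \<bar>f x \<omega>\<bar> * \<bar>f y \<omega>\<bar>" by simp
    ultimately have "\<bar>f x \<omega>\<bar> * \<bar>f y \<omega>\<bar> \<le> \<bar>(f x \<omega>)\<^sup>2 + (f y \<omega>)\<^sup>2\<bar>" by linarith
    then show "norm (f x \<omega> * f y \<omega>) \<le> norm ((f x \<omega>)\<^sup>2 + (f y \<omega>)\<^sup>2)" by (simp add: abs_mult)
  qed
qed measurable

lemma expectation_sum:
  assumes "finite I"
  shows "expectation (\<lambda>\<omega>. \<Sum>i\<in>I. c i * f (x i) \<omega>) = 0"
  using f_int centered_f by simp

lemma second_moment_sum:
  assumes "finite I"
  shows "expectation (\<lambda>\<omega>. (\<Sum>i\<in>I. c i * f (x i) \<omega>)\<^sup>2) = (\<Sum>i\<in>I. \<Sum>j\<in>I. c i * c j * \<kappa> (x i - x j))"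
proof -
  have "(\<Sum>i\<in>I. c i * f (x i) \<omega>)\<^sup>2 = (\<Sum>i\<in>I. \<Sum>j\<in>I. c i * c j * (f (x i) \<omega> * f (x j) \<omega>))" for \<omega>
    by (simp add: power2_eq_square sum_product mult_ac)
  then show ?thesis using f_mult_int cov by simp
qed

lemma expectation_cos_sum:
  assumes "finite I"
  shows "expectation (\<lambda>\<omega>. cos ((\<Sum>i\<in>I. c i * f (x i) \<omega>) + d)) =
    cos d * exp (- (\<Sum>i\<in>I. \<Sum>j\<in>I. c i * c j * \<kappa> (x i - x j)) / 2)"
  using centered_gaussian_rv(4)[OF gaussian_sum[OF assms] expectation_sum[OF assms]]
  by (simp add: second_moment_sum[OF assms])

lemma q_continuous: "continuous_on UNIV q"
  using q_differentiable by (intro continuous_at_imp_continuous_on ballI differentiable_imp_continuous_within)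

lemma spectral_kernel: "\<exists>b. spectral_kernel \<kappa> \<rho> q b"
proof -
  obtain K where K: "0 < K" "\<And>x. \<bar>q x\<bar> \<le> K * envelope x" "\<And>i x. \<bar>partial i q x\<bar> \<le> K * envelope x"
    by (rule decay_envelope) (rule that; assumption)
  have qm: "q \<in> borel_measurable borel" by (rule borel_measurable_continuous_onI[OF q_continuous])
  have "spectral_kernel \<kappa> \<rho> q (K * 1)"
  proof
    show "integrable lborel q"
    proof (rule Bochner_Integration.integrable_bound)
      show "integrable lborel (\<lambda>x. K * envelope x)" using envelope_int by simp
      show "AE x in lborel. norm (q x) \<le> norm (K * envelope x)"
        using K less_imp_le[OF envelope_pos] by (intro AE_I2) (simp add: abs_mult)
    qed (use qm in simp)
    show "\<bar>q x\<bar> \<le> K * 1" for x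
    proof -
      have "1 \<le> (1 + (x $ 1)\<^sup>2) * (1 + (x $ 2)\<^sup>2)"
        using mult_mono[of 1 "1 + (x $ 1)\<^sup>2" 1 "1 + (x $ 2)\<^sup>2"] by simp
      then have "envelope x \<le> 1" by (simp add: envelope_def)
      then show ?thesis using K(2)[of x] mult_left_mono[of "envelope x" 1 K] K(1) by linarith
    qed
    show "continuous_on UNIV \<kappa>" using sym by (simp add: symmetries_def stationary_cov_def)
    show "\<kappa> (- x) = \<kappa> x" for x
      using cov[of 0 x] cov[of x 0] by (simp add: mult.commute)
    show "q (- x) = q x" for x using reg by (simp add: strong_regularity_def)
  qed (use sd fl2 q_continuous in auto)
  then show ?thesis ..
qed

lemma q_vanishes: "(q \<longlongrightarrow> 0) at_infinity"
proof -
  obtain K where K: "0 < K" "\<And>x. \<bar>q x\<bar> \<le> K * envelope x" "\<And>i x. \<bar>partial i q x\<bar> \<le> K * envelope x"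
    by (rule decay_envelope) (rule that; assumption)
  show ?thesis
    unfolding tendsto_iff eventually_at_infinity
  proof (intro allI impI)
    fix e :: real assume e: "0 < e"
    define B where "B = K / e + 1"
    have B: "0 < B" "K / e < B" using K e by (auto simp: B_def add_pos_pos)
    have "dist (q x) 0 < e" if x: "2 * B + 2 \<le> norm x" for x
    proof -
      have "norm x \<le> \<bar>x $ 1\<bar> + \<bar>x $ 2\<bar>" using norm_le_l1_cart[of x] by (simp add: sum_2)
      then have "B + 1 \<le> \<bar>x $ 1\<bar> \<or> B + 1 \<le> \<bar>x $ 2\<bar>" using x by linarith
      then obtain i :: 2 where i: "B + 1 \<le> \<bar>x $ i\<bar>" by blast
      have "B \<le> (x $ i)\<^sup>2"
      proof -
        have "B * 1 \<le> \<bar>x $ i\<bar> * \<bar>x $ i\<bar>" using i B by (intro mult_mono) auto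
        then show ?thesis by (simp add: power2_eq_square)
      qed
      also have "\<dots> \<le> (1 + (x $ 1)\<^sup>2) * (1 + (x $ 2)\<^sup>2)"
        using exhaust_2[of i] by (auto simp: algebra_simps)
      finally have "envelope x \<le> 1 / B" unfolding envelope_def using B by (intro divide_left_mono) auto
      then have "K * envelope x \<le> K / B" using K(1) mult_left_mono[of "envelope x" "1 / B" K] by simp
      also have "\<dots> < e" using B e by (simp add: field_simps)
      finally show ?thesis using K(2)[of x] by simp
    qed
    then show "\<exists>b. \<forall>x. b \<le> norm x \<longrightarrow> dist (q x) 0 < e" by blast
  qed
qed

lemma \<kappa>_diff: "\<kappa> (x - x') = (\<integral>y. q (x - y) * q (x' - y) \<partial>lborel)"
  and \<kappa>_int: "integrable lborel (\<lambda>y. q (x - y) * q (x' - y))"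
  and \<kappa>_tendsto_0: "v \<noteq> 0 \<Longrightarrow> (\<lambda>n. \<kappa> (w + real n *\<^sub>R v)) \<longlonglongrightarrow> 0"
proof -
  obtain b where "spectral_kernel \<kappa> \<rho> q b" using spectral_kernel ..
  then interpret spectral_kernel \<kappa> \<rho> q b .
  show "\<kappa> (x - x') = (\<integral>y. q (x - y) * q (x' - y) \<partial>lborel)"
    "integrable lborel (\<lambda>y. q (x - y) * q (x' - y))"
    by (rule \<kappa>_diff \<kappa>_diff_integrable)+
  show "v \<noteq> 0 \<Longrightarrow> (\<lambda>n. \<kappa> (w + real n *\<^sub>R v)) \<longlonglongrightarrow> 0" by (rule \<kappa>_decay[OF q_vanishes])
qed

text \<open>The isometry that sends \<open>f x\<close> to the translate of \<open>q\<close>: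
  variances are computed as for \<open>q\<close> convolved with white noise, although no noise is
  constructed.\<close>

lemma second_moment_sum_eq:
  assumes "finite I"
  shows "expectation (\<lambda>\<omega>. (\<Sum>i\<in>I. c i * f (x i) \<omega>)\<^sup>2) = (\<integral>y. (\<Sum>i\<in>I. c i * q (x i - y))\<^sup>2 \<partial>lborel)"
    and "integrable lborel (\<lambda>y. (\<Sum>i\<in>I. c i * q (x i - y))\<^sup>2)"
proof -
  have e: "(\<Sum>i\<in>I. c i * q (x i - y))\<^sup>2 = (\<Sum>i\<in>I. \<Sum>j\<in>I. c i * c j * (q (x i - y) * q (x j - y)))" for y
    by (simp add: power2_eq_square sum_product mult_ac)
  show "expectation (\<lambda>\<omega>. (\<Sum>i\<in>I. c i * f (x i) \<omega>)\<^sup>2) = (\<integral>y. (\<Sum>i\<in>I. c i * q (x i - y))\<^sup>2 \<partial>lborel)"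
    unfolding second_moment_sum[OF assms] e using \<kappa>_int \<kappa>_diff by simp
  show "integrable lborel (\<lambda>y. (\<Sum>i\<in>I. c i * q (x i - y))\<^sup>2)"
    unfolding e using \<kappa>_int by simp
qed

text \<open>Schur's test: the variance of a combination of localised functionals of the field, one for each
  cell, is at most a constant times the sum of the squared coefficients.\<close>

lemma second_moment_localised:
  assumes S: "finite S" and A: "0 \<le> A"
    and loc: "\<And>z y. z \<in> S \<Longrightarrow> \<bar>\<alpha> z * q (u z - y) + \<beta> z * q (v z - y)\<bar> \<le> A * envelope (y - cell_corner z)"
  shows "expectation (\<lambda>\<omega>. (\<Sum>z\<in>S. t z * (\<alpha> z * f (u z) \<omega> + \<beta> z * f (v z) \<omega>))\<^sup>2)
    \<le> 28900 * A\<^sup>2 * (\<integral>y. envelope y \<partial>lborel) * (\<Sum>z\<in>S. (t z)\<^sup>2)"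
    and "gaussian_rv M (\<lambda>\<omega>. \<Sum>z\<in>S. t z * (\<alpha> z * f (u z) \<omega> + \<beta> z * f (v z) \<omega>))"
    and "expectation (\<lambda>\<omega>. \<Sum>z\<in>S. t z * (\<alpha> z * f (u z) \<omega> + \<beta> z * f (v z) \<omega>)) = 0"
proof -
  \<comment> \<open>There are two evaluation points per cell; the boolean selects \<open>u z\<close>
    or \<open>v z\<close>.\<close>
  define I where "I = S \<times> (UNIV :: bool set)"
  have I: "finite I" using S by (simp add: I_def)
  define c where "c i = (case i of (z, s) \<Rightarrow> t z * (if s then \<alpha> z else \<beta> z))" for i
  define x where "x i = (case i of (z, s) \<Rightarrow> if s then u z else v z)" for i
  have split: "(\<Sum>i\<in>I. c i * g (x i)) = (\<Sum>z\<in>S. t z * (\<alpha> z * g (u z) + \<beta> z * g (v z)))" for g :: "real^2 \<Rightarrow> real"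
  proof -
    have "(\<Sum>i\<in>I. c i * g (x i)) = (\<Sum>z\<in>S. \<Sum>s\<in>UNIV. c (z, s) * g (x (z, s)))"
      unfolding I_def by (simp only: sum.cartesian_product split_def prod.collapse)
    then show ?thesis by (simp add: c_def x_def UNIV_bool algebra_simps)
  qed
  have spf: "(\<lambda>\<omega>. \<Sum>i\<in>I. c i * f (x i) \<omega>) = (\<lambda>\<omega>. \<Sum>z\<in>S. t z * (\<alpha> z * f (u z) \<omega> + \<beta> z * f (v z) \<omega>))"
    using split[of "\<lambda>p. f p \<omega>" for \<omega>] by auto
  show "gaussian_rv M (\<lambda>\<omega>. \<Sum>z\<in>S. t z * (\<alpha> z * f (u z) \<omega> + \<beta> z * f (v z) \<omega>))"
    using gaussian_sum[OF I, of c x] unfolding spf .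
  show "expectation (\<lambda>\<omega>. \<Sum>z\<in>S. t z * (\<alpha> z * f (u z) \<omega> + \<beta> z * f (v z) \<omega>)) = 0"
    using expectation_sum[OF I, of c x] unfolding spf .
  define e where "e z y = envelope (y - cell_corner z)" for z y
  have e0: "0 \<le> e z y" for z y by (simp add: e_def less_imp_le envelope_pos)
  have e_int: "integrable lborel (e z)" "(\<integral>y. e z y \<partial>lborel) = (\<integral>y. envelope y \<partial>lborel)" for z
    using lborel_integral_translation[of envelope "- cell_corner z"] envelope_int by (auto simp: e_def[abs_def])
  have "expectation (\<lambda>\<omega>. (\<Sum>z\<in>S. t z * (\<alpha> z * f (u z) \<omega> + \<beta> z * f (v z) \<omega>))\<^sup>2) =
     (\<integral>y. (\<Sum>i\<in>I. c i * q (x i - y))\<^sup>2 \<partial>lborel)"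
    using second_moment_sum_eq(1)[OF I, of c x] by (simp only: spf[THEN fun_cong])
  also have "\<dots> \<le> (\<integral>y. 28900 * A\<^sup>2 * (\<Sum>z\<in>S. (t z)\<^sup>2 * e z y) \<partial>lborel)"
  proof (rule integral_mono)
    fix y
    have "\<bar>\<Sum>i\<in>I. c i * q (x i - y)\<bar> \<le> (\<Sum>z\<in>S. \<bar>t z\<bar> * (A * e z y))"
      unfolding split[of "\<lambda>p. q (p - y)"]
      by (rule order_trans[OF sum_abs sum_mono]) (use loc in \<open>auto simp: e_def abs_mult intro!: mult_left_mono\<close>)
    \<comment> \<open>The envelope is split into two square roots for Cauchy-Schwarz. The factor
      without coefficients becomes the sum of envelopes over the cells, which is at most 28900 for
      every \<open>y\<close>.\<close>
    also have "\<dots> = A * (\<Sum>z\<in>S. (\<bar>t z\<bar> * sqrt (e z y)) * sqrt (e z y))"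
      using e0 by (simp add: sum_distrib_left mult_ac)
    finally have 1: "\<bar>\<Sum>i\<in>I. c i * q (x i - y)\<bar> \<le> A * (\<Sum>z\<in>S. (\<bar>t z\<bar> * sqrt (e z y)) * sqrt (e z y))" .
    have "(\<Sum>i\<in>I. c i * q (x i - y))\<^sup>2 \<le> (A * (\<Sum>z\<in>S. (\<bar>t z\<bar> * sqrt (e z y)) * sqrt (e z y)))\<^sup>2"
      using power_mono[OF 1, of 2] by simp
    also have "\<dots> = A\<^sup>2 * (\<Sum>z\<in>S. (\<bar>t z\<bar> * sqrt (e z y)) * sqrt (e z y))\<^sup>2" by (simp add: power_mult_distrib)
    also have "\<dots> \<le> A\<^sup>2 * ((\<Sum>z\<in>S. (\<bar>t z\<bar> * sqrt (e z y))\<^sup>2) * (\<Sum>z\<in>S. (sqrt (e z y))\<^sup>2))"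
      by (intro mult_left_mono Cauchy_Schwarz_ineq_sum) auto
    also have "\<dots> = A\<^sup>2 * ((\<Sum>z\<in>S. (t z)\<^sup>2 * e z y) * (\<Sum>z\<in>S. e z y))"
      using e0 by (simp add: power_mult_distrib)
    also have "\<dots> \<le> A\<^sup>2 * ((\<Sum>z\<in>S. (t z)\<^sup>2 * e z y) * 28900)"
      using sum_envelope_cells[OF S, of y] e0 by (intro mult_left_mono sum_nonneg) (auto simp: e_def)
    finally show "(\<Sum>i\<in>I. c i * q (x i - y))\<^sup>2 \<le> 28900 * A\<^sup>2 * (\<Sum>z\<in>S. (t z)\<^sup>2 * e z y)" by (simp add: mult_ac)
  qed (use second_moment_sum_eq(2)[OF I] e_int in auto)
  also have "\<dots> = 28900 * A\<^sup>2 * (\<integral>y. envelope y \<partial>lborel) * (\<Sum>z\<in>S. (t z)\<^sup>2)"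
    using e_int by (simp add: sum_distrib_right[symmetric])
  finally show "expectation (\<lambda>\<omega>. (\<Sum>z\<in>S. t z * (\<alpha> z * f (u z) \<omega> + \<beta> z * f (v z) \<omega>))\<^sup>2)
    \<le> 28900 * A\<^sup>2 * (\<integral>y. envelope y \<partial>lborel) * (\<Sum>z\<in>S. (t z)\<^sup>2)" .
qed

text \<open>The mean value inequality along the segment. Each of the two partial derivatives
  contributes \<open>1156 * K\<close>, the price of moving the envelope to the corner of the cell;
  hence 2312.\<close>

lemma q_increment:
  assumes K: "\<And>i x. \<bar>partial i q x\<bar> \<le> K * envelope x" "0 < K"
    and near: "\<And>p i. p \<in> closed_segment u v \<Longrightarrow> \<bar>p $ i - cell_corner z $ i\<bar> \<le> 4"
  shows "\<bar>q (v - y) - q (u - y)\<bar> \<le> 2312 * K * envelope (y - cell_corner z) * norm (v - u)"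
proof -
  let ?S = "closed_segment u v"
  have "norm (q (v - y) - q (u - y)) \<le> 2312 * K * envelope (y - cell_corner z) * norm (v - u)"
  proof (rule differentiable_bound[of ?S "\<lambda>p. q (p - y)" "\<lambda>p. frechet_derivative q (at (p - y))"])
    show "convex ?S" by simp
    fix p assume p: "p \<in> ?S"
    have "(q has_derivative frechet_derivative q (at (p - y))) (at (p - y))"
      using q_differentiable by (simp add: frechet_derivative_works)
    moreover have "((\<lambda>p. p - y) has_derivative (\<lambda>h. h)) (at p)"
      by (auto intro!: derivative_eq_intros)
    ultimately have "((\<lambda>p. q (p - y)) has_derivative frechet_derivative q (at (p - y))) (at p)"
      using has_derivative_compose[where f="\<lambda>p. p - y" and g=q and f'="\<lambda>h. h" and s=UNIV] by blast
    then show "((\<lambda>p. q (p - y)) has_derivative frechet_derivative q (at (p - y))) (at p within ?S)"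
      by (rule has_derivative_at_withinI)
    have "envelope (p - y) \<le> 1156 * envelope (cell_corner z - y)"
      by (rule envelope_shift) (use near[OF p] in simp)
    also have "envelope (cell_corner z - y) = envelope (y - cell_corner z)"
      using envelope_uminus[of "y - cell_corner z"] by simp
    finally have "K * envelope (p - y) \<le> K * (1156 * envelope (y - cell_corner z))"
      using K(2) by (intro mult_left_mono) auto
    then have b: "\<bar>partial i q (p - y)\<bar> \<le> 1156 * K * envelope (y - cell_corner z)" for i
      using K(1)[of i "p - y"] by (simp add: mult_ac)
    show "onorm (frechet_derivative q (at (p - y))) \<le> 2312 * K * envelope (y - cell_corner z)"
    proof (rule onorm_le)
      fix h
      have "\<bar>frechet_derivative q (at (p - y)) h\<bar> \<le> (\<bar>partial 1 q (p - y)\<bar> + \<bar>partial 2 q (p - y)\<bar>) * norm h"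
        by (rule frechet_derivative_partial_bound[OF q_differentiable])
      also have "\<dots> \<le> 2312 * K * envelope (y - cell_corner z) * norm h"
        using b[of 1] b[of 2] by (intro mult_right_mono) auto
      finally show "norm (frechet_derivative q (at (p - y)) h) \<le> 2312 * K * envelope (y - cell_corner z) * norm h" by simp
    qed
  qed auto
  then show ?thesis by simp
qed

end


section \<open>Linear growth of the mean distance\<close>

text \<open>Positions are relative to the corner of a cell, so the same finite sets of tests serve
  every cell.\<close>

type_synonym cell_test = "real \<times> (real^2) \<times> real \<times> (real^2)"

definition test_value :: "(real^2 \<Rightarrow> real) \<Rightarrow> int \<times> int \<Rightarrow> cell_test \<Rightarrow> real" where
  "test_value h z \<tau> = (case \<tau> of (\<alpha>, u, \<beta>, v) \<Rightarrow> \<alpha> * h (cell_corner z + u) + \<beta> * h (cell_corner z + v))"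

definition corner_tests :: "cell_test set" where
  "corner_tests = (\<lambda>(k, s). (s, cell_corner k, 0, 0)) ` (({-1..1} \<times> {-1..1}) \<times> {-1, 1})"

text \<open>Differences between a dyadic point of level \<open>j\<close> in the block of nine cells
  and the points of level \<open>j + 1\<close> up and right of it, with both signs \<open>s\<close>.
  The factor \<open>2 ^ j\<close> compensates the length of the increment and makes the variances
  bounded uniformly in \<open>j\<close>.\<close>

definition increment_tests :: "nat \<Rightarrow> cell_test set" where
  "increment_tests j =
     (\<lambda>(k, d, s). (s * 2 ^ j, (1 / 2 ^ j) *\<^sub>R cell_corner k + (1 / 2 ^ Suc j) *\<^sub>R cell_corner d,
        - (s * 2 ^ j), (1 / 2 ^ j) *\<^sub>R cell_corner k)) `
     (({- (2 ^ j)..<2 * 2 ^ j} \<times> {- (2 ^ j)..<2 * 2 ^ j}) \<times> ({0, 1} \<times> {0, 1}) \<times> {-1, 1})"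

definition cell_tests :: "nat \<Rightarrow> cell_test set" where
  "cell_tests j = increment_tests j \<union> (if j = 0 then corner_tests else {})"

text \<open>A cell is bad if one of the dyadic increments of \<open>h\<close> in the surrounding block of nine cells, or a
  value at a corner, is large; the thresholds are such that chaining bounds \<open>\<bar>h\<bar>\<close> by \<open>m\<close> otherwise.\<close>

definition bad_cell :: "real \<Rightarrow> (real^2 \<Rightarrow> real) \<Rightarrow> int \<times> int \<Rightarrow> bool" where
  "bad_cell m h z \<longleftrightarrow> (\<exists>j. \<exists>\<tau>\<in>cell_tests j. m / 8 * (3 / 2) ^ j \<le> test_value h z \<tau>)"

lemma finite_cell_tests: "finite (cell_tests j)"
  by (simp add: cell_tests_def increment_tests_def corner_tests_def)

text \<open>There are at most \<open>9 * 2 = 18\<close> corner tests, and at most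
  \<open>(3 * 2 ^ j)\<^sup>2 * 4 * 2 = 72 * 4 ^ j\<close> increment tests at level
  \<open>j\<close>.\<close>

lemma card_cell_tests: "real (card (cell_tests j)) \<le> 90 * 4 ^ j"
proof -
  have c1: "card corner_tests \<le> 18"
    unfolding corner_tests_def by (rule card_image_le[THEN order_trans]) (auto simp: card_cartesian_product)
  have "card (increment_tests j) \<le> card ((({- (2 ^ j)..<2 * 2 ^ j} \<times> {- (2 ^ j)..<2 * 2 ^ j}) \<times> (({0, 1} \<times> {0, 1}) \<times> {-1, 1 :: real})) :: ((int \<times> int) \<times> (int \<times> int) \<times> real) set)"
    unfolding increment_tests_def by (rule card_image_le) auto
  also have "\<dots> = 72 * 4 ^ j"
  proof -
    have "nat (2 * 2 ^ j - - (2 ^ j) :: int) = 3 * 2 ^ j" by (simp add: nat_mult_distrib nat_power_eq)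
    then show ?thesis by (simp add: card_cartesian_product power_mult_distrib[symmetric] algebra_simps)
  qed
  finally have "card (increment_tests j) \<le> 72 * 4 ^ j" .
  then have "card (cell_tests j) \<le> 72 * 4 ^ j + (if j = 0 then 18 else 0)"
    unfolding cell_tests_def using c1 by (auto intro!: order_trans[OF card_Un_le] add_mono)
  also have "\<dots> \<le> 90 * 4 ^ j" by (cases "j = 0") auto
  finally have "real (card (cell_tests j)) \<le> real (90 * 4 ^ j)" by (rule of_nat_mono)
  then show ?thesis by simp
qed

lemma corner_test_less:
  assumes "\<not> bad_cell m h z" "k \<in> {-1..1} \<times> {-1..1}"
  shows "\<bar>h (cell_corner z + cell_corner k)\<bar> < m / 8"
proof -
  have "(s, cell_corner k, 0, 0) \<in> cell_tests 0" if "s \<in> {-1, 1}" for s :: real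
    using assms(2) that unfolding cell_tests_def corner_tests_def by (auto intro!: image_eqI[of _ _ "(k, s)"])
  then have "test_value h z (s, cell_corner k, 0, 0) < m / 8 * (3 / 2) ^ 0" if "s \<in> {-1, 1}" for s :: real
    using assms(1) that unfolding bad_cell_def by (meson not_le)
  from this[of 1] this[of "-1"] show ?thesis by (simp add: test_value_def abs_less_iff)
qed

text \<open>Dividing the threshold by the factor \<open>2 ^ j\<close> of the test leaves
  \<open>(3 / 4) ^ j\<close>, which is summable.\<close>

lemma increment_test_less:
  assumes "\<not> bad_cell m h z" "k \<in> {- (2 ^ j)..<2 * 2 ^ j} \<times> {- (2 ^ j)..<2 * 2 ^ j}" "d \<in> {0, 1} \<times> {0, 1}"
  shows "\<bar>h (cell_corner z + ((1 / 2 ^ j) *\<^sub>R cell_corner k + (1 / 2 ^ Suc j) *\<^sub>R cell_corner d))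
      - h (cell_corner z + (1 / 2 ^ j) *\<^sub>R cell_corner k)\<bar> \<le> m / 8 * (3 / 4) ^ j"
proof -
  let ?u = "(1 / 2 ^ j) *\<^sub>R cell_corner k + (1 / 2 ^ Suc j) *\<^sub>R cell_corner d" and ?v = "(1 / 2 ^ j) *\<^sub>R cell_corner k"
  have "(s * 2 ^ j, ?u, - (s * 2 ^ j), ?v) \<in> cell_tests j" if "s \<in> {-1, 1}" for s :: real
    using assms(2,3) that unfolding cell_tests_def increment_tests_def
    by (intro UnI1 image_eqI[of _ _ "(k, d, s)"]) auto
  then have *: "test_value h z (s * 2 ^ j, ?u, - (s * 2 ^ j), ?v) < m / 8 * (3 / 2) ^ j" if "s \<in> {-1, 1}" for s :: real
    using assms(1) that unfolding bad_cell_def by (meson not_le)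
  let ?D = "h (cell_corner z + ?u) - h (cell_corner z + ?v)"
  have "2 ^ j * \<bar>?D\<bar> \<le> m / 8 * (3 / 2) ^ j"
    using *[of 1] *[of "-1"] by (auto simp: test_value_def algebra_simps abs_if)
  also have "(3 / 2 :: real) ^ j = 2 ^ j * (3 / 4) ^ j" unfolding power_mult_distrib[symmetric] by simp
  also have "m / 8 * (2 ^ j * (3 / 4) ^ j) = 2 ^ j * (m / 8 * (3 / 4) ^ j)" by (simp only: mult_ac)
  finally show ?thesis by simp
qed

text \<open>Chaining along \<open>x j\<close>, the dyadic point of level \<open>j\<close> obtained
  from \<open>p\<close> by rounding down. The increments add up to at most
  \<open>m / 8 * 4 = m / 2\<close>, the corner at the start contributes less than
  \<open>m / 8\<close>, and continuity passes to the limit \<open>p\<close>.\<close>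

lemma good_cell_bound:
  assumes h: "continuous_on UNIV h" and m: "0 < m" and good: "\<not> bad_cell m h z" and p: "king z (cell p)"
  shows "\<bar>h p\<bar> \<le> m"
proof -
  define k where "k j = (\<lfloor>2 ^ j * p $ 1\<rfloor> - 2 ^ j * fst z, \<lfloor>2 ^ j * p $ 2\<rfloor> - 2 ^ j * snd z)" for j :: nat
  define x where "x j = cell_corner z + (1 / 2 ^ j) *\<^sub>R cell_corner (k j)" for j
  have xi: "x j $ 1 = of_int \<lfloor>2 ^ j * p $ 1\<rfloor> / 2 ^ j" "x j $ 2 = of_int \<lfloor>2 ^ j * p $ 2\<rfloor> / 2 ^ j" for j
    by (simp_all add: x_def k_def diff_divide_distrib)
  \<comment> \<open>Adjacency of the cells confines each coordinate of \<open>p\<close> to the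
    half-open interval from -1 to 2 relative to the corner; scaled by \<open>2 ^ j\<close>, this is
    the index range of the tests.\<close>
  have rng: "\<lfloor>2 ^ j * t\<rfloor> - 2 ^ j * a \<in> {- (2 ^ j)..<2 * 2 ^ j}" if "\<bar>a - \<lfloor>t\<rfloor>\<bar> \<le> 1" for j :: nat and t :: real and a :: int
  proof -
    have "of_int (a - 1) \<le> t" "t < of_int (a + 2)" using that by linarith+
    then have "2 ^ j * of_int (a - 1) \<le> 2 ^ j * t" "2 ^ j * t < 2 ^ j * of_int (a + 2)" by simp_all
    then have "of_int (2 ^ j * (a - 1)) \<le> 2 ^ j * t" "2 ^ j * t < of_int (2 ^ j * (a + 2))" by simp_all
    then have "2 ^ j * (a - 1) \<le> \<lfloor>2 ^ j * t\<rfloor>" "\<lfloor>2 ^ j * t\<rfloor> < 2 ^ j * (a + 2)"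
      by (simp_all only: le_floor_iff floor_less_iff)
    then show ?thesis by (simp add: algebra_simps)
  qed
  have kr: "k j \<in> {- (2 ^ j)..<2 * 2 ^ j} \<times> {- (2 ^ j)..<2 * 2 ^ j}" for j
    using p rng[of "fst z" "p $ 1" j] rng[of "snd z" "p $ 2" j] by (simp add: k_def king_def cell_def)
  have x0: "\<bar>h (x 0)\<bar> < m / 8"
    using corner_test_less[OF good, of "k 0"] kr[of 0] by (auto simp: x_def)
  have inc: "\<bar>h (x (Suc j)) - h (x j)\<bar> \<le> m / 8 * (3 / 4) ^ j" for j
  proof -
    define d where "d = (\<lfloor>2 ^ Suc j * p $ 1\<rfloor> - 2 * \<lfloor>2 ^ j * p $ 1\<rfloor>, \<lfloor>2 ^ Suc j * p $ 2\<rfloor> - 2 * \<lfloor>2 ^ j * p $ 2\<rfloor>)"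
    have "\<lfloor>2 * t\<rfloor> - 2 * \<lfloor>t\<rfloor> \<in> {0, 1}" for t :: real by (simp; linarith)
    from this[of "2 ^ j * p $ 1"] this[of "2 ^ j * p $ 2"] have d: "d \<in> {0, 1} \<times> {0, 1}"
      by (simp add: d_def mult.assoc) blast
    have "x (Suc j) = cell_corner z + ((1 / 2 ^ j) *\<^sub>R cell_corner (k j) + (1 / 2 ^ Suc j) *\<^sub>R cell_corner d)"
      by (simp add: vec_eq_iff forall_2 xi d_def k_def field_simps)
    then show ?thesis using increment_test_less[OF good kr d] by (simp add: x_def)
  qed
  have "\<bar>h (x n)\<bar> \<le> m" for n
  proof -
    have "\<bar>h (x n) - h (x 0)\<bar> \<le> (\<Sum>j<n. m / 8 * (3 / 4) ^ j)"
    proof (induction n)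
      case (Suc n)
      then show ?case using inc[of n] unfolding sum.lessThan_Suc by linarith
    qed simp
    also have "\<dots> = m / 8 * (\<Sum>j<n. (3 / 4) ^ j)" by (simp add: sum_distrib_left)
    also have "(\<Sum>j<n. (3 / 4 :: real) ^ j) \<le> 4" by (simp add: sum_gp_strict)
    finally have "\<bar>h (x n) - h (x 0)\<bar> \<le> m / 2" using m by simp
    then show ?thesis using x0 by linarith
  qed
  moreover have "(\<lambda>n. h (x n)) \<longlonglongrightarrow> h p"
  proof -
    have "(\<lambda>j. of_int \<lfloor>2 ^ j * t\<rfloor> / 2 ^ j) \<longlonglongrightarrow> t" for t :: real
    proof (rule tendsto_sandwich[of "\<lambda>j. t - (1 / 2) ^ j" _ _ "\<lambda>_. t"])
      have "(2 ^ j * t - 1) / 2 ^ j \<le> of_int \<lfloor>2 ^ j * t\<rfloor> / 2 ^ j" for j :: nat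
        by (intro divide_right_mono) (linarith, simp)
      then show "eventually (\<lambda>j. t - (1 / 2) ^ j \<le> of_int \<lfloor>2 ^ j * t\<rfloor> / 2 ^ j) sequentially"
        by (intro always_eventually allI) (simp add: diff_divide_distrib power_one_over)
      have "of_int \<lfloor>2 ^ j * t\<rfloor> / 2 ^ j \<le> (2 ^ j * t) / 2 ^ j" for j :: nat
        by (intro divide_right_mono) auto
      then show "eventually (\<lambda>j. of_int \<lfloor>2 ^ j * t\<rfloor> / 2 ^ j \<le> t) sequentially"
        by (intro always_eventually allI) simp
      have "(\<lambda>j. t - (1 / 2) ^ j) \<longlonglongrightarrow> t - 0" by (intro tendsto_intros LIMSEQ_realpow_zero) auto
      then show "(\<lambda>j. t - (1 / 2) ^ j) \<longlonglongrightarrow> t" by simp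
    qed simp
    note fl = this
    have "x \<longlonglongrightarrow> p"
    proof (rule vec_tendstoI)
      fix i :: 2
      show "(\<lambda>j. x j $ i) \<longlonglongrightarrow> p $ i" using exhaust_2[of i] fl by (auto simp: xi)
    qed
    then show ?thesis
      by (rule continuous_on_tendsto_compose[OF h]) auto
  qed
  ultimately show ?thesis
    by (intro LIMSEQ_le_const2[OF tendsto_rabs]) auto
qed

text \<open>A union bound over the choice of one test for each cell. The choices are infinitely
  many, so instead of summing over all of them at once the induction fixes the test of one further
  cell at a time, moving the cell from \<open>S\<close> to \<open>S1\<close>; each cell contributes
  the factor \<open>p\<close>.\<close>

lemma (in prob_space) prob_ball_bex_le:
  fixes A :: "'z \<Rightarrow> nat \<Rightarrow> 'i \<Rightarrow> 'a \<Rightarrow> bool" and F :: "nat \<Rightarrow> 'i set"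
  assumes A: "\<And>z j \<tau>. {\<omega> \<in> space M. A z j \<tau> \<omega>} \<in> events" and F: "\<And>j. finite (F j)"
    and a: "\<And>j. 0 \<le> a j" and p: "(\<lambda>j. real (card (F j)) * a j) sums p"
    and prob: "\<And>S j \<tau>. finite S \<Longrightarrow> (\<And>z. z \<in> S \<Longrightarrow> \<tau> z \<in> F (j z)) \<Longrightarrow>
      prob {\<omega> \<in> space M. \<forall>z\<in>S. A z (j z) (\<tau> z) \<omega>} \<le> (\<Prod>z\<in>S. a (j z))"
    and S: "finite S"
  shows "prob {\<omega> \<in> space M. \<forall>z\<in>S. \<exists>j. \<exists>\<tau>\<in>F j. A z j \<tau> \<omega>} \<le> p ^ card S"
proof -
  have m1: "{\<omega> \<in> space M. \<forall>z\<in>S. A z (j z) (\<tau> z) \<omega>} \<in> events" if "finite S" for S j \<tau>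
    using A that by (intro sets.sets_Collect_finite_All) auto
  have m2: "{\<omega> \<in> space M. \<forall>z\<in>S. \<exists>j. \<exists>\<tau>\<in>F j. A z j \<tau> \<omega>} \<in> events" if "finite S" for S
    using A F that by (intro sets.sets_Collect_finite_All sets.sets_Collect_countable_Ex sets.sets_Collect_finite_Ex) auto
  have m12: "{\<omega> \<in> space M. (\<forall>z\<in>S. A z (j z) (\<tau> z) \<omega>) \<and> (\<forall>z\<in>S'. \<exists>j. \<exists>\<tau>\<in>F j. A z j \<tau> \<omega>)} \<in> events"
    if "finite S" "finite S'" for S S' j \<tau>
    by (intro sets.sets_Collect_conj m1 m2 that)
  have "prob {\<omega> \<in> space M. (\<forall>z\<in>S1. A z (j z) (\<tau> z) \<omega>) \<and> (\<forall>z\<in>S. \<exists>j. \<exists>\<tau>\<in>F j. A z j \<tau> \<omega>)} \<le> (\<Prod>z\<in>S1. a (j z)) * p ^ card S"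
    if "finite S1" "S1 \<inter> S = {}" "\<And>z. z \<in> S1 \<Longrightarrow> \<tau> z \<in> F (j z)" for S1 j \<tau>
    using S that
  proof (induction S arbitrary: S1 j \<tau> rule: finite_induct)
    case empty
    then show ?case using prob[of S1 \<tau> j] by simp
  next
    case (insert y S)
    define P where "P = (\<Prod>z\<in>S1. a (j z)) * p ^ card S"
    have p0: "0 \<le> p" by (rule sums_le[OF _ sums_zero p]) (simp add: a)
    have P0: "0 \<le> P" unfolding P_def using a p0 by (intro mult_nonneg_nonneg prod_nonneg) auto
    \<comment> \<open>The cell \<open>y\<close> receives the test \<open>\<sigma>\<close> of level
      \<open>i\<close> and joins the cells with fixed tests.\<close>
    define E where "E i \<sigma> = {\<omega> \<in> space M. (\<forall>z\<in>insert y S1. A z ((j(y := i)) z) ((\<tau>(y := \<sigma>)) z) \<omega>) \<and> (\<forall>z\<in>S. \<exists>j. \<exists>\<tau>\<in>F j. A z j \<tau> \<omega>)}" for i \<sigma>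
    have Em: "E i \<sigma> \<in> events" for i \<sigma>
      unfolding E_def using insert.prems insert.hyps by (intro m12) auto
    have y: "y \<notin> S1" "y \<notin> S" using insert.prems insert.hyps by auto
    have Ep: "prob (E i \<sigma>) \<le> a i * P" if "\<sigma> \<in> F i" for i \<sigma>
    proof -
      have "prob (E i \<sigma>) \<le> (\<Prod>z\<in>insert y S1. a ((j(y := i)) z)) * p ^ card S"
        unfolding E_def by (rule insert.IH) (use insert.prems insert.hyps that in auto)
      also have "(\<Prod>z\<in>insert y S1. a ((j(y := i)) z)) = a i * (\<Prod>z\<in>S1. a (j z))"
        using insert.prems y by (subst prod.insert) (auto intro!: prod.cong)
      finally show ?thesis by (simp add: P_def mult.assoc)
    qed
    define U where "U i = (\<Union>\<sigma>\<in>F i. E i \<sigma>)" for i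
    have Um: "U i \<in> events" for i unfolding U_def using F Em by auto
    have Up: "prob (U i) \<le> real (card (F i)) * a i * P" for i
    proof -
      have "prob (U i) \<le> (\<Sum>\<sigma>\<in>F i. prob (E i \<sigma>))"
        unfolding U_def using F Em by (intro finite_measure_subadditive_finite) auto
      also have "\<dots> \<le> (\<Sum>\<sigma>\<in>F i. a i * P)" using Ep by (intro sum_mono)
      finally show ?thesis by (simp add: mult.assoc)
    qed
    have sm: "(\<lambda>i. real (card (F i)) * a i * P) sums (p * P)" by (rule sums_mult2[OF p])
    have smU: "summable (\<lambda>i. prob (U i))"
      by (rule summable_comparison_test'[OF sums_summable[OF sm], of 0]) (use Up in simp)
    have "{\<omega> \<in> space M. (\<forall>z\<in>S1. A z (j z) (\<tau> z) \<omega>) \<and> (\<forall>z\<in>insert y S. \<exists>j. \<exists>\<tau>\<in>F j. A z j \<tau> \<omega>)} \<subseteq> (\<Union>i. U i)"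
    proof
      fix \<omega> assume \<omega>: "\<omega> \<in> {\<omega> \<in> space M. (\<forall>z\<in>S1. A z (j z) (\<tau> z) \<omega>) \<and> (\<forall>z\<in>insert y S. \<exists>j. \<exists>\<tau>\<in>F j. A z j \<tau> \<omega>)}"
      then obtain i \<sigma> where "\<sigma> \<in> F i" "A y i \<sigma> \<omega>" by blast
      moreover have "\<forall>z\<in>S1. z \<noteq> y" using y by auto
      ultimately have "\<omega> \<in> E i \<sigma>" using \<omega> by (auto simp: E_def)
      then show "\<omega> \<in> (\<Union>i. U i)" using \<open>\<sigma> \<in> F i\<close> by (auto simp: U_def)
    qed
    then have "prob {\<omega> \<in> space M. (\<forall>z\<in>S1. A z (j z) (\<tau> z) \<omega>) \<and> (\<forall>z\<in>insert y S. \<exists>j. \<exists>\<tau>\<in>F j. A z j \<tau> \<omega>)} \<le> prob (\<Union>i. U i)"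
      using Um by (intro finite_measure_mono) auto
    also have "\<dots> \<le> (\<Sum>i. prob (U i))"
      using Um smU by (intro finite_measure_subadditive_countably) auto
    also have "\<dots> \<le> p * P"
      using suminf_le[OF Up smU sums_summable[OF sm]] sums_unique[OF sm] by simp
    finally show ?case using y insert.hyps by (simp add: P_def mult_ac)
  qed
  from this[of "{}"] show ?thesis by simp
qed

section \<open>Counting walks of cells\<close>

lemma king_continuations:
  "finite {zs. length zs = n \<and> successively king (z # zs)} \<and> card {zs. length zs = n \<and> successively king (z # zs)} \<le> 9 ^ n"
proof (induction n arbitrary: z)
  case 0
  have "{zs. length zs = 0 \<and> successively king (z # zs)} = {[]}" by auto
  then show ?case by simp
next
  case (Suc n)
  let ?L = "\<lambda>n z. {zs. length zs = n \<and> successively king (z # zs)}"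
  let ?K = "{u. king u z}"
  have ks: "king u z \<longleftrightarrow> king z u" for u by (auto simp: king_def abs_minus_commute)
  have sub: "?L (Suc n) z \<subseteq> (\<Union>u\<in>?K. (#) u ` ?L n u)"
  proof
    fix zs assume "zs \<in> ?L (Suc n) z"
    then obtain u us where "zs = u # us" "length us = n" "king z u" "successively king (u # us)"
      by (cases zs) auto
    then show "zs \<in> (\<Union>u\<in>?K. (#) u ` ?L n u)" using ks by (intro UN_I[of u] image_eqI[of _ _ us]) auto
  qed
  have fin: "finite (\<Union>u\<in>?K. (#) u ` ?L n u)" using finite_king Suc by auto
  have "card (\<Union>u\<in>?K. (#) u ` ?L n u) \<le> (\<Sum>u\<in>?K. card ((#) u ` ?L n u))"
    by (rule card_UN_le[OF finite_king])
  also have "\<dots> \<le> (\<Sum>u\<in>?K. 9 ^ n)"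
    by (intro sum_mono order_trans[OF card_image_le]) (use Suc in blast)+
  also have "\<dots> \<le> 9 * 9 ^ n" using card_king[of z] by simp
  finally have "card (\<Union>u\<in>?K. (#) u ` ?L n u) \<le> 9 ^ Suc n" by simp
  then show ?case using finite_subset[OF sub fin] card_mono[OF fin sub] by (meson order_trans)
qed

lemma finite_king_walks: "finite (king_walks n)" and card_king_walks: "card (king_walks n) \<le> 9 ^ n"
proof -
  have "finite (king_walks n) \<and> card (king_walks n) \<le> 9 ^ n"
  proof (cases n)
    case 0
    then have "king_walks n \<subseteq> {[]}" by (auto simp: king_walks_def)
    then have "finite (king_walks n)" "card (king_walks n) \<le> card {[] :: (int \<times> int) list}"
      by (auto intro: finite_subset simp del: card.insert intro!: card_mono)
    then show ?thesis using 0 by simp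
  next
    case (Suc k)
    let ?L = "{zs. length zs = k \<and> successively king ((0, 0) # zs)}"
    have sub: "king_walks n \<subseteq> (#) (0, 0) ` ?L"
    proof
      fix zs assume "zs \<in> king_walks n"
      then show "zs \<in> (#) (0, 0) ` ?L" using Suc by (cases zs) (auto simp: king_walks_def)
    qed
    have fin: "finite ((#) (0, 0) ` ?L)" using king_continuations by blast
    have "card ((#) (0, 0) ` ?L) \<le> card ?L" using king_continuations by (intro card_image_le) blast
    also have "\<dots> \<le> 9 ^ k" using king_continuations by blast
    also have "(9 :: nat) ^ k \<le> 9 ^ n" using Suc by simp
    finally show ?thesis using finite_subset[OF sub fin] card_mono[OF fin sub] by (meson order_trans)
  qed
  then show "finite (king_walks n)" "card (king_walks n) \<le> 9 ^ n" by auto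
qed

section \<open>Bad cells are rare\<close>

context decaying_field
begin

lemma test_measurable[measurable]: "(\<lambda>\<omega>. test_value (\<lambda>p. f p \<omega>) z \<tau>) \<in> borel_measurable M"
  unfolding test_value_def by (cases \<tau>) simp

lemma bad_cell_measurable[measurable]: "{\<omega> \<in> space M. bad_cell m (\<lambda>p. f p \<omega>) z} \<in> events"
  unfolding bad_cell_def
  by (intro sets.sets_Collect_countable_Ex sets.sets_Collect_finite_Ex finite_cell_tests) measurable

text \<open>A corner test shifts the envelope by at most 1 in each coordinate. An increment test is
  a difference over a length of at most \<open>1 / 2 ^ j\<close>, which cancels its factor
  \<open>2 ^ j\<close>, so the bound does not depend on \<open>j\<close>.\<close>

lemma test_localised:
  assumes K: "0 < K" "\<And>x. \<bar>q x\<bar> \<le> K * envelope x" "\<And>i x. \<bar>partial i q x\<bar> \<le> K * envelope x"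
    and \<tau>: "(\<alpha>, u, \<beta>, v) \<in> cell_tests j"
  shows "\<bar>\<alpha> * q (cell_corner z + u - y) + \<beta> * q (cell_corner z + v - y)\<bar> \<le> 2312 * K * envelope (y - cell_corner z)"
proof -
  consider (corner) k s where "k \<in> {-1..1} \<times> {-1..1}" "s \<in> {-1, 1}" "\<alpha> = s" "u = cell_corner k" "\<beta> = 0"
    | (inc) k d s where "k \<in> {- (2 ^ j)..<2 * 2 ^ j} \<times> {- (2 ^ j)..<2 * 2 ^ j}" "d \<in> {0, 1} \<times> {0, 1}" "s \<in> {-1, 1}"
      "\<alpha> = s * 2 ^ j" "u = (1 / 2 ^ j) *\<^sub>R cell_corner k + (1 / 2 ^ Suc j) *\<^sub>R cell_corner d" "\<beta> = - (s * 2 ^ j)"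
      "v = (1 / 2 ^ j) *\<^sub>R cell_corner k"
  proof -
    assume c: "\<And>k s. k \<in> {-1..1} \<times> {-1..1} \<Longrightarrow> s \<in> {-1, 1} \<Longrightarrow> \<alpha> = s \<Longrightarrow> u = cell_corner k \<Longrightarrow> \<beta> = 0 \<Longrightarrow> thesis"
      and i: "\<And>k d s. k \<in> {- (2 ^ j)..<2 * 2 ^ j} \<times> {- (2 ^ j)..<2 * 2 ^ j} \<Longrightarrow> d \<in> {0, 1} \<times> {0, 1} \<Longrightarrow> s \<in> {-1, 1} \<Longrightarrow>
        \<alpha> = s * 2 ^ j \<Longrightarrow> u = (1 / 2 ^ j) *\<^sub>R cell_corner k + (1 / 2 ^ Suc j) *\<^sub>R cell_corner d \<Longrightarrow> \<beta> = - (s * 2 ^ j) \<Longrightarrow>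
        v = (1 / 2 ^ j) *\<^sub>R cell_corner k \<Longrightarrow> thesis"
    from \<tau> have "(\<alpha>, u, \<beta>, v) \<in> increment_tests j \<or> (\<alpha>, u, \<beta>, v) \<in> corner_tests"
      by (simp add: cell_tests_def split: if_split_asm)
    then show thesis
    proof
      assume "(\<alpha>, u, \<beta>, v) \<in> increment_tests j"
      then show thesis unfolding increment_tests_def
      proof (rule imageE)
        fix x :: "(int \<times> int) \<times> (int \<times> int) \<times> real"
        obtain k d s where x: "x = (k, d, s)" by (rule prod_cases3)
        assume "(\<alpha>, u, \<beta>, v) = (case x of (k, d, s) \<Rightarrow> (s * 2 ^ j, (1 / 2 ^ j) *\<^sub>R cell_corner k + (1 / 2 ^ Suc j) *\<^sub>R cell_corner d,
            - (s * 2 ^ j), (1 / 2 ^ j) *\<^sub>R cell_corner k))"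
          "x \<in> ({- (2 ^ j)..<2 * 2 ^ j} \<times> {- (2 ^ j)..<2 * 2 ^ j}) \<times> ({0, 1} \<times> {0, 1}) \<times> {-1, 1}"
        then show thesis unfolding x mem_Times_iff[of "(k, d, s)"] mem_Times_iff[of "(d, s)"] fst_conv snd_conv prod.case prod.inject
          by (intro i[of k d s]) (simp_all only:)
      qed
    next
      assume "(\<alpha>, u, \<beta>, v) \<in> corner_tests"
      then show thesis unfolding corner_tests_def
      proof (rule imageE)
        fix x :: "(int \<times> int) \<times> real"
        obtain k s where x: "x = (k, s)" by (cases x)
        assume "(\<alpha>, u, \<beta>, v) = (case x of (k, s) \<Rightarrow> (s, cell_corner k, 0, 0))" "x \<in> ({-1..1} \<times> {-1..1}) \<times> {-1, 1}"
        then show thesis unfolding x mem_Times_iff[of "(k, s)"] fst_conv snd_conv prod.case prod.inject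
          by (intro c[of k s]) (simp_all only:)
      qed
    qed
  qed
  then show ?thesis
  proof cases
    case corner
    have "\<bar>q (cell_corner z + u - y)\<bar> \<le> K * envelope (cell_corner z + u - y)" by (rule K(2))
    also have "\<dots> \<le> K * (1156 * envelope (cell_corner z - y))"
    proof (intro mult_left_mono envelope_shift)
      fix i :: 2
      show "\<bar>(cell_corner z + u - y) $ i - (cell_corner z - y) $ i\<bar> \<le> 4"
        using exhaust_2[of i] corner by auto
    qed (use K in simp)
    also have "envelope (cell_corner z - y) = envelope (y - cell_corner z)"
      using envelope_uminus[of "y - cell_corner z"] by simp
    finally have "\<bar>q (cell_corner z + u - y)\<bar> \<le> 1156 * (K * envelope (y - cell_corner z))" by (simp add: mult_ac)
    moreover have "0 \<le> K * envelope (y - cell_corner z)" using K(1) envelope_pos by (simp add: less_imp_le)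
    moreover have "\<bar>\<alpha> * q (cell_corner z + u - y) + \<beta> * q (cell_corner z + v - y)\<bar> = \<bar>q (cell_corner z + u - y)\<bar>"
      using corner by auto
    ultimately show ?thesis by simp
  next
    case inc
    let ?a = "cell_corner z + v" and ?b = "cell_corner z + u"
    \<comment> \<open>At most 2 for the dyadic point and at most 1 for the increment, so the segment
      stays within 3 of the corner in each coordinate.\<close>
    have box: "\<bar>p $ i - cell_corner z $ i\<bar> \<le> 4" if p: "p \<in> closed_segment ?a ?b" for p i
    proof -
      have v: "\<bar>v $ i\<bar> \<le> 2"
      proof -
        have "\<bar>real_of_int a\<bar> \<le> 2 * 2 ^ j" if "\<bar>a\<bar> \<le> 2 * 2 ^ j" for a :: int
        proof -
          have "real_of_int \<bar>a\<bar> \<le> real_of_int (2 * 2 ^ j)" using that by (simp only: of_int_le_iff)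
          then show ?thesis by simp
        qed
        moreover have "\<bar>fst k\<bar> \<le> 2 * 2 ^ j" "\<bar>snd k\<bar> \<le> 2 * 2 ^ j" using inc(1) by auto
        ultimately have "\<bar>real_of_int (fst k)\<bar> \<le> 2 * 2 ^ j" "\<bar>real_of_int (snd k)\<bar> \<le> 2 * 2 ^ j" by blast+
        then show ?thesis using exhaust_2[of i] inc(7) by (auto simp: abs_mult divide_le_eq)
      qed
      have d: "\<bar>u $ i - v $ i\<bar> \<le> 1"
      proof -
        have "(1 :: real) \<le> 2 ^ Suc j" by (rule one_le_power) simp
        then show ?thesis using exhaust_2[of i] inc(2) unfolding inc(5,7) by auto
      qed
      from p obtain s where s: "0 \<le> s" "s \<le> 1" "p = (1 - s) *\<^sub>R ?a + s *\<^sub>R ?b" by (auto simp: in_segment)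
      have "p $ i - cell_corner z $ i = v $ i + s * (u $ i - v $ i)" unfolding s(3) by (simp add: algebra_simps)
      moreover have "\<bar>s * (u $ i - v $ i)\<bar> \<le> 1 * 1" unfolding abs_mult using s d by (intro mult_mono) auto
      ultimately show ?thesis using v by linarith
    qed
    have len: "norm (?b - ?a) \<le> 1 / 2 ^ j"
    proof -
      have "norm (?b - ?a) = (1 / 2 ^ Suc j) * norm (cell_corner d)" unfolding inc(5,7) by simp
      also have "norm (cell_corner d) \<le> 2"
        using norm_le_l1_cart[of "cell_corner d"] inc(2) by (auto simp: sum_2)
      finally show ?thesis by (simp add: field_simps mult_left_mono)
    qed
    have "\<bar>q (?b - y) - q (?a - y)\<bar> \<le> 2312 * K * envelope (y - cell_corner z) * norm (?b - ?a)"
      by (rule q_increment[OF K(3,1) box])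
    also have "\<dots> \<le> 2312 * K * envelope (y - cell_corner z) * (1 / 2 ^ j)"
      using len K(1) envelope_pos by (intro mult_left_mono) (simp_all add: less_imp_le)
    finally have "2 ^ j * \<bar>q (?b - y) - q (?a - y)\<bar> \<le> 2312 * K * envelope (y - cell_corner z)"
      by (simp add: field_simps)
    moreover have "\<alpha> * q (?b - y) + \<beta> * q (?a - y) = s * (2 ^ j * (q (?b - y) - q (?a - y)))"
      unfolding inc(4,6) by (simp add: algebra_simps)
    moreover have "\<bar>s * (2 ^ j * (q (?b - y) - q (?a - y)))\<bar> = 2 ^ j * \<bar>q (?b - y) - q (?a - y)\<bar>"
      using inc(3) by (auto simp: abs_mult)
    ultimately show ?thesis by simp
  qed
qed

text \<open>Each test is weighted with its own threshold \<open>t z\<close>. If all tests reach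
  their thresholds, the weighted sum reaches the sum of the squared thresholds, while its variance
  is at most \<open>C\<close> times that sum. Chernoff's bound is then the exponential of a sum over
  the cells, a product as for independent cells.\<close>

lemma prob_tests_le:
  "\<exists>C>0. \<forall>m>0. \<forall>S j \<tau>. finite S \<longrightarrow> (\<forall>z\<in>S. \<tau> z \<in> cell_tests (j z)) \<longrightarrow>
    prob {\<omega> \<in> space M. \<forall>z\<in>S. m / 8 * (3 / 2) ^ j z \<le> test_value (\<lambda>p. f p \<omega>) z (\<tau> z)}
      \<le> (\<Prod>z\<in>S. exp (- ((m / 8 * (3 / 2) ^ j z)\<^sup>2 / (2 * C))))"
proof -
  obtain K where K: "0 < K" "\<And>x. \<bar>q x\<bar> \<le> K * envelope x" "\<And>i x. \<bar>partial i q x\<bar> \<le> K * envelope x"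
    by (rule decay_envelope) (rule that; assumption)
  define A where "A = 2312 * K"
  define C where "C = 28900 * A\<^sup>2 * (\<integral>y. envelope y \<partial>lborel) + 1"
  have I0: "0 \<le> (\<integral>y. envelope y \<partial>lborel)" by (intro integral_nonneg_AE AE_I2 less_imp_le envelope_pos)
  have C: "0 < C" using I0 by (simp add: C_def add_nonneg_pos)
  have "prob {\<omega> \<in> space M. \<forall>z\<in>S. m / 8 * (3 / 2) ^ j z \<le> test_value (\<lambda>p. f p \<omega>) z (\<tau> z)}
      \<le> (\<Prod>z\<in>S. exp (- ((m / 8 * (3 / 2) ^ j z)\<^sup>2 / (2 * C))))"
    if m: "0 < m" and S: "finite S" and \<tau>: "\<forall>z\<in>S. \<tau> z \<in> cell_tests (j z)" for m S j \<tau>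
  proof -
    define t where "t z = m / 8 * (3 / 2) ^ j z" for z
    have t0: "0 \<le> t z" for z using m by (simp add: t_def)
    define \<alpha> where "\<alpha> z = fst (\<tau> z)" for z
    define u where "u z = cell_corner z + fst (snd (\<tau> z))" for z
    define \<beta> where "\<beta> z = fst (snd (snd (\<tau> z)))" for z
    define v where "v z = cell_corner z + snd (snd (snd (\<tau> z)))" for z
    have tv: "test_value h z (\<tau> z) = \<alpha> z * h (u z) + \<beta> z * h (v z)" for h z
      by (simp add: test_value_def \<alpha>_def u_def \<beta>_def v_def split_def)
    have loc: "\<bar>\<alpha> z * q (u z - y) + \<beta> z * q (v z - y)\<bar> \<le> A * envelope (y - cell_corner z)" if "z \<in> S" for z y
      unfolding \<alpha>_def u_def \<beta>_def v_def A_def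
      by (rule test_localised[OF K, of _ _ _ _ "j z"]) (use \<tau> that in simp)
    have A0: "0 \<le> A" using K by (simp add: A_def)
    let ?X = "\<lambda>\<omega>. \<Sum>z\<in>S. t z * (\<alpha> z * f (u z) \<omega> + \<beta> z * f (v z) \<omega>)"
    note sm = second_moment_localised[OF S A0 loc, of t]
    have T0: "0 \<le> (\<Sum>z\<in>S. (t z)\<^sup>2)" by (intro sum_nonneg) simp
    have "prob {\<omega> \<in> space M. \<forall>z\<in>S. t z \<le> test_value (\<lambda>p. f p \<omega>) z (\<tau> z)} \<le> prob {\<omega> \<in> space M. (\<Sum>z\<in>S. (t z)\<^sup>2) \<le> ?X \<omega>}"
    proof (rule finite_measure_mono)
      show "{\<omega> \<in> space M. \<forall>z\<in>S. t z \<le> test_value (\<lambda>p. f p \<omega>) z (\<tau> z)} \<subseteq> {\<omega> \<in> space M. (\<Sum>z\<in>S. (t z)\<^sup>2) \<le> ?X \<omega>}"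
        using t0 by (auto simp: tv power2_eq_square intro!: sum_mono mult_left_mono)
      show "{\<omega> \<in> space M. (\<Sum>z\<in>S. (t z)\<^sup>2) \<le> ?X \<omega>} \<in> events" by measurable
    qed
    also have "\<dots> \<le> exp (- (\<Sum>z\<in>S. (t z)\<^sup>2) / (2 * C))"
    proof (rule centered_gaussian_tail[OF sm(2,3) _ C T0])
      have "28900 * A\<^sup>2 * (\<integral>y. envelope y \<partial>lborel) * (\<Sum>z\<in>S. (t z)\<^sup>2) \<le> C * (\<Sum>z\<in>S. (t z)\<^sup>2)"
        using T0 by (intro mult_right_mono) (simp_all add: C_def)
      then show "expectation (\<lambda>\<omega>. (?X \<omega>)\<^sup>2) \<le> C * (\<Sum>z\<in>S. (t z)\<^sup>2)" using sm(1) by (rule order_trans[rotated])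
    qed
    also have "\<dots> = (\<Prod>z\<in>S. exp (- ((t z)\<^sup>2 / (2 * C))))"
      by (simp add: exp_sum[OF S, symmetric] sum_negf sum_divide_distrib)
    finally show ?thesis by (simp add: t_def)
  qed
  then show ?thesis using C by blast
qed

text \<open>Per cell, the union bound costs the sum over \<open>j\<close> of at most
  \<open>90 * 4 ^ j\<close> tests times \<open>exp (- y)\<close>, with \<open>y\<close> proportional
  to \<open>m\<^sup>2 * (9 / 4) ^ j\<close>. Since \<open>(9 / 4) ^ 3\<close> exceeds 4, the
  estimate \<open>exp (- y) \<le> 6 / y ^ 3\<close> turns this into a geometric series that is small
  for large \<open>m\<close>.\<close>

lemma prob_all_bad_le:
  assumes "0 < \<delta>"
  shows "\<exists>m>0. \<forall>S. finite S \<longrightarrow> prob {\<omega> \<in> space M. \<forall>z\<in>S. bad_cell m (\<lambda>p. f p \<omega>) z} \<le> \<delta> ^ card S"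
proof -
  obtain C where C: "0 < C" and P0: "\<forall>m>0. \<forall>S j \<tau>. finite S \<longrightarrow> (\<forall>z\<in>S. \<tau> z \<in> cell_tests (j z)) \<longrightarrow>
    prob {\<omega> \<in> space M. \<forall>z\<in>S. m / 8 * (3 / 2) ^ j z \<le> test_value (\<lambda>p. f p \<omega>) z (\<tau> z)}
      \<le> (\<Prod>z\<in>S. exp (- ((m / 8 * (3 / 2) ^ j z)\<^sup>2 / (2 * C))))"
    using prob_tests_le by (elim exE conjE) (rule that)
  note P = P0[rule_format]
  \<comment> \<open>\<open>540 = 90 * 6\<close> comes from the number of tests and from
    \<open>6 / y ^ 3\<close>; \<open>128 = 64 * 2\<close> from the square of \<open>m / 8\<close>
    and from \<open>2 * C\<close> in the tail bound.\<close>
  define B where "B = 540 * (128 * C) ^ 3"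
  have B: "0 < B" using C by (simp add: B_def)
  define m where "m = max 1 (2 * B / \<delta>)"
  have m: "1 \<le> m" "2 * B / \<delta> \<le> m" by (simp_all add: m_def)
  have m0: "0 < m" using m by simp
  define a where "a j = exp (- ((m / 8 * (3 / 2) ^ j)\<^sup>2 / (2 * C)))" for j :: nat
  have bound: "real (card (cell_tests j)) * a j \<le> B / m * (256 / 729) ^ j" for j
  proof -
    define y where "y = (m / 8 * (3 / 2) ^ j)\<^sup>2 / (2 * C)"
    have y: "y = m\<^sup>2 * (9 / 4) ^ j / (128 * C)"
    proof -
      have "((3 / 2 :: real) ^ j)\<^sup>2 = ((3 / 2)\<^sup>2) ^ j" by (simp only: power_mult[symmetric] mult.commute)
      then have "((3 / 2 :: real) ^ j)\<^sup>2 = (9 / 4) ^ j" by (simp add: power2_eq_square)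
      then have e: "(m / 8 * (3 / 2) ^ j)\<^sup>2 = m\<^sup>2 / 64 * (9 / 4) ^ j"
        unfolding power_mult_distrib by (simp add: power_divide)
      show ?thesis unfolding y_def e by simp
    qed
    have y0: "0 < y" using m0 C by (simp add: y)
    have "y ^ 3 / 6 \<le> exp y"
    proof -
      have "(\<Sum>k\<in>{3}. y ^ k /\<^sub>R fact k) \<le> (\<Sum>k. y ^ k /\<^sub>R fact k)"
        by (rule sum_le_suminf[OF summable_exp_generic]) (use y0 in auto)
      moreover have "fact 3 = (6 :: real)" by (simp add: eval_nat_numeral)
      moreover have "(\<Sum>k. y ^ k /\<^sub>R fact k) = exp y" by (simp only: exp_def)
      ultimately have "inverse 6 * y ^ 3 \<le> exp y" by simp
      then show ?thesis by (simp only: divide_inverse mult.commute[of "inverse 6"])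
    qed
    then have "exp (- y) \<le> 6 / y ^ 3" using y0 by (simp add: exp_minus field_simps)
    also have "6 / y ^ 3 = 6 * (128 * C) ^ 3 / (m ^ 6 * ((9 / 4) ^ j) ^ 3)"
      using m0 C by (simp add: y power_divide power_mult_distrib power_mult[symmetric])
    also have "\<dots> \<le> 6 * (128 * C) ^ 3 / (m * ((9 / 4) ^ j) ^ 3)"
    proof (intro divide_left_mono mult_right_mono)
      show "m \<le> m ^ 6" using power_increasing[of 1 6 m] m by simp
    qed (use C m0 in auto)
    finally have "a j \<le> 6 * (128 * C) ^ 3 / (m * ((9 / 4) ^ j) ^ 3)" by (simp add: a_def y_def)
    then have "real (card (cell_tests j)) * a j \<le> (90 * 4 ^ j) * (6 * (128 * C) ^ 3 / (m * ((9 / 4) ^ j) ^ 3))"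
      using card_cell_tests[of j] by (intro mult_mono) (auto simp: a_def)
    also have "\<dots> = B / m * (4 ^ j / ((9 / 4) ^ j) ^ 3)" by (simp add: B_def)
    also have "4 ^ j / ((9 / 4 :: real) ^ j) ^ 3 = (256 / 729) ^ j"
    proof -
      have "((9 / 4 :: real) ^ j) ^ 3 = (729 / 64) ^ j"
        by (simp add: power_mult[symmetric] mult.commute[of j]) (simp add: power_mult power_divide)
      then show ?thesis by (simp add: power_divide[symmetric])
    qed
    finally show ?thesis .
  qed
  have gs: "(\<lambda>j. B / m * (256 / 729) ^ j) sums (B / m * (1 / (1 - 256 / 729)))"
    by (intro sums_mult geometric_sums) simp
  have sm: "summable (\<lambda>j. real (card (cell_tests j)) * a j)"
    by (rule summable_comparison_test'[OF sums_summable[OF gs], of 0]) (use bound in \<open>simp add: a_def\<close>)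
  define p where "p = (\<Sum>j. real (card (cell_tests j)) * a j)"
  have p0: "0 \<le> p" unfolding p_def by (rule suminf_nonneg[OF sm]) (simp add: a_def)
  have "p \<le> B / m * (1 / (1 - 256 / 729))"
    unfolding p_def using suminf_le[OF bound sm sums_summable[OF gs]] sums_unique[OF gs] by simp
  \<comment> \<open>The sum of the geometric series with ratio \<open>256 / 729\<close> is below
    2.\<close>
  also have "\<dots> \<le> 2 * B / m" using B m0 by (simp add: field_simps)
  also have "\<dots> \<le> \<delta>" using m m0 assms by (simp add: field_simps)
  finally have p: "p \<le> \<delta>" .
  have "prob {\<omega> \<in> space M. \<forall>z\<in>S. bad_cell m (\<lambda>p. f p \<omega>) z} \<le> \<delta> ^ card S" if "finite S" for S
  proof -
    have "prob {\<omega> \<in> space M. \<forall>z\<in>S. \<exists>j. \<exists>\<tau>\<in>cell_tests j. m / 8 * (3 / 2) ^ j \<le> test_value (\<lambda>p. f p \<omega>) z \<tau>} \<le> p ^ card S"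
    proof (rule prob_ball_bex_le[where a=a])
      show "(\<lambda>j. real (card (cell_tests j)) * a j) sums p" unfolding p_def by (rule summable_sums[OF sm])
      show "prob {\<omega> \<in> space M. \<forall>z\<in>S. m / 8 * (3 / 2) ^ j z \<le> test_value (\<lambda>p. f p \<omega>) z (\<tau> z)} \<le> (\<Prod>z\<in>S. a (j z))"
        if "finite S" "\<And>z. z \<in> S \<Longrightarrow> \<tau> z \<in> cell_tests (j z)" for S j \<tau>
        unfolding a_def by (rule P[OF m0]) (use that in auto)
    qed (use finite_cell_tests that in \<open>auto simp: a_def\<close>)
    also have "\<dots> \<le> \<delta> ^ card S" by (rule power_mono[OF p p0])
    finally show ?thesis unfolding bad_cell_def .
  qed
  then show ?thesis using m0 by blast
qed

text \<open>If a walk of \<open>2 * n\<close> cells has fewer than \<open>n\<close> good ones, some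
  \<open>n\<close> of its cells are all bad. There are at most \<open>9 ^ (2 * n)\<close> walks and
  \<open>2 ^ (2 * n)\<close> subsets of each, and \<open>648 = 2 * 81 * 4\<close> is chosen so that
  the union bound becomes \<open>(1 / 2) ^ n\<close>.\<close>

lemma prob_few_good_le:
  "\<exists>m>0. \<forall>n\<ge>1. 1 / 2 \<le> prob {\<omega> \<in> space M. \<forall>zs\<in>king_walks (2 * n). n \<le> card (set zs - {z. bad_cell m (\<lambda>p. f p \<omega>) z})}"
proof -
  obtain m where m: "0 < m" and P: "\<And>S. finite S \<Longrightarrow> prob {\<omega> \<in> space M. \<forall>z\<in>S. bad_cell m (\<lambda>p. f p \<omega>) z} \<le> (1 / 648) ^ card S"
    using prob_all_bad_le[of "1 / 648"] by auto
  have "1 / 2 \<le> prob {\<omega> \<in> space M. \<forall>zs\<in>king_walks (2 * n). n \<le> card (set zs - {z. bad_cell m (\<lambda>p. f p \<omega>) z})}"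
    if n: "1 \<le> n" for n
  proof -
    define E where "E S = {\<omega> \<in> space M. \<forall>z\<in>S. bad_cell m (\<lambda>p. f p \<omega>) z}" for S
    have Em: "E S \<in> events" if "finite S" for S unfolding E_def using that by (intro sets.sets_Collect_finite_All) auto
    define I where "I zs = {S. S \<subseteq> set zs \<and> card S = n}" for zs :: "(int \<times> int) list"
    have I: "finite (I zs)" "card (I zs) \<le> 2 ^ (2 * n)" if "zs \<in> king_walks (2 * n)" for zs
    proof -
      have "I zs \<subseteq> Pow (set zs)" by (auto simp: I_def)
      moreover have "card (Pow (set zs)) = 2 ^ (2 * n)"
        using that by (simp add: card_Pow king_walks_def distinct_card)
      ultimately show "finite (I zs)" "card (I zs) \<le> 2 ^ (2 * n)"
        using card_mono[of "Pow (set zs)" "I zs"] by (auto intro: finite_subset)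
    qed
    have If: "finite S" "card S = n" if "S \<in> I zs" for S zs
      using that by (auto simp: I_def intro: finite_subset)
    let ?G = "{\<omega> \<in> space M. \<forall>zs\<in>king_walks (2 * n). n \<le> card (set zs - {z. bad_cell m (\<lambda>p. f p \<omega>) z})}"
    let ?U = "\<Union>zs\<in>king_walks (2 * n). \<Union>S\<in>I zs. E S"
    have Um: "(\<Union>S\<in>I zs. E S) \<in> events" if "zs \<in> king_walks (2 * n)" for zs
      using Em I(1)[OF that] If by blast
    \<comment> \<open>Counting good cells is turned into a finite choice of \<open>n + 1\<close> bad
      ones, which shows that the event is measurable; for the union bound only \<open>n\<close> of
      them are kept.\<close>
    have iff: "n \<le> card (set zs - {z. bad_cell m h z}) \<longleftrightarrow> \<not> (\<exists>S\<subseteq>set zs. card S = n + 1 \<and> (\<forall>z\<in>S. bad_cell m h z))"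
      if "zs \<in> king_walks (2 * n)" for zs h
    proof -
      let ?X = "{z \<in> set zs. bad_cell m h z}"
      have c: "card (set zs) = 2 * n" using that by (simp add: king_walks_def distinct_card)
      have eq: "set zs - {z. bad_cell m h z} = set zs - ?X" by auto
      have "card (set zs - ?X) = 2 * n - card ?X" "card ?X \<le> 2 * n"
        using c card_mono[of "set zs" ?X] by (auto simp: card_Diff_subset)
      then have "n \<le> card (set zs - ?X) \<longleftrightarrow> \<not> n + 1 \<le> card ?X" by linarith
      also have "\<dots> \<longleftrightarrow> \<not> (\<exists>S\<subseteq>set zs. card S = n + 1 \<and> (\<forall>z\<in>S. bad_cell m h z))"
      proof -
        have "n + 1 \<le> card ?X \<longleftrightarrow> (\<exists>S\<subseteq>?X. card S = n + 1)"
        proof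
          assume "n + 1 \<le> card ?X"
          then show "\<exists>S\<subseteq>?X. card S = n + 1" by (rule obtain_subset_with_card_n) blast
        next
          assume "\<exists>S\<subseteq>?X. card S = n + 1"
          then obtain S where "S \<subseteq> ?X" "card S = n + 1" by blast
          then show "n + 1 \<le> card ?X" using card_mono[of ?X S] by simp
        qed
        also have "\<dots> \<longleftrightarrow> (\<exists>S\<subseteq>set zs. card S = n + 1 \<and> (\<forall>z\<in>S. bad_cell m h z))" by blast
        finally show ?thesis by simp
      qed
      finally show ?thesis unfolding eq .
    qed
    have Gm: "?G \<in> events"
    proof -
      have "?G = {\<omega> \<in> space M. \<forall>zs\<in>king_walks (2 * n). \<not> (\<exists>S\<in>{S. S \<subseteq> set zs \<and> card S = n + 1}. \<forall>z\<in>S. bad_cell m (\<lambda>p. f p \<omega>) z)}"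
        using iff by auto
      also have "\<dots> \<in> events"
        by (intro sets.sets_Collect_finite_All sets.sets_Collect_neg sets.sets_Collect_finite_Ex finite_king_walks)
          (auto simp: king_walks_def intro: finite_subset)
      finally show ?thesis .
    qed
    have "space M - ?G \<subseteq> ?U"
    proof
      fix \<omega> assume \<omega>: "\<omega> \<in> space M - ?G"
      then obtain zs where zs: "zs \<in> king_walks (2 * n)" "\<not> n \<le> card (set zs - {z. bad_cell m (\<lambda>p. f p \<omega>) z})" by auto
      then obtain S where S: "S \<subseteq> set zs" "card S = n + 1" "\<forall>z\<in>S. bad_cell m (\<lambda>p. f p \<omega>) z"
        using iff[OF zs(1)] by blast
      obtain S' where "S' \<subseteq> S" "card S' = n" using obtain_subset_with_card_n[of n S] S(2) by auto
      then have "S' \<in> I zs" "\<omega> \<in> E S'" using S \<omega> by (auto simp: I_def E_def)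
      then show "\<omega> \<in> ?U" using zs(1) by blast
    qed
    then have "prob (space M - ?G) \<le> prob ?U"
      by (rule finite_measure_mono) (intro sets.finite_UN finite_king_walks Um)
    also have "\<dots> \<le> (\<Sum>zs\<in>king_walks (2 * n). prob (\<Union>S\<in>I zs. E S))"
      using Um finite_king_walks by (intro finite_measure_subadditive_finite) auto
    also have "\<dots> \<le> (\<Sum>zs\<in>king_walks (2 * n). \<Sum>S\<in>I zs. prob (E S))"
      using I If Em by (intro sum_mono finite_measure_subadditive_finite) auto
    also have "\<dots> \<le> (\<Sum>zs\<in>king_walks (2 * n). \<Sum>S\<in>I zs. (1 / 648) ^ n)"
      using P If by (intro sum_mono) (metis E_def)
    also have "\<dots> \<le> (\<Sum>zs\<in>king_walks (2 * n). 2 ^ (2 * n) * (1 / 648) ^ n)"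
    proof (rule sum_mono)
      fix zs assume "zs \<in> king_walks (2 * n)"
      then have "real (card (I zs)) \<le> real (2 ^ (2 * n))" by (intro of_nat_mono I(2))
      then have "real (card (I zs)) \<le> 2 ^ (2 * n)" by simp
      then show "(\<Sum>S\<in>I zs. (1 / 648 :: real) ^ n) \<le> 2 ^ (2 * n) * (1 / 648) ^ n"
        by (simp only: sum_constant) (intro mult_right_mono, auto)
    qed
    also have "\<dots> = real (card (king_walks (2 * n))) * (2 ^ (2 * n) * (1 / 648) ^ n)" by simp
    also have "\<dots> \<le> 9 ^ (2 * n) * (2 ^ (2 * n) * (1 / 648) ^ n)"
      using of_nat_mono[OF card_king_walks[of "2 * n"], where 'a=real] by (intro mult_right_mono) simp_all
    also have "\<dots> = (1 / 2) ^ n"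
      by (simp only: power_mult power_mult_distrib[symmetric]) simp
    also have "\<dots> \<le> (1 / 2) ^ 1" using n by (intro power_decreasing) auto
    finally have "prob (space M - ?G) \<le> 1 / 2" by simp
    then show ?thesis using prob_compl[OF Gm] by simp
  qed
  then show ?thesis using m by blast
qed

text \<open>With probability at least 1/2 every walk of \<open>2 * n\<close> cells has at least
  \<open>n\<close> good cells, and on their blocks the weight is at least
  \<open>sqrt (\<phi> (- m))\<close> by monotonicity. The factor 18 consists of 9 for overlapping
  blocks and 2 for the probability.\<close>

theorem expected_distance_lower_bound:
  assumes \<phi>: "continuous_on UNIV \<phi>" "\<And>u. 0 < \<phi> u" "mono \<phi>"
  shows "\<exists>c>0. \<forall>n\<ge>1. \<forall>x. int (2 * n) + 1 \<le> cell_norm (cell x) \<longrightarrow>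
    ennreal (c * real n) \<le> (\<integral>\<^sup>+\<omega>. cost_dist (\<lambda>p. sqrt (\<phi> (f p \<omega>))) 0 x \<partial>M)"
proof -
  obtain m where m: "0 < m" and P: "\<And>n. 1 \<le> n \<Longrightarrow>
    1 / 2 \<le> prob {\<omega> \<in> space M. \<forall>zs\<in>king_walks (2 * n). n \<le> card (set zs - {z. bad_cell m (\<lambda>p. f p \<omega>) z})}"
    using prob_few_good_le by blast
  define c where "c = sqrt (\<phi> (- m))"
  have c: "0 < c" using \<phi>(2) by (simp add: c_def)
  have "ennreal (c / 18 * real n) \<le> (\<integral>\<^sup>+\<omega>. cost_dist (\<lambda>p. sqrt (\<phi> (f p \<omega>))) 0 x \<partial>M)"
    if n: "1 \<le> n" and x: "int (2 * n) + 1 \<le> cell_norm (cell x)" for n x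
  proof -
    let ?G = "{\<omega> \<in> space M. \<forall>zs\<in>king_walks (2 * n). n \<le> card (set zs - {z. bad_cell m (\<lambda>p. f p \<omega>) z})}"
    \<comment> \<open>A set outside the sigma-algebra has measure 0 by convention, against the lower
      bound 1/2.\<close>
    have Gm: "?G \<in> events"
    proof (rule ccontr)
      assume "?G \<notin> events"
      then have "prob ?G = 0" by (rule measure_notin_sets)
      then show False using P[OF n] by simp
    qed
    have "ennreal (c * real n / 9) * ennreal (1 / 2) = ennreal (c * real n / 9 * (1 / 2))"
      by (rule ennreal_mult[symmetric]) (use c in auto)
    then have "ennreal (c / 18 * real n) = ennreal (c * real n / 9) * ennreal (1 / 2)" by simp
    also have "\<dots> \<le> ennreal (c * real n / 9) * emeasure M ?G"
      using P[OF n] by (intro mult_left_mono) (simp_all add: emeasure_eq_measure ennreal_leI del: ennreal_half)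
    also have "\<dots> = (\<integral>\<^sup>+\<omega>. ennreal (c * real n / 9) * indicator ?G \<omega> \<partial>M)"
      using Gm by (simp add: nn_integral_cmult_indicator)
    also have "\<dots> \<le> (\<integral>\<^sup>+\<omega>. cost_dist (\<lambda>p. sqrt (\<phi> (f p \<omega>))) 0 x \<partial>M)"
    proof (rule nn_integral_mono_AE)
      show "AE \<omega> in M. ennreal (c * real n / 9) * indicator ?G \<omega> \<le> cost_dist (\<lambda>p. sqrt (\<phi> (f p \<omega>))) 0 x"
        using continuous_paths
      proof eventually_elim
        case (elim \<omega>)
        show ?case
        proof (cases "\<omega> \<in> ?G")
          case True
          have "ennreal (c * real n / 9) \<le> cost_dist (\<lambda>p. sqrt (\<phi> (f p \<omega>))) 0 x"
          proof (rule cost_dist_lower_bound[where B="{z. bad_cell m (\<lambda>p. f p \<omega>) z}" and n="2 * n"])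
            show "continuous_on UNIV (\<lambda>p. sqrt (\<phi> (f p \<omega>)))"
              by (intro continuous_intros continuous_on_compose2[OF \<phi>(1) elim]) auto
            fix z p assume "z \<notin> {z. bad_cell m (\<lambda>p. f p \<omega>) z}" "king z (cell p)"
            then have "\<bar>f p \<omega>\<bar> \<le> m" using good_cell_bound[OF elim m] by simp
            then have "- m \<le> f p \<omega>" by simp
            then show "c \<le> sqrt (\<phi> (f p \<omega>))" unfolding c_def using monoD[OF \<phi>(3)] by simp
          qed (use c \<phi>(2) True x in \<open>auto simp: less_imp_le\<close>)
          then show ?thesis using True by simp
        qed simp
      qed
    qed
    finally show ?thesis .
  qed
  then show ?thesis using c by (intro exI[of _ "c / 18"]) auto
qed

end


section \<open>Mixing of the field\<close>

definition path_space :: "(real^2 \<Rightarrow> real) measure" where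
  "path_space = PiM UNIV (\<lambda>_. borel)"

text \<open>Lists are used instead of finitely supported coefficients: concatenation is addition,
  and points may repeat.\<close>

definition combination :: "(real \<times> (real^2)) list \<Rightarrow> (real^2 \<Rightarrow> real) \<Rightarrow> real" where
  "combination l h = (\<Sum>(c, x)\<leftarrow>l. c * h x)"

lemma combination_simps[simp]:
  "combination [] h = 0" "combination ((c, x) # l) h = c * h x + combination l h"
  "combination (l @ l') h = combination l h + combination l' h"
  by (simp_all add: combination_def)

lemma combination_scale: "combination (map (\<lambda>(c, x). (a * c, x)) l) h = a * combination l h"
  by (induction l) (auto simp: algebra_simps)

lemma combination_shift: "combination (map (\<lambda>(c, x). (c, x + a)) l) h = combination l (\<lambda>x. h (x + a))"
  by (induction l) auto

lemma space_path_space[simp]: "space path_space = UNIV"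
  by (simp add: path_space_def space_PiM)

lemma evaluation_measurable: "(\<lambda>h. h x) \<in> borel_measurable path_space"
  unfolding path_space_def by measurable

lemma path_space_measurableI:
  assumes "\<And>x. (\<lambda>\<omega>. F \<omega> x) \<in> borel_measurable M"
  shows "F \<in> measurable M path_space"
  unfolding path_space_def by (rule measurable_PiM_single') (use assms in auto)

lemma combination_measurable[measurable]: "combination l \<in> borel_measurable path_space"
proof (induction l)
  case (Cons p l)
  note [measurable] = this evaluation_measurable
  obtain c x where "p = (c, x)" by (cases p)
  then have "combination (p # l) = (\<lambda>h. c * h x + combination l h)" by auto
  then show ?case by simp
next
  case Nil
  have "combination [] = (\<lambda>_. 0)" by auto
  then show ?case by simp
qed

lemma function_subspace_combination: "function_subspace (range combination)"
  unfolding function_subspace_def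
proof (intro conjI ballI allI)
  show "(\<lambda>_. 0) \<in> range combination" by (rule range_eqI[of _ _ "[]"]) auto
  fix f g assume "f \<in> range combination" "g \<in> range combination"
  then obtain l l' where "f = combination l" "g = combination l'" by auto
  then show "(\<lambda>x. f x + g x) \<in> range combination" by (intro range_eqI[of _ _ "l @ l'"]) auto
next
  fix f c assume "f \<in> range combination"
  then obtain l where "f = combination l" by auto
  then show "(\<lambda>x. c * f x) \<in> range combination"
    by (intro range_eqI[of _ _ "map (\<lambda>(b, x). (c * b, x)) l"]) (auto simp: combination_scale)
qed

text \<open>Puts the product sigma-algebra into the form that the density of trigonometric
  polynomials asks for. Single evaluations are combinations with one term.\<close>

lemma sets_path_space:
  "sets path_space = sigma_sets (space path_space) {{h \<in> space path_space. t < k h} | t k. k \<in> range combination}"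
proof -
  let ?G = "{{h \<in> space path_space. t < k h} | t k. k \<in> range combination}"
  define N where "N = sigma (UNIV :: (real^2 \<Rightarrow> real) set) ?G"
  have N: "space N = UNIV" "sets N = sigma_sets UNIV ?G" by (simp_all add: N_def)
  have ev: "(\<lambda>h. h x) \<in> borel_measurable N" for x :: "real^2"
    unfolding borel_measurable_iff_greater
  proof
    fix t :: real
    have "(\<lambda>h. h x) = combination [(1, x)]" by (auto simp: fun_eq_iff)
    then have "{h \<in> space N. t < h x} \<in> ?G" using N(1) by (auto intro!: exI[of _ t] exI[of _ "combination [(1, x)]"])
    then show "{h \<in> space N. t < h x} \<in> sets N" unfolding N(2) by (rule sigma_sets.Basic)
  qed
  have "sets path_space \<subseteq> sets N"
    unfolding path_space_def
  proof (rule sets_PiM_in_sets)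
    show "space N = (\<Pi>\<^sub>E i\<in>UNIV. space borel)" using N by simp
    fix x :: "real^2" and A :: "real set" assume "A \<in> sets borel"
    from measurable_sets[OF ev this] show "{h \<in> space N. h x \<in> A} \<in> sets N" by (simp add: vimage_def Int_def conj_commute)
  qed
  moreover have "sets N \<subseteq> sets path_space"
    unfolding N(2) space_path_space[symmetric]
  proof (rule sets.sigma_sets_subset, rule subsetI)
    fix A assume "A \<in> ?G"
    then obtain t l where "A = {h \<in> space path_space. t < combination l h}" by auto
    moreover have "{h \<in> space path_space. t < combination l h} \<in> sets path_space" by measurable
    ultimately show "A \<in> sets path_space" by simp
  qed
  ultimately show ?thesis using N(2) by auto
qed

lemma combination_trig_dense:
  assumes "finite_measure N1" "finite_measure N2" "sets N1 = sets path_space" "sets N2 = sets path_space"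
    and "B \<in> sets path_space" "0 < e"
  shows "\<exists>P\<in>trig_polys (range combination).
    (\<integral>x. \<bar>indicator B x - P x\<bar> \<partial>N1) < e \<and> (\<integral>x. \<bar>indicator B x - P x\<bar> \<partial>N2) < e"
proof (rule trig_polys_dense)
  have sp: "space N1 = space path_space" using sets_eq_imp_space_eq[OF assms(3)] .
  show "sets N1 = sigma_sets (space N1) {{x \<in> space N1. t < h x} |t h. h \<in> range combination}"
    unfolding sp assms(3) by (rule sets_path_space)
  show "range combination \<subseteq> borel_measurable N1"
    using measurable_cong_sets[OF assms(3) refl] combination_measurable by blast
qed (use assms function_subspace_combination in auto)

lemma trig_combination_measurable:
  "P \<in> trig_polys (range combination) \<Longrightarrow> P \<in> borel_measurable path_space"
  by (rule trig_polys_measurable) auto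

context decaying_field
begin

definition field_path :: "real^2 \<Rightarrow> 'w \<Rightarrow> real^2 \<Rightarrow> real" where
  "field_path a \<omega> = (\<lambda>x. f (x + a) \<omega>)"

text \<open>The law lives on all functions with the product sigma-algebra, where continuity is not a
  measurable event. Statements that use continuous paths are therefore proved on \<open>M\<close>
  and then carried over.\<close>

definition law :: "(real^2 \<Rightarrow> real) measure" where
  "law = distr M path_space (field_path 0)"

definition bilinear_cov :: "(real \<times> (real^2)) list \<Rightarrow> (real \<times> (real^2)) list \<Rightarrow> real" where
  "bilinear_cov l l' = (\<Sum>(c, x)\<leftarrow>l. \<Sum>(c', x')\<leftarrow>l'. c * c' * \<kappa> (x - x'))"

lemma field_path_measurable[measurable]: "field_path a \<in> measurable M path_space"
  by (rule path_space_measurableI) (simp add: field_path_def)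

lemma sets_law[simp]: "sets law = sets path_space"
  by (simp add: law_def)

lemma prob_space_law: "prob_space law"
  unfolding law_def by (rule prob_space_distr) measurable

lemma bilinear_cov_append:
  "bilinear_cov (l1 @ l2) l' = bilinear_cov l1 l' + bilinear_cov l2 l'"
  "bilinear_cov l (l1 @ l2) = bilinear_cov l l1 + bilinear_cov l l2"
  by (auto simp: bilinear_cov_def sum_list_addf[symmetric] split_def)

lemma bilinear_cov_shift:
  "bilinear_cov (map (\<lambda>(c, x). (c, x + a)) l) (map (\<lambda>(c, x). (c, x + a)) l') = bilinear_cov l l'"
  by (simp add: bilinear_cov_def split_def comp_def)

lemma bilinear_cov_scale:
  "bilinear_cov (map (\<lambda>(c, x). (b * c, x)) l) l' = b * bilinear_cov l l'"
  "bilinear_cov l (map (\<lambda>(c, x). (b * c, x)) l') = b * bilinear_cov l l'"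
  by (simp_all add: bilinear_cov_def split_def comp_def sum_list_const_mult[symmetric] mult_ac)

lemma expectation_cos_combination:
  "expectation (\<lambda>\<omega>. cos (combination l (\<lambda>x. f x \<omega>) + d)) = cos d * exp (- bilinear_cov l l / 2)"
proof -
  have 1: "combination l h = (\<Sum>i<length l. fst (l ! i) * h (snd (l ! i)))" for h
    by (simp add: combination_def split_def sum_list_sum_nth atLeast0LessThan)
  have 2: "bilinear_cov l l = (\<Sum>i<length l. \<Sum>j<length l. fst (l ! i) * fst (l ! j) * \<kappa> (snd (l ! i) - snd (l ! j)))"
    by (simp add: bilinear_cov_def split_def sum_list_sum_nth atLeast0LessThan)
  show ?thesis unfolding 1 2 by (rule expectation_cos_sum) simp
qed

lemma expectation_cos_law:
  "(\<integral>h. cos (combination l h + d) \<partial>distr M path_space (field_path a)) = cos d * exp (- bilinear_cov l l / 2)"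
proof -
  let ?l = "map (\<lambda>(c, x). (c, x + a)) l"
  have "(\<integral>h. cos (combination l h + d) \<partial>distr M path_space (field_path a)) =
      expectation (\<lambda>\<omega>. cos (combination l (field_path a \<omega>) + d))"
    by (rule integral_distr) measurable
  also have "\<dots> = expectation (\<lambda>\<omega>. cos (combination ?l (\<lambda>x. f x \<omega>) + d))"
    by (simp add: field_path_def combination_shift)
  also have "\<dots> = cos d * exp (- bilinear_cov l l / 2)"
    by (simp only: expectation_cos_combination bilinear_cov_shift)
  finally show ?thesis .
qed

lemma bounded_integrable_law:
  assumes "sets N = sets path_space" "finite_measure N" "P \<in> borel_measurable path_space" "\<And>x. \<bar>P x\<bar> \<le> B"
  shows "integrable N (P :: _ \<Rightarrow> real)"
proof -
  interpret finite_measure N by fact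
  show ?thesis
    by (rule integrable_const_bound[of _ B]) (use assms measurable_cong_sets[OF assms(1) refl] in auto)
qed

lemma trig_integrable:
  assumes "sets N = sets path_space" "finite_measure N" "P \<in> trig_polys (range combination)"
  shows "integrable N P"
  using bounded_integrable_law[OF assms(1,2) trig_combination_measurable[OF assms(3)]] trig_polys_bounded[OF assms(3)] by blast

text \<open>Stationarity of the covariance gives stationarity of the law: the means of trigonometric
  polynomials depend on the covariances alone, and these polynomials approximate an indicator in
  both laws at once.\<close>

theorem law_field_path: "distr M path_space (field_path a) = law"
proof -
  let ?N = "distr M path_space (field_path a)"
  interpret N: prob_space ?N by (rule prob_space_distr) measurable
  interpret L: prob_space law by (rule prob_space_law)
  have fin: "finite_measure ?N" "finite_measure law" by (intro N.finite_measure_axioms L.finite_measure_axioms)+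
  have eq: "(\<integral>h. P h \<partial>?N) = (\<integral>h. P h \<partial>law)" if "P \<in> trig_polys (range combination)" for P
    using that
  proof (induction rule: trig_polys.induct)
    case (cos h b c)
    then obtain l where "h = combination l" by auto
    then show ?case using expectation_cos_law[of a l c] expectation_cos_law[of 0 l c] by (simp add: law_def)
  next
    case (add P Q)
    then show ?case using trig_integrable[OF _ fin(1)] trig_integrable[OF _ fin(2)] by simp
  qed
  show ?thesis
  proof (rule measure_eqI)
    show "sets ?N = sets law" by simp
    fix B assume "B \<in> sets ?N"
    then have B: "B \<in> sets path_space" by simp
    have "\<bar>measure ?N B - measure law B\<bar> \<le> e" if e: "0 < e" for e
    proof -
      obtain P where P: "P \<in> trig_polys (range combination)" "(\<integral>x. \<bar>indicator B x - P x\<bar> \<partial>?N) < e / 2"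
        "(\<integral>x. \<bar>indicator B x - P x\<bar> \<partial>law) < e / 2"
        using combination_trig_dense[OF fin _ _ B, of "e / 2"] e by auto
      have *: "\<bar>measure N B - (\<integral>x. P x \<partial>N)\<bar> \<le> (\<integral>x. \<bar>indicator B x - P x\<bar> \<partial>N)"
        if "sets N = sets path_space" "finite_measure N" for N
      proof -
        interpret finite_measure N by fact
        have "measure N B - (\<integral>x. P x \<partial>N) = (\<integral>x. indicator B x - P x \<partial>N)"
          using that B trig_integrable[OF that P(1)] by (simp add: integrable_real_indicator less_top[symmetric])
        then show ?thesis by (simp add: integral_abs_bound)
      qed
      show ?thesis using *[OF _ fin(1)] *[OF _ fin(2)] P eq[OF P(1)] by simp
    qed
    then have "\<bar>measure ?N B - measure law B\<bar> \<le> 0" by (metis field_le_epsilon add_0)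
    then show "emeasure ?N B = emeasure law B"
      by (simp add: N.emeasure_eq_measure L.emeasure_eq_measure)
  qed
qed

lemma bilinear_cov_tendsto:
  assumes "v \<noteq> 0"
  shows "(\<lambda>n. bilinear_cov l (map (\<lambda>(c, x). (c, x + real n *\<^sub>R v)) l')) \<longlonglongrightarrow> 0"
    and "(\<lambda>n. bilinear_cov (map (\<lambda>(c, x). (c, x + real n *\<^sub>R v)) l') l) \<longlonglongrightarrow> 0"
proof -
  have k: "(\<lambda>n. \<kappa> (w - real n *\<^sub>R v)) \<longlonglongrightarrow> 0" "(\<lambda>n. \<kappa> (w + real n *\<^sub>R v)) \<longlonglongrightarrow> 0" for w
    using \<kappa>_tendsto_0[of "-v" w] \<kappa>_tendsto_0[of v w] assms by simp_all
  have 1: "bilinear_cov l l' = (\<Sum>p\<in>{..<length l} \<times> {..<length l'}. fst (l ! fst p) * fst (l' ! snd p) * \<kappa> (snd (l ! fst p) - snd (l' ! snd p)))"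
    for l l'
    by (simp add: bilinear_cov_def split_def sum_list_sum_nth atLeast0LessThan sum.cartesian_product)
  have "(\<lambda>n. \<Sum>p\<in>{..<length l} \<times> {..<length l'}. fst (l ! fst p) * fst (l' ! snd p) * \<kappa> ((snd (l ! fst p) - snd (l' ! snd p)) - real n *\<^sub>R v))
    \<longlonglongrightarrow> (\<Sum>p\<in>{..<length l} \<times> {..<length l'}. fst (l ! fst p) * fst (l' ! snd p) * 0)"
    by (intro tendsto_sum tendsto_mult tendsto_const k)
  moreover have "bilinear_cov l (map (\<lambda>(c, x). (c, x + real n *\<^sub>R v)) l') = (\<Sum>p\<in>{..<length l} \<times> {..<length l'}. fst (l ! fst p) * fst (l' ! snd p) * \<kappa> ((snd (l ! fst p) - snd (l' ! snd p)) - real n *\<^sub>R v))" for n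
    unfolding 1 by (auto simp: split_def diff_diff_eq intro!: sum.cong)
  ultimately show "(\<lambda>n. bilinear_cov l (map (\<lambda>(c, x). (c, x + real n *\<^sub>R v)) l')) \<longlonglongrightarrow> 0" by simp
  have "(\<lambda>n. \<Sum>p\<in>{..<length l'} \<times> {..<length l}. fst (l' ! fst p) * fst (l ! snd p) * \<kappa> ((snd (l' ! fst p) - snd (l ! snd p)) + real n *\<^sub>R v))
    \<longlonglongrightarrow> (\<Sum>p\<in>{..<length l'} \<times> {..<length l}. fst (l' ! fst p) * fst (l ! snd p) * 0)"
    by (intro tendsto_sum tendsto_mult tendsto_const k)
  moreover have "bilinear_cov (map (\<lambda>(c, x). (c, x + real n *\<^sub>R v)) l') l = (\<Sum>p\<in>{..<length l'} \<times> {..<length l}. fst (l' ! fst p) * fst (l ! snd p) * \<kappa> ((snd (l' ! fst p) - snd (l ! snd p)) + real n *\<^sub>R v))" for n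
    unfolding 1 by (auto simp: split_def algebra_simps intro!: sum.cong)
  ultimately show "(\<lambda>n. bilinear_cov (map (\<lambda>(c, x). (c, x + real n *\<^sub>R v)) l') l) \<longlonglongrightarrow> 0" by simp
qed

definition shift :: "real^2 \<Rightarrow> (real^2 \<Rightarrow> real) \<Rightarrow> real^2 \<Rightarrow> real" where
  "shift v h = (\<lambda>x. h (x + v))"

lemma shift_measurable[measurable]: "shift v \<in> measurable path_space path_space"
  by (rule path_space_measurableI) (simp add: shift_def evaluation_measurable)

lemma shift_pow: "(shift v ^^ n) h = shift (real n *\<^sub>R v) h"
  by (induction n arbitrary: h) (auto simp: shift_def algebra_simps)

lemma shift_field_path: "shift v (field_path a \<omega>) = field_path (v + a) \<omega>"
  by (simp add: shift_def field_path_def add.assoc)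

lemma shift_law: "distr law law (shift v) = law"
proof -
  have "distr law law (shift v) = distr law path_space (shift v)"
    by (rule distr_cong) auto
  also have "\<dots> = distr M path_space (shift v \<circ> field_path 0)"
    unfolding law_def by (rule distr_distr) measurable
  also have "shift v \<circ> field_path 0 = field_path v"
    by (auto simp: shift_field_path)
  finally show ?thesis by (simp add: law_field_path)
qed

text \<open>The product formula for cosines gives two Gaussian means in whose exponents the cross
  covariances enter with opposite signs. These tend to 0 as the shift grows, and what remains
  factors.\<close>

lemma trig_mixing:
  assumes v: "v \<noteq> 0" and P: "P \<in> trig_polys (range combination)" and Q: "Q \<in> trig_polys (range combination)"
  shows "(\<lambda>n. \<integral>h. P h * Q ((shift v ^^ n) h) \<partial>law) \<longlonglongrightarrow> (\<integral>h. P h \<partial>law) * (\<integral>h. Q h \<partial>law)"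
proof -
  interpret L: prob_space law by (rule prob_space_law)
  have fin: "finite_measure law" by (rule L.finite_measure_axioms)
  have ml: "borel_measurable law = borel_measurable path_space" by (rule measurable_cong_sets) simp_all
  have int: "integrable law (\<lambda>h. P h * Q ((shift v ^^ n) h))"
    if P: "P \<in> trig_polys (range combination)" and Q: "Q \<in> trig_polys (range combination)" for P Q n
  proof -
    obtain B where B: "0 \<le> B" "\<And>x. \<bar>P x\<bar> \<le> B" using trig_polys_bounded[OF P] by auto
    obtain C where C: "0 \<le> C" "\<And>x. \<bar>Q x\<bar> \<le> C" using trig_polys_bounded[OF Q] by auto
    have [measurable]: "P \<in> borel_measurable path_space" "Q \<in> borel_measurable path_space"
      using P Q by (auto intro: trig_combination_measurable)
    show ?thesis
      unfolding shift_pow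
      by (rule bounded_integrable_law[OF _ fin, of _ "B * C"]) (auto simp: abs_mult intro!: mult_mono B C)
  qed
  show ?thesis
    using P
  proof (induction rule: trig_polys.induct)
    case (cos h a c)
    then obtain l where h: "h = combination l" by auto
    show ?case using Q
    proof (induction rule: trig_polys.induct)
      case (cos k b d)
      then obtain l' where k: "k = combination l'" by auto
      define s where "s n = map (\<lambda>(c, x). (c, x + real n *\<^sub>R v)) l'" for n
      \<comment> \<open>The negated combination, for the cosine of the difference.\<close>
      define s' where "s' n = map (\<lambda>(c, x). (-1 * c, x)) (s n)" for n
      have ks: "k ((shift v ^^ n) g) = combination (s n) g" for n g
        by (simp add: k shift_pow shift_def s_def combination_shift)
      have e: "a * cos (h g + c) * (b * cos (k ((shift v ^^ n) g) + d)) =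
          a * b / 2 * (cos (combination (l @ s n) g + (c + d)) + cos (combination (l @ s' n) g + (c - d)))" for n g
      proof -
        have sums: "(h g + c) - (combination (s n) g + d) = combination (l @ s' n) g + (c - d)"
          "(h g + c) + (combination (s n) g + d) = combination (l @ s n) g + (c + d)"
          unfolding s'_def by (simp_all only: combination_simps combination_scale h)
        then have prod: "cos (h g + c) * cos (combination (s n) g + d) =
          (cos (combination (l @ s' n) g + (c - d)) + cos (combination (l @ s n) g + (c + d))) / 2"
          by (simp only: cos_times_cos sums)
        have "a * cos (h g + c) * (b * cos (combination (s n) g + d)) =
          a * b * (cos (h g + c) * cos (combination (s n) g + d))" by (simp only: mult_ac)
        then show ?thesis unfolding ks prod by (simp add: add.commute)
      qed
      have ci: "integrable law (\<lambda>g. cos (combination l g + c))" for l c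
        by (rule bounded_integrable_law[OF _ fin, of _ 1]) auto
      have E: "(\<integral>g. cos (combination l g + d) \<partial>law) = cos d * exp (- bilinear_cov l l / 2)" for l d
        using expectation_cos_law[of 0 l d] by (simp add: law_def)
      have lim: "(\<lambda>n. bilinear_cov l (s n)) \<longlonglongrightarrow> 0" "(\<lambda>n. bilinear_cov (s n) l) \<longlonglongrightarrow> 0"
        unfolding s_def by (rule bilinear_cov_tendsto[OF v])+
      have ss: "bilinear_cov (s n) (s n) = bilinear_cov l' l'" for n
        unfolding s_def by (rule bilinear_cov_shift)
      have s': "bilinear_cov (s' n) l = - bilinear_cov (s n) l" "bilinear_cov l (s' n) = - bilinear_cov l (s n)"
        "bilinear_cov (s' n) (s' n) = bilinear_cov l' l'" for n l
        unfolding s'_def bilinear_cov_scale ss by simp_all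
      have 1: "(\<integral>g. a * cos (h g + c) * (b * cos (k ((shift v ^^ n) g) + d)) \<partial>law) =
          a * b / 2 * (cos (c + d) * exp (- (bilinear_cov l l + bilinear_cov (s n) l + (bilinear_cov l (s n) + bilinear_cov l' l')) / 2) +
            cos (c - d) * exp (- (bilinear_cov l l - bilinear_cov (s n) l + (- bilinear_cov l (s n) + bilinear_cov l' l')) / 2))" for n
        unfolding e by (simp add: E ci bilinear_cov_append ss s' del: combination_simps)
      have "(\<lambda>n. \<integral>g. a * cos (h g + c) * (b * cos (k ((shift v ^^ n) g) + d)) \<partial>law) \<longlonglongrightarrow>
          a * b / 2 * (cos (c + d) * exp (- (bilinear_cov l l + 0 + (0 + bilinear_cov l' l')) / 2) +
            cos (c - d) * exp (- (bilinear_cov l l - 0 + (- 0 + bilinear_cov l' l')) / 2))"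
        unfolding 1 by (intro tendsto_intros lim) auto
      also have "a * b / 2 * (cos (c + d) * exp (- (bilinear_cov l l + 0 + (0 + bilinear_cov l' l')) / 2) +
            cos (c - d) * exp (- (bilinear_cov l l - 0 + (- 0 + bilinear_cov l' l')) / 2)) =
          a * (cos c * exp (- bilinear_cov l l / 2)) * (b * (cos d * exp (- bilinear_cov l' l' / 2)))"
      proof -
        have "exp (- (bilinear_cov l l + bilinear_cov l' l') / 2) = exp (- bilinear_cov l l / 2) * exp (- bilinear_cov l' l' / 2)"
          by (simp add: exp_add[symmetric] add_divide_distrib[symmetric])
        then show ?thesis by (simp add: cos_add cos_diff algebra_simps)
      qed
      also have "\<dots> = (\<integral>g. a * cos (h g + c) \<partial>law) * (\<integral>g. b * cos (k g + d) \<partial>law)"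
        by (simp add: h k E)
      finally show ?case .
    next
      case (add Q1 Q2)
      have A: "(\<lambda>x. a * cos (h x + c)) \<in> trig_polys (range combination)" using cos by (rule trig_polys.cos)
      from tendsto_add[OF add.IH] show ?case
        using int[OF A add.hyps(1)] int[OF A add.hyps(2)] trig_integrable[OF _ fin add.hyps(1)] trig_integrable[OF _ fin add.hyps(2)]
        by (simp add: distrib_left)
    qed
  next
    case (add P1 P2)
    from tendsto_add[OF add.IH] show ?case
      using int[OF add.hyps(1) Q] int[OF add.hyps(2) Q] trig_integrable[OF _ fin add.hyps(1)] trig_integrable[OF _ fin add.hyps(2)]
      by (simp add: distrib_right)
  qed
qed

text \<open>Mixing passes from trigonometric polynomials to events by approximation in mean;
  invariance of the law under shifts makes the error of \<open>Q\<close> the same at every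
  time.\<close>

theorem mixing_system_shift:
  assumes v: "v \<noteq> 0"
  shows "mixing_system law (shift v)"
proof -
  interpret L: prob_space law by (rule prob_space_law)
  have fin: "finite_measure law" by (rule L.finite_measure_axioms)
  have ml[simp]: "borel_measurable law = borel_measurable path_space" by (rule measurable_cong_sets) simp_all
  have space[simp]: "space law = UNIV" by (simp add: law_def)
  have tri: "\<bar>a * b + c * d\<bar> \<le> \<bar>a\<bar> * \<bar>b\<bar> + \<bar>c\<bar> * \<bar>d\<bar>" for a b c d :: real
    using abs_triangle_ineq[of "a * b" "c * d"] by (simp add: abs_mult)
  show ?thesis
  proof
    show "shift v \<in> law \<rightarrow>\<^sub>M law"
      using shift_measurable measurable_cong_sets[OF sets_law sets_law] by blast
    show "distr law law (shift v) = law" by (rule shift_law)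
    fix A B assume "A \<in> sets law" "B \<in> sets law"
    then have [measurable]: "A \<in> sets path_space" "B \<in> sets path_space" by simp_all
    note AB = this
    have pinv: "(\<integral>h. F (shift w h) \<partial>law) = (\<integral>h. F h \<partial>law)" if "F \<in> borel_measurable path_space" for F :: "_ \<Rightarrow> real" and w
    proof -
      have "(\<integral>h. F (shift w h) \<partial>law) = (\<integral>h. F h \<partial>distr law path_space (shift w))"
        by (rule integral_distr[symmetric]) (use that shift_measurable[of w] measurable_cong_sets[OF sets_law refl, of path_space] in auto)
      also have "distr law path_space (shift w) = distr law law (shift w)" by (rule distr_cong) auto
      finally show ?thesis by (simp add: shift_law)
    qed
    show "(\<lambda>n. L.prob (A \<inter> ((shift v ^^ n) -` B \<inter> space law))) \<longlonglongrightarrow> L.prob A * L.prob B"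
    proof (rule LIMSEQ_I)
      fix e :: real assume e: "0 < e"
      obtain P where P: "P \<in> trig_polys (range combination)" "(\<integral>x. \<bar>indicator A x - P x\<bar> \<partial>law) < e / 6"
        using combination_trig_dense[OF fin fin _ _ AB(1), of "e / 6"] e by auto
      obtain K where K: "0 \<le> K" "\<And>x. \<bar>P x\<bar> \<le> K" using trig_polys_bounded[OF P(1)] by auto
      \<comment> \<open>The error of \<open>Q\<close> will be multiplied by the bound
        \<open>K\<close> of \<open>P\<close>.\<close>
      have e': "0 < e / (6 * (K + 1))" using e K by simp
      obtain Q where Q: "Q \<in> trig_polys (range combination)" "(\<integral>x. \<bar>indicator B x - Q x\<bar> \<partial>law) < e / (6 * (K + 1))"
        using combination_trig_dense[OF fin fin _ _ AB(2) e'] by auto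
      obtain K' where K': "0 \<le> K'" "\<And>x. \<bar>Q x\<bar> \<le> K'" using trig_polys_bounded[OF Q(1)] by auto
      have [measurable]: "P \<in> borel_measurable path_space" "Q \<in> borel_measurable path_space"
        using P Q by (auto intro: trig_combination_measurable)
      have KQ: "K * (\<integral>x. \<bar>indicator B x - Q x\<bar> \<partial>law) \<le> e / 6"
      proof -
        have "K * (\<integral>x. \<bar>indicator B x - Q x\<bar> \<partial>law) \<le> K * (e / (6 * (K + 1)))" using Q(2) K by (intro mult_left_mono) auto
        also have "\<dots> \<le> e / 6" using K e by (simp add: field_simps)
        finally show ?thesis .
      qed
      have iP: "integrable law P" and iQ: "integrable law Q" using P Q trig_integrable[OF _ fin] by auto
      have ind: "integrable law (indicator C :: _ \<Rightarrow> real)" if "C \<in> sets path_space" for C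
        by (rule bounded_integrable_law[OF _ fin, of _ 1]) (use that in \<open>auto split: split_indicator\<close>)
      have iAP: "integrable law (\<lambda>x. \<bar>indicator A x - P x\<bar>)" and iBQ: "integrable law (\<lambda>x. \<bar>indicator B x - Q x\<bar>)"
        using ind AB iP iQ by (auto intro!: integrable_abs Bochner_Integration.integrable_diff)
      have absle: "\<bar>(\<integral>x. F x \<partial>law) - (\<integral>x. G x \<partial>law)\<bar> \<le> (\<integral>x. \<bar>F x - G x\<bar> \<partial>law)" if "integrable law F" "integrable law G" for F G :: "_ \<Rightarrow> real"
        using that integral_abs_bound[of law "\<lambda>x. F x - G x"] by simp
      have near: "\<bar>L.prob (A \<inter> ((shift v ^^ n) -` B \<inter> space law)) - (\<integral>h. P h * Q ((shift v ^^ n) h) \<partial>law)\<bar> \<le> e / 3" for n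
      proof -
        let ?s = "shift (real n *\<^sub>R v)"
        have sm: "?s -` B \<in> sets path_space" using measurable_sets[OF shift_measurable AB(2)] by simp
        have i1: "integrable law (\<lambda>h. P h * Q (?s h))"
          by (rule bounded_integrable_law[OF _ fin, of _ "K * K'"]) (auto simp: abs_mult intro!: mult_mono K K')
        have i2: "integrable law (\<lambda>h. \<bar>indicator B (?s h) - Q (?s h)\<bar>)"
          by (rule bounded_integrable_law[OF _ fin, of _ "1 + K'"])
            (auto intro!: order_trans[OF abs_triangle_ineq4] add_mono K' order_trans[OF K'(2)] split: split_indicator)
        have "L.prob (A \<inter> ((shift v ^^ n) -` B \<inter> space law)) = (\<integral>h. indicator (A \<inter> ?s -` B) h \<partial>law)"
          using sm by (simp add: shift_pow[abs_def])
        also have "\<bar>\<dots> - (\<integral>h. P h * Q ((shift v ^^ n) h) \<partial>law)\<bar> \<le> (\<integral>h. \<bar>indicator (A \<inter> ?s -` B) h - P h * Q (?s h)\<bar> \<partial>law)"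
          unfolding shift_pow using sm i1 by (intro absle ind) auto
        also have "\<dots> \<le> (\<integral>h. \<bar>indicator A h - P h\<bar> + K * \<bar>indicator B (?s h) - Q (?s h)\<bar> \<partial>law)"
        proof (rule integral_mono)
          fix h
          have "indicator (A \<inter> ?s -` B) h - P h * Q (?s h) =
            (indicator A h - P h) * indicator B (?s h) + P h * (indicator B (?s h) - Q (?s h))"
            by (auto simp: algebra_simps split: split_indicator)
          then have "\<bar>indicator (A \<inter> ?s -` B) h - P h * Q (?s h)\<bar> \<le>
            \<bar>indicator A h - P h\<bar> * \<bar>indicator B (?s h)\<bar> + \<bar>P h\<bar> * \<bar>indicator B (?s h) - Q (?s h)\<bar>"
            by (simp only: tri)
          also have "\<dots> \<le> \<bar>indicator A h - P h\<bar> * 1 + K * \<bar>indicator B (?s h) - Q (?s h)\<bar>"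
            by (intro add_mono mult_left_mono mult_right_mono K) (auto split: split_indicator)
          finally show "\<bar>indicator (A \<inter> ?s -` B) h - P h * Q (?s h)\<bar> \<le> \<bar>indicator A h - P h\<bar> + K * \<bar>indicator B (?s h) - Q (?s h)\<bar>"
            by simp
        qed (use sm i1 i2 iAP ind AB in \<open>auto intro!: integrable_abs Bochner_Integration.integrable_diff\<close>)
        also have "\<dots> = (\<integral>h. \<bar>indicator A h - P h\<bar> \<partial>law) + K * (\<integral>h. \<bar>indicator B h - Q h\<bar> \<partial>law)"
          using iAP i2 pinv[of "\<lambda>h. \<bar>indicator B h - Q h\<bar>" "real n *\<^sub>R v"] by simp
        also have "\<dots> \<le> e / 3" using P(2) KQ by simp
        finally show ?thesis .
      qed
      have prod: "\<bar>(\<integral>h. P h \<partial>law) * (\<integral>h. Q h \<partial>law) - L.prob A * L.prob B\<bar> \<le> e / 3"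
      proof -
        have a: "\<bar>L.prob A - (\<integral>h. P h \<partial>law)\<bar> \<le> e / 6"
          using absle[OF ind[OF AB(1)] iP] P(2) by simp
        have b: "\<bar>L.prob B - (\<integral>h. Q h \<partial>law)\<bar> \<le> (\<integral>x. \<bar>indicator B x - Q x\<bar> \<partial>law)"
          using absle[OF ind[OF AB(2)] iQ] by simp
        have c: "\<bar>\<integral>h. P h \<partial>law\<bar> \<le> K"
        proof -
          have "\<bar>\<integral>h. P h \<partial>law\<bar> \<le> (\<integral>h. \<bar>P h\<bar> \<partial>law)" by (rule integral_abs_bound)
          also have "\<dots> \<le> (\<integral>h. K \<partial>law)" using iP K by (intro integral_mono) auto
          finally show ?thesis using L.prob_space by simp
        qed
        have "L.prob A * L.prob B - (\<integral>h. P h \<partial>law) * (\<integral>h. Q h \<partial>law) =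
          (L.prob A - (\<integral>h. P h \<partial>law)) * L.prob B + (\<integral>h. P h \<partial>law) * (L.prob B - (\<integral>h. Q h \<partial>law))"
          by (simp add: algebra_simps)
        then have "\<bar>L.prob A * L.prob B - (\<integral>h. P h \<partial>law) * (\<integral>h. Q h \<partial>law)\<bar> \<le>
          \<bar>L.prob A - (\<integral>h. P h \<partial>law)\<bar> * \<bar>L.prob B\<bar> + \<bar>\<integral>h. P h \<partial>law\<bar> * \<bar>L.prob B - (\<integral>h. Q h \<partial>law)\<bar>"
          by (simp only: tri)
        also have "\<dots> \<le> e / 6 * 1 + K * (\<integral>x. \<bar>indicator B x - Q x\<bar> \<partial>law)"
          using a b c e K by (intro add_mono mult_mono) auto
        finally show ?thesis using KQ by (simp add: abs_minus_commute)
      qed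
      have "eventually (\<lambda>n. \<bar>(\<integral>h. P h * Q ((shift v ^^ n) h) \<partial>law) - (\<integral>h. P h \<partial>law) * (\<integral>h. Q h \<partial>law)\<bar> < e / 3) sequentially"
        using LIMSEQ_D[OF trig_mixing[OF v P(1) Q(1)], of "e / 3"] e by (auto simp: eventually_sequentially)
      then have "eventually (\<lambda>n. norm (L.prob (A \<inter> ((shift v ^^ n) -` B \<inter> space law)) - L.prob A * L.prob B) < e) sequentially"
      proof eventually_elim
        case (elim n)
        then show ?case using near[of n] prod unfolding real_norm_def by linarith
      qed
      then show "\<exists>no. \<forall>n\<ge>no. norm (L.prob (A \<inter> ((shift v ^^ n) -` B \<inter> space law)) - L.prob A * L.prob B) < e"
        by (simp add: eventually_sequentially)
    qed
  qed
qed

end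


section \<open>The time constant\<close>

text \<open>The preimages of a Borel set under the two functions differ by a subset of a null set,
  and the completion contains all such sets.\<close>

lemma ae_eq_measurable_completion:
  fixes F G :: "'a \<Rightarrow> real"
  assumes F: "F \<in> borel_measurable M" and ae: "AE x in M. F x = G x"
  shows "G \<in> borel_measurable (completion M)"
proof (rule measurableI)
  fix A :: "real set" assume A: "A \<in> sets borel"
  have "AE x in completion M. x \<in> F -` A \<inter> space M \<longleftrightarrow> x \<in> G -` A \<inter> space M"
    using AE_completion[OF ae] by eventually_elim auto
  then show "G -` A \<inter> space (completion M) \<in> sets (completion M)"
    unfolding space_completion
    by (rule completion.in_sets_AE) (use measurable_sets[OF F A] in auto)
qed simp

lemma integral_abs_diff_tendsto_0:
  fixes F :: "nat \<Rightarrow> 'a \<Rightarrow> real"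
  assumes "prob_space M" and int: "\<And>n. integrable M (F n)" and nn: "\<And>n x. 0 \<le> F n x"
    and ae: "AE x in M. (\<lambda>n. F n x) \<longlonglongrightarrow> l" and mean: "(\<lambda>n. \<integral>x. F n x \<partial>M) \<longlonglongrightarrow> l"
  shows "(\<lambda>n. \<integral>x. \<bar>F n x - l\<bar> \<partial>M) \<longlonglongrightarrow> 0"
proof -
  interpret prob_space M by fact
  have l: "0 \<le> l" by (rule LIMSEQ_le_const[OF mean]) (use nn in \<open>auto intro!: integral_nonneg\<close>)
  have eq: "(\<integral>\<^sup>+x. norm (F n x) \<partial>M) = ennreal (\<integral>x. F n x \<partial>M)" for n
    using nn by (subst nn_integral_eq_integral[symmetric, OF int]) auto
  have "(\<lambda>n. \<integral>\<^sup>+x. norm (F n x - l) \<partial>M) \<longlonglongrightarrow> 0"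
  proof (rule Scheffe_lemma1[OF int _ ae])
    have "limsup (\<lambda>n. \<integral>\<^sup>+x. norm (F n x) \<partial>M) = ennreal l"
      unfolding eq by (rule lim_imp_Limsup) (use mean in \<open>auto intro!: tendsto_ennrealI\<close>)
    then show "limsup (\<lambda>n. \<integral>\<^sup>+x. norm (F n x) \<partial>M) \<le> (\<integral>\<^sup>+x. norm l \<partial>M)"
      using l by (simp add: emeasure_space_1)
  qed simp
  then have "(\<lambda>n. ennreal (\<integral>x. \<bar>F n x - l\<bar> \<partial>M)) \<longlonglongrightarrow> ennreal 0"
    using int by (subst (asm) nn_integral_eq_integral) auto
  then show ?thesis
    by (subst (asm) tendsto_ennreal_iff) (auto intro!: integral_nonneg)
qed

lemma chain_cost_measurable:
  assumes D: "countable D" and w: "\<And>p. (\<lambda>\<omega>. w \<omega> p) \<in> borel_measurable N"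
  shows "(\<lambda>\<omega>. chain_cost (w \<omega>) D zs) \<in> borel_measurable N"
proof (induction zs rule: induct_list012)
  case (3 x y zs)
  have "(\<lambda>\<omega>. step_cost (w \<omega>) D x y) \<in> borel_measurable N"
    unfolding step_cost_def using D w
    by (intro borel_measurable_times_ennreal borel_measurable_SUP borel_measurable_const) auto
  with 3 show ?case by simp
qed simp_all

text \<open>The hypothesis controls \<open>\<phi>\<close> on the positive half-line, the conclusion
  concerns its square root on the whole line: \<open>sqrt (\<phi> u) \<le> 1 + \<phi> u\<close>, and
  \<open>\<phi> u \<le> \<phi> 0\<close> for negative \<open>u\<close> by monotonicity.\<close>

lemma std_normal_nn_integral_finite:
  assumes \<phi>: "\<phi> \<in> borel_measurable borel" "\<And>u. 0 \<le> \<phi> u" "mono \<phi>"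
    and int: "set_integrable lborel {0..} (\<lambda>u. \<phi> u * exp (- u\<^sup>2 / 2))"
  shows "(\<integral>\<^sup>+u. ennreal (std_normal_density u) * ennreal (sqrt (\<phi> u)) \<partial>lborel) < \<infinity>"
proof -
  let ?F = "\<lambda>u. (1 + \<phi> 0) * std_normal_density u + indicator {0..} u *\<^sub>R (\<phi> u * exp (- u\<^sup>2 / 2))"
  have iF: "integrable lborel ?F"
    using int unfolding set_integrable_def
    by (intro Bochner_Integration.integrable_add integrable_mult_right) auto
  have nn: "0 \<le> ?F u" for u
    using \<phi>(2) by (auto intro!: add_nonneg_nonneg mult_nonneg_nonneg simp: indicator_def)
  have "(\<integral>\<^sup>+u. ennreal (std_normal_density u) * ennreal (sqrt (\<phi> u)) \<partial>lborel) \<le> (\<integral>\<^sup>+u. ennreal (?F u) \<partial>lborel)"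
  proof (rule nn_integral_mono)
    fix u :: real
    have "sqrt (\<phi> u) \<le> 1 + \<phi> u"
      by (rule real_le_lsqrt) (use \<phi>(2)[of u] in \<open>auto simp: power2_eq_square algebra_simps\<close>)
    then have "std_normal_density u * sqrt (\<phi> u) \<le> std_normal_density u * (1 + \<phi> u)"
      by (intro mult_left_mono) auto
    also have "\<dots> \<le> ?F u"
    proof (cases "0 \<le> u")
      case True
      have l1: "1 / sqrt (2 * pi) \<le> 1" using pi_ge_two by (simp add: divide_le_eq_1)
      have "std_normal_density u \<le> exp (- u\<^sup>2 / 2)"
        unfolding std_normal_density_def by (rule mult_left_le_one_le) (assumption | rule l1 | simp)+
      then have "\<phi> u * std_normal_density u \<le> \<phi> u * exp (- u\<^sup>2 / 2)" by (intro mult_left_mono \<phi>)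
      moreover have "0 \<le> \<phi> 0 * std_normal_density u" using \<phi>(2) by simp
      ultimately show ?thesis using True by (simp add: algebra_simps)
    next
      case False
      then have "\<phi> u \<le> \<phi> 0" by (intro monoD[OF \<phi>(3)]) simp
      then have "std_normal_density u * (1 + \<phi> u) \<le> std_normal_density u * (1 + \<phi> 0)"
        by (intro mult_left_mono) auto
      with False show ?thesis by (simp add: mult.commute)
    qed
    finally show "ennreal (std_normal_density u) * ennreal (sqrt (\<phi> u)) \<le> ennreal (?F u)"
      using \<phi>(2) by (simp only: ennreal_mult[symmetric] normal_density_nonneg real_sqrt_ge_zero ennreal_leI)
  qed
  also have "\<dots> = ennreal (\<integral>u. ?F u \<partial>lborel)"
    by (rule nn_integral_eq_integral[OF iF]) (use nn in auto)
  also have "\<dots> < \<infinity>" by simp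
  finally show ?thesis .
qed

section \<open>The passage time as a measurable function of the path\<close>

locale conformal_field = decaying_field M f \<kappa> \<rho> q
  for M :: "'w measure" and f :: "real^2 \<Rightarrow> 'w \<Rightarrow> real" and \<kappa> \<rho> q :: "real^2 \<Rightarrow> real" +
  fixes \<phi> :: "real \<Rightarrow> real"
  assumes \<phi>_continuous: "continuous_on UNIV \<phi>" and \<phi>_pos: "0 < \<phi> u" and \<phi>_mono: "mono \<phi>"
    and \<phi>_integrable: "set_integrable lborel {0..} (\<lambda>u. \<phi> u * exp (- u\<^sup>2 / 2))"
begin

definition weight :: "'w \<Rightarrow> real^2 \<Rightarrow> real" where
  "weight \<omega> p = sqrt (\<phi> (f p \<omega>))"

text \<open>One fixed countable dense set, so that \<open>passage\<close> is a single measurable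
  function for all paths.\<close>

definition dense_set :: "(real^2) set" where
  "dense_set = (SOME D. countable D \<and> closure D = UNIV)"

text \<open>The passage time as a function of the path alone. For discontinuous paths it is merely some
  measurable function.\<close>

definition passage :: "real^2 \<Rightarrow> (real^2 \<Rightarrow> real) \<Rightarrow> real" where
  "passage x h = enn2real (INF zs\<in>lists dense_set. chain_cost (\<lambda>p. sqrt (\<phi> (h p))) dense_set (0 # zs @ [x]))"

abbreviation passage_time :: "'w \<Rightarrow> real^2 \<Rightarrow> real^2 \<Rightarrow> real" where
  "passage_time \<omega> x y \<equiv> enn2real (cost_dist (weight \<omega>) x y)"

definition mean_passage :: "real^2 \<Rightarrow> real" where
  "mean_passage x = expectation (\<lambda>\<omega>. passage x (field_path 0 \<omega>))"


lemma dense_set: "countable dense_set" "closure dense_set = UNIV"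
proof -
  obtain D :: "(real^2) set" where "countable D" "UNIV \<subseteq> closure D"
    by (rule separable[of UNIV]) blast
  then have "\<exists>D :: (real^2) set. countable D \<and> closure D = UNIV" by blast
  from someI_ex[OF this] show "countable dense_set" "closure dense_set = UNIV"
    by (simp_all add: dense_set_def)
qed

lemma \<phi>_measurable[measurable]: "\<phi> \<in> borel_measurable borel"
  by (rule borel_measurable_continuous_onI[OF \<phi>_continuous])

lemma sqrt_\<phi>_measurable: "(\<lambda>u. sqrt (\<phi> u)) \<in> borel_measurable borel"
  by (intro borel_measurable_continuous_onI continuous_on_real_sqrt \<phi>_continuous)

lemma weight_nonneg: "0 \<le> weight \<omega> p"
  using \<phi>_pos[of "f p \<omega>"] by (simp add: weight_def)

lemma weight_continuous: "continuous_on UNIV (\<lambda>x. f x \<omega>) \<Longrightarrow> continuous_on UNIV (weight \<omega>)"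
  unfolding weight_def[abs_def]
  by (intro continuous_on_real_sqrt continuous_on_compose2[OF \<phi>_continuous]) auto

lemma weight_measurable[measurable]: "(\<lambda>\<omega>. weight \<omega> p) \<in> borel_measurable M"
  unfolding weight_def by measurable

lemma passage_measurable[measurable]: "passage x \<in> borel_measurable path_space"
proof -
  have "(\<lambda>h. chain_cost (\<lambda>p. sqrt (\<phi> (h p))) dense_set (0 # zs @ [x])) \<in> borel_measurable path_space" for zs
    by (rule chain_cost_measurable[OF dense_set(1)])
      (rule measurable_compose[OF evaluation_measurable sqrt_\<phi>_measurable])
  then show ?thesis
    unfolding passage_def[abs_def]
    by (intro borel_measurable_enn2real borel_measurable_INF countable_lists dense_set)
qed

lemma passage_nonneg: "0 \<le> passage x h"
  by (simp add: passage_def)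

text \<open>For a continuous path the infimum over chains is the distance, and translating the path
  by \<open>a\<close> moves the starting point from 0 to \<open>a\<close>.\<close>

lemma passage_field_path:
  assumes "continuous_on UNIV (\<lambda>x. f x \<omega>)"
  shows "passage x (field_path a \<omega>) = passage_time \<omega> a (a + x)"
proof -
  have w: "continuous_on UNIV (\<lambda>p. weight \<omega> (p + a))"
    by (intro continuous_on_compose2[OF weight_continuous[OF assms]] continuous_intros) auto
  have "passage x (field_path a \<omega>) = enn2real (cost_dist (\<lambda>p. weight \<omega> (p + a)) 0 x)"
    unfolding cost_dist_eq_chain[OF w _ dense_set(2)] using \<phi>_pos
    by (subst cost_dist_eq_chain[OF w _ dense_set(2)]) (simp_all add: passage_def weight_def field_path_def)
  then show ?thesis by (simp add: cost_dist_translate add.commute)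
qed

lemma AE_passage_time: "AE \<omega> in M. \<forall>x. passage x (field_path 0 \<omega>) = passage_time \<omega> 0 x"
  using continuous_paths by eventually_elim (simp add: passage_field_path)

lemma passage_time_triangle:
  assumes "continuous_on UNIV (\<lambda>x. f x \<omega>)"
  shows "passage_time \<omega> x z \<le> passage_time \<omega> x y + passage_time \<omega> y z"
proof -
  note w = weight_continuous[OF assms]
  have "enn2real (cost_dist (weight \<omega>) x z) \<le> enn2real (cost_dist (weight \<omega>) x y + cost_dist (weight \<omega>) y z)"
    using cost_dist_triangle[OF w] cost_dist_finite[OF w] by (intro enn2real_mono) (auto simp: less_top)
  also have "\<dots> = passage_time \<omega> x y + passage_time \<omega> y z"
    using cost_dist_finite[OF w] by (intro enn2real_plus) (auto simp: less_top)
  finally show ?thesis .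
qed

lemma passage_0: "continuous_on UNIV (\<lambda>x. f x \<omega>) \<Longrightarrow> passage 0 (field_path a \<omega>) = 0"
  by (simp add: passage_field_path cost_dist_self)

section \<open>Mean passage times\<close>

definition mean_weight :: real where
  "mean_weight = expectation (\<lambda>\<omega>. weight \<omega> 0)"

text \<open>\<open>\<kappa> 0 = 1\<close> makes every \<open>f x\<close> standard normal, so the
  weights at all points have the same finite mean.\<close>

lemma weight_integral: "integrable M (\<lambda>\<omega>. weight \<omega> p)" "expectation (\<lambda>\<omega>. weight \<omega> p) = mean_weight"
proof -
  have D: "distributed M lborel (f x) std_normal_density" for x
    by (rule centered_gaussian_rv(7)[OF gaussian_f centered_f])
      (use cov[of x x] \<kappa>_0 in \<open>simp add: power2_eq_square\<close>)
  have nn: "(\<integral>\<^sup>+\<omega>. ennreal (weight \<omega> x) \<partial>M) = (\<integral>\<^sup>+u. ennreal (std_normal_density u) * ennreal (sqrt (\<phi> u)) \<partial>lborel)" for x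
    unfolding weight_def by (rule distributed_nn_integral[OF D, symmetric]) (use sqrt_\<phi>_measurable in simp)
  have "(\<integral>\<^sup>+\<omega>. ennreal (weight \<omega> x) \<partial>M) < \<infinity>" for x
    unfolding nn by (rule std_normal_nn_integral_finite) (use \<phi>_pos \<phi>_mono \<phi>_integrable in \<open>auto simp: less_imp_le\<close>)
  then have int: "integrable M (\<lambda>\<omega>. weight \<omega> x)" for x
    by (intro integrableI_nonneg) (auto simp: weight_nonneg)
  then show "integrable M (\<lambda>\<omega>. weight \<omega> p)" .
  have "ennreal (expectation (\<lambda>\<omega>. weight \<omega> p)) = ennreal (expectation (\<lambda>\<omega>. weight \<omega> 0))"
    by (simp only: nn nn_integral_eq_integral[symmetric, OF int AE_I2] weight_nonneg)
  then show "expectation (\<lambda>\<omega>. weight \<omega> p) = mean_weight"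
    by (simp add: mean_weight_def weight_nonneg)
qed

lemma mean_weight_nonneg: "0 \<le> mean_weight"
  by (simp add: mean_weight_def weight_nonneg)

text \<open>Averaging the cost of the segment directly would call for joint measurability in the
  point and in \<open>\<omega>\<close>. Riemann sums and Fatou's lemma need only the common mean of
  the weights at single points.\<close>

lemma nn_integral_cost_dist_le:
  "(\<integral>\<^sup>+\<omega>. cost_dist (weight \<omega>) 0 x \<partial>M) \<le> ennreal (norm x * mean_weight)"
proof (rule ennreal_le_epsilon)
  fix e :: real assume e: "0 < e"
  let ?R = "\<lambda>n \<omega>. ennreal (norm x * (\<Sum>i<n. weight \<omega> ((real i / real n) *\<^sub>R x)) / n + e)"
  have "(\<integral>\<^sup>+\<omega>. cost_dist (weight \<omega>) 0 x \<partial>M) \<le> (\<integral>\<^sup>+\<omega>. liminf (\<lambda>n. ?R n \<omega>) \<partial>M)"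
  proof (rule nn_integral_mono_AE)
    show "AE \<omega> in M. cost_dist (weight \<omega>) 0 x \<le> liminf (\<lambda>n. ?R n \<omega>)"
      using continuous_paths
    proof eventually_elim
      case (elim \<omega>)
      show ?case
        using cost_dist_le_riemann_sum[OF weight_continuous[OF elim] weight_nonneg e, of 0 x]
        by (intro Liminf_bounded) simp
    qed
  qed
  also have "\<dots> \<le> liminf (\<lambda>n. \<integral>\<^sup>+\<omega>. ?R n \<omega> \<partial>M)" by (rule nn_integral_liminf) measurable
  also have "\<dots> \<le> liminf (\<lambda>n :: nat. ennreal (norm x * mean_weight + e))"
  proof (rule Liminf_mono, rule always_eventually, rule allI)
    fix n :: nat
    have i: "integrable M (\<lambda>\<omega>. norm x * (\<Sum>i<n. weight \<omega> ((real i / real n) *\<^sub>R x)) / n + e)"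
      by (intro Bochner_Integration.integrable_add integrable_divide integrable_mult_right
        Bochner_Integration.integrable_sum weight_integral) auto
    have "(\<integral>\<^sup>+\<omega>. ?R n \<omega> \<partial>M) = ennreal (\<integral>\<omega>. norm x * (\<Sum>i<n. weight \<omega> ((real i / real n) *\<^sub>R x)) / n + e \<partial>M)"
      using e by (intro nn_integral_eq_integral[OF i])
        (auto intro!: add_nonneg_nonneg divide_nonneg_nonneg mult_nonneg_nonneg sum_nonneg weight_nonneg)
    also have "(\<integral>\<omega>. norm x * (\<Sum>i<n. weight \<omega> ((real i / real n) *\<^sub>R x)) / n + e \<partial>M) =
      norm x * (real n * mean_weight) / n + e"
      using weight_integral
      by (subst Bochner_Integration.integral_add) (auto simp: prob_space intro!: integrable_divide integrable_mult_right
        Bochner_Integration.integrable_sum)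
    \<comment> \<open>For \<open>n = 0\<close> the quotient is 0 by convention, so the bound holds
      there too.\<close>
    also have "\<dots> \<le> norm x * mean_weight + e" using mean_weight_nonneg by (cases "n = 0") auto
    finally show "(\<integral>\<^sup>+\<omega>. ?R n \<omega> \<partial>M) \<le> ennreal (norm x * mean_weight + e)" by (simp add: ennreal_leI)
  qed
  also have "\<dots> = ennreal (norm x * mean_weight) + ennreal e"
    using e mean_weight_nonneg by (subst Liminf_const) (auto simp: ennreal_plus)
  finally show "(\<integral>\<^sup>+\<omega>. cost_dist (weight \<omega>) 0 x \<partial>M) \<le> ennreal (norm x * mean_weight) + ennreal e" .
qed

lemma nn_integral_passage:
  "(\<integral>\<^sup>+\<omega>. ennreal (passage x (field_path 0 \<omega>)) \<partial>M) = (\<integral>\<^sup>+\<omega>. cost_dist (weight \<omega>) 0 x \<partial>M)"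
proof (rule nn_integral_cong_AE)
  show "AE \<omega> in M. ennreal (passage x (field_path 0 \<omega>)) = cost_dist (weight \<omega>) 0 x"
    using continuous_paths
  proof eventually_elim
    case (elim \<omega>)
    then show ?case
      using cost_dist_finite[OF weight_continuous[OF elim], of 0 x] by (simp add: passage_field_path)
  qed
qed

lemma passage_integrable: "integrable M (\<lambda>\<omega>. passage x (field_path 0 \<omega>))"
proof (rule integrableI_nonneg)
  show "(\<integral>\<^sup>+\<omega>. ennreal (passage x (field_path 0 \<omega>)) \<partial>M) < \<infinity>"
    unfolding nn_integral_passage
    using nn_integral_cost_dist_le[of x] by (simp add: le_less_trans)
qed (auto simp: passage_nonneg)

lemma ennreal_mean_passage: "ennreal (mean_passage x) = (\<integral>\<^sup>+\<omega>. cost_dist (weight \<omega>) 0 x \<partial>M)"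
  unfolding nn_integral_passage[symmetric] mean_passage_def
  by (rule nn_integral_eq_integral[symmetric, OF passage_integrable]) (simp add: passage_nonneg)

lemma mean_passage_nonneg: "0 \<le> mean_passage x"
  by (simp add: mean_passage_def passage_nonneg)

lemma mean_passage_le: "mean_passage x \<le> mean_weight * norm x"
  using nn_integral_cost_dist_le[of x] mean_weight_nonneg
  unfolding ennreal_mean_passage[symmetric] by (simp add: mult.commute)

lemma mean_passage_0: "mean_passage 0 = 0"
  using mean_passage_le[of 0] mean_passage_nonneg[of 0] by simp

lemma passage_law:
  "integrable law (passage x)" "(\<integral>h. passage x h \<partial>law) = mean_passage x"
  "integrable M (\<lambda>\<omega>. passage x (field_path a \<omega>))" "expectation (\<lambda>\<omega>. passage x (field_path a \<omega>)) = mean_passage x"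
proof -
  have 1: "integrable law (passage x)"
    unfolding law_def by (subst integrable_distr_eq) (auto intro: passage_integrable)
  have 2: "(\<integral>h. passage x h \<partial>law) = mean_passage x"
    unfolding law_def mean_passage_def by (rule integral_distr) auto
  have "integrable (distr M path_space (field_path a)) (passage x)"
    "(\<integral>h. passage x h \<partial>distr M path_space (field_path a)) = mean_passage x"
    using 1 2 by (simp_all add: law_field_path)
  then show "integrable M (\<lambda>\<omega>. passage x (field_path a \<omega>))" "expectation (\<lambda>\<omega>. passage x (field_path a \<omega>)) = mean_passage x"
    by (simp_all add: integrable_distr_eq integral_distr)
  show "integrable law (passage x)" "(\<integral>h. passage x h \<partial>law) = mean_passage x" by fact+
qed

lemma AE_passage_subadditive:
  "AE \<omega> in M. \<forall>a x y. passage (x + y) (field_path a \<omega>) \<le> passage x (field_path a \<omega>) + passage y (field_path (a + x) \<omega>)"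
  using continuous_paths
proof eventually_elim
  case (elim \<omega>)
  show ?case
  proof (intro allI)
    fix a x y
    show "passage (x + y) (field_path a \<omega>) \<le> passage x (field_path a \<omega>) + passage y (field_path (a + x) \<omega>)"
      using passage_time_triangle[OF elim, of a "a + x + y" "a + x"] by (simp add: passage_field_path[OF elim] add.assoc)
  qed
qed

lemma mean_passage_subadditive: "mean_passage (x + y) \<le> mean_passage x + mean_passage y"
proof -
  have "mean_passage (x + y) \<le> expectation (\<lambda>\<omega>. passage x (field_path 0 \<omega>) + passage y (field_path (0 + x) \<omega>))"
    unfolding mean_passage_def
  proof (intro integral_mono_AE Bochner_Integration.integrable_add passage_law(3))
    show "AE \<omega> in M. passage (x + y) (field_path 0 \<omega>) \<le> passage x (field_path 0 \<omega>) + passage y (field_path (0 + x) \<omega>)"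
      using AE_passage_subadditive by eventually_elim blast
  qed
  then show ?thesis using passage_law(3,4) by simp
qed

text \<open>Stationarity moves the starting point to \<open>x\<close>, and the distance from
  \<open>x\<close> to 0 is the distance from 0 to \<open>x\<close>.\<close>

lemma mean_passage_uminus: "mean_passage (- x) = mean_passage x"
proof -
  have "expectation (\<lambda>\<omega>. passage (- x) (field_path x \<omega>)) = expectation (\<lambda>\<omega>. passage x (field_path 0 \<omega>))"
  proof (rule integral_cong_AE)
    show "AE \<omega> in M. passage (- x) (field_path x \<omega>) = passage x (field_path 0 \<omega>)"
      using continuous_paths
    proof eventually_elim
      case (elim \<omega>)
      show ?case using cost_dist_commute[OF weight_continuous[OF elim], of x 0]
        by (simp add: passage_field_path[OF elim])
    qed
  qed measurable
  then show ?thesis by (simp add: passage_law(4))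
qed

text \<open>This Lipschitz bound later extends homogeneity from integer to real multiples.\<close>

lemma mean_passage_diff: "\<bar>mean_passage x - mean_passage y\<bar> \<le> mean_weight * norm (x - y)"
proof -
  have "mean_passage x \<le> mean_passage y + mean_weight * norm (x - y)" for x y
    using mean_passage_subadditive[of y "x - y"] mean_passage_le[of "x - y"] by simp
  from this[of x y] this[of y x] show ?thesis by (simp add: norm_minus_commute abs_le_iff)
qed

definition time_constant :: "real^2 \<Rightarrow> real" where
  "time_constant v = lim (\<lambda>n. mean_passage (real n *\<^sub>R v) / real n)"

lemma time_constant: "(\<lambda>n. mean_passage (real n *\<^sub>R v) / real n) \<longlonglongrightarrow> time_constant v"
proof -
  have "\<exists>l. (\<lambda>n. mean_passage (real n *\<^sub>R v) / real n) \<longlonglongrightarrow> l \<and> (\<forall>n\<ge>1. l \<le> mean_passage (real n *\<^sub>R v) / real n)"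
    by (rule subadditive_limit)
      (auto simp: mean_passage_nonneg mean_passage_0 scaleR_add_left intro: mean_passage_subadditive)
  then show ?thesis by (auto simp: time_constant_def limI)
qed

text \<open>The subadditive ergodic theorem for the shift by \<open>v\<close>. The shift by 0 is the
  identity, which is not covered by the mixing result, so \<open>v = 0\<close> is treated
  directly.\<close>

lemma AE_passage_limit:
  "AE \<omega> in M. (\<lambda>n. passage (real n *\<^sub>R v) (field_path 0 \<omega>) / real n) \<longlonglongrightarrow> time_constant v"
proof (cases "v = 0")
  case True
  have "time_constant 0 = 0"
    using time_constant[of 0] by (simp add: mean_passage_0 LIMSEQ_const_iff)
  then show ?thesis using continuous_paths True
    by (auto elim!: eventually_mono simp: passage_0)
next
  case False
  interpret S: mixing_system law "shift v" by (rule mixing_system_shift[OF False])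
  \<comment> \<open>Setting the value at \<open>n = 0\<close> to 0 by definition meets the pointwise
    hypotheses of the ergodic theorem for every path.\<close>
  let ?h = "\<lambda>n h. if n = 0 then 0 else passage (real n *\<^sub>R v) h"
  have "AE h in law. (\<lambda>n. ?h n h / real n) \<longlonglongrightarrow> time_constant v"
  proof (rule S.subadditive_ergodic)
    show "integrable law (?h n)" for n by (cases "n = 0") (simp_all add: passage_law(1))
    show "0 \<le> ?h n h" "?h 0 h = 0" for n h by (auto simp: passage_nonneg)
    have e: "(\<integral>h. ?h n h \<partial>law) = mean_passage (real n *\<^sub>R v)" for n
      by (cases "n = 0") (simp_all add: passage_law(2) mean_passage_0)
    show "(\<lambda>n. (\<integral>h. ?h n h \<partial>law) / real n) \<longlonglongrightarrow> time_constant v"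
      unfolding e by (rule time_constant)
    have [measurable]: "passage x \<in> borel_measurable path_space" for x by (rule passage_measurable)
    have h: "(\<lambda>h. ?h n (shift w h)) \<in> borel_measurable path_space" "(\<lambda>h. ?h n h) \<in> borel_measurable path_space" for n w
      by measurable
    show "AE h in law. \<forall>m n. ?h (m + n) h \<le> ?h m h + ?h n ((shift v ^^ m) h)"
      unfolding law_def shift_pow
    proof (subst AE_distr_iff)
      show "AE \<omega> in M. \<forall>m n. ?h (m + n) (field_path 0 \<omega>) \<le>
          ?h m (field_path 0 \<omega>) + ?h n (shift (real m *\<^sub>R v) (field_path 0 \<omega>))"
        using AE_passage_subadditive
      proof eventually_elim
        case (elim \<omega>)
        show ?case
        proof (intro allI)
          fix m n
          show "?h (m + n) (field_path 0 \<omega>) \<le>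
            ?h m (field_path 0 \<omega>) + ?h n (shift (real m *\<^sub>R v) (field_path 0 \<omega>))"
            using elim[rule_format, of "real m *\<^sub>R v" "real n *\<^sub>R v" 0]
            by (cases "m = 0"; cases "n = 0")
              (auto simp: shift_field_path scaleR_add_left passage_nonneg shift_def field_path_def)
        qed
      qed
      have "Measurable.pred path_space (\<lambda>h. \<forall>m n. ?h (m + n) h \<le> ?h m h + ?h n (shift (real m *\<^sub>R v) h))"
        by (intro pred_intros_countable, unfold pred_def, intro borel_measurable_le borel_measurable_add h)
      then show "{h \<in> space path_space. \<forall>m n. ?h (m + n) h \<le> ?h m h + ?h n (shift (real m *\<^sub>R v) h)} \<in> sets path_space"
        by (simp add: pred_def)
    qed (rule field_path_measurable)
  qed
  then have "AE \<omega> in M. (\<lambda>n. ?h n (field_path 0 \<omega>) / real n) \<longlonglongrightarrow> time_constant v"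
    unfolding law_def by (rule AE_distrD[OF field_path_measurable])
  moreover have "?h n g / real n = passage (real n *\<^sub>R v) g / real n" for n g by simp
  ultimately show ?thesis by simp
qed

text \<open>\<open>T\<close> agrees with the measurable passage variable only almost surely;
  measurability, integrability and the means are carried over to the completion from that
  variable.\<close>

theorem time_constant_limit:
  assumes T: "\<And>\<omega> x y. T \<omega> x y = passage_time \<omega> x y"
  shows "is_time_constant M T time_constant"
  unfolding is_time_constant_def
proof (intro allI conjI)
  fix v n
  let ?X = "\<lambda>n \<omega>. passage (real n *\<^sub>R v) (field_path 0 \<omega>)"
  have X: "?X n \<in> borel_measurable M" for n by measurable
  have TX: "AE \<omega> in M. \<forall>n. ?X n \<omega> = T \<omega> 0 (real n *\<^sub>R v)"
    using AE_passage_time by (auto elim!: eventually_mono simp: T)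
  from TX AE_passage_limit[of v] show "AE \<omega> in M. (\<lambda>n. T \<omega> 0 (real n *\<^sub>R v) / real n) \<longlonglongrightarrow> time_constant v"
    by eventually_elim simp
  have TX': "AE \<omega> in M. ?X n \<omega> = T \<omega> 0 (real n *\<^sub>R v)" for n using TX by eventually_elim simp
  have T': "(\<lambda>\<omega>. T \<omega> 0 (real n *\<^sub>R v)) \<in> borel_measurable (completion M)" for n
    by (rule ae_eq_measurable_completion[OF X TX'])
  have X': "?X n \<in> borel_measurable (completion M)" for n by (rule measurable_completion[OF X])
  have "integrable (completion M) (?X n)" using passage_integrable integrable_completion[OF X] by blast
  then show "integrable (completion M) (\<lambda>\<omega>. T \<omega> 0 (real n *\<^sub>R v))"
    by (rule integrable_cong_AE_imp[OF _ T']) (use AE_completion[OF TX'] in \<open>auto elim: eventually_mono\<close>)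
  have eq: "(\<integral>\<omega>. \<bar>T \<omega> 0 (real n *\<^sub>R v) / real n - time_constant v\<bar> \<partial>completion M) =
      expectation (\<lambda>\<omega>. \<bar>?X n \<omega> / real n - time_constant v\<bar>)" for n
  proof -
    have "(\<integral>\<omega>. \<bar>T \<omega> 0 (real n *\<^sub>R v) / real n - time_constant v\<bar> \<partial>completion M) =
        (\<integral>\<omega>. \<bar>?X n \<omega> / real n - time_constant v\<bar> \<partial>completion M)"
      using T'[of n] X'[of n] AE_completion[OF TX'[of n]]
      by (intro integral_cong_AE) (auto elim!: eventually_mono)
    also have "\<dots> = expectation (\<lambda>\<omega>. \<bar>?X n \<omega> / real n - time_constant v\<bar>)"
      by (rule integral_completion) measurable
    finally show ?thesis .
  qed
  have "(\<lambda>n. expectation (\<lambda>\<omega>. \<bar>?X n \<omega> / real n - time_constant v\<bar>)) \<longlonglongrightarrow> 0"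
  proof (rule integral_abs_diff_tendsto_0[OF prob_space_axioms])
    show "(\<lambda>n. expectation (\<lambda>\<omega>. ?X n \<omega> / real n)) \<longlonglongrightarrow> time_constant v"
      using time_constant[of v] by (simp add: mean_passage_def)
  qed (auto intro: passage_integrable AE_passage_limit simp: passage_nonneg)
  then show "(\<lambda>n. \<integral>\<omega>. \<bar>T \<omega> 0 (real n *\<^sub>R v) / real n - time_constant v\<bar> \<partial>completion M) \<longlonglongrightarrow> 0"
    unfolding eq .
qed

text \<open>If a coordinate of \<open>v\<close> is non-zero, the cell of \<open>n\<close> times
  \<open>v\<close> moves away linearly in \<open>n\<close>, so the lower bound for the mean distance
  applies with \<open>k\<close> proportional to \<open>n\<close>.\<close>

lemma time_constant_pos:
  assumes "v \<noteq> 0"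
  shows "0 < time_constant v"
proof -
  obtain c where c: "0 < c" and low: "\<And>n x. 1 \<le> n \<Longrightarrow> int (2 * n) + 1 \<le> cell_norm (cell x) \<Longrightarrow>
      ennreal (c * real n) \<le> (\<integral>\<^sup>+\<omega>. cost_dist (weight \<omega>) 0 x \<partial>M)"
    using expected_distance_lower_bound[OF \<phi>_continuous \<phi>_pos \<phi>_mono] unfolding weight_def[abs_def] by blast
  obtain i where i: "v $ i \<noteq> 0" using assms by (metis vec_eq_iff zero_index)
  have "c * \<bar>v $ i\<bar> / 4 \<le> time_constant v"
  proof (rule tendsto_lowerbound[OF time_constant])
    obtain N :: nat where N: "8 / \<bar>v $ i\<bar> < N" using reals_Archimedean2 by blast
    show "\<forall>\<^sub>F n in sequentially. c * \<bar>v $ i\<bar> / 4 \<le> mean_passage (real n *\<^sub>R v) / real n"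
      using eventually_ge_at_top[of "Suc N"]
    proof eventually_elim
      case (elim n)
      define t where "t = real n * \<bar>v $ i\<bar>"
      have n: "8 / \<bar>v $ i\<bar> < real n" "0 < real n" using elim N by simp_all
      have t: "8 < t" using n i by (simp add: t_def pos_divide_less_eq)
      \<comment> \<open>The largest \<open>k\<close> with \<open>2 * k + 2 \<le> t\<close>, which
        leaves room for the rounding in \<open>cell\<close> and for the \<open>+ 1\<close> in the
        lower bound. For \<open>t > 8\<close> it exceeds \<open>t / 4\<close>; this is why
        \<open>n\<close> was taken beyond 8 divided by the coordinate.\<close>
      define k where "k = nat \<lfloor>(t - 2) / 2\<rfloor>"
      have k: "real k \<le> (t - 2) / 2" "(t - 2) / 2 < real k + 1" 
      proof -
        have "real k = real_of_int \<lfloor>(t - 2) / 2\<rfloor>" using t by (simp add: k_def)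
        then show "real k \<le> (t - 2) / 2" "(t - 2) / 2 < real k + 1" by linarith+
      qed
      have "0 < real k" using k t by argo
      then have k1: "1 \<le> k" by simp
      have "int (2 * k) + 1 \<le> cell_norm (cell (real n *\<^sub>R v))"
      proof -
        have fl: "\<bar>r\<bar> < \<bar>real_of_int \<lfloor>r\<rfloor>\<bar> + 1" for r :: real by linarith
        have "\<bar>\<lfloor>(real n *\<^sub>R v) $ i\<rfloor>\<bar> \<le> cell_norm (cell (real n *\<^sub>R v))"
          using exhaust_2[of i] by (auto simp: cell_norm_def cell_def)
        moreover have "t < \<bar>real_of_int \<lfloor>(real n *\<^sub>R v) $ i\<rfloor>\<bar> + 1"
          using fl[of "(real n *\<^sub>R v) $ i"] by (simp add: t_def abs_mult)
        then have "real_of_int (2 * int k) < real_of_int \<bar>\<lfloor>(real n *\<^sub>R v) $ i\<rfloor>\<bar>" using k by simp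
        ultimately show ?thesis by simp
      qed
      then have "ennreal (c * real k) \<le> ennreal (mean_passage (real n *\<^sub>R v))"
        unfolding ennreal_mean_passage by (rule low[OF k1])
      then have "c * real k \<le> mean_passage (real n *\<^sub>R v)" using mean_passage_nonneg by (simp add: ennreal_le_iff)
      moreover have "c * (t / 4) \<le> c * real k" using k t c by (intro mult_left_mono) auto
      ultimately have "c * \<bar>v $ i\<bar> / 4 * real n \<le> mean_passage (real n *\<^sub>R v)" by (simp add: t_def mult_ac)
      then show ?case using n by (simp add: pos_le_divide_eq)
    qed
  qed simp
  moreover have "0 < c * \<bar>v $ i\<bar> / 4" using c i by simp
  ultimately show ?thesis by linarith
qed

text \<open>\<open>n * c\<close> is replaced by its integer part \<open>k n\<close>. The two mean
  passage times differ by a bounded amount, and \<open>k n / n\<close> tends to \<open>c\<close>, so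
  the limit along the integers gives the value for the real multiple.\<close>

lemma time_constant_scale_pos:
  assumes c: "0 < c"
  shows "time_constant (c *\<^sub>R v) = c * time_constant v"
proof -
  define k where "k n = nat \<lfloor>real n * c\<rfloor>" for n :: nat
  have k: "real (k n) \<le> real n * c" "real n * c < real (k n) + 1" for n
    using c by (simp_all add: k_def)
  have k_top: "filterlim k at_top sequentially"
    unfolding k_def
    by (rule filterlim_compose[OF filterlim_nat_sequentially filterlim_compose[OF filterlim_floor_sequentially]])
      (use c in real_asymp)
  have kn: "(\<lambda>n. real (k n) / real n) \<longlonglongrightarrow> c"
  proof (rule tendsto_sandwich)
    show "\<forall>\<^sub>F n in sequentially. c - 1 / real n \<le> real (k n) / real n"
      using eventually_gt_at_top[of 0]
    proof eventually_elim
      case (elim n)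
      then have "(c - 1 / real n) * real n \<le> real (k n)" using k(2)[of n] by (simp add: algebra_simps)
      then show ?case using elim by (simp add: pos_le_divide_eq)
    qed
    show "\<forall>\<^sub>F n in sequentially. real (k n) / real n \<le> c"
      using eventually_gt_at_top[of 0]
      by eventually_elim (use k(1) in \<open>simp add: divide_le_eq mult.commute\<close>)
    show "(\<lambda>n. c - 1 / real n) \<longlonglongrightarrow> c" by real_asymp
  qed simp
  have "(\<lambda>n. mean_passage (real (k n) *\<^sub>R v) / real (k n) * (real (k n) / real n)) \<longlonglongrightarrow> time_constant v * c"
    by (intro tendsto_mult kn filterlim_compose[OF time_constant k_top])
  moreover have "(\<lambda>n. mean_passage (real n *\<^sub>R (c *\<^sub>R v)) / real n -
      mean_passage (real (k n) *\<^sub>R v) / real (k n) * (real (k n) / real n)) \<longlonglongrightarrow> 0"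
  proof (rule Lim_null_comparison)
    show "(\<lambda>n. mean_weight * norm v / real n) \<longlonglongrightarrow> 0" by (rule lim_const_over_n)
    show "\<forall>\<^sub>F n in sequentially. norm (mean_passage (real n *\<^sub>R (c *\<^sub>R v)) / real n -
      mean_passage (real (k n) *\<^sub>R v) / real (k n) * (real (k n) / real n)) \<le> mean_weight * norm v / real n"
    proof (rule always_eventually, rule allI)
      fix n
      \<comment> \<open>If \<open>k n = 0\<close>, the left side is 0 by the convention for
        division, and the mean passage time to the origin vanishes as well.\<close>
      have "mean_passage (real (k n) *\<^sub>R v) / real (k n) * (real (k n) / real n) = mean_passage (real (k n) *\<^sub>R v) / real n"
        by (cases "k n = 0") (auto simp: mean_passage_0)
      then have "norm (mean_passage (real n *\<^sub>R (c *\<^sub>R v)) / real n -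
          mean_passage (real (k n) *\<^sub>R v) / real (k n) * (real (k n) / real n)) =
        \<bar>mean_passage (real n *\<^sub>R (c *\<^sub>R v)) - mean_passage (real (k n) *\<^sub>R v)\<bar> / real n"
        by (simp only: real_norm_def diff_divide_distrib[symmetric] abs_divide abs_of_nat)
      also have "\<dots> \<le> mean_weight * norm v / real n"
      proof (rule divide_right_mono)
        have "\<bar>mean_passage (real n *\<^sub>R (c *\<^sub>R v)) - mean_passage (real (k n) *\<^sub>R v)\<bar> \<le>
          mean_weight * norm (real n *\<^sub>R (c *\<^sub>R v) - real (k n) *\<^sub>R v)" by (rule mean_passage_diff)
        also have "real n *\<^sub>R (c *\<^sub>R v) - real (k n) *\<^sub>R v = (real n * c - real (k n)) *\<^sub>R v"
          by (simp add: scaleR_diff_left)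
        also have "norm \<dots> \<le> 1 * norm v"
          unfolding norm_scaleR using k[of n] by (intro mult_right_mono) auto
        finally show "\<bar>mean_passage (real n *\<^sub>R (c *\<^sub>R v)) - mean_passage (real (k n) *\<^sub>R v)\<bar> \<le> mean_weight * norm v"
          using mean_weight_nonneg by (simp add: mult_left_mono)
      qed simp
      finally show "norm (mean_passage (real n *\<^sub>R (c *\<^sub>R v)) / real n -
          mean_passage (real (k n) *\<^sub>R v) / real (k n) * (real (k n) / real n)) \<le> mean_weight * norm v / real n" .
    qed
  qed
  ultimately have "(\<lambda>n. mean_passage (real n *\<^sub>R (c *\<^sub>R v)) / real n) \<longlonglongrightarrow> time_constant v * c + 0"
    using tendsto_add by fastforce
  with time_constant[of "c *\<^sub>R v"] show ?thesis
    using LIMSEQ_unique[of _ "time_constant (c *\<^sub>R v)" "time_constant v * c"] by (simp add: mult.commute)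
qed

text \<open>Definiteness is the positivity above; evenness, subadditivity and non-negativity pass to
  the limit from \<open>mean_passage\<close>.\<close>

theorem is_norm_time_constant: "is_norm time_constant"
  unfolding is_norm_def
proof (intro conjI allI)
  have zero: "time_constant 0 = 0"
    using time_constant[of 0] by (simp add: mean_passage_0 LIMSEQ_const_iff)
  show nn: "0 \<le> time_constant v" for v
    by (rule LIMSEQ_le_const[OF time_constant]) (auto simp: mean_passage_nonneg)
  show "time_constant v = 0 \<longleftrightarrow> v = 0" for v
    using time_constant_pos[of v] zero by (cases "v = 0") auto
  have even: "time_constant (- v) = time_constant v" for v
    unfolding time_constant_def by (simp add: mean_passage_uminus)
  show "time_constant (c *\<^sub>R v) = \<bar>c\<bar> * time_constant v" for c v
    using time_constant_scale_pos[of c v] time_constant_scale_pos[of "- c" v] even[of "c *\<^sub>R v"] zero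
    by (cases c "0 :: real" rule: linorder_cases) auto
  show "time_constant (v + w) \<le> time_constant v + time_constant w" for v w
  proof (rule LIMSEQ_le[OF time_constant tendsto_add[OF time_constant time_constant]])
    have "mean_passage (real n *\<^sub>R (v + w)) / real n \<le> mean_passage (real n *\<^sub>R v) / real n + mean_passage (real n *\<^sub>R w) / real n" for n
      using mean_passage_subadditive[of "real n *\<^sub>R v" "real n *\<^sub>R w"]
      by (simp add: scaleR_add_right add_divide_distrib[symmetric] divide_right_mono)
    then show "\<exists>N. \<forall>n\<ge>N. mean_passage (real n *\<^sub>R (v + w)) / real n \<le>
      mean_passage (real n *\<^sub>R v) / real n + mean_passage (real n *\<^sub>R w) / real n" by blast
  qed
qed

end

theorem corollary3p20:
  fixes M :: "'w measure"
    and f :: "real^2 \<Rightarrow> 'w \<Rightarrow> real"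
    and \<kappa> \<rho> q :: "real^2 \<Rightarrow> real"
    and \<phi> :: "real \<Rightarrow> real"
    and g :: "'w \<Rightarrow> real^2 \<Rightarrow> real^2^2"
    and T :: "'w \<Rightarrow> real^2 \<Rightarrow> real^2 \<Rightarrow> real"
  assumes "prob_space M"
    and "gaussian_field M f"
    and "AE \<omega> in M. continuous_on UNIV (\<lambda>x. f x \<omega>)"
    and "spectral_density \<kappa> \<rho>"
    and "fourier_L2 \<rho> (\<lambda>x. complex_of_real (q x))"
    and "symmetries M f \<kappa>"
    and "strong_regularity \<rho> q"
    and "strong_decay q"
    and "continuous_on UNIV \<phi>"
    and "\<forall>u. 0 < \<phi> u"
    and "mono \<phi>"
    and "set_integrable lborel {0..} (\<lambda>u. \<phi> u * exp (- u\<^sup>2 / 2))"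
    and "\<forall>\<omega> x. g \<omega> x = \<phi> (f x \<omega>) *\<^sub>R standard_metric x"
    and "\<forall>\<omega> x y. T \<omega> x y = riem_dist (g \<omega>) x y"
  shows "\<exists>\<mu>. is_time_constant M T \<mu> \<and> is_norm \<mu>"
proof -
  interpret conformal_field M f \<kappa> \<rho> q \<phi>
    by (intro conformal_field.intro decaying_field.intro decaying_field_axioms.intro conformal_field_axioms.intro)
      (use assms in auto)
  have "T \<omega> x y = passage_time \<omega> x y" for \<omega> x y
  proof -
    have "g \<omega> = (\<lambda>x. \<phi> (f x \<omega>) *\<^sub>R standard_metric x)" using assms(13) by auto
    then show ?thesis
      using assms(14) riem_dist_conformal[of "\<lambda>x. \<phi> (f x \<omega>)" x y] \<phi>_pos
      by (simp add: weight_def[abs_def] less_imp_le)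
  qed
  then show ?thesis using time_constant_limit is_norm_time_constant by blast
qed

end
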